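(* Let $\beta>0$ and consider the Itô stochastic differential equation on $\mathcal{P}(I)$ $$dp_i(t)=\sum_{j\in N(i)}\omega_{ij}\theta_{ij}(p(t))\Big(\frac{\partial}{\partial p_j}-\frac{\partial}{\partial p_i}\Big)\mathrm{D}_\phi(p(t)\|\pi)\,dt+\beta\sum_{j\in N(i)}\omega_{ij}\theta_{ij}(p(t))\Big(\frac{\partial}{\partial p_j}-\frac{\partial}{\partial p_i}\Big)\log\frac{\Pi(p(t))^{1/2}}{\theta_{ij}(p(t))}\,dt$$ $$+\sqrt\beta\sum_{j\in N(i)}\sqrt{\omega_{ij}\theta_{ij}(p(t))}\,\big(dB_{ij}(t)-dB_{ji}(t)\big),\qquad i\in I,$$ where $B_{ij}$, $1\le i,j\le n$, are independent standard Brownian motions. Let $\mathbb{P}(t,p)$ denote the probability density function of its solution. Then $\mathbb{P}$ satisfies the Fokker–Planck equation $$\frac{\partial}{\partial t}\mathbb{P}(t,p)+\nabla_p\cdot\Big(\mathbb{P}(t,p)\Big(\sum_{j=1}^n[Q_{ji}p_j-Q_{ij}p_i]\Big)_{i=1}^n\Big)=\beta\,\mathsf{L}_W^*\mathbb{P}(t,p).$$ Assume that $Z=\int_{\mathcal{P}(I)}e^{-\frac1\beta\mathrm{D}_\phi(p\|\pi)}\Pi(p)^{-\frac12}\,dp<+\infty$. Then $$\mathbb{P}^*(p)=\frac1Z e^{-\frac1\beta\mathrm{D}_\phi(p\|\pi)}\Pi(p)^{-\frac12}$$ is a stationary solution of this Fokker–Planck equation.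
   Context: **Graph.** $G=(I,E,\omega)$ is a finite connected undirected weighted graph without self-loops, $I=\{1,\dots,n\}$; $\omega=(\omega_{ij})\in\mathbb{R}^{n\times n}$ is symmetric with $\omega_{ij}=\omega_{ji}>0$ if $(i,j)\in E$ and $\omega_{ij}=0$ otherwise. $E$ consists of ordered pairs: each edge contributes both $(i,j)$ and $(j,i)$. $N(i)=\{j:(i,j)\in E\}$. Set $\pi_i=\frac{\sum_{j\in N(i)}\omega_{ij}}{\sum_{(k,l)\in E}\omega_{kl}}$. **Simplex.** $\mathcal{P}(I)=\{p\in\mathbb{R}^n:\sum_i p_i=1,\ p_i>0\}$, and $dp$ is the (Lebesgue) volume form on it. $\nabla_p$ and $\nabla_p\cdot$ are the gradient and divergence of $\mathbb{R}^n$. Functions on $\mathcal{P}(I)$ are differentiated after a smooth extension to a neighbourhood in $\mathbb{R}^n$; only the tangential derivatives $\frac{\partial}{\partial p_j}-\frac{\partial}{\partial p_i}$ enter. **Average function.** $\theta(x,y)=\frac{x-y}{\phi'(x)-\phi'(y)}$ (extended continuously to $x=y$ and to the boundary of $[0,\infty)^2$), where $\phi$ is a $C^1$ convex real function on $(0,\infty)$ with $\phi(1)=0$, such that $\theta:[0,\infty)^2\to[0,\infty)$ satisfies $\theta(x,y)=\theta(y,x)$; $\theta(x,y)>0$ if $xy\neq0$; $\theta(x,y)=0$ if $xy=0$; and $\theta$ is $C^2$ on $(0,\infty)^2$. Write $\theta_{ij}(p)=\theta(p_i/\pi_i,p_j/\pi_j)$. The $\phi$-divergence is $\mathrm{D}_\phi(p\|\pi)=\sum_{i=1}^n\phi\big(\frac{p_i}{\pi_i}\big)\pi_i$.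 **Weighted Laplacian matrix.** $L(p)\in\mathbb{R}^{n\times n}$ has entries $L(p)_{ij}=-\omega_{ij}\theta_{ij}(p)$ for $j\neq i$ and $L(p)_{ii}=\sum_{k\in N(i)}\omega_{ki}\theta_{ki}(p)$. For $p\in\mathcal{P}(I)$ it is symmetric positive semidefinite with exactly one zero eigenvalue; $0<\lambda_1(p)\le\dots\le\lambda_{n-1}(p)$ are its positive eigenvalues, and $\Pi(p)=\prod_{i=1}^{n-1}\lambda_i(p)$. **$Q$-matrix.** $Q_{ij}=\frac{\omega_{ij}}{\pi_i}$ for $j\ne i$ and $Q_{ii}=-\sum_{k\in N(i)}\frac{\omega_{ik}}{\pi_i}$. **Operator.** $\mathsf{L}_W^*\mathbb{P}(p)=\tfrac12\nabla_p\cdot\big(\mathbb{P}(p)L(p)\nabla_p\log\Pi(p)\big)+\nabla_p\cdot\big(L(p)\nabla_p\mathbb{P}(p)\big).$ **Fokker–Planck equation.** For an Itô SDE with drift $b$ and covariation $d\langle p_i,p_j\rangle_t=c_{ij}(p_t)dt$, it is $\partial_t\mathbb{P}=\mathcal{A}^*\mathbb{P}$, where $\mathcal{A}^*$ is the formal adjoint with respect to $dp$ on $\mathcal{P}(I)$ of the generator $\mathcal{A}\Phi=b\cdot\nabla_p\Phi+\frac12\sum_{i,j}c_{ij}\frac{\partial^2\Phi}{\partial p_i\partial p_j}$; densities are with respect to $dp$. A stationary solution is a time-independent solution. *)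

theory Defs
  imports "HOL-Probability.Probability"
begin

section \<open>Differentiation\<close>

definition C1_on :: "'a::euclidean_space set \<Rightarrow> ('a \<Rightarrow> real) \<Rightarrow> bool" where
  "C1_on U f \<longleftrightarrow>
     (\<forall>x\<in>U. f differentiable (at x)) \<and>
     (\<forall>v. continuous_on U (\<lambda>x. frechet_derivative f (at x) v))"

definition C2_on :: "'a::euclidean_space set \<Rightarrow> ('a \<Rightarrow> real) \<Rightarrow> bool" where
  "C2_on U f \<longleftrightarrow> C1_on U f \<and> (\<forall>v. C1_on U (\<lambda>x. frechet_derivative f (at x) v))"

definition partial :: "'n::finite \<Rightarrow> (real^'n \<Rightarrow> real) \<Rightarrow> real^'n \<Rightarrow> real" where
  "partial i f p = frechet_derivative f (at p) (axis i 1)"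

definition grad :: "(real^'n::finite \<Rightarrow> real) \<Rightarrow> real^'n \<Rightarrow> real^'n" where
  "grad f p = (\<chi> i. partial i f p)"

definition divergence :: "(real^'n::finite \<Rightarrow> real^'n) \<Rightarrow> real^'n \<Rightarrow> real" where
  "divergence V p = (\<Sum>i\<in>UNIV. partial i (\<lambda>q. V q $ i) p)"

section \<open>The open probability simplex and its volume\<close>

definition prob_simplex :: "(real^'n::finite) set" where
  "prob_simplex = {p. (\<Sum>i\<in>UNIV. p $ i) = 1 \<and> (\<forall>i. 0 < p $ i)}"

text \<open>Orthogonal projection of \<open>real^'n\<close> onto the affine hyperplane of coordinate sum 1.\<close>

definition hyperplane_proj :: "real^'n::finite \<Rightarrow> real^'n" where
  "hyperplane_proj x = (\<chi> i. x $ i - ((\<Sum>j\<in>UNIV. x $ j) - 1) / real CARD('n))"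

text \<open>
  The Euclidean \<open>(n-1)\<close>-dimensional volume on the simplex. The slab used here lies on one side of
  the hyperplane of coordinate sum 1 and has Euclidean thickness 1 (the unit normal has all
  coordinates \<open>1 / sqrt n\<close>), so projecting its \<open>n\<close>-dimensional Lebesgue measure orthogonally gives
  the Lebesgue measure of the hyperplane.
\<close>

definition simplex_volume :: "(real^'n::finite) measure" where
  "simplex_volume =
     restrict_space
       (distr
          (restrict_space lborel
             {x. 1 \<le> (\<Sum>i\<in>UNIV. x $ i) \<and> (\<Sum>i\<in>UNIV. x $ i) \<le> 1 + sqrt (real CARD('n))})
          borel hyperplane_proj)
       prob_simplex"

text \<open>
  A function on the simplex is represented by an extension to \<open>real^'n\<close> that is \<open>C\<^sup>2\<close> on some
  neighbourhood; the values of the extension elsewhere are irrelevant.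
\<close>

definition C2_near_simplex :: "(real^'n::finite \<Rightarrow> real) \<Rightarrow> bool" where
  "C2_near_simplex f \<longleftrightarrow> (\<exists>U. open U \<and> prob_simplex \<subseteq> U \<and> C2_on U f)"

definition test_function :: "(real^'n::finite \<Rightarrow> real) \<Rightarrow> bool" where
  "test_function \<Phi> \<longleftrightarrow>
     C2_near_simplex \<Phi> \<and> (\<exists>K. compact K \<and> K \<subseteq> prob_simplex \<and> (\<forall>p\<in>prob_simplex - K. \<Phi> p = 0))"

section \<open>Ito stochastic differential equations\<close>

definition filtered_prob_space :: "'a measure \<Rightarrow> (real \<Rightarrow> 'a measure) \<Rightarrow> bool" where
  "filtered_prob_space M F \<longleftrightarrow>
     prob_space M \<and>
     (\<forall>t\<ge>0. subalgebra M (F t)) \<and>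
     (\<forall>s t. 0 \<le> s \<longrightarrow> s \<le> t \<longrightarrow> subalgebra (F t) (F s))"

text \<open>
  A finite family of independent standard Brownian motions relative to the filtration \<open>F\<close>. In the
  last clause the index \<open>None\<close> stands for the past \<open>F s\<close>: the past and the increments of all the
  Brownian motions after time \<open>s\<close> are jointly independent.
\<close>

definition brownian_motions ::
  "'a measure \<Rightarrow> (real \<Rightarrow> 'a measure) \<Rightarrow> ('m::finite \<Rightarrow> real \<Rightarrow> 'a \<Rightarrow> real) \<Rightarrow> bool" where
  "brownian_motions M F B \<longleftrightarrow>
     (\<forall>k. \<forall>t\<ge>0. B k t \<in> borel_measurable (F t)) \<and>
     (\<forall>k. AE \<omega> in M. B k 0 \<omega> = 0 \<and> continuous_on {0..} (\<lambda>t. B k t \<omega>)) \<and>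
     (\<forall>s t. 0 \<le> s \<longrightarrow> s < t \<longrightarrow>
        (\<forall>k. distributed M lborel (\<lambda>\<omega>. B k t \<omega> - B k s \<omega>) (normal_density 0 (sqrt (t - s)))) \<and>
        prob_space.indep_sets M
          (\<lambda>k. case k of
              None \<Rightarrow> sets (F s)
            | Some k \<Rightarrow> {(\<lambda>\<omega>. B k t \<omega> - B k s \<omega>) -` A \<inter> space M | A. A \<in> sets borel})
          UNIV)"

text \<open>
  A simple process on the time interval from 0 to \<open>t\<close> is given by partition points
  \<open>\<tau> 0 \<le> \<dots> \<le> \<tau> m\<close> and bounded coefficients \<open>\<xi> k\<close> known at time \<open>\<tau> k\<close>.
\<close>

definition simple_process ::
  "'a measure \<Rightarrow> (real \<Rightarrow> 'a measure) \<Rightarrow> real \<Rightarrow> nat \<Rightarrow> (nat \<Rightarrow> real) \<Rightarrow> (nat \<Rightarrow> 'a \<Rightarrow> real) \<Rightarrow> bool"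
where
  "simple_process M F t m \<tau> \<xi> \<longleftrightarrow>
     \<tau> 0 = 0 \<and> \<tau> m = t \<and>
     (\<forall>k<m. \<tau> k \<le> \<tau> (Suc k) \<and> \<xi> k \<in> borel_measurable (F (\<tau> k)) \<and>
        (\<exists>C. \<forall>\<omega>\<in>space M. \<bar>\<xi> k \<omega>\<bar> \<le> C))"

definition simple_value ::
  "nat \<Rightarrow> (nat \<Rightarrow> real) \<Rightarrow> (nat \<Rightarrow> 'a \<Rightarrow> real) \<Rightarrow> real \<Rightarrow> 'a \<Rightarrow> real" where
  "simple_value m \<tau> \<xi> s \<omega> = (\<Sum>k<m. \<xi> k \<omega> * indicator {\<tau> k..<\<tau> (Suc k)} s)"

definition simple_integral ::
  "nat \<Rightarrow> (nat \<Rightarrow> real) \<Rightarrow> (nat \<Rightarrow> 'a \<Rightarrow> real) \<Rightarrow> (real \<Rightarrow> 'a \<Rightarrow> real) \<Rightarrow> 'a \<Rightarrow> real" where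
  "simple_integral m \<tau> \<xi> W \<omega> = (\<Sum>k<m. \<xi> k \<omega> * (W (\<tau> (Suc k)) \<omega> - W (\<tau> k) \<omega>))"

definition ito_integrand ::
  "'a measure \<Rightarrow> (real \<Rightarrow> 'a measure) \<Rightarrow> real \<Rightarrow> (real \<Rightarrow> 'a \<Rightarrow> real) \<Rightarrow> bool" where
  "ito_integrand M F t H \<longleftrightarrow>
     (\<lambda>(s, \<omega>). H s \<omega>) \<in> borel_measurable (restrict_space lborel {0..t} \<Otimes>\<^sub>M M) \<and>
     (\<forall>s\<in>{0..t}. H s \<in> borel_measurable (F s)) \<and>
     (\<integral>\<^sup>+\<omega>. (\<integral>\<^sup>+s\<in>{0..t}. ennreal ((H s \<omega>)\<^sup>2) \<partial>lborel) \<partial>M) < \<infinity>"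

text \<open>
  \<open>ito_integral M F W H t J\<close>: the random variable \<open>J\<close> is (a version of) the Ito integral of \<open>H\<close>
  against the Brownian motion \<open>W\<close> over the time interval from 0 to \<open>t\<close>, that is, the \<open>L\<^sup>2\<close> limit of
  the integrals of simple processes approximating \<open>H\<close> in \<open>L\<^sup>2\<close>. Square integrability of \<open>H\<close> is no
  restriction for the equation below, whose noise coefficients are bounded on the simplex.
\<close>

definition ito_integral ::
  "'a measure \<Rightarrow> (real \<Rightarrow> 'a measure) \<Rightarrow> (real \<Rightarrow> 'a \<Rightarrow> real) \<Rightarrow> (real \<Rightarrow> 'a \<Rightarrow> real) \<Rightarrow> real \<Rightarrow>
    ('a \<Rightarrow> real) \<Rightarrow> bool" where
  "ito_integral M F W H t J \<longleftrightarrow>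
     ito_integrand M F t H \<and> J \<in> borel_measurable M \<and>
     (\<exists>m \<tau> \<xi>.
        (\<forall>l. simple_process M F t (m l) (\<tau> l) (\<xi> l)) \<and>
        (\<lambda>l. \<integral>\<^sup>+\<omega>. (\<integral>\<^sup>+s\<in>{0..t}.
            ennreal ((H s \<omega> - simple_value (m l) (\<tau> l) (\<xi> l) s \<omega>)\<^sup>2) \<partial>lborel) \<partial>M) \<longlonglongrightarrow> 0 \<and>
        (\<lambda>l. \<integral>\<^sup>+\<omega>. ennreal ((J \<omega> - simple_integral (m l) (\<tau> l) (\<xi> l) W \<omega>)\<^sup>2) \<partial>M) \<longlonglongrightarrow> 0)"

text \<open>
  \<open>X\<close> is a continuous solution, living in the set \<open>S\<close>, of \<open>dX = b(X) dt + \<sigma>(X) dB\<close> on the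
  filtered probability space \<open>(M, F)\<close>; the initial law is arbitrary. Here \<open>\<sigma> x i k\<close> is the
  coefficient of \<open>dB k\<close> in the equation for the component \<open>i\<close>.
\<close>

definition ito_sde_solution ::
  "'a measure \<Rightarrow> (real \<Rightarrow> 'a measure) \<Rightarrow> ('m::finite \<Rightarrow> real \<Rightarrow> 'a \<Rightarrow> real) \<Rightarrow>
    (real^'n::finite) set \<Rightarrow> (real^'n \<Rightarrow> real^'n) \<Rightarrow> (real^'n \<Rightarrow> 'n \<Rightarrow> 'm \<Rightarrow> real) \<Rightarrow>
    (real \<Rightarrow> 'a \<Rightarrow> real^'n) \<Rightarrow> bool" where
  "ito_sde_solution M F B S b \<sigma> X \<longleftrightarrow>
     filtered_prob_space M F \<and> brownian_motions M F B \<and>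
     (\<forall>t\<ge>0. X t \<in> borel_measurable (F t)) \<and>
     (\<forall>\<omega>\<in>space M. continuous_on {0..} (\<lambda>t. X t \<omega>) \<and> (\<forall>t\<ge>0. X t \<omega> \<in> S)) \<and>
     (\<forall>t\<ge>0. \<exists>J.
        (\<forall>i k. ito_integral M F (B k) (\<lambda>s \<omega>. \<sigma> (X s \<omega>) i k) t (J i k)) \<and>
        (AE \<omega> in M. \<forall>i.
           X t \<omega> $ i = X 0 \<omega> $ i + integral {0..t} (\<lambda>s. b (X s \<omega>) $ i) + (\<Sum>k\<in>UNIV. J i k \<omega>)))"

text \<open>The covariation density \<open>c i j\<close> of the components \<open>i\<close> and \<open>j\<close>, and the generator.\<close>

definition covariation ::
  "(real^'n \<Rightarrow> 'n \<Rightarrow> 'm::finite \<Rightarrow> real) \<Rightarrow> real^'n::finite \<Rightarrow> real^'n^'n" where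
  "covariation \<sigma> p = (\<chi> i j. \<Sum>k\<in>UNIV. \<sigma> p i k * \<sigma> p j k)"

definition generator ::
  "(real^'n \<Rightarrow> real^'n) \<Rightarrow> (real^'n \<Rightarrow> real^'n^'n) \<Rightarrow> (real^'n::finite \<Rightarrow> real) \<Rightarrow> real^'n \<Rightarrow> real" where
  "generator b c \<Phi> p =
     b p \<bullet> grad \<Phi> p + 1/2 * (\<Sum>i\<in>UNIV. \<Sum>j\<in>UNIV. c p $ i $ j * partial i (partial j \<Phi>) p)"

definition formal_adjoint_on_simplex ::
  "((real^'n::finite \<Rightarrow> real) \<Rightarrow> real^'n \<Rightarrow> real) \<Rightarrow> ((real^'n \<Rightarrow> real) \<Rightarrow> real^'n \<Rightarrow> real) \<Rightarrow> bool" where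
  "formal_adjoint_on_simplex A A' \<longleftrightarrow>
     (\<forall>\<Phi> u. test_function \<Phi> \<longrightarrow> C2_near_simplex u \<longrightarrow>
        (\<integral>p. A \<Phi> p * u p \<partial>simplex_volume) = (\<integral>p. \<Phi> p * A' u p \<partial>simplex_volume))"

text \<open>
  \<open>u t\<close> is, for every \<open>t > 0\<close>, a probability density of \<open>X t\<close> with respect to the volume of the
  simplex, and has the regularity of a classical density. (Nonnegativity has to be required
  because \<open>ennreal\<close> truncates negative values to 0.)
\<close>

definition classical_density_of ::
  "'a measure \<Rightarrow> (real \<Rightarrow> 'a \<Rightarrow> real^'n::finite) \<Rightarrow> (real \<Rightarrow> real^'n \<Rightarrow> real) \<Rightarrow> bool" where
  "classical_density_of M X u \<longleftrightarrow>
     (\<forall>t>0. distributed M simplex_volume (X t) (\<lambda>p. ennreal (u t p)) \<and>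
        (\<forall>p\<in>prob_simplex. 0 \<le> u t p) \<and> C2_near_simplex (u t) \<and>
        (\<forall>p\<in>prob_simplex. (\<lambda>s. u s p) differentiable (at t))) \<and>
     continuous_on ({0<..} \<times> prob_simplex) (\<lambda>(t, p). u t p) \<and>
     continuous_on ({0<..} \<times> prob_simplex) (\<lambda>(t, p). deriv (\<lambda>s. u s p) t)"

section \<open>Weighted graphs and average functions\<close>

definition weighted_graph :: "('n::finite \<times> 'n) set \<Rightarrow> real^'n^'n \<Rightarrow> bool" where
  "weighted_graph E w \<longleftrightarrow>
     sym E \<and> irrefl E \<and> (\<forall>i j. (i, j) \<in> E\<^sup>*) \<and>
     (\<forall>i j. w $ i $ j = w $ j $ i) \<and>
     (\<forall>i j. if (i, j) \<in> E then 0 < w $ i $ j else w $ i $ j = 0)"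

definition stat :: "('n::finite \<times> 'n) set \<Rightarrow> real^'n^'n \<Rightarrow> 'n \<Rightarrow> real" where
  "stat E w i = (\<Sum>j\<in>E``{i}. w $ i $ j) / (\<Sum>(k, l)\<in>E. w $ k $ l)"

definition average_function :: "(real \<Rightarrow> real) \<Rightarrow> (real \<Rightarrow> real \<Rightarrow> real) \<Rightarrow> bool" where
  "average_function \<phi> \<theta> \<longleftrightarrow>
     C1_on {0<..} \<phi> \<and> convex_on {0<..} \<phi> \<and> \<phi> 1 = 0 \<and>
     (\<forall>x>0. \<forall>y>0. x \<noteq> y \<longrightarrow> \<theta> x y = (x - y) / (deriv \<phi> x - deriv \<phi> y)) \<and>
     continuous_on ({0..} \<times> {0..}) (\<lambda>(x, y). \<theta> x y) \<and>
     C2_on ({0<..} \<times> {0<..}) (\<lambda>(x, y). \<theta> x y) \<and>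
     (\<forall>x\<ge>0. \<forall>y\<ge>0. 0 \<le> \<theta> x y \<and> \<theta> x y = \<theta> y x \<and>
        (x * y \<noteq> 0 \<longrightarrow> 0 < \<theta> x y) \<and> (x * y = 0 \<longrightarrow> \<theta> x y = 0))"

definition theta_edge ::
  "('n::finite \<times> 'n) set \<Rightarrow> real^'n^'n \<Rightarrow> (real \<Rightarrow> real \<Rightarrow> real) \<Rightarrow> 'n \<Rightarrow> 'n \<Rightarrow> real^'n \<Rightarrow> real" where
  "theta_edge E w \<theta> i j p = \<theta> (p $ i / stat E w i) (p $ j / stat E w j)"

definition phi_divergence ::
  "('n::finite \<times> 'n) set \<Rightarrow> real^'n^'n \<Rightarrow> (real \<Rightarrow> real) \<Rightarrow> real^'n \<Rightarrow> real" where
  "phi_divergence E w \<phi> p = (\<Sum>i\<in>UNIV. \<phi> (p $ i / stat E w i) * stat E w i)"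

definition laplacian ::
  "('n::finite \<times> 'n) set \<Rightarrow> real^'n^'n \<Rightarrow> (real \<Rightarrow> real \<Rightarrow> real) \<Rightarrow> real^'n \<Rightarrow> real^'n^'n" where
  "laplacian E w \<theta> p =
     (\<chi> i j. if i = j then \<Sum>k\<in>E``{i}. w $ k $ i * theta_edge E w \<theta> k i p
             else - w $ i $ j * theta_edge E w \<theta> i j p)"

text \<open>
  The product of the positive eigenvalues of a symmetric matrix, counted with multiplicity
  (the dimension of the eigenspace).
\<close>

definition prod_pos_eigenvalues :: "real^'n^'n \<Rightarrow> real" where
  "prod_pos_eigenvalues A =
     (\<Prod>l\<in>{l. 0 < l \<and> (\<exists>v. v \<noteq> 0 \<and> A *v v = l *\<^sub>R v)}. l ^ dim {v. A *v v = l *\<^sub>R v})"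

definition Pi_lap ::
  "('n::finite \<times> 'n) set \<Rightarrow> real^'n^'n \<Rightarrow> (real \<Rightarrow> real \<Rightarrow> real) \<Rightarrow> real^'n \<Rightarrow> real" where
  "Pi_lap E w \<theta> p = prod_pos_eigenvalues (laplacian E w \<theta> p)"

definition Q_matrix :: "('n::finite \<times> 'n) set \<Rightarrow> real^'n^'n \<Rightarrow> real^'n^'n" where
  "Q_matrix E w =
     (\<chi> i j. if i = j then - (\<Sum>k\<in>E``{i}. w $ i $ k / stat E w i) else w $ i $ j / stat E w i)"

section \<open>The Wasserstein stochastic differential equation and its Fokker--Planck equation\<close>

definition sde_drift ::
  "('n::finite \<times> 'n) set \<Rightarrow> real^'n^'n \<Rightarrow> (real \<Rightarrow> real) \<Rightarrow> (real \<Rightarrow> real \<Rightarrow> real) \<Rightarrow> real \<Rightarrow>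
    real^'n \<Rightarrow> real^'n" where
  "sde_drift E w \<phi> \<theta> \<beta> p =
     (\<chi> i.
        (\<Sum>j\<in>E``{i}. w $ i $ j * theta_edge E w \<theta> i j p *
           (partial j (phi_divergence E w \<phi>) p - partial i (phi_divergence E w \<phi>) p)) +
        \<beta> * (\<Sum>j\<in>E``{i}. w $ i $ j * theta_edge E w \<theta> i j p *
           (partial j (\<lambda>q. ln (Pi_lap E w \<theta> q powr (1/2) / theta_edge E w \<theta> i j q)) p -
            partial i (\<lambda>q. ln (Pi_lap E w \<theta> q powr (1/2) / theta_edge E w \<theta> i j q)) p)))"

text \<open>
  The noise \<open>sqrt \<beta> * (\<Sum>j\<in>N(i). sqrt (w i j * \<theta> i j) * (dB (i, j) - dB (j, i)))\<close> in the equation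
  for component \<open>i\<close>: coefficient of \<open>dB k\<close>, for the Brownian motions indexed by pairs \<open>k\<close> of vertices.
\<close>

definition sde_noise ::
  "('n::finite \<times> 'n) set \<Rightarrow> real^'n^'n \<Rightarrow> (real \<Rightarrow> real \<Rightarrow> real) \<Rightarrow> real \<Rightarrow>
    real^'n \<Rightarrow> 'n \<Rightarrow> 'n \<times> 'n \<Rightarrow> real" where
  "sde_noise E w \<theta> \<beta> p i k =
     sqrt \<beta> * (\<Sum>j\<in>E``{i}. sqrt (w $ i $ j * theta_edge E w \<theta> i j p) *
       ((if k = (i, j) then 1 else 0) - (if k = (j, i) then 1 else 0)))"

definition LW_adj ::
  "('n::finite \<times> 'n) set \<Rightarrow> real^'n^'n \<Rightarrow> (real \<Rightarrow> real \<Rightarrow> real) \<Rightarrow> (real^'n \<Rightarrow> real) \<Rightarrow> real^'n \<Rightarrow> real"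
where
  "LW_adj E w \<theta> u p =
     1/2 * divergence (\<lambda>q. u q *\<^sub>R (laplacian E w \<theta> q *v grad (\<lambda>r. ln (Pi_lap E w \<theta> r)) q)) p +
     divergence (\<lambda>q. laplacian E w \<theta> q *v grad u q) p"

definition Q_field :: "('n::finite \<times> 'n) set \<Rightarrow> real^'n^'n \<Rightarrow> real^'n \<Rightarrow> real^'n" where
  "Q_field E w p = (\<chi> i. \<Sum>j\<in>UNIV. Q_matrix E w $ j $ i * p $ j - Q_matrix E w $ i $ j * p $ i)"

definition fokker_planck_solution ::
  "('n::finite \<times> 'n) set \<Rightarrow> real^'n^'n \<Rightarrow> (real \<Rightarrow> real \<Rightarrow> real) \<Rightarrow> real \<Rightarrow>
    (real \<Rightarrow> real^'n \<Rightarrow> real) \<Rightarrow> bool" where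
  "fokker_planck_solution E w \<theta> \<beta> u \<longleftrightarrow>
     (\<forall>t>0. C2_near_simplex (u t) \<and>
       (\<forall>p\<in>prob_simplex. (\<lambda>s. u s p) differentiable (at t) \<and>
          deriv (\<lambda>s. u s p) t + divergence (\<lambda>q. u t q *\<^sub>R Q_field E w q) p =
            \<beta> * LW_adj E w \<theta> (u t) p))"

text \<open>The integrand of the normalising constant \<open>Z\<close>.\<close>

definition gibbs_weight ::
  "('n::finite \<times> 'n) set \<Rightarrow> real^'n^'n \<Rightarrow> (real \<Rightarrow> real) \<Rightarrow> (real \<Rightarrow> real \<Rightarrow> real) \<Rightarrow> real \<Rightarrow>
    real^'n \<Rightarrow> real" where
  "gibbs_weight E w \<phi> \<theta> \<beta> p =
     exp (- (1 / \<beta>) * phi_divergence E w \<phi> p) * Pi_lap E w \<theta> p powr (- 1/2)"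

end

theory Submission
  imports Defs
begin

text \<open>
  The equation lives on the edges of the graph. Write \<open>D i j f\<close> for the derivative of \<open>f\<close> in the
  direction \<open>e i - e j\<close> (\<open>edge_deriv\<close>) and \<open>F i j = p j / \<pi> j - p i / \<pi> i\<close> (\<open>flux\<close>). The average
  \<open>\<theta>\<close> is made so that \<open>\<theta> i j * D i j\<close> of the divergence is \<open>- F i j\<close>: the gradient flow of the
  divergence is the linear flow of the \<open>Q\<close>-matrix. Since \<open>\<theta> * D (log (\<Pi>^(1/2) / \<theta>))\<close> equals
  \<open>1/2 * \<theta> * D (log \<Pi>) - D \<theta>\<close>, the drift is the sum over the edges at \<open>i\<close> of
  \<open>\<omega> i j * (a i j + \<beta> * D i j (\<theta> i j))\<close> with \<open>a = F - \<beta>/2 * \<theta> * D (log \<Pi>)\<close> (\<open>coef\<close>); the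
  covariation is \<open>2 * \<beta> * L\<close>, because every edge carries two Brownian motions. Hence

    \<open>A \<Phi> = 1/2 * \<Sum> \<omega> i j * (a i j * D i j \<Phi> + \<beta> * D i j (\<theta> i j * D i j \<Phi>))\<close>   (\<open>generator_eq\<close>),

  while the Fokker--Planck equation says that the time derivative of \<open>u\<close> is
  \<open>- 1/2 * \<Sum> \<omega> i j * D i j (J i j)\<close> with the probability current \<open>J = a * u - \<beta> * \<theta> * D u\<close> (\<open>fp_operator_eq\<close>).

  \<^item> The two operators are adjoint by the product rule and because the integral of \<open>D i j W\<close> over the
    simplex vanishes for compactly supported \<open>W\<close>: the volume of the simplex is invariant under
    translations along the hyperplane (\<open>integral_tangential_derivative_eq_0\<close>).

  \<^item> The Gibbs density is stationary because it is in detailed balance: its current vanishes on every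
    single edge (\<open>gibbs_prob_flux\<close>).

  \<^item> These computations need \<open>log \<Pi>\<close> to be of class \<open>C\<^sup>2\<close>. The Laplacian matrix is positive
    semidefinite, and by connectedness its kernel consists of the constant vectors. Adding the
    orthogonal projection onto the constants replaces the eigenvalue 0 by 1, so \<open>\<Pi>\<close> is the
    determinant of \<open>L\<close> plus the matrix with all entries \<open>1/n\<close>, a polynomial in the entries of \<open>L\<close>
    (\<open>prod_pos_eigenvalues_eq_det\<close>).

  \<^item> For a solution of the stochastic equation, Dynkin's formula
    \<open>E \<Phi>(X T) - E \<Phi>(X 0) = \<integral> E (A \<Phi>)(X s) ds\<close> (\<open>ito_dynkin\<close>) and the adjointness give the
    equation for the density in weak form. Both of its sides are continuous on the simplex, so testing
    with functions concentrated near a point gives the equation at that point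
    (\<open>density_fokker_planck\<close>).

  Dynkin's formula is derived from the \<open>L\<^sup>2\<close> definition of the Ito integral. By the isometry for simple
  integrands, the Ito integral over a cell of a fine grid is the left-point value of the integrand
  times the Brownian increment, up to a residual that is small in mean square compared with the cell
  (\<open>ito_grid_residual\<close>). The squares of the residuals, summed over the cells, and the fluctuations of
  the quadratic variation thus tend to 0 in the mean, and almost surely along a subsequence. Along this
  subsequence Taylor's formula can be summed path by path (\<open>pathwise_ito_remainder\<close>). The stochastic
  sums have expectation 0 and bounded second moments, which allows passing to the limit in the
  expectations.
\<close>

section \<open>Functions of class C1 and C2\<close>

lemma C1_onI:
  assumes "\<And>x. x \<in> U \<Longrightarrow> (f has_derivative f' x) (at x)"
    and "\<And>v. continuous_on U (\<lambda>x. f' x v)"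
  shows "C1_on U f"
proof -
  have fr: "frechet_derivative f (at x) = f' x" if "x \<in> U" for x
    using frechet_derivative_at[OF assms(1)[OF that]] by simp
  show ?thesis
    unfolding C1_on_def
  proof (intro conjI ballI allI)
    show "f differentiable (at x)" if "x \<in> U" for x
      using assms(1)[OF that] differentiableI by blast
    show "continuous_on U (\<lambda>x. frechet_derivative f (at x) v)" for v
      using assms(2)[of v] by (rule continuous_on_eq) (simp add: fr)
  qed
qed

lemma C1_on_has_derivative:
  "C1_on U f \<Longrightarrow> x \<in> U \<Longrightarrow> (f has_derivative frechet_derivative f (at x)) (at x)"
  unfolding C1_on_def by (simp add: frechet_derivative_works[symmetric])

lemma C1_on_subset: "C1_on U f \<Longrightarrow> V \<subseteq> U \<Longrightarrow> C1_on V f"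
  unfolding C1_on_def by (blast intro: continuous_on_subset)

lemma C2_on_subset: "C2_on U f \<Longrightarrow> V \<subseteq> U \<Longrightarrow> C2_on V f"
  unfolding C2_on_def by (blast intro: C1_on_subset)

lemma C2_on_imp_C1_on: "C2_on U f \<Longrightarrow> C1_on U f"
  unfolding C2_on_def by simp

lemma C2_on_frechet: "C2_on U f \<Longrightarrow> C1_on U (\<lambda>x. frechet_derivative f (at x) v)"
  unfolding C2_on_def by simp

lemma C1_on_imp_continuous_on: "C1_on U f \<Longrightarrow> continuous_on U f"
  by (rule differentiable_imp_continuous_on)
     (auto simp: C1_on_def differentiable_on_def intro: differentiable_at_withinI)

lemma C1_on_frechet_continuous: "C1_on U f \<Longrightarrow> continuous_on U (\<lambda>x. frechet_derivative f (at x) v)"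
  unfolding C1_on_def by simp

lemma frechet_derivative_cong:
  assumes "open U" "x \<in> U" "\<And>y. y \<in> U \<Longrightarrow> f y = g y"
  shows "frechet_derivative f (at x) = frechet_derivative g (at x)"
proof -
  have "eventually (\<lambda>y. f y = g y) (nhds x)"
    using assms by (auto simp: eventually_nhds)
  then have "(f has_derivative D) (at x) \<longleftrightarrow> (g has_derivative D) (at x)" for D
    using has_derivative_transform_within_open[OF _ assms(1,2)] assms(3) by metis
  then show ?thesis unfolding frechet_derivative_def by simp
qed

lemma C1_on_cong:
  assumes "open U" "C1_on U f" "\<And>y. y \<in> U \<Longrightarrow> f y = g y"
  shows "C1_on U g"
proof (rule C1_onI)
  show "(g has_derivative frechet_derivative f (at x)) (at x)" if "x \<in> U" for x
    using has_derivative_transform_within_open[OF C1_on_has_derivative[OF assms(2) that] assms(1) that]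
      assms(3) by metis
  show "continuous_on U (\<lambda>x. frechet_derivative f (at x) v)" for v
    by (rule C1_on_frechet_continuous) fact
qed

lemma C2_on_cong:
  assumes "open U" "C2_on U f" "\<And>y. y \<in> U \<Longrightarrow> f y = g y"
  shows "C2_on U g"
  unfolding C2_on_def
proof (intro conjI allI)
  show "C1_on U g" using C1_on_cong[OF assms(1) C2_on_imp_C1_on] assms(2,3) by blast
  show "C1_on U (\<lambda>x. frechet_derivative g (at x) v)" for v
    using C2_on_frechet[OF assms(2), of v]
    by (rule C1_on_cong[OF assms(1)]) (simp add: frechet_derivative_cong[OF assms(1) _ assms(3)])
qed

lemma C2_onI:
  assumes "open U" and "\<And>x. x \<in> U \<Longrightarrow> (f has_derivative f' x) (at x)"
    and "\<And>v. C1_on U (\<lambda>x. f' x v)"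
  shows "C2_on U f"
  unfolding C2_on_def
proof (intro conjI allI)
  show "C1_on U f" by (rule C1_onI[OF assms(2) C1_on_imp_continuous_on[OF assms(3)]])
  show "C1_on U (\<lambda>x. frechet_derivative f (at x) v)" for v
    using assms(3)[of v]
    by (rule C1_on_cong[OF assms(1)]) (simp add: frechet_derivative_at[OF assms(2), symmetric])
qed

lemma C1_on_const: "C1_on U (\<lambda>x. c)"
  by (rule C1_onI[where f'="\<lambda>x v. 0"]) auto

lemma C2_on_const: "open U \<Longrightarrow> C2_on U (\<lambda>x. c)"
  by (rule C2_onI[where f'="\<lambda>x v. 0"]) (auto intro: C1_on_const)

lemma C1_on_linear: assumes "bounded_linear f" shows "C1_on U f"
  by (rule C1_onI[where f'="\<lambda>x. f"]) (auto intro: bounded_linear_imp_has_derivative assms)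

lemma C2_on_linear: assumes "open U" "bounded_linear f" shows "C2_on U f"
  by (rule C2_onI[where f'="\<lambda>x. f"]) (auto intro: bounded_linear_imp_has_derivative assms C1_on_const)

lemma C1_on_add:
  assumes "C1_on U f" "C1_on U g"
  shows "C1_on U (\<lambda>x. f x + g x)"
  by (rule C1_onI[where f'="\<lambda>x v. frechet_derivative f (at x) v + frechet_derivative g (at x) v"])
     (auto intro!: has_derivative_add continuous_on_add C1_on_frechet_continuous assms
        intro: C1_on_has_derivative assms)

lemma C1_on_mult:
  assumes "C1_on U f" "C1_on U g"
  shows "C1_on U (\<lambda>x. f x * g x)"
  by (rule C1_onI[where f'="\<lambda>x v. f x * frechet_derivative g (at x) v + frechet_derivative f (at x) v * g x"])
     (auto intro!: has_derivative_mult continuous_on_add continuous_on_mult C1_on_frechet_continuous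
        C1_on_imp_continuous_on[OF assms(1)] C1_on_imp_continuous_on[OF assms(2)] assms
        intro: C1_on_has_derivative assms)

lemma C2_on_add:
  assumes "open U" "C2_on U f" "C2_on U g"
  shows "C2_on U (\<lambda>x. f x + g x)"
  by (rule C2_onI[OF assms(1), where f'="\<lambda>x v. frechet_derivative f (at x) v + frechet_derivative g (at x) v"])
     (auto intro!: has_derivative_add C1_on_add C2_on_frechet assms
        intro: C1_on_has_derivative C2_on_imp_C1_on assms)

lemma C2_on_mult:
  assumes "open U" "C2_on U f" "C2_on U g"
  shows "C2_on U (\<lambda>x. f x * g x)"
  by (rule C2_onI[OF assms(1), where f'="\<lambda>x v. f x * frechet_derivative g (at x) v + frechet_derivative f (at x) v * g x"])
     (auto intro!: has_derivative_mult C1_on_add C1_on_mult C2_on_frechet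
        C2_on_imp_C1_on[OF assms(2)] C2_on_imp_C1_on[OF assms(3)] assms
        intro: C1_on_has_derivative C2_on_imp_C1_on assms)

lemma C1_on_cmult: "C1_on U f \<Longrightarrow> C1_on U (\<lambda>x. c * f x)"
  by (intro C1_on_mult C1_on_const)

lemma C2_on_cmult: "open U \<Longrightarrow> C2_on U f \<Longrightarrow> C2_on U (\<lambda>x. c * f x)"
  by (intro C2_on_mult C2_on_const)

lemma C1_on_diff: "C1_on U f \<Longrightarrow> C1_on U g \<Longrightarrow> C1_on U (\<lambda>x. f x - g x)"
  using C1_on_add[of U f "\<lambda>x. -1 * g x"] C1_on_cmult[of U g "-1"] by simp

lemma C2_on_diff: "open U \<Longrightarrow> C2_on U f \<Longrightarrow> C2_on U g \<Longrightarrow> C2_on U (\<lambda>x. f x - g x)"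
  using C2_on_add[of U f "\<lambda>x. -1 * g x"] C2_on_cmult[of U g "-1"] by simp

lemma C2_on_sum:
  "open U \<Longrightarrow> (\<And>i. i \<in> I \<Longrightarrow> C2_on U (f i)) \<Longrightarrow> C2_on U (\<lambda>x. \<Sum>i\<in>I. f i x)"
  by (induction I rule: infinite_finite_induct) (auto intro: C2_on_const C2_on_add)

lemma C2_on_prod:
  "open U \<Longrightarrow> (\<And>i. i \<in> I \<Longrightarrow> C2_on U (f i)) \<Longrightarrow> C2_on U (\<lambda>x. \<Prod>i\<in>I. f i x)"
  by (induction I rule: infinite_finite_induct) (auto intro: C2_on_const C2_on_mult)

lemma C1_on_compose_affine:
  assumes g: "C1_on V g" and f: "bounded_linear f" and sub: "\<And>x. x \<in> U \<Longrightarrow> f x + c \<in> V"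
  shows "C1_on U (\<lambda>x. g (f x + c))"
proof (rule C1_onI)
  show "((\<lambda>x. g (f x + c)) has_derivative (\<lambda>v. frechet_derivative g (at (f x + c)) (f v))) (at x)"
    if "x \<in> U" for x
  proof -
    have "((\<lambda>x. f x + c) has_derivative f) (at x)"
      using has_derivative_add_const[OF bounded_linear_imp_has_derivative[OF f]] .
    from diff_chain_at[OF this C1_on_has_derivative[OF g sub[OF that]]]
    show ?thesis by (simp add: o_def)
  qed
  show "continuous_on U (\<lambda>x. frechet_derivative g (at (f x + c)) (f v))" for v
    by (rule continuous_on_compose2[OF C1_on_frechet_continuous[OF g, of "f v"]])
       (auto intro!: continuous_on_add[OF linear_continuous_on[OF f] continuous_on_const] sub)
qed

lemma C2_on_compose_affine:
  assumes "open U" and g: "C2_on V g" and f: "bounded_linear f" and sub: "\<And>x. x \<in> U \<Longrightarrow> f x + c \<in> V"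
  shows "C2_on U (\<lambda>x. g (f x + c))"
proof (rule C2_onI[OF assms(1)])
  show "((\<lambda>x. g (f x + c)) has_derivative (\<lambda>v. frechet_derivative g (at (f x + c)) (f v))) (at x)"
    if "x \<in> U" for x
  proof -
    have "((\<lambda>x. f x + c) has_derivative f) (at x)"
      using has_derivative_add_const[OF bounded_linear_imp_has_derivative[OF f]] .
    from diff_chain_at[OF this C1_on_has_derivative[OF C2_on_imp_C1_on[OF g] sub[OF that]]]
    show ?thesis by (simp add: o_def)
  qed
  show "C1_on U (\<lambda>x. frechet_derivative g (at (f x + c)) (f v))" for v
    by (rule C1_on_compose_affine[OF C2_on_frechet[OF g] f sub])
qed

lemma C1_on_compose_real:
  fixes h h' :: "real \<Rightarrow> real"
  assumes f: "C1_on U f" and h: "\<And>s. s \<in> T \<Longrightarrow> (h has_real_derivative h' s) (at s)"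
    and h': "continuous_on T h'" and sub: "\<And>x. x \<in> U \<Longrightarrow> f x \<in> T"
  shows "C1_on U (\<lambda>x. h (f x))"
proof (rule C1_onI)
  show "((\<lambda>x. h (f x)) has_derivative (\<lambda>v. h' (f x) * frechet_derivative f (at x) v)) (at x)"
    if "x \<in> U" for x
    using diff_chain_at[OF C1_on_has_derivative[OF f that] h[OF sub[OF that], unfolded has_field_derivative_def]]
    by (simp add: o_def)
  show "continuous_on U (\<lambda>x. h' (f x) * frechet_derivative f (at x) v)" for v
    by (intro continuous_on_mult C1_on_frechet_continuous f
        continuous_on_compose2[OF h' C1_on_imp_continuous_on[OF f]]) (use sub in auto)
qed

lemma C2_on_compose_real:
  fixes h h' h'' :: "real \<Rightarrow> real"
  assumes "open U" and f: "C2_on U f" and h: "\<And>s. s \<in> T \<Longrightarrow> (h has_real_derivative h' s) (at s)"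
    and h': "\<And>s. s \<in> T \<Longrightarrow> (h' has_real_derivative h'' s) (at s)"
    and h'': "continuous_on T h''" and sub: "\<And>x. x \<in> U \<Longrightarrow> f x \<in> T"
  shows "C2_on U (\<lambda>x. h (f x))"
proof (rule C2_onI[OF assms(1)])
  show "((\<lambda>x. h (f x)) has_derivative (\<lambda>v. h' (f x) * frechet_derivative f (at x) v)) (at x)"
    if "x \<in> U" for x
    using diff_chain_at[OF C1_on_has_derivative[OF C2_on_imp_C1_on[OF f] that]
        h[OF sub[OF that], unfolded has_field_derivative_def]]
    by (simp add: o_def)
  show "C1_on U (\<lambda>x. h' (f x) * frechet_derivative f (at x) v)" for v
    by (intro C1_on_mult C2_on_frechet f C1_on_compose_real[OF C2_on_imp_C1_on[OF f] h' h'' sub])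
qed

lemma C2_on_ln: "open U \<Longrightarrow> C2_on U f \<Longrightarrow> (\<And>x. x \<in> U \<Longrightarrow> 0 < f x) \<Longrightarrow> C2_on U (\<lambda>x. ln (f x))"
  by (rule C2_on_compose_real[where T="{0<..}" and h'="\<lambda>s. 1 / s" and h''="\<lambda>s. - 1 / s^2"])
     (auto intro!: derivative_eq_intros continuous_intros simp: power2_eq_square)

lemma C2_on_exp: "open U \<Longrightarrow> C2_on U f \<Longrightarrow> C2_on U (\<lambda>x. exp (f x))"
  by (rule C2_on_compose_real[where T=UNIV and h'=exp and h''=exp])
     (auto intro!: derivative_eq_intros continuous_intros)

lemma C2_on_inverse: "open U \<Longrightarrow> C2_on U f \<Longrightarrow> (\<And>x. x \<in> U \<Longrightarrow> 0 < f x) \<Longrightarrow> C2_on U (\<lambda>x. 1 / f x)"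
  by (rule C2_on_compose_real[where T="{0<..}" and h="\<lambda>s. 1 / s" and h'="\<lambda>s. - 1 / s^2" and h''="\<lambda>s. 2 / s^3"])
     (auto intro!: derivative_eq_intros continuous_intros simp: power2_eq_square power3_eq_cube)

lemma C2_on_powr:
  assumes "open U" "C2_on U f" "\<And>x. x \<in> U \<Longrightarrow> 0 < f x"
  shows "C2_on U (\<lambda>x. f x powr a)"
proof -
  have "C2_on U (\<lambda>x. exp (a * ln (f x)))"
    using assms by (intro C2_on_exp C2_on_cmult C2_on_ln)
  then show ?thesis
    by (rule C2_on_cong[OF assms(1)]) (use assms(3) in \<open>force simp: powr_def\<close>)
qed

lemma C2_on_nth: "open U \<Longrightarrow> C2_on U (\<lambda>x::real^'n. x $ i)"
  by (rule C2_on_linear) (auto intro: bounded_linear_vec_nth)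

section \<open>Eigenvalues of symmetric matrices\<close>

lemma orthonormal_family_expand:
  fixes e :: "'n::finite \<Rightarrow> real^'n::finite"
  assumes "\<And>i j. e i \<bullet> e j = (if i = j then 1 else 0)"
  shows "(\<Sum>i\<in>UNIV. (v \<bullet> e i) *\<^sub>R e i) = v"
proof -
  have inj: "inj e"
  proof (rule injI)
    fix i j assume "e i = e j"
    then show "i = j" using assms[of i i] assms[of i j] by (auto split: if_splits)
  qed
  have po: "pairwise orthogonal (range e)"
    using assms by (auto simp: pairwise_def orthogonal_def)
  have nz: "0 \<notin> range e" 
  proof
    assume "0 \<in> range e" then obtain i where "e i = 0" by (metis rangeE)
    then show False using assms[of i i] by simp
  qed
  have ind: "independent (range e)" using pairwise_orthogonal_independent[OF po nz] .
  have "card (range e) = CARD('n)" using inj by (simp add: card_image)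
  then have sp: "span (range e) = UNIV"
    using ind card_eq_dim[of "range e" UNIV] by (auto simp: dim_UNIV)
  have "(\<Sum>b\<in>range e. (v \<bullet> b) *\<^sub>R b) = v"
    by (rule orthonormal_basis_expand[OF po]) (use sp assms in \<open>auto simp: norm_eq_1\<close>)
  then show ?thesis using inj by (simp add: sum.reindex)
qed

text \<open>
  A symmetric matrix maps the orthogonal complement \<open>W\<close> of a set of eigenvectors to itself, and a unit
  vector that maximises the quadratic form on \<open>W\<close> is an eigenvector.
\<close>

lemma symmetric_matrix_eigenvector_in_complement:
  fixes A :: "real^'n::finite^'n"
  assumes sym: "\<And>x y. x \<bullet> (A *v y) = (A *v x) \<bullet> y"
    and S: "\<And>v. v \<in> S \<Longrightarrow> \<exists>l. A *v v = l *\<^sub>R v"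
    and z: "z \<noteq> 0" "\<And>v. v \<in> S \<Longrightarrow> z \<bullet> v = 0"
  obtains x m where "norm x = 1" "A *v x = m *\<^sub>R x" "\<And>v. v \<in> S \<Longrightarrow> x \<bullet> v = 0"
proof -
  define W where "W = {x. \<forall>v\<in>S. x \<bullet> v = 0}"
  have WA: "A *v x \<in> W" if "x \<in> W" for x
    unfolding W_def
  proof (clarify)
    fix v assume v: "v \<in> S"
    then obtain l where "A *v v = l *\<^sub>R v" using S by blast
    then have "(A *v x) \<bullet> v = l * (x \<bullet> v)" using sym[of x v] by simp
    then show "(A *v x) \<bullet> v = 0" using that v by (simp add: W_def)
  qed
  have Wl: "a *\<^sub>R x + b *\<^sub>R y \<in> W" if "x \<in> W" "y \<in> W" for a b x y
    using that by (auto simp: W_def inner_simps)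
  have "closed W"
  proof -
    have "W = (\<Inter>v\<in>S. {x. x \<bullet> v = 0})" by (auto simp: W_def)
    moreover have "closed {x. x \<bullet> v = 0}" for v :: "real^'n"
      by (intro closed_Collect_eq continuous_intros)
    ultimately show ?thesis by auto
  qed
  then have cK: "compact (W \<inter> sphere 0 1)" by (simp add: closed_Int_compact)
  have "z /\<^sub>R norm z \<in> W \<inter> sphere 0 1"
    using z by (auto simp: W_def)
  then have ne: "W \<inter> sphere 0 1 \<noteq> {}" by blast
  have cont: "continuous_on (W \<inter> sphere 0 1) (\<lambda>x. x \<bullet> (A *v x))"
    by (intro continuous_intros linear_continuous_on) auto
  from continuous_attains_sup[OF cK ne cont] obtain x where x: "x \<in> W" "norm x = 1"
    and mx: "\<And>y. y \<in> W \<Longrightarrow> norm y = 1 \<Longrightarrow> y \<bullet> (A *v y) \<le> x \<bullet> (A *v x)" by auto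
  define m where "m = x \<bullet> (A *v x)"
  define q where "q y = m * (y \<bullet> y) - y \<bullet> (A *v y)" for y
  have q0: "0 \<le> q y" if "y \<in> W" for y
  proof (cases "y = 0")
    case False
    have "y /\<^sub>R norm y \<in> W" using Wl[OF that that, of "inverse (norm y)" 0] by simp
    from mx[OF this] False have "(y /\<^sub>R norm y) \<bullet> (A *v (y /\<^sub>R norm y)) \<le> m" by (simp add: m_def)
    then have "(y \<bullet> (A *v y)) / (norm y)^2 \<le> m"
      by (simp add: matrix_vector_mult_scaleR power2_eq_square divide_simps)
    then show ?thesis using False by (simp add: q_def pos_divide_le_eq power2_norm_eq_inner)
  qed (simp add: q_def)
  (* The form q is nonnegative on W and vanishes at the maximiser x. If y were not 0, moving x a
     little against y would make q negative. *)
  define y where "y = m *\<^sub>R x - A *v x"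
  have yW: "y \<in> W" using Wl[OF x(1) WA[OF x(1)], of m "-1"] by (simp add: y_def)
  have exp: "q (x - t *\<^sub>R y) = - 2 * t * (y \<bullet> y) + t^2 * q y" for t
  proof -
    have xx: "x \<bullet> x = 1" using x(2) by (simp add: norm_eq_1)
    have "(A *v x) \<bullet> y = x \<bullet> (A *v y)" using sym by simp
    moreover have "y \<bullet> (A *v x) = (A *v x) \<bullet> y" by (rule inner_commute)
    moreover have "y \<bullet> y = m * (x \<bullet> y) - (A *v x) \<bullet> y"
      by (subst (1) y_def) (simp add: inner_simps)
    moreover from this have "t * (y \<bullet> y) = t * (m * (x \<bullet> y) - (A *v x) \<bullet> y)" by simp
    ultimately have "t * (y \<bullet> y) = m * (t * (x \<bullet> y)) - t * (x \<bullet> (A *v y))"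
      and "(A *v x) \<bullet> y = x \<bullet> (A *v y)" "y \<bullet> (A *v x) = x \<bullet> (A *v y)"
      by (simp_all only:) (simp_all add: algebra_simps)
    then show ?thesis
      unfolding q_def
      by (simp add: inner_diff_left inner_diff_right matrix_vector_mult_diff_distrib
          matrix_vector_mult_scaleR xx m_def[symmetric] inner_commute[of y x] power2_eq_square algebra_simps)
  qed
  have "y \<bullet> y = 0"
  proof (rule ccontr)
    assume "y \<bullet> y \<noteq> 0"
    then have yy: "y \<bullet> y > 0" by (simp add: inner_gt_zero_iff)
    define t where "t = (y \<bullet> y) / (q y + 1)"
    have q1: "q y + 1 > 0" using q0[OF yW] by simp
    have t: "t > 0" unfolding t_def using yy q1 by simp
    have "x - t *\<^sub>R y \<in> W" using Wl[OF x(1) yW, of 1 "-t"] by simp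
    from q0[OF this] have "0 \<le> t * (t * q y - 2 * (y \<bullet> y))"
      by (simp add: exp power2_eq_square algebra_simps)
    with t have "2 * (y \<bullet> y) \<le> t * q y" by (simp add: zero_le_mult_iff)
    also have "\<dots> \<le> t * (q y + 1)" using t by simp
    also have "\<dots> = y \<bullet> y" using q1 by (simp add: t_def)
    finally show False using yy by simp
  qed
  then have "A *v x = m *\<^sub>R x" by (simp add: y_def)
  then show thesis using that x by (auto simp: W_def)
qed

text \<open>
  An orthonormal set of eigenvectors of maximal size is a basis: otherwise the previous lemma
  extends it.
\<close>

theorem symmetric_matrix_orthonormal_eigenbasis:
  fixes A :: "real^'n::finite^'n"
  assumes A: "transpose A = A"
  obtains e :: "'n \<Rightarrow> real^'n" and l :: "'n \<Rightarrow> real"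
  where "\<And>i j. e i \<bullet> e j = (if i = j then 1 else 0)" "\<And>i. A *v e i = l i *\<^sub>R e i"
proof -
  have sym: "x \<bullet> (A *v y) = (A *v x) \<bullet> y" for x y
    using dot_lmul_matrix[of x A y] A by (metis vector_transpose_matrix)
  define good where "good S \<longleftrightarrow> pairwise orthogonal S \<and> (\<forall>v\<in>S. norm v = 1 \<and> (\<exists>l. A *v v = l *\<^sub>R v))"
    for S :: "(real^'n) set"
  have ind: "independent S" if "good S" for S
    using that by (intro pairwise_orthogonal_independent) (auto simp: good_def)
  have bnd: "finite S \<and> card S \<le> CARD('n)" if "good S" for S
    using independent_bound[OF ind[OF that]] by simp
  have "good {}" by (simp add: good_def)
  then obtain S where S: "good S" and mx: "\<And>S'. good S' \<Longrightarrow> card S' \<le> card S"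
    using ex_has_greatest_nat[of good "{}" card "CARD('n) + 1"] bnd by force
  have "card S = CARD('n)"
  proof (rule ccontr)
    assume "card S \<noteq> CARD('n)"
    then have lt: "card S < CARD('n)" using bnd[OF S] by simp
    have "span S \<noteq> UNIV"
    proof
      assume "span S = UNIV"
      then have "CARD('n) \<le> card S" using dim_le_card[of UNIV S] bnd[OF S] by (simp add: dim_UNIV)
      then show False using lt by simp
    qed
    then obtain z where z: "z \<noteq> 0" "\<And>x. x \<in> span S \<Longrightarrow> orthogonal z x"
      using orthogonal_to_subspace_exists_gen[of S UNIV] 
      by (metis UNIV_I psubsetI span_UNIV subset_UNIV orthogonal_commute)
    have Se: "\<exists>l. A *v v = l *\<^sub>R v" if "v \<in> S" for v using S that by (auto simp: good_def)
    have zo: "z \<bullet> v = 0" if "v \<in> S" for v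
      using z(2)[of v] that by (simp add: span_base orthogonal_def)
    obtain x m where x: "norm x = 1" "A *v x = m *\<^sub>R x" "\<And>v. v \<in> S \<Longrightarrow> x \<bullet> v = 0"
      by (rule symmetric_matrix_eigenvector_in_complement[OF sym Se z(1) zo]) blast+
    have "good (insert x S)"
      using S x by (auto simp: good_def pairwise_insert orthogonal_def inner_commute)
    moreover have "x \<notin> S" using x(3)[of x] x(1) by (auto simp: norm_eq_1)
    ultimately show False using mx[of "insert x S"] bnd[OF S] by simp
  qed
  then obtain e where e: "bij_betw e (UNIV :: 'n set) S"
    using finite_same_card_bij[of "UNIV :: 'n set" S] bnd[OF S] by auto
  have eS: "e i \<in> S" for i using e by (auto simp: bij_betw_def)
  have "e i \<bullet> e j = (if i = j then 1 else 0)" for i j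
  proof (cases "i = j")
    case True then show ?thesis using S eS[of i] by (auto simp: good_def norm_eq_1)
  next
    case False
    then have "e i \<noteq> e j" using e by (auto simp: bij_betw_def inj_on_def)
    then show ?thesis using False S eS[of i] eS[of j] by (auto simp: good_def pairwise_def orthogonal_def)
  qed
  moreover have "\<exists>l. \<forall>i. A *v e i = l i *\<^sub>R e i"
    using S eS by (intro choice) (auto simp: good_def)
  ultimately show thesis using that by blast
qed

lemma det_eq_prod_eigenvalues:
  fixes A :: "real^'n::finite^'n" and e :: "'n \<Rightarrow> real^'n"
  assumes e: "\<And>i j. e i \<bullet> e j = (if i = j then 1 else 0)" and l: "\<And>i. A *v e i = l i *\<^sub>R e i"
  shows "det A = (\<Prod>i\<in>UNIV. l i)"
proof -
  define P :: "real^'n^'n" where "P = (\<chi> i j. e j $ i)"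
  define D :: "real^'n^'n" where "D = (\<chi> i j. if i = j then l i else 0)"
  have "transpose P ** P = mat 1"
    using e by (simp add: vec_eq_iff matrix_matrix_mult_def transpose_def P_def mat_def inner_vec_def)
  then have "det P * det P = 1"
    by (metis det_I det_mul det_transpose)
  then have P0: "det P \<noteq> 0" by auto
  have "A ** P = P ** D"
  proof -
    have "(A ** P) $ i $ j = (A *v e j) $ i" for i j
      by (simp add: matrix_matrix_mult_def matrix_vector_mult_def P_def)
    moreover have "(P ** D) $ i $ j = l j * e j $ i" for i j
      by (simp add: matrix_matrix_mult_def P_def D_def if_distrib[of "\<lambda>x. _ * x"] cong: if_cong)
    ultimately show ?thesis by (simp add: vec_eq_iff l)
  qed
  then have "det A * det P = det P * det D" by (metis det_mul)
  then have "det A = det D" using P0 by simp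
  also have "det D = (\<Prod>i\<in>UNIV. l i)"
    by (subst det_diagonal) (auto simp: D_def)
  finally show ?thesis .
qed

text \<open>
  Adding the projection onto the line of \<open>u\<close> changes the eigenvalue of \<open>u\<close> from 0 to 1 and keeps all
  other eigenvectors and eigenvalues. The determinant on the right is a polynomial in the entries of the
  matrix, so the product of the positive eigenvalues depends smoothly on the matrix although the single
  eigenvalues do not.
\<close>

lemma prod_pos_eigenvalues_eq_det:
  fixes A :: "real^'n::finite^'n" and u :: "real^'n"
  assumes A: "transpose A = A" and psd: "\<And>x. 0 \<le> x \<bullet> (A *v x)"
    and u: "norm u = 1" "A *v u = 0" and ker: "\<And>x. A *v x = 0 \<Longrightarrow> \<exists>c. x = c *\<^sub>R u"
  shows "prod_pos_eigenvalues A = det (\<chi> i j. A $ i $ j + u $ i * u $ j)"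
    and "0 < prod_pos_eigenvalues A"
proof -
  obtain e :: "'n \<Rightarrow> real^'n" and l where e: "\<And>i j. e i \<bullet> e j = (if i = j then 1 else 0)"
    and l: "\<And>i. A *v e i = l i *\<^sub>R e i"
    using symmetric_matrix_orthonormal_eigenbasis[OF A] by metis
  have uu: "u \<bullet> u = 1" using u(1) by (simp add: norm_eq_1)
  define B :: "real^'n^'n" where "B = (\<chi> i j. A $ i $ j + u $ i * u $ j)"
  have B: "B *v x = A *v x + (u \<bullet> x) *\<^sub>R u" for x
    by (simp add: B_def vec_eq_iff matrix_vector_mult_def inner_vec_def sum.distrib
        distrib_right sum_distrib_left mult_ac) (simp add: algebra_simps sum.distrib)
  have "det A = 0"
  proof (rule ccontr)
    assume "det A \<noteq> 0"
    then have "invertible A" by (simp add: invertible_det_nz)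
    then obtain A' where "A' ** A = mat 1" by (auto simp: invertible_def)
    then have "u = A' *v (A *v u)" by (simp add: matrix_vector_mul_assoc)
    then show False using u by simp
  qed
  then obtain i0 where i0: "l i0 = 0" using det_eq_prod_eigenvalues[OF e l] by auto
  then obtain c where c: "e i0 = c *\<^sub>R u" using ker l[of i0] by fastforce
  then have c0: "c \<noteq> 0" using e[of i0 i0] by auto
  have ue: "u \<bullet> e i = 0" if "i \<noteq> i0" for i
    using e[of i0 i] that c c0 by auto
  have ln0: "l i \<noteq> 0" if "i \<noteq> i0" for i
  proof
    assume "l i = 0"
    then obtain d where d: "e i = d *\<^sub>R u" using ker l[of i] by fastforce
    then have "d = 0" using ue[OF that] uu by simp
    then show False using d e[of i i] by simp
  qed
  have lpos: "0 < l i" if "i \<noteq> i0" for i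
    using psd[of "e i"] ln0[OF that] l[of i] e[of i i] by simp
  have detB: "det B = (\<Prod>i\<in>UNIV. (l(i0 := 1)) i)"
  proof (rule det_eq_prod_eigenvalues[OF e])
    show "B *v e i = (l(i0 := 1)) i *\<^sub>R e i" for i
      using ue l i0 uu by (auto simp: B c)
  qed
  also have "\<dots> = (\<Prod>i\<in>UNIV - {i0}. (l(i0 := 1)) i)"
    by (subst prod.remove[of UNIV i0]) auto
  also have "\<dots> = (\<Prod>i\<in>UNIV - {i0}. l i)"
    by (rule prod.cong) auto
  finally have detB': "det B = (\<Prod>i\<in>UNIV - {i0}. l i)" .
  have eig: "{v. A *v v = m *\<^sub>R v} = span (e ` {i. l i = m})" for m
  proof (intro set_eqI iffI)
    fix v assume "v \<in> {v. A *v v = m *\<^sub>R v}"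
    then have v: "A *v v = m *\<^sub>R v" by simp
    have "v \<bullet> e i = 0" if "l i \<noteq> m" for i
    proof -
      have "m * (v \<bullet> e i) = (A *v v) \<bullet> e i" using v by simp
      also have "\<dots> = v \<bullet> (A *v e i)"
        using dot_lmul_matrix[of v A "e i"] A by (metis vector_transpose_matrix)
      also have "\<dots> = l i * (v \<bullet> e i)" using l by simp
      finally show ?thesis using that by auto
    qed
    then have "v = (\<Sum>i\<in>{i. l i = m}. (v \<bullet> e i) *\<^sub>R e i)"
      by (subst orthonormal_family_expand[OF e, of v, symmetric])
         (rule sum.mono_neutral_right, auto)
    also have "\<dots> \<in> span (e ` {i. l i = m})"
      by (intro span_sum span_scale span_base) auto
    finally show "v \<in> span (e ` {i. l i = m})" .
  next
    fix v assume "v \<in> span (e ` {i. l i = m})"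
    then have "A *v v = m *\<^sub>R v"
      by (induction rule: span_induct_alt)
         (auto simp: matrix_vector_right_distrib matrix_vector_mult_scaleR l scaleR_add_right)
    then show "v \<in> {v. A *v v = m *\<^sub>R v}" by simp
  qed
  have inj: "inj e"
  proof (rule injI)
    fix i j assume "e i = e j"
    then show "i = j" using e[of i i] e[of i j] by (auto split: if_splits)
  qed
  have dim: "dim {v. A *v v = m *\<^sub>R v} = card {i. l i = m}" for m
  proof -
    have "independent (e ` {i. l i = m})"
    proof (rule pairwise_orthogonal_independent)
      show "pairwise orthogonal (e ` {i. l i = m})"
        using e by (auto simp: pairwise_def orthogonal_def)
      show "0 \<notin> e ` {i. l i = m}"
      proof
        assume "0 \<in> e ` {i. l i = m}"
        then obtain i where "e i = 0" by (metis imageE)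
        then show False using e[of i i] by simp
      qed
    qed
    then have "dim {v. A *v v = m *\<^sub>R v} = card (e ` {i. l i = m})"
      by (simp add: eig dim_span dim_eq_card_independent)
    then show ?thesis using inj by (simp add: card_image inj_on_def inj_def)
  qed
  have evs: "{m. 0 < m \<and> (\<exists>v. v \<noteq> 0 \<and> A *v v = m *\<^sub>R v)} = l ` (UNIV - {i0})"
  proof (intro set_eqI iffI)
    fix m assume "m \<in> {m. 0 < m \<and> (\<exists>v. v \<noteq> 0 \<and> A *v v = m *\<^sub>R v)}"
    then obtain v where m: "0 < m" and v: "v \<noteq> 0" "v \<in> span (e ` {i. l i = m})"
      using eig by blast
    then have "{i. l i = m} \<noteq> {}" by (metis image_empty span_empty singletonD)
    then show "m \<in> l ` (UNIV - {i0})" using m i0 by auto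
  next
    fix m assume "m \<in> l ` (UNIV - {i0})"
    then obtain i where i: "i \<noteq> i0" "m = l i" by blast
    moreover have "e i \<noteq> 0" using e[of i i] by auto
    ultimately show "m \<in> {m. 0 < m \<and> (\<exists>v. v \<noteq> 0 \<and> A *v v = m *\<^sub>R v)}" using lpos l by auto
  qed
  have "prod_pos_eigenvalues A = (\<Prod>m\<in>l ` (UNIV - {i0}). m ^ card {i. l i = m})"
    unfolding prod_pos_eigenvalues_def evs dim ..
  also have "\<dots> = (\<Prod>m\<in>l ` (UNIV - {i0}). \<Prod>i\<in>{i \<in> UNIV - {i0}. l i = m}. l i)"
  proof (rule prod.cong[OF refl])
    fix m assume "m \<in> l ` (UNIV - {i0})"
    then have "m > 0" using lpos by auto
    then have "{i \<in> UNIV - {i0}. l i = m} = {i. l i = m}" using i0 by auto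
    then show "m ^ card {i. l i = m} = (\<Prod>i\<in>{i \<in> UNIV - {i0}. l i = m}. l i)" by simp
  qed
  also have "\<dots> = (\<Prod>i\<in>UNIV - {i0}. l i)" by (rule prod.image_gen[symmetric]) simp
  finally have main: "prod_pos_eigenvalues A = (\<Prod>i\<in>UNIV - {i0}. l i)" .
  then show "prod_pos_eigenvalues A = det (\<chi> i j. A $ i $ j + u $ i * u $ j)"
    using detB' by (simp add: B_def)
  show "0 < prod_pos_eigenvalues A" unfolding main by (rule prod_pos) (use lpos in auto)
qed

section \<open>Integration over the simplex\<close>

definition orthant :: "(real^'n::finite) set" where
  "orthant = {p. \<forall>i. 0 < p $ i}"

lemma open_orthant: "open (orthant :: (real^'n::finite) set)"
proof -
  have "open {p :: real^'n. 0 < p $ i}" for i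
    by (rule open_Collect_less) (intro continuous_intros)+
  then have "open (\<Inter>i\<in>UNIV. {p :: real^'n. 0 < p $ i})" by (intro open_INT) auto
  moreover have "(\<Inter>i\<in>UNIV. {p :: real^'n. 0 < p $ i}) = orthant" by (auto simp: orthant_def)
  ultimately show ?thesis by simp
qed

lemma prob_simplex_eq: "prob_simplex = {p. (\<Sum>i\<in>UNIV. p $ i) = 1} \<inter> orthant"
  by (auto simp: prob_simplex_def orthant_def)

lemma prob_simplex_subset_orthant: "prob_simplex \<subseteq> orthant"
  by (auto simp: prob_simplex_eq)

definition slab :: "(real^'n::finite) set" where
  "slab = {x. 1 \<le> (\<Sum>i\<in>UNIV. x $ i) \<and> (\<Sum>i\<in>UNIV. x $ i) \<le> 1 + sqrt (real CARD('n))}"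

text \<open>
  Extension by 0 turns integrals over the simplex into Lebesgue integrals over the slab, where
  translations are available.
\<close>

definition on_simplex :: "(real^'n::finite \<Rightarrow> real) \<Rightarrow> real^'n \<Rightarrow> real" where
  "on_simplex f p = (if p \<in> prob_simplex then f p else 0)"

lemma sum_hyperplane_proj: "(\<Sum>i\<in>UNIV. hyperplane_proj (x :: real^'n::finite) $ i) = 1"
  by (simp add: hyperplane_proj_def sum_subtractf)

lemma hyperplane_proj_add:
  "(\<Sum>i\<in>UNIV. v $ i) = 0 \<Longrightarrow> hyperplane_proj (x + v) = hyperplane_proj x + (v :: real^'n::finite)"
  by (simp add: hyperplane_proj_def vec_eq_iff sum.distrib)

lemma slab_add: "(\<Sum>i\<in>UNIV. v $ i) = 0 \<Longrightarrow> x + v \<in> slab \<longleftrightarrow> (x :: real^'n::finite) \<in> slab"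
  by (simp add: slab_def sum.distrib)

lemma continuous_hyperplane_proj: "continuous_on A (hyperplane_proj :: real^'n::finite \<Rightarrow> real^'n)"
  unfolding hyperplane_proj_def by (intro continuous_on_vec_lambda continuous_intros) simp

lemma hyperplane_proj_measurable [measurable]: "hyperplane_proj \<in> borel_measurable borel"
  by (intro borel_measurable_continuous_onI continuous_hyperplane_proj)

lemma closed_slab: "closed (slab :: (real^'n::finite) set)"
proof -
  have 1: "closed {x :: real^'n. 1 \<le> (\<Sum>i\<in>UNIV. x $ i)}"
    by (intro closed_Collect_le continuous_intros)
  have 2: "closed {x :: real^'n. (\<Sum>i\<in>UNIV. x $ i) \<le> 1 + sqrt (real CARD('n))}"
    by (intro closed_Collect_le continuous_intros)
  show ?thesis unfolding slab_def Collect_conj_eq by (rule closed_Int[OF 1 2])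
qed

lemma slab_measurable [measurable]: "slab \<in> sets borel"
  using closed_slab by (rule borel_closed)

lemma prob_simplex_measurable [measurable]: "prob_simplex \<in> sets (borel :: (real^'n::finite) measure)"
proof -
  have "closed {p :: real^'n. (\<Sum>i\<in>UNIV. p $ i) = 1}"
    by (intro closed_Collect_eq continuous_intros)
  then show ?thesis
    unfolding prob_simplex_eq by (intro sets.Int borel_closed borel_open open_orthant)
qed

lemma simplex_volume_integral:
  fixes f :: "real^'n::finite \<Rightarrow> real"
  assumes "on_simplex f \<in> borel_measurable borel"
  shows "(\<integral>p. f p \<partial>simplex_volume) = (\<integral>x. indicator slab x * on_simplex f (hyperplane_proj x) \<partial>lborel)"
    and "integrable simplex_volume f \<longleftrightarrow> integrable lborel (\<lambda>x. indicator slab x * on_simplex f (hyperplane_proj x))"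
proof -
  let ?R = "restrict_space (lborel :: (real^'n) measure) slab"
  have ind: "(\<lambda>p. indicator prob_simplex p *\<^sub>R f p) = on_simplex f"
    by (auto simp: on_simplex_def fun_eq_iff)
  have S: "prob_simplex \<inter> space (distr ?R borel hyperplane_proj) \<in> sets (distr ?R borel hyperplane_proj)"
    by simp
  have pm: "hyperplane_proj \<in> ?R \<rightarrow>\<^sub>M borel" by (intro measurable_restrict_space1) simp
  have sl: "slab \<inter> space (lborel :: (real^'n) measure) \<in> sets lborel" by simp
  have eq: "simplex_volume = restrict_space (distr ?R borel hyperplane_proj) prob_simplex"
    by (simp add: simplex_volume_def slab_def)
  have "(\<integral>p. f p \<partial>simplex_volume) = (\<integral>p. on_simplex f p \<partial>distr ?R borel hyperplane_proj)"
    unfolding eq ind[symmetric] by (rule integral_restrict_space[OF S])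
  also have "\<dots> = (\<integral>x. on_simplex f (hyperplane_proj x) \<partial>?R)"
    by (rule integral_distr[OF pm assms])
  also have "\<dots> = (\<integral>x. indicator slab x * on_simplex f (hyperplane_proj x) \<partial>lborel)"
    by (subst integral_restrict_space[OF sl]) simp
  finally show "(\<integral>p. f p \<partial>simplex_volume) = (\<integral>x. indicator slab x * on_simplex f (hyperplane_proj x) \<partial>lborel)" .
  have "integrable simplex_volume f \<longleftrightarrow> integrable (distr ?R borel hyperplane_proj) (on_simplex f)"
    unfolding eq ind[symmetric] by (rule integrable_restrict_space[OF S])
  also have "\<dots> \<longleftrightarrow> integrable ?R (\<lambda>x. on_simplex f (hyperplane_proj x))"
    by (rule integrable_distr_eq[OF pm assms])
  also have "\<dots> \<longleftrightarrow> integrable lborel (\<lambda>x. indicator slab x * on_simplex f (hyperplane_proj x))"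
    by (subst integrable_restrict_space[OF sl]) simp
  finally show "integrable simplex_volume f \<longleftrightarrow> integrable lborel (\<lambda>x. indicator slab x * on_simplex f (hyperplane_proj x))" .
qed

lemma on_simplex_measurable:
  fixes f :: "real^'n::finite \<Rightarrow> real"
  assumes "continuous_on prob_simplex f"
  shows "on_simplex f \<in> borel_measurable borel"
proof -
  have "(\<lambda>p. indicator prob_simplex p *\<^sub>R f p) = on_simplex f"
    by (auto simp: on_simplex_def fun_eq_iff)
  then show ?thesis
    using borel_measurable_continuous_on_indicator[OF prob_simplex_measurable assms] by simp
qed

lemma simplex_volume_measurable:
  assumes "continuous_on prob_simplex f"
  shows "f \<in> borel_measurable (simplex_volume :: (real^'n::finite) measure)"
proof -
  have "f \<in> borel_measurable (restrict_space borel prob_simplex)"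
    by (rule borel_measurable_continuous_on_restrict[OF assms])
  moreover have "sets (simplex_volume :: (real^'n) measure) = sets (restrict_space borel prob_simplex)"
    unfolding simplex_volume_def by (rule sets_restrict_space_cong) simp
  ultimately show ?thesis using measurable_cong_sets by blast
qed

lemma space_simplex_volume: "space simplex_volume = prob_simplex"
  by (simp add: simplex_volume_def space_restrict_space)

definition compact_support_in_simplex :: "(real^'n::finite \<Rightarrow> real) \<Rightarrow> bool" where
  "compact_support_in_simplex f \<longleftrightarrow> (\<exists>K. compact K \<and> K \<subseteq> prob_simplex \<and> (\<forall>p\<in>prob_simplex - K. f p = 0))"

text \<open>
  Functions with bounded support on the hyperplane thus have bounded support on the slab, after
  composition with the projection.
\<close>

lemma slab_bounded_fibre:
  "\<exists>R'. \<forall>x\<in>slab. norm (hyperplane_proj (x :: real^'n::finite)) \<le> R \<longrightarrow> norm x \<le> R'"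
proof (intro exI ballI impI)
  fix x :: "real^'n" assume x: "x \<in> slab" and n: "norm (hyperplane_proj x) \<le> R"
  define c where "c = ((\<Sum>j\<in>UNIV. x $ j) - 1) / real CARD('n)"
  have c: "0 \<le> c" "c \<le> sqrt (real CARD('n))"
  proof -
    show "0 \<le> c" using x by (simp add: c_def slab_def)
    have "c \<le> sqrt (real CARD('n)) / real CARD('n)" using x by (simp add: c_def slab_def divide_right_mono)
    also have "\<dots> \<le> sqrt (real CARD('n)) / 1" by (rule divide_left_mono) (auto simp: Suc_le_eq)
    finally show "c \<le> sqrt (real CARD('n))" by simp
  qed
  have "x = hyperplane_proj x + c *\<^sub>R (\<chi> i. 1)" by (simp add: vec_eq_iff hyperplane_proj_def c_def)
  then have "norm x \<le> norm (hyperplane_proj x) + norm (c *\<^sub>R (\<chi> i. 1) :: real^'n)" by (metis norm_triangle_ineq)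
  also have "\<dots> \<le> R + sqrt (real CARD('n)) * norm ((\<chi> i. 1) :: real^'n)"
    using n c by (intro add_mono) (auto intro!: mult_right_mono)
  finally show "norm x \<le> R + sqrt (real CARD('n)) * norm ((\<chi> i. 1) :: real^'n)" .
qed

lemma integrable_bounded_slab:
  fixes k :: "real^'n::finite \<Rightarrow> real"
  assumes m: "k \<in> borel_measurable borel" and b: "\<And>p. \<bar>k p\<bar> \<le> C" and z: "\<And>p. R < norm p \<Longrightarrow> k p = 0"
  shows "integrable lborel (\<lambda>x. indicator slab x * k (hyperplane_proj x))"
proof -
  obtain R' where R': "\<And>x :: real^'n. x \<in> slab \<Longrightarrow> norm (hyperplane_proj x) \<le> R \<Longrightarrow> norm x \<le> R'"
    using slab_bounded_fibre[of R] by blast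
  show ?thesis
  proof (rule Bochner_Integration.integrable_bound[of lborel "\<lambda>x. C * indicator (cball 0 R') x"])
    show "integrable lborel (\<lambda>x :: real^'n. C * indicator (cball 0 R') x)"
      by (intro integrable_mult_right integrable_real_indicator emeasure_bounded_finite) auto
    show "(\<lambda>x. indicator slab x * k (hyperplane_proj x)) \<in> borel_measurable lborel"
      using m by measurable
    have "\<bar>indicator slab x * k (hyperplane_proj x)\<bar> \<le> \<bar>C * indicator (cball 0 R') x\<bar>" for x
    proof (cases "x \<in> slab \<and> norm (hyperplane_proj x) \<le> R")
      case True
      then have "x \<in> cball 0 R'" using R' by simp
      moreover have "\<bar>k (hyperplane_proj x)\<bar> \<le> \<bar>C\<bar>"
        using b[of "hyperplane_proj x"] abs_ge_self[of C] by (rule order_trans)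
      ultimately show ?thesis using True by (simp add: indicator_def)
    next
      case False
      then have z0: "indicator slab x * k (hyperplane_proj x) = 0"
        using z[of "hyperplane_proj x"] by (auto simp: indicator_def)
      show ?thesis unfolding z0 by simp
    qed
    then show "AE x in lborel. norm (indicator slab x * k (hyperplane_proj x)) \<le> norm (C * indicator (cball 0 R') x)"
      by (intro AE_I2) simp
  qed
qed

lemma compact_support_bounds:
  fixes f :: "real^'n::finite \<Rightarrow> real"
  assumes "continuous_on prob_simplex f" "compact K" "K \<subseteq> prob_simplex" "\<And>p. p \<in> prob_simplex - K \<Longrightarrow> f p = 0"
  shows "\<exists>C R. (\<forall>p. \<bar>on_simplex f p\<bar> \<le> C) \<and> (\<forall>p. R < norm p \<longrightarrow> on_simplex f p = 0)"
proof -
  have "compact (f ` K)" using assms by (intro compact_continuous_image continuous_on_subset[OF assms(1)])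
  then obtain C where C: "\<And>p. p \<in> K \<Longrightarrow> \<bar>f p\<bar> \<le> C" using compact_imp_bounded[of "f ` K"] by (auto simp: bounded_iff)
  obtain R where R: "\<And>p. p \<in> K \<Longrightarrow> norm p \<le> R" using compact_imp_bounded[OF assms(2)] by (auto simp: bounded_iff)
  have off: "on_simplex f p = 0" if "p \<notin> K" for p
    using assms(4)[of p] that by (simp add: on_simplex_def)
  have 1: "\<bar>on_simplex f p\<bar> \<le> \<bar>C\<bar>" for p
  proof (cases "p \<in> K")
    case True
    then have "on_simplex f p = f p" using assms(3) by (auto simp: on_simplex_def)
    then show ?thesis using C[OF True] by linarith
  qed (simp add: off)
  have 2: "on_simplex f p = 0" if "R < norm p" for p
    by (rule off) (use R[of p] that in linarith)
  show ?thesis using 1 2 by blast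
qed

lemma integrable_simplex_volume:
  fixes f :: "real^'n::finite \<Rightarrow> real"
  assumes f: "continuous_on prob_simplex f" and s: "compact_support_in_simplex f"
  shows "integrable simplex_volume f"
proof -
  obtain K where K: "compact K" "K \<subseteq> prob_simplex" "\<And>p. p \<in> prob_simplex - K \<Longrightarrow> f p = 0"
    using s unfolding compact_support_in_simplex_def by blast
  obtain C R where "\<forall>p. \<bar>on_simplex f p\<bar> \<le> C" "\<forall>p. R < norm p \<longrightarrow> on_simplex f p = 0"
    using compact_support_bounds[OF f K] by blast
  note b = this[rule_format]
  show ?thesis
    unfolding simplex_volume_integral(2)[OF on_simplex_measurable[OF f]]
    by (rule integrable_bounded_slab[OF on_simplex_measurable[OF f] b])
qed

text \<open>
  Lebesgue measure is invariant under translation by \<open>v\<close>, and such a translation along the hyperplane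
  maps the slab to itself and commutes with the projection.
\<close>

lemma slab_integral_translate:
  fixes k :: "real^'n::finite \<Rightarrow> real"
  assumes k: "k \<in> borel_measurable borel" and v: "(\<Sum>i\<in>UNIV. v $ i) = 0"
  shows "(\<integral>x. indicator slab x * k (hyperplane_proj x + v) \<partial>lborel) = (\<integral>x. indicator slab x * k (hyperplane_proj x) \<partial>lborel)"
proof -
  let ?g = "\<lambda>x. indicator slab x * k (hyperplane_proj x)"
  have m: "?g \<in> borel_measurable borel" using k by measurable
  have "(\<integral>x. ?g x \<partial>lborel) = (\<integral>x. ?g x \<partial>distr lborel borel ((+) v))" by (simp only: lborel_distr_plus)
  also have "\<dots> = (\<integral>x. ?g (v + x) \<partial>lborel)" by (rule integral_distr) (use m in auto)
  also have "\<dots> = (\<integral>x. indicator slab x * k (hyperplane_proj x + v) \<partial>lborel)"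
    by (intro Bochner_Integration.integral_cong refl)
       (simp add: add.commute[of v] hyperplane_proj_add[OF v] indicator_def slab_add[OF v])
  finally show ?thesis ..
qed

text \<open>
  The extension by 0 of a compactly supported function is differentiable along every line in the
  hyperplane, also where the line leaves the simplex: near such a point the extension vanishes, since
  the support is closed.
\<close>

lemma simplex_line_derivative:
  fixes h :: "real^'n::finite \<Rightarrow> real"
  assumes U: "prob_simplex \<subseteq> U" and h: "C1_on U h"
    and K: "compact K" "K \<subseteq> prob_simplex" "\<And>p. p \<in> prob_simplex - K \<Longrightarrow> h p = 0"
    and v: "(\<Sum>i\<in>UNIV. v $ i) = 0" and p: "(\<Sum>i\<in>UNIV. p $ i) = 1"
  shows "((\<lambda>t. on_simplex h (p + t *\<^sub>R v)) has_real_derivative on_simplex (\<lambda>q. frechet_derivative h (at q) v) (p + t *\<^sub>R v)) (at t)"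
    and "p \<notin> K \<Longrightarrow> on_simplex (\<lambda>q. frechet_derivative h (at q) v) p = 0"
proof -
  have sums: "(\<Sum>i\<in>UNIV. (p + t *\<^sub>R v) $ i) = 1" for t
    using v p by (simp add: sum.distrib sum_distrib_left[symmetric])
  have inS: "((\<lambda>t. on_simplex h (p + t *\<^sub>R v)) has_real_derivative frechet_derivative h (at (p + t *\<^sub>R v)) v) (at t)"
    if S: "p + t *\<^sub>R v \<in> prob_simplex" for t
  proof -
    have d: "(h has_derivative frechet_derivative h (at (p + t *\<^sub>R v))) (at (p + t *\<^sub>R v))"
      using C1_on_has_derivative[OF h] U S by blast
    have l: "((\<lambda>t. p + t *\<^sub>R v) has_derivative (\<lambda>s. s *\<^sub>R v)) (at t)"
      by (auto intro!: derivative_eq_intros)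
    have "((\<lambda>t. h (p + t *\<^sub>R v)) has_derivative (\<lambda>s. frechet_derivative h (at (p + t *\<^sub>R v)) (s *\<^sub>R v))) (at t)"
      using diff_chain_at[OF l d] by (simp add: o_def)
    then have hd: "((\<lambda>t. h (p + t *\<^sub>R v)) has_real_derivative frechet_derivative h (at (p + t *\<^sub>R v)) v) (at t)"
      unfolding has_field_derivative_def
      by (simp add: linear_scale[OF has_derivative_linear[OF d]] mult.commute[of _ "frechet_derivative h (at (p + t *\<^sub>R v)) v"])
    define Op where "Op = (\<lambda>t. p + t *\<^sub>R v) -` orthant"
    have "open Op" unfolding Op_def by (rule open_vimage[OF open_orthant]) (intro continuous_intros)
    moreover have "t \<in> Op" using S by (simp add: Op_def prob_simplex_eq)
    moreover have "h (p + t *\<^sub>R v) = on_simplex h (p + t *\<^sub>R v)" if "t \<in> Op" for t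
      using that sums[of t] by (auto simp: on_simplex_def prob_simplex_eq Op_def)
    ultimately show ?thesis by (rule has_field_derivative_transform_within_open[OF hd])
  qed
  have offK: "((\<lambda>t. on_simplex h (p + t *\<^sub>R v)) has_real_derivative 0) (at t)"
    if S: "p + t *\<^sub>R v \<notin> K" for t
  proof -
    define Op where "Op = (\<lambda>t. p + t *\<^sub>R v) -` (- K)"
    have "open Op" unfolding Op_def
      by (rule open_vimage) (use K(1) in \<open>auto intro!: continuous_intros simp: compact_imp_closed open_Compl\<close>)
    moreover have "t \<in> Op" using S by (simp add: Op_def)
    moreover have "0 = on_simplex h (p + t *\<^sub>R v)" if "t \<in> Op" for t
      using that K(3)[of "p + t *\<^sub>R v"] by (auto simp: on_simplex_def Op_def)
    ultimately show ?thesis by (rule has_field_derivative_transform_within_open[OF DERIV_const])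
  qed
  show "((\<lambda>t. on_simplex h (p + t *\<^sub>R v)) has_real_derivative on_simplex (\<lambda>q. frechet_derivative h (at q) v) (p + t *\<^sub>R v)) (at t)"
  proof (cases "p + t *\<^sub>R v \<in> prob_simplex")
    case True
    then show ?thesis using inS[OF True] by (simp add: on_simplex_def)
  next
    case False
    then show ?thesis using offK[of t] K(2) by (auto simp: on_simplex_def)
  qed
  show "on_simplex (\<lambda>q. frechet_derivative h (at q) v) p = 0" if "p \<notin> K"
  proof (cases "p \<in> prob_simplex")
    case True
    then show ?thesis using DERIV_unique[OF inS[of 0] offK[of 0]] that by (simp add: on_simplex_def)
  qed (simp add: on_simplex_def)
qed

text \<open>
  Integration by parts on the simplex. By translation invariance all difference quotients in the
  direction \<open>v\<close> have integral 0; they converge dominatedly to the derivative.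
\<close>

theorem integral_tangential_derivative_eq_0:
  fixes h :: "real^'n::finite \<Rightarrow> real"
  assumes U: "prob_simplex \<subseteq> U" and h: "C1_on U h" and s: "compact_support_in_simplex h"
    and v: "(\<Sum>i\<in>UNIV. v $ i) = 0"
  shows "(\<integral>p. frechet_derivative h (at p) v \<partial>simplex_volume) = 0"
proof -
  obtain K where K: "compact K" "K \<subseteq> prob_simplex" "\<And>p. p \<in> prob_simplex - K \<Longrightarrow> h p = 0"
    using s unfolding compact_support_in_simplex_def by blast
  let ?d = "\<lambda>q. frechet_derivative h (at q) v"
  have hc: "continuous_on prob_simplex h" using C1_on_imp_continuous_on[OF h] U continuous_on_subset by blast
  have dc: "continuous_on prob_simplex ?d" using C1_on_frechet_continuous[OF h] U continuous_on_subset by blast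
  have d0: "?d p = 0" if "p \<in> prob_simplex - K" for p
    using simplex_line_derivative(2)[OF U h K v, of p] that by (auto simp: on_simplex_def prob_simplex_def)
  obtain C where "\<forall>p. \<bar>on_simplex ?d p\<bar> \<le> C"
    using compact_support_bounds[OF dc K(1,2) d0] by blast
  note C = this[rule_format]
  have C0: "0 \<le> C" by (rule order_trans[OF abs_ge_zero C])
  obtain C' R where C'_all: "\<forall>p. \<bar>on_simplex h p\<bar> \<le> C'" and R_all: "\<forall>p. R < norm p \<longrightarrow> on_simplex h p = 0"
    using compact_support_bounds[OF hc K] by blast
  note C' = C'_all[rule_format] and R = R_all[rule_format]
  have hm: "on_simplex h \<in> borel_measurable borel" by (rule on_simplex_measurable[OF hc])
  have dm: "on_simplex ?d \<in> borel_measurable borel" by (rule on_simplex_measurable[OF dc])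
  define t where "t n = 1 / real (Suc n)" for n
  have t0: "0 < t n" "t n \<le> 1" for n by (auto simp: t_def)
  have vt: "(\<Sum>i\<in>UNIV. (t n *\<^sub>R v) $ i) = 0" for n using v by (simp add: sum_distrib_left[symmetric])
  define k where "k n p = (on_simplex h (p + t n *\<^sub>R v) - on_simplex h p) / t n" for n p
  have shm: "(\<lambda>p. on_simplex h (p + t n *\<^sub>R v)) \<in> borel_measurable borel" for n
    by (rule measurable_compose[OF _ hm]) simp
  have km: "k n \<in> borel_measurable borel" for n
    unfolding k_def[abs_def] using hm shm by (intro borel_measurable_divide borel_measurable_diff) auto
  have kb: "\<bar>k n p\<bar> \<le> C" if p: "(\<Sum>i\<in>UNIV. p $ i) = 1" for n p
  proof -
    have "norm (on_simplex h (p + t n *\<^sub>R v) - on_simplex h (p + 0 *\<^sub>R v)) \<le> C * norm (t n - 0)"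
      by (rule field_differentiable_bound[of UNIV "\<lambda>t. on_simplex h (p + t *\<^sub>R v)"
            "\<lambda>t. on_simplex ?d (p + t *\<^sub>R v)"])
         (use simplex_line_derivative(1)[OF U h K v p] C in auto)
    then show ?thesis using t0[of n] by (simp add: k_def pos_divide_le_eq)
  qed
  have kz: "k n p = 0" if "R + norm v < norm p" for n p
  proof -
    have "R < norm p" using that norm_ge_zero[of v] by linarith
    moreover have "R < norm (p + t n *\<^sub>R v)"
    proof -
      have "norm (t n *\<^sub>R v) \<le> 1 * norm v" using t0[of n] unfolding norm_scaleR by (intro mult_right_mono) auto
      then show ?thesis using that norm_diff_ineq[of p "t n *\<^sub>R v"] by linarith
    qed
    ultimately show ?thesis by (simp add: k_def R)
  qed
  have k0: "(\<integral>x. indicator slab x * k n (hyperplane_proj x) \<partial>lborel) = 0" for n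
  proof -
    have i1: "integrable lborel (\<lambda>x. indicator slab x * on_simplex h (hyperplane_proj x))"
      by (rule integrable_bounded_slab[OF hm C' R])
    have i2: "integrable lborel (\<lambda>x. indicator slab x * on_simplex h (hyperplane_proj x + t n *\<^sub>R v))"
    proof (rule integrable_bounded_slab[OF shm C'])
      fix p :: "real^'n" assume "R + norm v < norm p"
      have "norm (t n *\<^sub>R v) \<le> 1 * norm v" using t0[of n] unfolding norm_scaleR by (intro mult_right_mono) auto
      then have "R < norm (p + t n *\<^sub>R v)" using \<open>R + norm v < norm p\<close> norm_diff_ineq[of p "t n *\<^sub>R v"] by linarith
      then show "on_simplex h (p + t n *\<^sub>R v) = 0" by (rule R)
    qed
    have "(\<integral>x. indicator slab x * k n (hyperplane_proj x) \<partial>lborel) =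
      (\<integral>x. (indicator slab x * on_simplex h (hyperplane_proj x + t n *\<^sub>R v) -
         indicator slab x * on_simplex h (hyperplane_proj x)) / t n \<partial>lborel)"
      by (intro Bochner_Integration.integral_cong refl) (simp add: k_def right_diff_distrib)
    also have "\<dots> = 0"
      using i1 i2 slab_integral_translate[OF hm vt[of n]] by simp
    finally show ?thesis .
  qed
  obtain R' where R': "\<And>x :: real^'n. x \<in> slab \<Longrightarrow> norm (hyperplane_proj x) \<le> R + norm v \<Longrightarrow> norm x \<le> R'"
    using slab_bounded_fibre[of "R + norm v"] by blast
  have "(\<lambda>n. \<integral>x. indicator slab x * k n (hyperplane_proj x) \<partial>lborel) \<longlonglongrightarrow>
      (\<integral>x. indicator slab x * on_simplex ?d (hyperplane_proj x) \<partial>lborel)"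
  proof (rule integral_dominated_convergence[where w="\<lambda>x. C * indicator (cball 0 R') x"])
    show "integrable lborel (\<lambda>x :: real^'n. C * indicator (cball 0 R') x)"
      by (intro integrable_mult_right integrable_real_indicator emeasure_bounded_finite) auto
    show "(\<lambda>x. indicator slab x * on_simplex ?d (hyperplane_proj x)) \<in> borel_measurable lborel"
      using dm by measurable
    show "(\<lambda>x. indicator slab x * k n (hyperplane_proj x)) \<in> borel_measurable lborel" for n
      using km[of n] by measurable
    show "AE x in lborel. (\<lambda>n. indicator slab x * k n (hyperplane_proj x)) \<longlonglongrightarrow> indicator slab x * on_simplex ?d (hyperplane_proj x)"
    proof (intro AE_I2 tendsto_mult tendsto_const)
      fix x :: "real^'n"
      let ?p = "hyperplane_proj x"
      have "((\<lambda>t. on_simplex h (?p + t *\<^sub>R v)) has_real_derivative on_simplex ?d (?p + 0 *\<^sub>R v)) (at 0)"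
        by (rule simplex_line_derivative(1)[OF U h K v sum_hyperplane_proj])
      then have lim: "((\<lambda>t. (on_simplex h (?p + t *\<^sub>R v) - on_simplex h ?p) / t) \<longlongrightarrow> on_simplex ?d ?p) (at 0)"
        by (simp add: DERIV_def)
      have "t \<longlonglongrightarrow> 0" unfolding t_def by (rule LIMSEQ_Suc[OF lim_const_over_n])
      moreover have "t n \<noteq> 0" for n using t0(1)[of n] by simp
      ultimately have "filterlim t (at 0) sequentially" by (simp add: filterlim_at)
      from filterlim_compose[OF lim this] show "(\<lambda>n. k n ?p) \<longlonglongrightarrow> on_simplex ?d ?p"
        unfolding k_def .
    qed
    show "AE x in lborel. norm (indicator slab x * k n (hyperplane_proj x)) \<le> C * indicator (cball 0 R') x" for n
    proof (rule AE_I2)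
      fix x :: "real^'n"
      show "norm (indicator slab x * k n (hyperplane_proj x)) \<le> C * indicator (cball 0 R') x"
      proof (cases "x \<in> slab \<and> norm (hyperplane_proj x) \<le> R + norm v")
        case True
        then have "x \<in> cball 0 R'" using R' by simp
        then show ?thesis using True kb[OF sum_hyperplane_proj, of n x] by (simp add: indicator_def)
      next
        case False
        then have z0: "indicator slab x * k n (hyperplane_proj x) = 0"
          using kz[of "hyperplane_proj x"] by (auto simp: indicator_def)
        show ?thesis unfolding z0 using C0 by simp
      qed
    qed
  qed
  then have "(\<integral>x. indicator slab x * on_simplex ?d (hyperplane_proj x) \<partial>lborel) = 0"
    unfolding k0 by (simp add: LIMSEQ_const_iff)
  then show ?thesis using simplex_volume_integral(1)[OF dm] by simp
qed

text \<open>
  If \<open>f\<close> were positive at a point of the simplex, its extension to the slab would be positive on a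
  nonempty open set, which has positive Lebesgue measure.
\<close>

lemma nonneg_integral_eq_0_imp:
  fixes f :: "real^'n::finite \<Rightarrow> real"
  assumes f: "continuous_on prob_simplex f" and s: "compact_support_in_simplex f"
    and nn: "\<And>p. p \<in> prob_simplex \<Longrightarrow> 0 \<le> f p" and int: "(\<integral>p. f p \<partial>simplex_volume) = 0"
    and p: "p \<in> prob_simplex"
  shows "f p = 0"
proof (rule ccontr)
  assume "f p \<noteq> 0"
  then have fp: "0 < f p" using nn[OF p] by simp
  note m = on_simplex_measurable[OF f]
  let ?g = "\<lambda>x. indicator slab x * on_simplex f (hyperplane_proj x)"
  have "integrable lborel ?g"
    using integrable_simplex_volume[OF f s] simplex_volume_integral(2)[OF m] by simp
  moreover have "(\<integral>x. ?g x \<partial>lborel) = 0" using int simplex_volume_integral(1)[OF m] by simp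
  moreover have "AE x in lborel. 0 \<le> ?g x" using nn by (intro AE_I2) (auto simp: on_simplex_def indicator_def)
  ultimately have ae: "AE x in lborel. ?g x = 0" using integral_nonneg_eq_0_iff_AE by blast
  obtain A where A: "open A" "A \<inter> prob_simplex = f -` {0<..} \<inter> prob_simplex"
    using continuous_on_open_invariant[THEN iffD1, OF f, rule_format, of "{0<..}"] by auto
  define O' where "O' = {x :: real^'n. 1 < (\<Sum>i\<in>UNIV. x $ i)} \<inter> {x. (\<Sum>i\<in>UNIV. x $ i) < 1 + sqrt (real CARD('n))} \<inter>
     hyperplane_proj -` (A \<inter> orthant)"
  have oO: "open O'"
    unfolding O'_def
    by (intro open_Int open_vimage A(1) continuous_hyperplane_proj open_orthant open_Collect_less continuous_intros)
  (* A point strictly inside the slab above p: its coordinates have the sum 3/2. *)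
  define x where "x = p + (1 / (2 * real CARD('n))) *\<^sub>R (\<chi> i. 1 :: real^'n)"
  have sp: "(\<Sum>i\<in>UNIV. p $ i) = 1" using p by (simp add: prob_simplex_def)
  have sx: "(\<Sum>i\<in>UNIV. x $ i) = 1 + 1 / 2"
    by (simp add: x_def sum.distrib sp)
  have px: "hyperplane_proj x = p"
    by (simp add: hyperplane_proj_def vec_eq_iff sx) (simp add: x_def)
  have "1 \<le> sqrt (real CARD('n))" by (simp add: Suc_le_eq)
  then have "1 < sqrt (real CARD('n)) * 2" by linarith
  moreover have "p \<in> A" using A(2) p fp by blast
  ultimately have "x \<in> O'" using p by (auto simp: O'_def sx px prob_simplex_eq)
  have sub: "?g y \<noteq> 0" if "y \<in> O'" for y
  proof -
    have S: "hyperplane_proj y \<in> prob_simplex" using that sum_hyperplane_proj[of y] by (auto simp: O'_def prob_simplex_eq)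
    moreover have "hyperplane_proj y \<in> A" using that by (simp add: O'_def)
    ultimately have "0 < f (hyperplane_proj y)" using A(2) by blast
    moreover have "y \<in> slab" using that by (simp add: O'_def slab_def)
    ultimately show ?thesis using S by (simp add: on_simplex_def)
  qed
  obtain N where N: "N \<in> null_sets lborel" "{y \<in> space lborel. \<not> ?g y = 0} \<subseteq> N"
    using ae unfolding eventually_ae_filter by blast
  have "negligible N"
    unfolding negligible_iff_null_sets by (rule null_sets_completionI[OF N(1)])
  moreover have "O' \<subseteq> N" using sub N(2) by fastforce
  ultimately have "negligible O'" by (rule negligible_subset)
  then show False using open_not_negligible[OF oO] \<open>x \<in> O'\<close> by blast
qed

section \<open>Increments of Brownian motions\<close>

locale brownian_filtration = prob_space M for M :: "'a measure" +
  fixes F :: "real \<Rightarrow> 'a measure" and B :: "'m::finite \<Rightarrow> real \<Rightarrow> 'a \<Rightarrow> real"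
  assumes filt: "filtered_prob_space M F" and bm: "brownian_motions M F B"
begin

lemma subalg: "0 \<le> s \<Longrightarrow> subalgebra M (F s)"
  using filt unfolding filtered_prob_space_def by blast

lemma subalg_mono: "0 \<le> s \<Longrightarrow> s \<le> t \<Longrightarrow> subalgebra (F t) (F s)"
  using filt unfolding filtered_prob_space_def by blast

lemma adapted_mono: "f \<in> borel_measurable (F s) \<Longrightarrow> 0 \<le> s \<Longrightarrow> s \<le> t \<Longrightarrow> f \<in> borel_measurable (F t)"
  using measurable_from_subalg[OF subalg_mono] by blast

lemma adapted_measurable: "f \<in> borel_measurable (F s) \<Longrightarrow> 0 \<le> s \<Longrightarrow> f \<in> borel_measurable M"
  using measurable_from_subalg[OF subalg] by blast

lemma B_adapted: "0 \<le> s \<Longrightarrow> B k s \<in> borel_measurable (F s)"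
  using bm unfolding brownian_motions_def by blast

lemma increment_adapted:
  "0 \<le> s \<Longrightarrow> s \<le> t \<Longrightarrow> t \<le> u \<Longrightarrow> (\<lambda>\<omega>. B k t \<omega> - B k s \<omega>) \<in> borel_measurable (F u)"
  using adapted_mono[OF B_adapted] by (intro borel_measurable_diff) auto

lemma increment_measurable:
  "0 \<le> s \<Longrightarrow> s \<le> t \<Longrightarrow> (\<lambda>\<omega>. B k t \<omega> - B k s \<omega>) \<in> borel_measurable M"
  using adapted_measurable[OF B_adapted] by (intro borel_measurable_diff) auto

lemma increment_distributed:
  "0 \<le> s \<Longrightarrow> s < t \<Longrightarrow>
    distributed M lborel (\<lambda>\<omega>. B k t \<omega> - B k s \<omega>) (normal_density 0 (sqrt (t - s)))"
  using bm unfolding brownian_motions_def by blast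

text \<open>
  Independence of the past and the increments as a product formula. Taking \<open>f c = (\<lambda>_. 1)\<close> removes the
  increment of \<open>B c\<close> from the product, so single increments and products of two are special cases.
\<close>

lemma past_and_increments_indep:
  fixes W :: "'a \<Rightarrow> real" and f :: "'m \<Rightarrow> real \<Rightarrow> real"
  assumes st: "0 \<le> s" "s < t" and W: "W \<in> borel_measurable (F s)" "integrable M W"
    and f: "\<And>c. f c \<in> borel_measurable borel"
    and fi: "\<And>c. integrable M (\<lambda>\<omega>. f c (B c t \<omega> - B c s \<omega>))"
  shows "integrable M (\<lambda>\<omega>. W \<omega> * (\<Prod>c\<in>UNIV. f c (B c t \<omega> - B c s \<omega>)))"
    and "expectation (\<lambda>\<omega>. W \<omega> * (\<Prod>c\<in>UNIV. f c (B c t \<omega> - B c s \<omega>))) =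
      expectation W * (\<Prod>c\<in>UNIV. expectation (\<lambda>\<omega>. f c (B c t \<omega> - B c s \<omega>)))"
proof -
  define X where "X k = (case k of None \<Rightarrow> W | Some c \<Rightarrow> (\<lambda>\<omega>. f c (B c t \<omega> - B c s \<omega>)))" for k
  have ind: "indep_sets (\<lambda>k. case k of None \<Rightarrow> sets (F s)
            | Some k \<Rightarrow> {(\<lambda>\<omega>. B k t \<omega> - B k s \<omega>) -` A \<inter> space M | A. A \<in> sets borel}) UNIV"
    using bm st unfolding brownian_motions_def by blast
  have sp: "space (F s) = space M" using subalg[OF st(1)] by (simp add: subalgebra_def)
  have "indep_vars (\<lambda>_. borel) X UNIV"
    unfolding indep_vars_def2
  proof (intro conjI ballI)
    show "X k \<in> borel_measurable M" for k
      using adapted_measurable[OF W(1) st(1)] fi by (cases k) (auto simp: X_def)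
    show "indep_sets (\<lambda>k. {X k -` A \<inter> space M | A. A \<in> sets borel}) UNIV"
    proof (rule indep_sets_mono_sets[OF ind], clarify)
      fix k A assume A: "A \<in> sets (borel :: real measure)"
      show "X k -` A \<inter> space M \<in> (case k of None \<Rightarrow> sets (F s)
            | Some k \<Rightarrow> {(\<lambda>\<omega>. B k t \<omega> - B k s \<omega>) -` A \<inter> space M | A. A \<in> sets borel})"
      proof (cases k)
        case None
        then show ?thesis using measurable_sets[OF W(1) A] by (simp add: X_def sp)
      next
        case (Some c)
        have "f c -` A \<in> sets borel" using measurable_sets[OF f A, of c] by simp
        moreover have "X k -` A \<inter> space M = (\<lambda>\<omega>. B c t \<omega> - B c s \<omega>) -` (f c -` A) \<inter> space M"
          by (auto simp: X_def Some)
        ultimately show ?thesis using Some by auto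
      qed
    qed
  qed
  note iv = this
  have Xi: "integrable M (X k)" for k using W(2) fi by (cases k) (simp_all add: X_def)
  have eq: "(\<Prod>k\<in>UNIV. g k) = g None * (\<Prod>c\<in>UNIV. g (Some c))" for g :: "'m option \<Rightarrow> real"
  proof -
    have "(\<Prod>k\<in>UNIV. g k) = g None * (\<Prod>k\<in>range Some. g k)"
      by (subst UNIV_option_conv, subst prod.insert) auto
    then show ?thesis by (simp add: prod.reindex)
  qed
  have XN: "X None \<omega> = W \<omega>" "X (Some c) \<omega> = f c (B c t \<omega> - B c s \<omega>)" for c \<omega>
    by (simp_all add: X_def)
  from indep_vars_integrable[OF _ iv Xi]
  have "integrable M (\<lambda>\<omega>. \<Prod>k\<in>UNIV. X k \<omega>)" by simp
  then show "integrable M (\<lambda>\<omega>. W \<omega> * (\<Prod>c\<in>UNIV. f c (B c t \<omega> - B c s \<omega>)))"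
    unfolding eq XN .
  from indep_vars_lebesgue_integral[OF _ iv Xi]
  have "expectation (\<lambda>\<omega>. \<Prod>k\<in>UNIV. X k \<omega>) = (\<Prod>k\<in>UNIV. expectation (X k))" by simp
  then show "expectation (\<lambda>\<omega>. W \<omega> * (\<Prod>c\<in>UNIV. f c (B c t \<omega> - B c s \<omega>))) =
      expectation W * (\<Prod>c\<in>UNIV. expectation (\<lambda>\<omega>. f c (B c t \<omega> - B c s \<omega>)))"
    unfolding eq XN by (simp only: XN[abs_def])
qed

lemma increment_moment:
  assumes "0 \<le> s" "s < t"
  shows "integrable M (\<lambda>\<omega>. (B k t \<omega> - B k s \<omega>) ^ p)"
    and "expectation (\<lambda>\<omega>. (B k t \<omega> - B k s \<omega>) ^ p) = (\<integral>x. normal_density 0 (sqrt (t - s)) x * x ^ p \<partial>lborel)"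
proof -
  have D: "distributed M lborel (\<lambda>\<omega>. B k t \<omega> - B k s \<omega>) (normal_density 0 (sqrt (t - s)))"
    using increment_distributed assms by blast
  have "integrable lborel (\<lambda>x. normal_density 0 (sqrt (t - s)) x * (x - 0) ^ p)"
    using integrable_normal_moment[of "sqrt (t - s)" 0 p] assms by simp
  then show "integrable M (\<lambda>\<omega>. (B k t \<omega> - B k s \<omega>) ^ p)"
    using distributed_integrable[OF D, of "\<lambda>x. x ^ p"] by simp
  show "expectation (\<lambda>\<omega>. (B k t \<omega> - B k s \<omega>) ^ p) = (\<integral>x. normal_density 0 (sqrt (t - s)) x * x ^ p \<partial>lborel)"
    using distributed_integral[OF D, of "\<lambda>x. x ^ p"] by simp
qed

lemma increment_moments:
  assumes "0 \<le> s" "s < t"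
  shows "expectation (\<lambda>\<omega>. B k t \<omega> - B k s \<omega>) = 0"
    and "expectation (\<lambda>\<omega>. (B k t \<omega> - B k s \<omega>)\<^sup>2) = t - s"
    and "expectation (\<lambda>\<omega>. (B k t \<omega> - B k s \<omega>) ^ 4) = 3 * (t - s)\<^sup>2"
proof -
  have s: "0 < sqrt (t - s)" using assms by simp
  show "expectation (\<lambda>\<omega>. B k t \<omega> - B k s \<omega>) = 0"
    using increment_moment(2)[OF assms, of k 1] integral_normal_moment_odd[OF s, of 0 0] by simp
  show "expectation (\<lambda>\<omega>. (B k t \<omega> - B k s \<omega>)\<^sup>2) = t - s"
    using increment_moment(2)[OF assms, of k 2] integral_normal_moment_even[OF s, of 0 1] assms
    by (simp add: fact_numeral)
  have "fact 4 = (24::real)" by (simp add: fact_numeral)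
  then show "expectation (\<lambda>\<omega>. (B k t \<omega> - B k s \<omega>) ^ 4) = 3 * (t - s)\<^sup>2"
    using increment_moment(2)[OF assms, of k 4] integral_normal_moment_even[OF s, of 0 2] assms
    by (simp add: fact_numeral power_divide field_simps)
qed

text \<open>
  \<open>Z\<close> has conditional mean 0 and conditional second moment \<open>v\<close> given the \<open>\<sigma>\<close>-algebra of \<open>G\<close>. The
  conditional moments are tested against integrable weights, which is how they are used below.
\<close>

definition centered_given :: "'a measure \<Rightarrow> real \<Rightarrow> ('a \<Rightarrow> real) \<Rightarrow> bool" where
  "centered_given G v Z \<longleftrightarrow> Z \<in> borel_measurable M \<and>
     (\<forall>W\<in>borel_measurable G. integrable M W \<longrightarrow>
        integrable M (\<lambda>\<omega>. W \<omega> * Z \<omega>) \<and> expectation (\<lambda>\<omega>. W \<omega> * Z \<omega>) = 0 \<and>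
        integrable M (\<lambda>\<omega>. W \<omega> * (Z \<omega>)\<^sup>2) \<and> expectation (\<lambda>\<omega>. W \<omega> * (Z \<omega>)\<^sup>2) = v * expectation W)"

lemma centered_increment:
  assumes "0 \<le> s" "s \<le> t"
  shows "centered_given (F s) (t - s) (\<lambda>\<omega>. B k t \<omega> - B k s \<omega>)"
proof (cases "s = t")
  case True
  then show ?thesis by (simp add: centered_given_def)
next
  case False
  then have st: "0 \<le> s" "s < t" using assms by auto
  have pr: "integrable M (\<lambda>\<omega>. W \<omega> * (B k t \<omega> - B k s \<omega>) ^ p) \<and>
      expectation (\<lambda>\<omega>. W \<omega> * (B k t \<omega> - B k s \<omega>) ^ p) =
       expectation W * expectation (\<lambda>\<omega>. (B k t \<omega> - B k s \<omega>) ^ p)"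
    if W: "W \<in> borel_measurable (F s)" "integrable M W" for W p
  proof -
    define f where "f c = (\<lambda>x::real. if c = k then x ^ p else 1)" for c
    have f: "f c \<in> borel_measurable borel" "integrable M (\<lambda>\<omega>. f c (B c t \<omega> - B c s \<omega>))" for c
      using increment_moment(1)[OF st, of k p] by (auto simp: f_def) (cases "c = k"; simp)
    have 1: "(\<Prod>c\<in>UNIV. f c (B c t \<omega> - B c s \<omega>)) = (B k t \<omega> - B k s \<omega>) ^ p" for \<omega>
      unfolding f_def by (subst prod.remove[of UNIV k]) auto
    have 2: "(\<Prod>c\<in>UNIV. expectation (\<lambda>\<omega>. f c (B c t \<omega> - B c s \<omega>))) =
        expectation (\<lambda>\<omega>. (B k t \<omega> - B k s \<omega>) ^ p)"
      unfolding f_def by (subst prod.remove[of UNIV k]) (auto simp: prob_space)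
    show ?thesis
      using past_and_increments_indep[OF st W f] by (simp add: 1 2)
  qed
  show ?thesis
    unfolding centered_given_def
    using pr[of _ 1] pr[of _ 2] increment_moments[OF st, of k] increment_measurable[OF assms]
    by (auto simp: mult.commute)
qed

text \<open>
  The products of increments minus their mean are themselves centered given the past. Their second
  moments \<open>2 * (t - s)\<^sup>2\<close> and \<open>(t - s)\<^sup>2\<close> come from the fourth and the second moments of the normal law.
\<close>

lemma centered_increment_product:
  assumes st: "0 \<le> s" "s < t"
  shows "centered_given (F s) (if a = b then 2 * (t - s)\<^sup>2 else (t - s)\<^sup>2)
     (\<lambda>\<omega>. (B a t \<omega> - B a s \<omega>) * (B b t \<omega> - B b s \<omega>) - (if a = b then t - s else 0))"
proof -
  define D where "D c \<omega> = B c t \<omega> - B c s \<omega>" for c \<omega>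
  have Dm: "D c \<in> borel_measurable M" for c
    using increment_measurable[of s t c] st unfolding D_def by simp
  have Di: "integrable M (\<lambda>\<omega>. D c \<omega> ^ p)" for c p
    using increment_moment(1)[OF st] unfolding D_def by simp
  have E: "expectation (D c) = 0" "expectation (\<lambda>\<omega>. (D c \<omega>)\<^sup>2) = t - s"
    "expectation (\<lambda>\<omega>. (D c \<omega>)^4) = 3 * (t - s)\<^sup>2" for c
    using increment_moments[OF st] unfolding D_def by auto
  show ?thesis
  proof (cases "a = b")
    case True
    have pr: "integrable M (\<lambda>\<omega>. W \<omega> * (D a \<omega> ^ 2 - (t - s)) ^ p) \<and>
      expectation (\<lambda>\<omega>. W \<omega> * (D a \<omega> ^ 2 - (t - s)) ^ p) =
       expectation W * expectation (\<lambda>\<omega>. (D a \<omega> ^ 2 - (t - s)) ^ p)"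
      if W: "W \<in> borel_measurable (F s)" "integrable M W" and p: "p = 1 \<or> p = 2" for W p
    proof -
      define f where "f c = (\<lambda>x::real. if c = a then (x\<^sup>2 - (t - s)) ^ p else 1)" for c
      have *: "integrable M (\<lambda>\<omega>. (D a \<omega> ^ 2 - (t - s)) ^ p)"
      proof -
        have "(D a \<omega> ^ 2 - (t - s)) ^ 2 = D a \<omega> ^ 4 - 2 * (t - s) * D a \<omega> ^ 2 + (t - s)\<^sup>2" for \<omega>
          by (simp add: power2_eq_square power4_eq_xxxx algebra_simps)
        then show ?thesis using p Di[of a 2] Di[of a 4] by auto
      qed
      have f: "f c \<in> borel_measurable borel" "integrable M (\<lambda>\<omega>. f c (B c t \<omega> - B c s \<omega>))" for c
        using * by (auto simp: f_def D_def) (cases "c = a"; simp)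
      have 1: "(\<Prod>c\<in>UNIV. f c (B c t \<omega> - B c s \<omega>)) = (D a \<omega> ^ 2 - (t - s)) ^ p" for \<omega>
        unfolding f_def D_def by (subst prod.remove[of UNIV a]) auto
      have 2: "(\<Prod>c\<in>UNIV. expectation (\<lambda>\<omega>. f c (B c t \<omega> - B c s \<omega>))) =
          expectation (\<lambda>\<omega>. (D a \<omega> ^ 2 - (t - s)) ^ p)"
        unfolding f_def D_def by (subst prod.remove[of UNIV a]) (auto simp: prob_space)
      show ?thesis
        using past_and_increments_indep[OF st W f] by (simp add: 1 2)
    qed
    have "expectation (\<lambda>\<omega>. D a \<omega> ^ 2 - (t - s)) = 0"
      using Di[of a 2] E by (simp add: prob_space)
    moreover have "expectation (\<lambda>\<omega>. (D a \<omega> ^ 2 - (t - s)) ^ 2) = 2 * (t - s)\<^sup>2"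
    proof -
      have "(D a \<omega> ^ 2 - (t - s)) ^ 2 = D a \<omega> ^ 4 - 2 * (t - s) * D a \<omega> ^ 2 + (t - s)\<^sup>2" for \<omega>
        by (simp add: power2_eq_square power4_eq_xxxx algebra_simps)
      then have "expectation (\<lambda>\<omega>. (D a \<omega> ^ 2 - (t - s)) ^ 2) =
          expectation (\<lambda>\<omega>. D a \<omega> ^ 4 - 2 * (t - s) * D a \<omega> ^ 2 + (t - s)\<^sup>2)"
        by (simp only:)
      also have "\<dots> = 3 * (t - s)\<^sup>2 - 2 * (t - s) * (t - s) + (t - s)\<^sup>2"
        using Di[of a 2] Di[of a 4] E by (simp add: prob_space)
      finally show ?thesis by (simp add: power2_eq_square)
    qed
    ultimately show ?thesis
      unfolding centered_given_def D_def[symmetric] using True pr[of _ 1] pr[of _ 2] Dm[of b]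
      by (auto simp: power2_eq_square[symmetric] mult.commute)
  next
    case False
    have pr: "integrable M (\<lambda>\<omega>. W \<omega> * (D a \<omega> * D b \<omega>) ^ p) \<and>
      expectation (\<lambda>\<omega>. W \<omega> * (D a \<omega> * D b \<omega>) ^ p) =
       expectation W * (expectation (\<lambda>\<omega>. D a \<omega> ^ p) * expectation (\<lambda>\<omega>. D b \<omega> ^ p))"
      if W: "W \<in> borel_measurable (F s)" "integrable M W" for W p
    proof -
      define f where "f c = (\<lambda>x::real. if c = a \<or> c = b then x ^ p else 1)" for c
      have f1: "f c \<in> borel_measurable borel" for c by (simp add: f_def)
      have f2: "integrable M (\<lambda>\<omega>. f c (B c t \<omega> - B c s \<omega>))" for c
      proof (cases "c = a \<or> c = b")
        case True
        show ?thesis unfolding f_def if_P[OF True] using Di[of c p] by (simp only: D_def)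
      next
        case False
        show ?thesis unfolding f_def if_not_P[OF False] by simp
      qed
      note f = f1 f2
      have 1: "(\<Prod>c\<in>UNIV. f c (B c t \<omega> - B c s \<omega>)) = (D a \<omega> * D b \<omega>) ^ p" for \<omega>
      proof -
        have "(\<Prod>c\<in>UNIV. f c (B c t \<omega> - B c s \<omega>)) = (\<Prod>c\<in>{a, b}. f c (B c t \<omega> - B c s \<omega>))"
          by (rule prod.mono_neutral_right) (auto simp: f_def)
        then show ?thesis using False by (simp add: f_def D_def power_mult_distrib)
      qed
      have 2: "(\<Prod>c\<in>UNIV. expectation (\<lambda>\<omega>. f c (B c t \<omega> - B c s \<omega>))) =
          expectation (\<lambda>\<omega>. D a \<omega> ^ p) * expectation (\<lambda>\<omega>. D b \<omega> ^ p)"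
      proof -
        have "(\<Prod>c\<in>UNIV. expectation (\<lambda>\<omega>. f c (B c t \<omega> - B c s \<omega>))) =
          (\<Prod>c\<in>{a, b}. expectation (\<lambda>\<omega>. f c (B c t \<omega> - B c s \<omega>)))"
          by (rule prod.mono_neutral_right) (auto simp: f_def prob_space)
        then show ?thesis using False by (simp add: f_def D_def)
      qed
      show ?thesis
        using past_and_increments_indep[OF st W f] by (simp add: 1 2)
    qed
    show ?thesis
      unfolding centered_given_def D_def[symmetric] using False pr[of _ 1] pr[of _ 2] Dm E
      by (auto simp: power2_eq_square)
  qed
qed

lemma centered_given_subst: "centered_given G v Z \<Longrightarrow> v = v' \<Longrightarrow> centered_given G v' Z" by simp

lemma bounded_measurable_integrable:
  "f \<in> borel_measurable M \<Longrightarrow> (\<And>\<omega>. \<omega> \<in> space M \<Longrightarrow> \<bar>f \<omega>\<bar> \<le> C) \<Longrightarrow> integrable M (f :: 'a \<Rightarrow> real)"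
  by (rule integrable_const_bound[where B=C]) auto

lemma integrable_square_imp:
  assumes "f \<in> borel_measurable M" "integrable M (\<lambda>\<omega>. (f \<omega> :: real)\<^sup>2)"
  shows "integrable M f"
proof (rule Bochner_Integration.integrable_bound[of M "\<lambda>\<omega>. 1 + (f \<omega>)\<^sup>2"])
  show "AE x in M. norm (f x) \<le> norm (1 + (f x)\<^sup>2)"
  proof (rule AE_I2)
    fix x
    have "\<bar>f x\<bar> \<le> 1 + (f x)\<^sup>2"
      using zero_le_power2[of "\<bar>f x\<bar> - 1 / 2"] zero_le_power2[of "f x"]
      by (simp add: power2_diff power_divide)
    then show "norm (f x) \<le> norm (1 + (f x)\<^sup>2)" by simp
  qed
qed (use assms in auto)

text \<open>
  The sum is a martingale in the number of terms: when its square is expanded, each mixed term is the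
  product of a centered factor \<open>Z n\<close> and a weight known before. Bounded coefficients keep all products
  integrable.
\<close>

lemma martingale_transform:
  fixes G :: "nat \<Rightarrow> 'a measure" and Y Z :: "nat \<Rightarrow> 'a \<Rightarrow> real"
  assumes sub: "\<And>k. subalgebra M (G k)" and mono: "\<And>k. subalgebra (G (Suc k)) (G k)"
    and Y: "\<And>k. k < N \<Longrightarrow> Y k \<in> borel_measurable (G k)"
    and bd: "\<And>k \<omega>. k < N \<Longrightarrow> \<omega> \<in> space M \<Longrightarrow> \<bar>Y k \<omega>\<bar> \<le> C"
    and Z: "\<And>k. k < N \<Longrightarrow> Z k \<in> borel_measurable (G (Suc k))"
    and cen: "\<And>k. k < N \<Longrightarrow> centered_given (G k) (v k) (Z k)"
  shows "(\<lambda>\<omega>. \<Sum>k<N. Y k \<omega> * Z k \<omega>) \<in> borel_measurable (G N)"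
    "integrable M (\<lambda>\<omega>. (\<Sum>k<N. Y k \<omega> * Z k \<omega>)\<^sup>2)"
    "integrable M (\<lambda>\<omega>. \<Sum>k<N. Y k \<omega> * Z k \<omega>)"
    "expectation (\<lambda>\<omega>. \<Sum>k<N. Y k \<omega> * Z k \<omega>) = 0"
    "expectation (\<lambda>\<omega>. (\<Sum>k<N. Y k \<omega> * Z k \<omega>)\<^sup>2) = (\<Sum>k<N. v k * expectation (\<lambda>\<omega>. (Y k \<omega>)\<^sup>2))"
proof -
  let ?S = "\<lambda>n \<omega>. \<Sum>k<n. Y k \<omega> * Z k \<omega>"
  have "?S n \<in> borel_measurable (G n) \<and> integrable M (\<lambda>\<omega>. (?S n \<omega>)\<^sup>2) \<and> integrable M (?S n) \<and>
     expectation (?S n) = 0 \<and> expectation (\<lambda>\<omega>. (?S n \<omega>)\<^sup>2) = (\<Sum>k<n. v k * expectation (\<lambda>\<omega>. (Y k \<omega>)\<^sup>2))"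
    if "n \<le> N" for n
    using that
  proof (induction n)
    case 0
    then show ?case by simp
  next
    case (Suc n)
    then have n: "n < N" by simp
    from Suc have S: "?S n \<in> borel_measurable (G n)" "integrable M (\<lambda>\<omega>. (?S n \<omega>)\<^sup>2)" "integrable M (?S n)"
       "expectation (?S n) = 0" "expectation (\<lambda>\<omega>. (?S n \<omega>)\<^sup>2) = (\<Sum>k<n. v k * expectation (\<lambda>\<omega>. (Y k \<omega>)\<^sup>2))"
      by auto
    have YM: "Y n \<in> borel_measurable M" using measurable_from_subalg[OF sub Y[OF n]] .
    have c: "W \<in> borel_measurable (G n) \<Longrightarrow> integrable M W \<Longrightarrow>
        integrable M (\<lambda>\<omega>. W \<omega> * Z n \<omega>) \<and> expectation (\<lambda>\<omega>. W \<omega> * Z n \<omega>) = 0 \<and>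
        integrable M (\<lambda>\<omega>. W \<omega> * (Z n \<omega>)\<^sup>2) \<and> expectation (\<lambda>\<omega>. W \<omega> * (Z n \<omega>)\<^sup>2) = v n * expectation W" for W
      using cen[OF n] unfolding centered_given_def by blast
    have Yi: "integrable M (Y n)"
      using bounded_measurable_integrable[OF YM bd[OF n]] by blast
    have Y2i: "integrable M (\<lambda>\<omega>. (Y n \<omega>)\<^sup>2)"
    proof (rule bounded_measurable_integrable[where C="C\<^sup>2"])
      show "(\<lambda>\<omega>. (Y n \<omega>)\<^sup>2) \<in> borel_measurable M" using YM by measurable
      show "\<bar>(Y n \<omega>)\<^sup>2\<bar> \<le> C\<^sup>2" if "\<omega> \<in> space M" for \<omega>
        using power_mono[OF bd[OF n that], of 2] by simp
    qed
    have SYi: "integrable M (\<lambda>\<omega>. ?S n \<omega> * Y n \<omega>)"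
    proof (rule Bochner_Integration.integrable_bound[of M "\<lambda>\<omega>. C * ?S n \<omega>"])
      show "integrable M (\<lambda>\<omega>. C * ?S n \<omega>)" using S(3) by simp
      show "(\<lambda>\<omega>. ?S n \<omega> * Y n \<omega>) \<in> borel_measurable M"
        using YM measurable_from_subalg[OF sub S(1)] by (rule borel_measurable_times[rotated])
      show "AE x in M. norm (?S n x * Y n x) \<le> norm (C * ?S n x)"
      proof (rule AE_I2)
        fix x assume "x \<in> space M"
        from bd[OF n this] have "\<bar>Y n x\<bar> \<le> \<bar>C\<bar>" by linarith
        then show "norm (?S n x * Y n x) \<le> norm (C * ?S n x)"
          by (simp add: abs_mult mult.commute[of "\<bar>C\<bar>"] mult_left_mono)
      qed
    qed
    have SYm: "(\<lambda>\<omega>. ?S n \<omega> * Y n \<omega>) \<in> borel_measurable (G n)"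
      using S(1) Y[OF n] by (rule borel_measurable_times)
    have Y2m: "(\<lambda>\<omega>. (Y n \<omega>)\<^sup>2) \<in> borel_measurable (G n)"
      using Y[OF n] by measurable
    note c1 = c[OF Y[OF n] Yi] and c2 = c[OF SYm SYi] and c3 = c[OF Y2m Y2i]
    have sq: "(?S (Suc n) \<omega>)\<^sup>2 = (?S n \<omega>)\<^sup>2 + (2 * (?S n \<omega> * Y n \<omega> * Z n \<omega>) + (Y n \<omega>)\<^sup>2 * (Z n \<omega>)\<^sup>2)" for \<omega>
      by (simp add: power2_eq_square algebra_simps)
    have "?S (Suc n) \<in> borel_measurable (G (Suc n))"
      using measurable_from_subalg[OF mono S(1)] measurable_from_subalg[OF mono Y[OF n]] Z[OF n]
      by (simp only: sum.lessThan_Suc) (intro borel_measurable_add borel_measurable_times)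
    moreover have "integrable M (\<lambda>\<omega>. (?S (Suc n) \<omega>)\<^sup>2)"
      unfolding sq using S c1 c2 c3 by (intro Bochner_Integration.integrable_add) auto
    moreover have "integrable M (?S (Suc n))" "expectation (?S (Suc n)) = 0" using S c1 by auto
    moreover have "expectation (\<lambda>\<omega>. (?S (Suc n) \<omega>)\<^sup>2) = (\<Sum>k<Suc n. v k * expectation (\<lambda>\<omega>. (Y k \<omega>)\<^sup>2))"
      unfolding sq using S c1 c2 c3 by simp
    ultimately show ?case by blast
  qed
  from this[OF order_refl] show "(\<lambda>\<omega>. \<Sum>k<N. Y k \<omega> * Z k \<omega>) \<in> borel_measurable (G N)"
    "integrable M (\<lambda>\<omega>. (\<Sum>k<N. Y k \<omega> * Z k \<omega>)\<^sup>2)"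
    "integrable M (\<lambda>\<omega>. \<Sum>k<N. Y k \<omega> * Z k \<omega>)"
    "expectation (\<lambda>\<omega>. \<Sum>k<N. Y k \<omega> * Z k \<omega>) = 0"
    "expectation (\<lambda>\<omega>. (\<Sum>k<N. Y k \<omega> * Z k \<omega>)\<^sup>2) = (\<Sum>k<N. v k * expectation (\<lambda>\<omega>. (Y k \<omega>)\<^sup>2))"
    by auto
qed

lemma centered_givenD:
  assumes "centered_given G v Z" "W \<in> borel_measurable G" "integrable M W"
  shows "integrable M (\<lambda>\<omega>. W \<omega> * Z \<omega>)" "expectation (\<lambda>\<omega>. W \<omega> * Z \<omega>) = 0"
    "integrable M (\<lambda>\<omega>. W \<omega> * (Z \<omega>)\<^sup>2)" "expectation (\<lambda>\<omega>. W \<omega> * (Z \<omega>)\<^sup>2) = v * expectation W"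
  using assms unfolding centered_given_def by auto

text \<open>
  The two time intervals may overlap in any way, since they will come from two different partitions.
  Cutting them at each other's end points leaves products of increments over disjoint intervals, whose
  expectations vanish, and the square of the increment over the common part.
\<close>

lemma increment_pair_expectation_ordered:
  assumes ord: "0 \<le> a" "a \<le> b" "a \<le> c" "c \<le> d"
    and \<xi>: "\<xi> \<in> borel_measurable (F a)" "\<And>\<omega>. \<omega> \<in> space M \<Longrightarrow> \<bar>\<xi> \<omega>\<bar> \<le> C"
    and \<eta>: "\<eta> \<in> borel_measurable (F c)" "\<And>\<omega>. \<omega> \<in> space M \<Longrightarrow> \<bar>\<eta> \<omega>\<bar> \<le> D"
  shows "integrable M (\<lambda>\<omega>. (\<xi> \<omega> * (B k b \<omega> - B k a \<omega>)) * (\<eta> \<omega> * (B k d \<omega> - B k c \<omega>)))"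
    and "expectation (\<lambda>\<omega>. (\<xi> \<omega> * (B k b \<omega> - B k a \<omega>)) * (\<eta> \<omega> * (B k d \<omega> - B k c \<omega>))) =
      expectation (\<lambda>\<omega>. \<xi> \<omega> * \<eta> \<omega>) * max 0 (min b d - max a c)"
proof -
  let ?p = "\<lambda>\<omega>. \<xi> \<omega> * \<eta> \<omega>"
  have c0: "0 \<le> c" using ord by simp
  have pm: "?p \<in> borel_measurable (F u)" if "c \<le> u" for u
    using adapted_mono[OF \<xi>(1), of u] adapted_mono[OF \<eta>(1), of u] ord that by (intro borel_measurable_times) auto
  have pM: "?p \<in> borel_measurable M" using adapted_measurable[OF pm[OF order_refl] c0] .
  have pb: "\<bar>?p \<omega>\<bar> \<le> C * D" if "\<omega> \<in> space M" for \<omega>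
  proof -
    have "0 \<le> C" using \<xi>(2)[OF that] by linarith
    then show ?thesis unfolding abs_mult using \<xi>(2)[OF that] \<eta>(2)[OF that] by (intro mult_mono) auto
  qed
  have pi: "integrable M ?p" using bounded_measurable_integrable[OF pM pb] .
  have Wm: "(\<lambda>\<omega>. ?p \<omega> * (B k y \<omega> - B k x \<omega>)) \<in> borel_measurable (F u)"
    if "0 \<le> x" "x \<le> y" "y \<le> u" "c \<le> u" for x y u
    using pm[OF that(4)] increment_adapted[OF that(1-3)] by (rule borel_measurable_times)
  have Wi: "integrable M (\<lambda>\<omega>. ?p \<omega> * (B k y \<omega> - B k x \<omega>))" if xy: "0 \<le> x" "x \<le> y" for x y
  proof (rule Bochner_Integration.integrable_bound[of M "\<lambda>\<omega>. (C * D) * (B k y \<omega> - B k x \<omega>)"])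
    have "integrable M (\<lambda>\<omega>. 1 * (B k y \<omega> - B k x \<omega>))"
      by (rule centered_givenD(1)[OF centered_increment[OF xy]]) simp_all
    then show "integrable M (\<lambda>\<omega>. (C * D) * (B k y \<omega> - B k x \<omega>))"
      by (intro integrable_mult_right) simp
    show "(\<lambda>\<omega>. ?p \<omega> * (B k y \<omega> - B k x \<omega>)) \<in> borel_measurable M"
      using pM increment_measurable[OF xy] by (rule borel_measurable_times)
    show "AE \<omega> in M. norm (?p \<omega> * (B k y \<omega> - B k x \<omega>)) \<le> norm ((C * D) * (B k y \<omega> - B k x \<omega>))"
    proof (rule AE_I2)
      fix \<omega> assume "\<omega> \<in> space M"
      from pb[OF this] have "\<bar>?p \<omega>\<bar> \<le> \<bar>C * D\<bar>" by linarith
      then show "norm (?p \<omega> * (B k y \<omega> - B k x \<omega>)) \<le> norm ((C * D) * (B k y \<omega> - B k x \<omega>))"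
        unfolding real_norm_def abs_mult[of "?p \<omega>"] abs_mult[of "C * D"] by (rule mult_right_mono) simp
    qed
  qed
  (* products of increments over consecutive intervals contribute nothing *)
  have O: "integrable M (\<lambda>\<omega>. ?p \<omega> * (B k y \<omega> - B k x \<omega>) * (B k z \<omega> - B k u \<omega>)) \<and>
      expectation (\<lambda>\<omega>. ?p \<omega> * (B k y \<omega> - B k x \<omega>) * (B k z \<omega> - B k u \<omega>)) = 0"
    if "0 \<le> x" "x \<le> y" "y \<le> u" "c \<le> u" "u \<le> z" for x y u z
  proof -
    have "centered_given (F u) (z - u) (\<lambda>\<omega>. B k z \<omega> - B k u \<omega>)"
      by (rule centered_increment) (use that in auto)
    from centered_givenD(1,2)[OF this Wm[OF that(1-4)] Wi[OF that(1,2)]] show ?thesis by blast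
  qed
  have V: "integrable M (\<lambda>\<omega>. ?p \<omega> * (B k z \<omega> - B k c \<omega>)\<^sup>2) \<and>
      expectation (\<lambda>\<omega>. ?p \<omega> * (B k z \<omega> - B k c \<omega>)\<^sup>2) = (z - c) * expectation ?p"
    if "c \<le> z" for z
    using centered_givenD(3,4)[OF centered_increment[OF c0 that, of k] pm[OF order_refl] pi] by blast
  consider "b \<le> c" | "c < b" "b \<le> d" | "c < b" "d < b" by linarith
  then have "integrable M (\<lambda>\<omega>. (\<xi> \<omega> * (B k b \<omega> - B k a \<omega>)) * (\<eta> \<omega> * (B k d \<omega> - B k c \<omega>))) \<and>
    expectation (\<lambda>\<omega>. (\<xi> \<omega> * (B k b \<omega> - B k a \<omega>)) * (\<eta> \<omega> * (B k d \<omega> - B k c \<omega>))) =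
      expectation ?p * max 0 (min b d - max a c)"
  proof cases
    case 1
    have "(\<xi> \<omega> * (B k b \<omega> - B k a \<omega>)) * (\<eta> \<omega> * (B k d \<omega> - B k c \<omega>)) =
        ?p \<omega> * (B k b \<omega> - B k a \<omega>) * (B k d \<omega> - B k c \<omega>)" for \<omega> by simp
    note eq = this
    have "max 0 (min b d - max a c) = 0" using ord 1 by simp
    then show ?thesis unfolding eq using O[of a b c d] ord 1 by simp
  next
    case 2
    have "(\<xi> \<omega> * (B k b \<omega> - B k a \<omega>)) * (\<eta> \<omega> * (B k d \<omega> - B k c \<omega>)) =
        ?p \<omega> * (B k c \<omega> - B k a \<omega>) * (B k d \<omega> - B k c \<omega>) +
        (?p \<omega> * (B k b \<omega> - B k c \<omega>)\<^sup>2 +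
        ?p \<omega> * (B k b \<omega> - B k c \<omega>) * (B k d \<omega> - B k b \<omega>))" for \<omega>
      by (simp add: power2_eq_square algebra_simps)
    note eq = this
    have "max 0 (min b d - max a c) = b - c" using ord 2 by simp
    note parts = O[of a c c d] O[of c b b d] V[of b]
    show ?thesis unfolding eq \<open>max 0 (min b d - max a c) = b - c\<close> using parts ord 2 by simp
  next
    case 3
    have "(\<xi> \<omega> * (B k b \<omega> - B k a \<omega>)) * (\<eta> \<omega> * (B k d \<omega> - B k c \<omega>)) =
        ?p \<omega> * (B k c \<omega> - B k a \<omega>) * (B k d \<omega> - B k c \<omega>) +
        (?p \<omega> * (B k d \<omega> - B k c \<omega>)\<^sup>2 +
        ?p \<omega> * (B k d \<omega> - B k c \<omega>) * (B k b \<omega> - B k d \<omega>))" for \<omega>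
      by (simp add: power2_eq_square algebra_simps)
    note eq = this
    have "max 0 (min b d - max a c) = d - c" using ord 3 by simp
    note parts = O[of a c c d] O[of c d d b] V[of d]
    show ?thesis unfolding eq \<open>max 0 (min b d - max a c) = d - c\<close> using parts ord 3 by simp
  qed
  then show "integrable M (\<lambda>\<omega>. (\<xi> \<omega> * (B k b \<omega> - B k a \<omega>)) * (\<eta> \<omega> * (B k d \<omega> - B k c \<omega>)))"
    and "expectation (\<lambda>\<omega>. (\<xi> \<omega> * (B k b \<omega> - B k a \<omega>)) * (\<eta> \<omega> * (B k d \<omega> - B k c \<omega>))) =
      expectation ?p * max 0 (min b d - max a c)"
    by auto
qed

lemma increment_pair_expectation:
  assumes ord: "0 \<le> a" "a \<le> b" "0 \<le> c" "c \<le> d"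
    and \<xi>: "\<xi> \<in> borel_measurable (F a)" "\<And>\<omega>. \<omega> \<in> space M \<Longrightarrow> \<bar>\<xi> \<omega>\<bar> \<le> C"
    and \<eta>: "\<eta> \<in> borel_measurable (F c)" "\<And>\<omega>. \<omega> \<in> space M \<Longrightarrow> \<bar>\<eta> \<omega>\<bar> \<le> D"
  shows "integrable M (\<lambda>\<omega>. (\<xi> \<omega> * (B k b \<omega> - B k a \<omega>)) * (\<eta> \<omega> * (B k d \<omega> - B k c \<omega>)))"
    and "expectation (\<lambda>\<omega>. (\<xi> \<omega> * (B k b \<omega> - B k a \<omega>)) * (\<eta> \<omega> * (B k d \<omega> - B k c \<omega>))) =
      expectation (\<lambda>\<omega>. \<xi> \<omega> * \<eta> \<omega>) * max 0 (min b d - max a c)"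
proof -
  have "integrable M (\<lambda>\<omega>. (\<xi> \<omega> * (B k b \<omega> - B k a \<omega>)) * (\<eta> \<omega> * (B k d \<omega> - B k c \<omega>))) \<and>
    expectation (\<lambda>\<omega>. (\<xi> \<omega> * (B k b \<omega> - B k a \<omega>)) * (\<eta> \<omega> * (B k d \<omega> - B k c \<omega>))) =
      expectation (\<lambda>\<omega>. \<xi> \<omega> * \<eta> \<omega>) * max 0 (min b d - max a c)"
  proof (cases "a \<le> c")
    case True
    show ?thesis
      using increment_pair_expectation_ordered[OF ord(1,2) True ord(4) \<xi> \<eta>, of k] by blast
  next
    case False
    then have "c \<le> a" by simp
    note * = increment_pair_expectation_ordered[OF ord(3,4) this ord(2) \<eta> \<xi>, of k]
    have 1: "(\<lambda>\<omega>. (\<xi> \<omega> * (B k b \<omega> - B k a \<omega>)) * (\<eta> \<omega> * (B k d \<omega> - B k c \<omega>))) =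
      (\<lambda>\<omega>. (\<eta> \<omega> * (B k d \<omega> - B k c \<omega>)) * (\<xi> \<omega> * (B k b \<omega> - B k a \<omega>)))"
      by (rule ext) (rule mult.commute)
    have 2: "(\<lambda>\<omega>. \<xi> \<omega> * \<eta> \<omega>) = (\<lambda>\<omega>. \<eta> \<omega> * \<xi> \<omega>)"
      by (rule ext) (rule mult.commute)
    show ?thesis
      unfolding 1 2 min.commute[of b d] max.commute[of a c] using * by blast
  qed
  then show "integrable M (\<lambda>\<omega>. (\<xi> \<omega> * (B k b \<omega> - B k a \<omega>)) * (\<eta> \<omega> * (B k d \<omega> - B k c \<omega>)))"
    and "expectation (\<lambda>\<omega>. (\<xi> \<omega> * (B k b \<omega> - B k a \<omega>)) * (\<eta> \<omega> * (B k d \<omega> - B k c \<omega>))) =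
      expectation (\<lambda>\<omega>. \<xi> \<omega> * \<eta> \<omega>) * max 0 (min b d - max a c)"
    by blast+
qed

end

section \<open>Approximation of Ito integrals\<close>

lemma interval_overlap_integral:
  assumes "0 \<le> a" "a \<le> b" "b \<le> T" "0 \<le> c" "c \<le> d" "d \<le> (T::real)"
  shows "integrable lborel (\<lambda>s. indicator {a..<b} s * indicator {c..<d} s * indicator {0..T} s :: real)"
    and "(\<integral>s. indicator {a..<b} s * indicator {c..<d} s * indicator {0..T} s \<partial>lborel) = max 0 (min b d - max a c)"
proof -
  have eq: "indicator {a..<b} s * indicator {c..<d} s * indicator {0..T} s = (indicator {max a c..<min b d} s :: real)" for s
    using assms by (auto simp: indicator_def)
  show "integrable lborel (\<lambda>s. indicator {a..<b} s * indicator {c..<d} s * indicator {0..T} s :: real)"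
    unfolding eq by (intro integrable_real_indicator emeasure_bounded_finite) auto
  show "(\<integral>s. indicator {a..<b} s * indicator {c..<d} s * indicator {0..T} s \<partial>lborel) = max 0 (min b d - max a c)"
  proof (cases "max a c \<le> min b d")
    case True
    then show ?thesis unfolding eq by (simp add: measure_def emeasure_lborel_Ico[OF True])
  next
    case False
    then have "{max a c..<min b d} = {}" by auto
    then show ?thesis unfolding eq using False by auto
  qed
qed

context brownian_filtration
begin

text \<open>
  Simple processes with intervals that need not be ordered or disjoint. The difference of two simple
  processes is then again of this kind, over the disjoint union of the index sets, and no common
  refinement of the partitions has to be formed.
\<close>

definition step_family :: "real \<Rightarrow> 'i set \<Rightarrow> ('i \<Rightarrow> real) \<Rightarrow> ('i \<Rightarrow> real) \<Rightarrow> ('i \<Rightarrow> 'a \<Rightarrow> real) \<Rightarrow> bool" where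
  "step_family T I a b \<xi> \<longleftrightarrow> finite I \<and> (\<forall>i\<in>I. 0 \<le> a i \<and> a i \<le> b i \<and> b i \<le> T \<and>
     \<xi> i \<in> borel_measurable (F (a i)) \<and> (\<exists>C. \<forall>\<omega>\<in>space M. \<bar>\<xi> i \<omega>\<bar> \<le> C))"

definition step_value :: "'i set \<Rightarrow> ('i \<Rightarrow> real) \<Rightarrow> ('i \<Rightarrow> real) \<Rightarrow> ('i \<Rightarrow> 'a \<Rightarrow> real) \<Rightarrow> real \<Rightarrow> 'a \<Rightarrow> real" where
  "step_value I a b \<xi> s \<omega> = (\<Sum>i\<in>I. \<xi> i \<omega> * indicator {a i..<b i} s)"

definition step_sum :: "'m \<Rightarrow> 'i set \<Rightarrow> ('i \<Rightarrow> real) \<Rightarrow> ('i \<Rightarrow> real) \<Rightarrow> ('i \<Rightarrow> 'a \<Rightarrow> real) \<Rightarrow> 'a \<Rightarrow> real" where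
  "step_sum k I a b \<xi> \<omega> = (\<Sum>i\<in>I. \<xi> i \<omega> * (B k (b i) \<omega> - B k (a i) \<omega>))"

lemma step_family_measurable:
  "step_family T I a b \<xi> \<Longrightarrow> i \<in> I \<Longrightarrow> \<xi> i \<in> borel_measurable M"
  unfolding step_family_def using adapted_measurable by blast

lemma step_sum_measurable:
  "step_family T I a b \<xi> \<Longrightarrow> step_sum k I a b \<xi> \<in> borel_measurable M"
  unfolding step_sum_def
  by (intro borel_measurable_sum borel_measurable_times increment_measurable)
     (auto intro: step_family_measurable simp: step_family_def)

lemma step_value_measurable:
  assumes "step_family T I a b \<xi>"
  shows "(\<lambda>(s, \<omega>). step_value I a b \<xi> s \<omega>) \<in> borel_measurable (lborel \<Otimes>\<^sub>M M)"
  unfolding step_value_def case_prod_beta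
proof (intro borel_measurable_sum borel_measurable_times)
  fix i assume "i \<in> I"
  note [measurable] = step_family_measurable[OF assms this]
  show "(\<lambda>x. \<xi> i (snd x)) \<in> borel_measurable (lborel \<Otimes>\<^sub>M M)" by measurable
  show "(\<lambda>x. indicat_real {a i..<b i} (fst x)) \<in> borel_measurable (lborel \<Otimes>\<^sub>M M)" by measurable
qed

text \<open>
  The Ito isometry. Both sides expand into double sums over the pairs of intervals, weighted with the
  length of the common part of the two intervals.
\<close>

theorem step_isometry:
  assumes fam: "step_family T I a b \<xi>"
  shows "integrable M (\<lambda>\<omega>. (step_sum k I a b \<xi> \<omega>)\<^sup>2)"
    and "(\<integral>\<^sup>+\<omega>. ennreal ((step_sum k I a b \<xi> \<omega>)\<^sup>2) \<partial>M) =
      (\<integral>\<^sup>+\<omega>. (\<integral>\<^sup>+s\<in>{0..T}. ennreal ((step_value I a b \<xi> s \<omega>)\<^sup>2) \<partial>lborel) \<partial>M)"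
proof -
  define ov where "ov i j = max 0 (min (b i) (b j) - max (a i) (a j))" for i j
  let ?D = "\<lambda>i \<omega>. B k (b i) \<omega> - B k (a i) \<omega>"
  have pair: "integrable M (\<lambda>\<omega>. (\<xi> i \<omega> * ?D i \<omega>) * (\<xi> j \<omega> * ?D j \<omega>)) \<and>
     expectation (\<lambda>\<omega>. (\<xi> i \<omega> * ?D i \<omega>) * (\<xi> j \<omega> * ?D j \<omega>)) = expectation (\<lambda>\<omega>. \<xi> i \<omega> * \<xi> j \<omega>) * ov i j"
    if ij: "i \<in> I" "j \<in> I" for i j
  proof -
    obtain C where C: "\<forall>\<omega>\<in>space M. \<bar>\<xi> i \<omega>\<bar> \<le> C" using fam ij unfolding step_family_def by blast
    obtain D where D: "\<forall>\<omega>\<in>space M. \<bar>\<xi> j \<omega>\<bar> \<le> D" using fam ij unfolding step_family_def by blast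
    show ?thesis
      unfolding ov_def
      using increment_pair_expectation[of "a i" "b i" "a j" "b j" "\<xi> i" C "\<xi> j" D k] C D fam ij
      by (auto simp: step_family_def)
  qed
  have xi_i: "integrable M (\<lambda>\<omega>. \<xi> i \<omega> * \<xi> j \<omega>)" if ij: "i \<in> I" "j \<in> I" for i j
  proof -
    obtain C where C: "\<forall>\<omega>\<in>space M. \<bar>\<xi> i \<omega>\<bar> \<le> C" using fam ij unfolding step_family_def by blast
    obtain D where D: "\<forall>\<omega>\<in>space M. \<bar>\<xi> j \<omega>\<bar> \<le> D" using fam ij unfolding step_family_def by blast
    show ?thesis
    proof (rule bounded_measurable_integrable[where C="C * D"])
      show "(\<lambda>\<omega>. \<xi> i \<omega> * \<xi> j \<omega>) \<in> borel_measurable M"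
        using step_family_measurable[OF fam] ij by (intro borel_measurable_times) auto
      fix \<omega> assume \<omega>: "\<omega> \<in> space M"
      then have "\<bar>\<xi> i \<omega>\<bar> \<le> C" "\<bar>\<xi> j \<omega>\<bar> \<le> D" using C D by auto
      then show "\<bar>\<xi> i \<omega> * \<xi> j \<omega>\<bar> \<le> C * D"
        unfolding abs_mult by (intro mult_mono) auto
    qed
  qed
  have sq: "(step_sum k I a b \<xi> \<omega>)\<^sup>2 = (\<Sum>i\<in>I. \<Sum>j\<in>I. (\<xi> i \<omega> * ?D i \<omega>) * (\<xi> j \<omega> * ?D j \<omega>))" for \<omega>
    unfolding step_sum_def power2_eq_square by (rule sum_product)
  show int: "integrable M (\<lambda>\<omega>. (step_sum k I a b \<xi> \<omega>)\<^sup>2)"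
    unfolding sq using pair by (intro Bochner_Integration.integrable_sum) auto
  have sqv: "integrable lborel (\<lambda>s. (step_value I a b \<xi> s \<omega>)\<^sup>2 * indicator {0..T} s) \<and>
      (\<integral>s. (step_value I a b \<xi> s \<omega>)\<^sup>2 * indicator {0..T} s \<partial>lborel) =
        (\<Sum>i\<in>I. \<Sum>j\<in>I. \<xi> i \<omega> * \<xi> j \<omega> * ov i j)" for \<omega>
  proof -
    have eq: "(step_value I a b \<xi> s \<omega>)\<^sup>2 * indicator {0..T} s =
      (\<Sum>i\<in>I. \<Sum>j\<in>I. (\<xi> i \<omega> * \<xi> j \<omega>) * (indicator {a i..<b i} s * indicator {a j..<b j} s * indicator {0..T} s))" for s
    proof -
      have "(step_value I a b \<xi> s \<omega>)\<^sup>2 * indicator {0..T} s = (\<Sum>i\<in>I. \<Sum>j\<in>I.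
        (\<xi> i \<omega> * indicator {a i..<b i} s) * (\<xi> j \<omega> * indicator {a j..<b j} s)) * indicator {0..T} s"
        unfolding step_value_def power2_eq_square sum_product ..
      also have "\<dots> = (\<Sum>i\<in>I. \<Sum>j\<in>I.
        (\<xi> i \<omega> * indicator {a i..<b i} s) * (\<xi> j \<omega> * indicator {a j..<b j} s) * indicator {0..T} s)"
        by (simp only: sum_distrib_right)
      also have "\<dots> = (\<Sum>i\<in>I. \<Sum>j\<in>I.
        (\<xi> i \<omega> * \<xi> j \<omega>) * (indicator {a i..<b i} s * indicator {a j..<b j} s * indicator {0..T} s))"
        by (intro sum.cong refl) (simp only: mult_ac)
      finally show ?thesis .
    qed
    have it: "integrable lborel (\<lambda>s. indicator {a i..<b i} s * indicator {a j..<b j} s * indicator {0..T} s :: real)"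
      "(\<integral>s. indicator {a i..<b i} s * indicator {a j..<b j} s * indicator {0..T} s \<partial>lborel) = ov i j"
      if "i \<in> I" "j \<in> I" for i j
      using interval_overlap_integral[of "a i" "b i" T "a j" "b j"] fam that
      by (auto simp: step_family_def ov_def)
    show ?thesis
      unfolding eq using it
      by (simp add: Bochner_Integration.integral_sum Bochner_Integration.integrable_sum del: mult.assoc)
  qed
  have inner: "(\<integral>\<^sup>+s\<in>{0..T}. ennreal ((step_value I a b \<xi> s \<omega>)\<^sup>2) \<partial>lborel) =
      ennreal (\<Sum>i\<in>I. \<Sum>j\<in>I. \<xi> i \<omega> * \<xi> j \<omega> * ov i j)" for \<omega>
  proof -
    have "(\<integral>\<^sup>+s. ennreal ((step_value I a b \<xi> s \<omega>)\<^sup>2 * indicator {0..T} s) \<partial>lborel) =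
       ennreal (\<Sum>i\<in>I. \<Sum>j\<in>I. \<xi> i \<omega> * \<xi> j \<omega> * ov i j)"
      using sqv by (subst nn_integral_eq_integral) auto
    then show ?thesis
      by (simp add: ennreal_mult'' ennreal_indicator)
  qed
  have nn: "0 \<le> (\<Sum>i\<in>I. \<Sum>j\<in>I. \<xi> i \<omega> * \<xi> j \<omega> * ov i j)" for \<omega>
    unfolding conjunct2[OF sqv, symmetric] by (intro Bochner_Integration.integral_nonneg) simp
  have oi: "integrable M (\<lambda>\<omega>. \<Sum>i\<in>I. \<Sum>j\<in>I. \<xi> i \<omega> * \<xi> j \<omega> * ov i j)"
    using xi_i by (intro Bochner_Integration.integrable_sum integrable_mult_left) auto
  have "expectation (\<lambda>\<omega>. (step_sum k I a b \<xi> \<omega>)\<^sup>2) = (\<Sum>i\<in>I. \<Sum>j\<in>I. expectation (\<lambda>\<omega>. \<xi> i \<omega> * \<xi> j \<omega>) * ov i j)"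
    unfolding sq using pair by (simp add: Bochner_Integration.integral_sum Bochner_Integration.integrable_sum)
  also have "\<dots> = expectation (\<lambda>\<omega>. \<Sum>i\<in>I. \<Sum>j\<in>I. \<xi> i \<omega> * \<xi> j \<omega> * ov i j)"
    using xi_i by (simp add: Bochner_Integration.integral_sum Bochner_Integration.integrable_sum)
  finally have E: "expectation (\<lambda>\<omega>. (step_sum k I a b \<xi> \<omega>)\<^sup>2) =
      expectation (\<lambda>\<omega>. \<Sum>i\<in>I. \<Sum>j\<in>I. \<xi> i \<omega> * \<xi> j \<omega> * ov i j)" .
  show "(\<integral>\<^sup>+\<omega>. ennreal ((step_sum k I a b \<xi> \<omega>)\<^sup>2) \<partial>M) =
      (\<integral>\<^sup>+\<omega>. (\<integral>\<^sup>+s\<in>{0..T}. ennreal ((step_value I a b \<xi> s \<omega>)\<^sup>2) \<partial>lborel) \<partial>M)"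
    unfolding inner by (subst (1 2) nn_integral_eq_integral) (use int oi nn E in auto)
qed

lemma step_family_diff:
  assumes "step_family T I a b \<xi>" "step_family T I' a' b' \<xi>'"
  shows "step_family T (I <+> I') (case_sum a a') (case_sum b b') (case_sum \<xi> (\<lambda>i \<omega>. - \<xi>' i \<omega>))"
    and "step_value (I <+> I') (case_sum a a') (case_sum b b') (case_sum \<xi> (\<lambda>i \<omega>. - \<xi>' i \<omega>)) s \<omega> =
      step_value I a b \<xi> s \<omega> - step_value I' a' b' \<xi>' s \<omega>"
    and "step_sum k (I <+> I') (case_sum a a') (case_sum b b') (case_sum \<xi> (\<lambda>i \<omega>. - \<xi>' i \<omega>)) \<omega> =
      step_sum k I a b \<xi> \<omega> - step_sum k I' a' b' \<xi>' \<omega>"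
proof -
  show "step_family T (I <+> I') (case_sum a a') (case_sum b b') (case_sum \<xi> (\<lambda>i \<omega>. - \<xi>' i \<omega>))"
    using assms by (auto simp: step_family_def)
  have fin: "finite I" "finite I'" using assms by (auto simp: step_family_def)
  show "step_value (I <+> I') (case_sum a a') (case_sum b b') (case_sum \<xi> (\<lambda>i \<omega>. - \<xi>' i \<omega>)) s \<omega> =
      step_value I a b \<xi> s \<omega> - step_value I' a' b' \<xi>' s \<omega>"
    unfolding step_value_def sum.Plus[OF fin] by (simp add: sum_negf del: sum_mult_indicator)
  show "step_sum k (I <+> I') (case_sum a a') (case_sum b b') (case_sum \<xi> (\<lambda>i \<omega>. - \<xi>' i \<omega>)) \<omega> =
      step_sum k I a b \<xi> \<omega> - step_sum k I' a' b' \<xi>' \<omega>"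
    unfolding step_sum_def sum.Plus[OF fin] by (simp add: sum_negf)
qed

lemma square_add_le: "ennreal ((x + y)\<^sup>2) \<le> 2 * ennreal (x\<^sup>2) + 2 * ennreal (y\<^sup>2)"
proof -
  have "(x + y)\<^sup>2 \<le> 2 * x\<^sup>2 + 2 * y\<^sup>2"
    using zero_le_power2[of "x - y"] by (simp add: power2_sum power2_diff)
  then have "ennreal ((x + y)\<^sup>2) \<le> ennreal (2 * x\<^sup>2 + 2 * y\<^sup>2)" by (rule ennreal_leI)
  also have "\<dots> = 2 * ennreal (x\<^sup>2) + 2 * ennreal (y\<^sup>2)"
    by (simp add: ennreal_plus ennreal_mult)
  finally show ?thesis .
qed

text \<open>
  The isometry carries over to the \<open>L\<^sup>2\<close> limits that define the Ito integral: compare \<open>J\<close> with the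
  integrals of the simple processes that define it, and these with the given step sum. The factor 4 comes
  from using \<open>(x + y)\<^sup>2 \<le> 2 * x\<^sup>2 + 2 * y\<^sup>2\<close> twice.
\<close>

theorem ito_integral_step_bound:
  assumes ito: "ito_integral M F (B k) H T J" and fam: "step_family T I a b \<xi>"
  shows "(\<integral>\<^sup>+\<omega>. ennreal ((J \<omega> - step_sum k I a b \<xi> \<omega>)\<^sup>2) \<partial>M) \<le>
    4 * (\<integral>\<^sup>+\<omega>. (\<integral>\<^sup>+s\<in>{0..T}. ennreal ((H s \<omega> - step_value I a b \<xi> s \<omega>)\<^sup>2) \<partial>lborel) \<partial>M)"
proof -
  from ito obtain m \<tau> \<zeta> where sp: "\<And>l. simple_process M F T (m l) (\<tau> l) (\<zeta> l)"
    and limH: "(\<lambda>l. \<integral>\<^sup>+\<omega>. (\<integral>\<^sup>+s\<in>{0..T}.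
            ennreal ((H s \<omega> - simple_value (m l) (\<tau> l) (\<zeta> l) s \<omega>)\<^sup>2) \<partial>lborel) \<partial>M) \<longlonglongrightarrow> 0"
    and limJ: "(\<lambda>l. \<integral>\<^sup>+\<omega>. ennreal ((J \<omega> - simple_integral (m l) (\<tau> l) (\<zeta> l) (B k) \<omega>)\<^sup>2) \<partial>M) \<longlonglongrightarrow> 0"
    and Jm: "J \<in> borel_measurable M" and Hi: "ito_integrand M F T H"
    unfolding ito_integral_def by blast
  have Hm: "(\<lambda>(s, \<omega>). H s \<omega>) \<in> borel_measurable (restrict_space lborel {0..T} \<Otimes>\<^sub>M M)"
    using Hi by (simp add: ito_integrand_def)
  define fl where "fl l = (\<lambda>i. \<tau> l (Suc i))" for l
  have mono: "\<tau> l i \<le> \<tau> l j" if "i \<le> j" "j \<le> m l" for l i j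
    using that
  proof (induction j rule: dec_induct)
    case (step n)
    then show ?case using sp[of l] unfolding simple_process_def by (meson Suc_le_lessD Suc_leD order_trans)
  qed simp
  have sf: "step_family T {..<m l} (\<tau> l) (fl l) (\<zeta> l)" for l
    using sp[of l] mono[of 0 _ l] mono[of _ "m l" l]
    unfolding step_family_def simple_process_def fl_def by (auto simp: Suc_le_eq less_imp_le)
  have sv: "simple_value (m l) (\<tau> l) (\<zeta> l) s \<omega> = step_value {..<m l} (\<tau> l) (fl l) (\<zeta> l) s \<omega>" for l s \<omega>
    by (simp add: simple_value_def step_value_def fl_def)
  have si: "simple_integral (m l) (\<tau> l) (\<zeta> l) (B k) \<omega> = step_sum k {..<m l} (\<tau> l) (fl l) (\<zeta> l) \<omega>" for l \<omega>
    by (simp add: simple_integral_def step_sum_def fl_def)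
  let ?v = "\<lambda>l. step_value {..<m l} (\<tau> l) (fl l) (\<zeta> l)" and ?I = "\<lambda>l. step_sum k {..<m l} (\<tau> l) (fl l) (\<zeta> l)"
  let ?w = "step_value I a b \<xi>" and ?S = "step_sum k I a b \<xi>"
  define A where "A l = (\<integral>\<^sup>+\<omega>. (\<integral>\<^sup>+s\<in>{0..T}. ennreal ((H s \<omega> - ?v l s \<omega>)\<^sup>2) \<partial>lborel) \<partial>M)" for l
  define Q where "Q l = (\<integral>\<^sup>+\<omega>. ennreal ((J \<omega> - ?I l \<omega>)\<^sup>2) \<partial>M)" for l
  define R where "R = (\<integral>\<^sup>+\<omega>. (\<integral>\<^sup>+s\<in>{0..T}. ennreal ((H s \<omega> - ?w s \<omega>)\<^sup>2) \<partial>lborel) \<partial>M)"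
  have A0: "A \<longlonglongrightarrow> 0" and Q0: "Q \<longlonglongrightarrow> 0"
    using limH limJ by (simp_all add: A_def[abs_def] Q_def[abs_def] sv si)
  let ?L = "restrict_space lborel {0..T}"
  have sL: "sigma_finite_measure ?L"
    by (intro sigma_finite_measure_restrict_space) (auto simp: lborel.sigma_finite_measure_axioms)
  have vm: "(\<lambda>(s, \<omega>). step_value I' a' b' \<xi>' s \<omega>) \<in> borel_measurable (?L \<Otimes>\<^sub>M M)"
    if "step_family T I' a' b' \<xi>'" for I' :: "'z set" and a' b' \<xi>'
  proof -
    have "(\<lambda>x. x) \<in> ?L \<rightarrow>\<^sub>M lborel" by (rule measurable_restrict_space1) simp
    from measurable_compose[OF measurable_fst this]
    have "(\<lambda>x. (fst x, snd x)) \<in> ?L \<Otimes>\<^sub>M M \<rightarrow>\<^sub>M lborel \<Otimes>\<^sub>M M" by (intro measurable_Pair) auto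
    from measurable_compose[OF this step_value_measurable[OF that]]
    show ?thesis by (simp add: case_prod_beta)
  qed
  have dm: "(\<lambda>(\<omega>, s). ennreal ((H s \<omega> - step_value I' a' b' \<xi>' s \<omega>)\<^sup>2)) \<in> borel_measurable (M \<Otimes>\<^sub>M ?L)"
    if "step_family T I' a' b' \<xi>'" for I' :: "'z set" and a' b' \<xi>'
  proof -
    have "(\<lambda>(s, \<omega>). H s \<omega> - step_value I' a' b' \<xi>' s \<omega>) \<in> borel_measurable (?L \<Otimes>\<^sub>M M)"
      using borel_measurable_diff[OF Hm vm[OF that]] by (simp add: case_prod_beta)
    from measurable_compose[OF measurable_pair_swap' this]
    have "(\<lambda>(\<omega>, s). H s \<omega> - step_value I' a' b' \<xi>' s \<omega>) \<in> borel_measurable (M \<Otimes>\<^sub>M ?L)"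
      by (simp add: case_prod_beta)
    then show ?thesis by (simp add: case_prod_beta)
  qed
  have setL: "(\<integral>\<^sup>+s\<in>{0..T}. f s \<partial>lborel) = (\<integral>\<^sup>+s. f s \<partial>?L)" for f :: "real \<Rightarrow> ennreal"
    by (simp add: nn_integral_restrict_space)
  have inner_m: "(\<lambda>s. ennreal ((H s \<omega> - step_value I' a' b' \<xi>' s \<omega>)\<^sup>2)) \<in> borel_measurable ?L"
    if "step_family T I' a' b' \<xi>'" "\<omega> \<in> space M" for I' :: "'z set" and a' b' \<xi>' \<omega>
    using measurable_compose_Pair1[OF that(2) dm[OF that(1)]] by simp
  have outer_m: "(\<lambda>\<omega>. \<integral>\<^sup>+s. ennreal ((H s \<omega> - step_value I' a' b' \<xi>' s \<omega>)\<^sup>2) \<partial>?L) \<in> borel_measurable M"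
    if "step_family T I' a' b' \<xi>'" for I' :: "'z set" and a' b' \<xi>'
    using sigma_finite_measure.borel_measurable_nn_integral[OF sL dm[OF that]] .
  have est: "(\<integral>\<^sup>+\<omega>. ennreal ((J \<omega> - ?S \<omega>)\<^sup>2) \<partial>M) \<le> 2 * Q l + 4 * A l + 4 * R" for l
  proof -
    have Im: "?I l \<in> borel_measurable M" "?S \<in> borel_measurable M"
      using step_sum_measurable[OF sf] step_sum_measurable[OF fam] by auto
    note df = step_family_diff[OF sf[of l] fam]
    have "(\<integral>\<^sup>+\<omega>. ennreal ((?I l \<omega> - ?S \<omega>)\<^sup>2) \<partial>M) =
       (\<integral>\<^sup>+\<omega>. (\<integral>\<^sup>+s\<in>{0..T}. ennreal ((?v l s \<omega> - ?w s \<omega>)\<^sup>2) \<partial>lborel) \<partial>M)"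
      using step_isometry(2)[OF df(1), of k] by (simp only: df(2,3))
    also have "\<dots> \<le> (\<integral>\<^sup>+\<omega>. (2 * (\<integral>\<^sup>+s. ennreal ((H s \<omega> - ?v l s \<omega>)\<^sup>2) \<partial>?L) +
        2 * (\<integral>\<^sup>+s. ennreal ((H s \<omega> - ?w s \<omega>)\<^sup>2) \<partial>?L)) \<partial>M)"
    proof (rule nn_integral_mono)
      fix \<omega> assume \<omega>: "\<omega> \<in> space M"
      have "(\<integral>\<^sup>+s\<in>{0..T}. ennreal ((?v l s \<omega> - ?w s \<omega>)\<^sup>2) \<partial>lborel) \<le>
        (\<integral>\<^sup>+s. 2 * ennreal ((H s \<omega> - ?v l s \<omega>)\<^sup>2) + 2 * ennreal ((H s \<omega> - ?w s \<omega>)\<^sup>2) \<partial>?L)"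
        unfolding setL
      proof (rule nn_integral_mono)
        fix s
        show "ennreal ((?v l s \<omega> - ?w s \<omega>)\<^sup>2) \<le> 2 * ennreal ((H s \<omega> - ?v l s \<omega>)\<^sup>2) + 2 * ennreal ((H s \<omega> - ?w s \<omega>)\<^sup>2)"
          using square_add_le[of "- (H s \<omega> - ?v l s \<omega>)" "H s \<omega> - ?w s \<omega>"] by (simp only: power2_minus) simp
      qed
      also have "\<dots> = 2 * (\<integral>\<^sup>+s. ennreal ((H s \<omega> - ?v l s \<omega>)\<^sup>2) \<partial>?L) +
        2 * (\<integral>\<^sup>+s. ennreal ((H s \<omega> - ?w s \<omega>)\<^sup>2) \<partial>?L)"
        using inner_m[OF sf \<omega>] inner_m[OF fam \<omega>]
        by (subst nn_integral_add) (auto simp: nn_integral_cmult)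
      finally show "(\<integral>\<^sup>+s\<in>{0..T}. ennreal ((?v l s \<omega> - ?w s \<omega>)\<^sup>2) \<partial>lborel) \<le> \<dots>" .
    qed
    also have "\<dots> = 2 * A l + 2 * R"
      using outer_m[OF sf, of l] outer_m[OF fam]
      by (subst nn_integral_add) (auto simp: nn_integral_cmult A_def R_def setL)
    finally have 1: "(\<integral>\<^sup>+\<omega>. ennreal ((?I l \<omega> - ?S \<omega>)\<^sup>2) \<partial>M) \<le> 2 * A l + 2 * R" .
    have "(\<integral>\<^sup>+\<omega>. ennreal ((J \<omega> - ?S \<omega>)\<^sup>2) \<partial>M) \<le>
       (\<integral>\<^sup>+\<omega>. 2 * ennreal ((J \<omega> - ?I l \<omega>)\<^sup>2) + 2 * ennreal ((?I l \<omega> - ?S \<omega>)\<^sup>2) \<partial>M)"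
    proof (rule nn_integral_mono)
      fix \<omega>
      show "ennreal ((J \<omega> - ?S \<omega>)\<^sup>2) \<le> 2 * ennreal ((J \<omega> - ?I l \<omega>)\<^sup>2) + 2 * ennreal ((?I l \<omega> - ?S \<omega>)\<^sup>2)"
        using square_add_le[of "J \<omega> - ?I l \<omega>" "?I l \<omega> - ?S \<omega>"] by simp
    qed
    also have "\<dots> = 2 * Q l + 2 * (\<integral>\<^sup>+\<omega>. ennreal ((?I l \<omega> - ?S \<omega>)\<^sup>2) \<partial>M)"
      using Im Jm by (subst nn_integral_add) (auto simp: nn_integral_cmult Q_def)
    also have "\<dots> \<le> 2 * Q l + 2 * (2 * A l + 2 * R)"
      by (intro add_mono mult_left_mono 1) auto
    also have "\<dots> = 2 * Q l + 4 * A l + 4 * R"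
      by (simp add: distrib_left mult.assoc[symmetric] add.assoc)
    finally show ?thesis .
  qed
  have "(\<lambda>l. 2 * Q l + 4 * A l + 4 * R) \<longlonglongrightarrow> 2 * 0 + 4 * 0 + 4 * R"
    by (intro tendsto_add ennreal_tendsto_cmult A0 Q0 tendsto_const) auto
  then have "(\<integral>\<^sup>+\<omega>. ennreal ((J \<omega> - ?S \<omega>)\<^sup>2) \<partial>M) \<le> 2 * 0 + 4 * 0 + 4 * R"
    by (rule LIMSEQ_le_const) (use est in auto)
  then show ?thesis by (simp add: R_def)
qed

definition square_integrable :: "('a \<Rightarrow> real) \<Rightarrow> bool" where
  "square_integrable f \<longleftrightarrow> f \<in> borel_measurable M \<and> integrable M (\<lambda>\<omega>. (f \<omega>)\<^sup>2)"

lemma square_integrable_add: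
  assumes "square_integrable f" "square_integrable g"
  shows "square_integrable (\<lambda>\<omega>. f \<omega> + g \<omega>)"
    and "expectation (\<lambda>\<omega>. (f \<omega> + g \<omega>)\<^sup>2) \<le> 2 * expectation (\<lambda>\<omega>. (f \<omega>)\<^sup>2) + 2 * expectation (\<lambda>\<omega>. (g \<omega>)\<^sup>2)"
proof -
  have le: "(f \<omega> + g \<omega>)\<^sup>2 \<le> 2 * (f \<omega>)\<^sup>2 + 2 * (g \<omega>)\<^sup>2" for \<omega>
    using zero_le_power2[of "f \<omega> - g \<omega>"] by (simp add: power2_sum power2_diff)
  have i: "integrable M (\<lambda>\<omega>. 2 * (f \<omega>)\<^sup>2 + 2 * (g \<omega>)\<^sup>2)"
    using assms by (auto simp: square_integrable_def)
  have m: "(\<lambda>\<omega>. f \<omega> + g \<omega>) \<in> borel_measurable M"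
    using assms by (auto simp: square_integrable_def)
  have s: "integrable M (\<lambda>\<omega>. (f \<omega> + g \<omega>)\<^sup>2)"
    by (rule Bochner_Integration.integrable_bound[OF i]) (use m le in \<open>auto intro!: AE_I2 simp: abs_of_nonneg\<close>)
  show "square_integrable (\<lambda>\<omega>. f \<omega> + g \<omega>)" using m s by (simp add: square_integrable_def)
  have "expectation (\<lambda>\<omega>. (f \<omega> + g \<omega>)\<^sup>2) \<le> expectation (\<lambda>\<omega>. 2 * (f \<omega>)\<^sup>2 + 2 * (g \<omega>)\<^sup>2)"
    by (rule integral_mono[OF s i]) (rule le)
  then show "expectation (\<lambda>\<omega>. (f \<omega> + g \<omega>)\<^sup>2) \<le> 2 * expectation (\<lambda>\<omega>. (f \<omega>)\<^sup>2) + 2 * expectation (\<lambda>\<omega>. (g \<omega>)\<^sup>2)"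
    using assms by (simp add: square_integrable_def)
qed

lemma square_integrable_mult_bounded:
  assumes "square_integrable f" "g \<in> borel_measurable M" "\<And>\<omega>. \<omega> \<in> space M \<Longrightarrow> \<bar>g \<omega>\<bar> \<le> C"
  shows "square_integrable (\<lambda>\<omega>. g \<omega> * f \<omega>)"
    and "expectation (\<lambda>\<omega>. (g \<omega> * f \<omega>)\<^sup>2) \<le> C\<^sup>2 * expectation (\<lambda>\<omega>. (f \<omega>)\<^sup>2)"
proof -
  have le: "(g \<omega> * f \<omega>)\<^sup>2 \<le> C\<^sup>2 * (f \<omega>)\<^sup>2" if "\<omega> \<in> space M" for \<omega>
    unfolding power_mult_distrib using power_mono[OF assms(3)[OF that], of 2]
    by (intro mult_right_mono) auto
  have i: "integrable M (\<lambda>\<omega>. C\<^sup>2 * (f \<omega>)\<^sup>2)"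
    using assms by (auto simp: square_integrable_def)
  have m: "(\<lambda>\<omega>. g \<omega> * f \<omega>) \<in> borel_measurable M"
    using assms by (auto simp: square_integrable_def)
  have s: "integrable M (\<lambda>\<omega>. (g \<omega> * f \<omega>)\<^sup>2)"
    by (rule Bochner_Integration.integrable_bound[OF i])
       (use m le in \<open>auto intro!: AE_I2 simp: abs_of_nonneg\<close>)
  show "square_integrable (\<lambda>\<omega>. g \<omega> * f \<omega>)" using m s by (simp add: square_integrable_def)
  have "expectation (\<lambda>\<omega>. (g \<omega> * f \<omega>)\<^sup>2) \<le> expectation (\<lambda>\<omega>. C\<^sup>2 * (f \<omega>)\<^sup>2)"
    by (rule integral_mono[OF s i]) (rule le)
  then show "expectation (\<lambda>\<omega>. (g \<omega> * f \<omega>)\<^sup>2) \<le> C\<^sup>2 * expectation (\<lambda>\<omega>. (f \<omega>)\<^sup>2)" by simp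
qed

lemma square_integrable_cmult: "square_integrable f \<Longrightarrow> square_integrable (\<lambda>\<omega>. c * f \<omega>)"
  by (auto simp: square_integrable_def power_mult_distrib)

lemma square_integrable_diff:
  assumes "square_integrable f" "square_integrable g"
  shows "square_integrable (\<lambda>\<omega>. f \<omega> - g \<omega>)"
    and "expectation (\<lambda>\<omega>. (f \<omega> - g \<omega>)\<^sup>2) \<le> 2 * expectation (\<lambda>\<omega>. (f \<omega>)\<^sup>2) + 2 * expectation (\<lambda>\<omega>. (g \<omega>)\<^sup>2)"
  using square_integrable_add[OF assms(1) square_integrable_cmult[OF assms(2), of "-1"]]
  by (auto simp: power2_minus)

lemma square_integrable_sum:
  assumes "finite I" "\<And>i. i \<in> I \<Longrightarrow> square_integrable (f i)"
  shows "square_integrable (\<lambda>\<omega>. \<Sum>i\<in>I. f i \<omega>)"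
  using assms
proof (induction I rule: finite_induct)
  case empty
  then show ?case by (simp add: square_integrable_def)
next
  case (insert x F)
  then show ?case using square_integrable_add(1)[of "f x" "\<lambda>\<omega>. \<Sum>i\<in>F. f i \<omega>"] by simp
qed

lemma square_integrable_integrable: "square_integrable f \<Longrightarrow> integrable M f"
  unfolding square_integrable_def using integrable_square_imp by blast

lemma expectation_square_le:
  assumes "square_integrable f"
  shows "(expectation f)\<^sup>2 \<le> expectation (\<lambda>\<omega>. (f \<omega>)\<^sup>2)"
proof -
  have "0 \<le> variance f" by (rule Bochner_Integration.integral_nonneg) simp
  moreover have "variance f = expectation (\<lambda>\<omega>. (f \<omega>)\<^sup>2) - (expectation f)\<^sup>2"
    by (rule variance_eq[OF square_integrable_integrable[OF assms]])
       (use assms in \<open>simp add: square_integrable_def\<close>)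
  ultimately show ?thesis by linarith
qed

lemma square_integrable_of_nn_integral:
  assumes "f \<in> borel_measurable M" "(\<integral>\<^sup>+\<omega>. ennreal ((f \<omega>)\<^sup>2) \<partial>M) \<le> ennreal c" "0 \<le> c"
  shows "square_integrable f" "expectation (\<lambda>\<omega>. (f \<omega>)\<^sup>2) \<le> c"
proof -
  have "(\<integral>\<^sup>+\<omega>. ennreal ((f \<omega>)\<^sup>2) \<partial>M) < \<infinity>" using assms(2) by (simp add: le_less_trans)
  then have i: "integrable M (\<lambda>\<omega>. (f \<omega>)\<^sup>2)"
    using assms(1) by (intro integrableI_nonneg) auto
  then show "square_integrable f" using assms(1) by (simp add: square_integrable_def)
  have "ennreal (expectation (\<lambda>\<omega>. (f \<omega>)\<^sup>2)) \<le> ennreal c"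
    using assms(2) i by (subst nn_integral_eq_integral[symmetric]) auto
  then show "expectation (\<lambda>\<omega>. (f \<omega>)\<^sup>2) \<le> c" using assms(3) by simp
qed

lemma square_integrable_bounded:
  "f \<in> borel_measurable M \<Longrightarrow> (\<And>\<omega>. \<omega> \<in> space M \<Longrightarrow> \<bar>f \<omega>\<bar> \<le> C) \<Longrightarrow> square_integrable f"
  unfolding square_integrable_def
  by (auto intro!: bounded_measurable_integrable[where C="C\<^sup>2"]) (metis abs_ge_zero power2_abs power_mono)

text \<open>
  A sequence of pairs of times violating the claim would have distances tending to 0; by uniform
  continuity of the paths and dominated convergence the mean squares would tend to 0 as well.
\<close>

lemma uniform_mean_square_continuity:
  fixes Y :: "real \<Rightarrow> 'a \<Rightarrow> real"
  assumes m: "\<And>s. 0 \<le> s \<Longrightarrow> s \<le> T \<Longrightarrow> Y s \<in> borel_measurable M"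
    and c: "\<And>\<omega>. \<omega> \<in> space M \<Longrightarrow> continuous_on {0..T} (\<lambda>s. Y s \<omega>)"
    and b: "\<And>s \<omega>. 0 \<le> s \<Longrightarrow> s \<le> T \<Longrightarrow> \<omega> \<in> space M \<Longrightarrow> \<bar>Y s \<omega>\<bar> \<le> C"
    and \<eta>: "0 < \<eta>"
  shows "\<exists>\<delta>>0. \<forall>r\<in>{0..T}. \<forall>s\<in>{0..T}. \<bar>r - s\<bar> < \<delta> \<longrightarrow> expectation (\<lambda>\<omega>. (Y r \<omega> - Y s \<omega>)\<^sup>2) \<le> \<eta>"
proof (rule ccontr)
  assume "\<not> ?thesis"
  then have "\<exists>r s. r \<in> {0..T} \<and> s \<in> {0..T} \<and> \<bar>r - s\<bar> < inverse (Suc n) \<and>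
      \<eta> < expectation (\<lambda>\<omega>. (Y r \<omega> - Y s \<omega>)\<^sup>2)" for n :: nat
    by (metis inverse_positive_iff_positive not_le of_nat_0_less_iff zero_less_Suc)
  then obtain r s where rs: "\<And>n. r n \<in> {0..T}" "\<And>n. s n \<in> {0..T}"
    "\<And>n. \<bar>r n - s n\<bar> < inverse (real (Suc n))" "\<And>n. \<eta> < expectation (\<lambda>\<omega>. (Y (r n) \<omega> - Y (s n) \<omega>)\<^sup>2)"
    by metis
  have d0: "(\<lambda>n. r n - s n) \<longlonglongrightarrow> 0"
    by (rule Lim_null_comparison[OF _ LIMSEQ_inverse_real_of_nat])
       (use rs(3) in \<open>auto intro: always_eventually less_imp_le\<close>)
  have "(\<lambda>n. expectation (\<lambda>\<omega>. (Y (r n) \<omega> - Y (s n) \<omega>)\<^sup>2)) \<longlonglongrightarrow> expectation (\<lambda>\<omega>. 0)"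
  proof (rule integral_dominated_convergence[where w="\<lambda>_. (2 * C)\<^sup>2"])
    show "(\<lambda>\<omega>. (Y (r n) \<omega> - Y (s n) \<omega>)\<^sup>2) \<in> borel_measurable M" for n
      using m rs(1,2)[of n] by (intro borel_measurable_power borel_measurable_diff) auto
    show "AE \<omega> in M. (\<lambda>n. (Y (r n) \<omega> - Y (s n) \<omega>)\<^sup>2) \<longlonglongrightarrow> 0"
    proof (rule AE_I2)
      fix \<omega> assume \<omega>: "\<omega> \<in> space M"
      have "uniformly_continuous_on {0..T} (\<lambda>s. Y s \<omega>)"
        using c[OF \<omega>] by (intro compact_uniformly_continuous) auto
      then have "(\<lambda>n. dist (Y (r n) \<omega>) (Y (s n) \<omega>)) \<longlonglongrightarrow> 0"
        unfolding uniformly_continuous_on_sequentially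
        using rs(1,2) d0 by (auto simp: dist_real_def tendsto_rabs_zero)
      then have "(\<lambda>n. (dist (Y (r n) \<omega>) (Y (s n) \<omega>))\<^sup>2) \<longlonglongrightarrow> 0\<^sup>2" by (intro tendsto_power)
      then show "(\<lambda>n. (Y (r n) \<omega> - Y (s n) \<omega>)\<^sup>2) \<longlonglongrightarrow> 0" by (simp add: dist_real_def)
    qed
    show "AE \<omega> in M. norm ((Y (r n) \<omega> - Y (s n) \<omega>)\<^sup>2) \<le> (2 * C)\<^sup>2" for n
    proof (rule AE_I2)
      fix \<omega> assume \<omega>: "\<omega> \<in> space M"
      have "\<bar>Y (r n) \<omega> - Y (s n) \<omega>\<bar> \<le> 2 * C"
        using b[OF _ _ \<omega>, of "r n"] b[OF _ _ \<omega>, of "s n"] rs(1,2)[of n] by auto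
      from power_mono[OF this, of 2] show "norm ((Y (r n) \<omega> - Y (s n) \<omega>)\<^sup>2) \<le> (2 * C)\<^sup>2" by simp
    qed
  qed simp_all
  then have "(\<lambda>n. expectation (\<lambda>\<omega>. (Y (r n) \<omega> - Y (s n) \<omega>)\<^sup>2)) \<longlonglongrightarrow> 0" by simp
  then have "\<eta> \<le> 0" by (rule LIMSEQ_le_const) (use rs(4) in \<open>auto intro: less_imp_le\<close>)
  then show False using \<eta> by simp
qed

definition euler_sum :: "'m \<Rightarrow> (real \<Rightarrow> 'a \<Rightarrow> real) \<Rightarrow> real \<Rightarrow> nat \<Rightarrow> 'a \<Rightarrow> real" where
  "euler_sum k H h q \<omega> = (\<Sum>l<q. H (real l * h) \<omega> * (B k (real (Suc l) * h) \<omega> - B k (real l * h) \<omega>))"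

text \<open>
  The Euler sum is the step sum whose coefficients are the values of \<open>H\<close> at the left end points of the
  grid cells; so the previous bound applies, and the distance of the integrands is controlled by the
  mean-square modulus of continuity of \<open>H\<close> at the mesh size \<open>h\<close>.
\<close>

lemma euler_sum_bound:
  assumes ito: "ito_integral M F (B k) H T J" and T: "T = real q * h" and h: "0 < h"
    and bd: "\<And>s \<omega>. 0 \<le> s \<Longrightarrow> s \<le> T \<Longrightarrow> \<omega> \<in> space M \<Longrightarrow> \<bar>H s \<omega>\<bar> \<le> C"
    and mod: "\<And>r s. r \<in> {0..T} \<Longrightarrow> s \<in> {0..T} \<Longrightarrow> \<bar>r - s\<bar> \<le> h \<Longrightarrow> expectation (\<lambda>\<omega>. (H r \<omega> - H s \<omega>)\<^sup>2) \<le> \<eta>"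
    and \<eta>: "0 \<le> \<eta>"
  shows "square_integrable (\<lambda>\<omega>. J \<omega> - euler_sum k H h q \<omega>)"
    and "expectation (\<lambda>\<omega>. (J \<omega> - euler_sum k H h q \<omega>)\<^sup>2) \<le> 4 * (T * \<eta>)"
proof -
  let ?a = "\<lambda>l::nat. real l * h" and ?b = "\<lambda>l. real (Suc l) * h" and ?\<xi> = "\<lambda>l. H (real l * h)"
  let ?v = "step_value {..<q} ?a ?b ?\<xi>"
  have Hm: "(\<lambda>(s, \<omega>). H s \<omega>) \<in> borel_measurable (restrict_space lborel {0..T} \<Otimes>\<^sub>M M)"
    and Had: "\<And>s. s \<in> {0..T} \<Longrightarrow> H s \<in> borel_measurable (F s)" and Jm: "J \<in> borel_measurable M"
    using ito by (auto simp: ito_integral_def ito_integrand_def)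
  have aT: "?a l \<in> {0..T}" if "l \<le> q" for l
    using that h by (auto simp: T mult_right_mono)
  have fam: "step_family T {..<q} ?a ?b ?\<xi>"
    unfolding step_family_def
  proof (intro conjI ballI)
    fix l assume l: "l \<in> {..<q}"
    show "0 \<le> ?a l" using h by simp
    show "?a l \<le> ?b l" using h by (simp add: mult_right_mono)
    show "?b l \<le> T" using aT[of "Suc l"] l by auto
    show "?\<xi> l \<in> borel_measurable (F (?a l))" using Had aT[of l] l by auto
    show "\<exists>C. \<forall>\<omega>\<in>space M. \<bar>?\<xi> l \<omega>\<bar> \<le> C" using bd aT[of l] l by auto
  qed simp
  have es: "step_sum k {..<q} ?a ?b ?\<xi> \<omega> = euler_sum k H h q \<omega>" for \<omega>
    by (simp add: step_sum_def euler_sum_def)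
  let ?L = "restrict_space lborel {0..T}"
  have sL: "sigma_finite_measure ?L"
    by (intro sigma_finite_measure_restrict_space) (auto simp: lborel.sigma_finite_measure_axioms)
  have vm: "(\<lambda>(s, \<omega>). ?v s \<omega>) \<in> borel_measurable (?L \<Otimes>\<^sub>M M)"
  proof -
    have "(\<lambda>x. x) \<in> ?L \<rightarrow>\<^sub>M lborel" by (rule measurable_restrict_space1) simp
    from measurable_compose[OF measurable_fst this]
    have "(\<lambda>x. (fst x, snd x)) \<in> ?L \<Otimes>\<^sub>M M \<rightarrow>\<^sub>M lborel \<Otimes>\<^sub>M M" by (intro measurable_Pair) auto
    from measurable_compose[OF this step_value_measurable[OF fam]]
    show ?thesis by (simp add: case_prod_beta)
  qed
  have dm: "(\<lambda>(s, \<omega>). ennreal ((H s \<omega> - ?v s \<omega>)\<^sup>2)) \<in> borel_measurable (?L \<Otimes>\<^sub>M M)"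
    using borel_measurable_diff[OF Hm vm] by (simp add: case_prod_beta)
  (* At a time s < T the step process takes the value of H at the last grid point up to s.
     At s = T it is 0, which is irrelevant for the integral. *)
  have val: "?v s \<omega> = H (?a (nat \<lfloor>s / h\<rfloor>)) \<omega>" "nat \<lfloor>s / h\<rfloor> < q" "\<bar>s - ?a (nat \<lfloor>s / h\<rfloor>)\<bar> \<le> h"
    if s: "0 \<le> s" "s < T" for s \<omega>
  proof -
    define n where "n = nat \<lfloor>s / h\<rfloor>"
    have rn: "real n = of_int \<lfloor>s / h\<rfloor>" using s h by (simp add: n_def)
    have n1: "real n * h \<le> s" "s < real (Suc n) * h"
    proof -
      have "real n \<le> s / h" "s / h < real n + 1" using rn by linarith+
      then show "real n * h \<le> s" "s < real (Suc n) * h"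
        by (simp_all add: pos_le_divide_eq[OF h] pos_divide_less_eq[OF h] add.commute)
    qed
    then show "\<bar>s - ?a (nat \<lfloor>s / h\<rfloor>)\<bar> \<le> h" by (simp add: n_def[symmetric] algebra_simps)
    have "real n * h < real q * h" using n1 s T by simp
    then show nq: "nat \<lfloor>s / h\<rfloor> < q" using h by (simp add: n_def)
    have "indicator {?a l..<?b l} s = (if l = n then 1 else 0 :: real)" for l
    proof (cases "l = n")
      case False
      then consider "Suc l \<le> n" | "Suc n \<le> l" by linarith
      then have "s \<notin> {?a l..<?b l}"
      proof cases
        case 1
        then have "?b l \<le> real n * h" using h by (intro mult_right_mono) auto
        then show ?thesis using n1 by auto
      next
        case 2
        then have "real (Suc n) * h \<le> ?a l" using h by (intro mult_right_mono) auto
        then show ?thesis using n1 by auto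
      qed
      then show ?thesis using False by simp
    qed (use n1 in auto)
    then have "?v s \<omega> = (\<Sum>l<q. ?\<xi> l \<omega> * (if l = n then 1 else 0))"
      unfolding step_value_def by (intro sum.cong) auto
    also have "\<dots> = (\<Sum>l<q. if l = n then ?\<xi> l \<omega> else 0)" by (intro sum.cong) auto
    finally show "?v s \<omega> = H (?a (nat \<lfloor>s / h\<rfloor>)) \<omega>" using nq by (simp add: n_def[symmetric])
  qed
  have T0: "0 \<le> T" using T h by simp
  have point: "(\<integral>\<^sup>+\<omega>. ennreal ((H s \<omega> - ?v s \<omega>)\<^sup>2) \<partial>M) \<le> ennreal \<eta>" if s: "0 \<le> s" "s < T" for s
  proof -
    obtain n where n: "\<And>\<omega>. ?v s \<omega> = H (?a n) \<omega>" "n < q" "\<bar>s - ?a n\<bar> \<le> h" using val[OF s] by blast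
    have aa: "?a n \<in> {0..T}" using aT[of n] n(2) by simp
    have m: "(\<lambda>\<omega>. H s \<omega> - H (?a n) \<omega>) \<in> borel_measurable M"
      using adapted_measurable[OF Had[of s]] adapted_measurable[OF Had[OF aa]] aa s by (intro borel_measurable_diff) auto
    have "square_integrable (\<lambda>\<omega>. H s \<omega> - H (?a n) \<omega>)"
    proof (rule square_integrable_bounded[OF m, where C="2 * C"])
      fix \<omega> assume "\<omega> \<in> space M"
      then show "\<bar>H s \<omega> - H (?a n) \<omega>\<bar> \<le> 2 * C" using bd[of s \<omega>] bd[of "?a n" \<omega>] aa s by auto
    qed
    then have "(\<integral>\<^sup>+\<omega>. ennreal ((H s \<omega> - H (?a n) \<omega>)\<^sup>2) \<partial>M) = ennreal (expectation (\<lambda>\<omega>. (H s \<omega> - H (?a n) \<omega>)\<^sup>2))"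
      by (intro nn_integral_eq_integral) (auto simp: square_integrable_def)
    also have "\<dots> \<le> ennreal \<eta>"
      using mod[of s "?a n"] aa n(3) s by (intro ennreal_leI) auto
    finally show ?thesis using n(1) by simp
  qed
  have "(\<integral>\<^sup>+\<omega>. (\<integral>\<^sup>+s\<in>{0..T}. ennreal ((H s \<omega> - ?v s \<omega>)\<^sup>2) \<partial>lborel) \<partial>M) =
      (\<integral>\<^sup>+\<omega>. (\<integral>\<^sup>+s. ennreal ((H s \<omega> - ?v s \<omega>)\<^sup>2) \<partial>?L) \<partial>M)"
    by (simp add: nn_integral_restrict_space)
  also have "\<dots> = (\<integral>\<^sup>+s. (\<integral>\<^sup>+\<omega>. ennreal ((H s \<omega> - ?v s \<omega>)\<^sup>2) \<partial>M) \<partial>?L)"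
    using pair_sigma_finite.Fubini'[of ?L M "\<lambda>s \<omega>. ennreal ((H s \<omega> - ?v s \<omega>)\<^sup>2)"] dm sL sigma_finite_measure_axioms
    by (simp add: pair_sigma_finite_def)
  also have "\<dots> \<le> (\<integral>\<^sup>+s. ennreal \<eta> \<partial>?L)"
  proof (rule nn_integral_mono_AE)
    have "AE s in lborel. s \<noteq> T" by (rule AE_lborel_singleton)
    then have "AE s in lborel. s \<in> {0..T} \<longrightarrow> (\<integral>\<^sup>+\<omega>. ennreal ((H s \<omega> - ?v s \<omega>)\<^sup>2) \<partial>M) \<le> ennreal \<eta>"
    proof (rule AE_mp, intro AE_I2 impI)
      fix s assume "s \<noteq> T" "s \<in> {0..T}"
      then show "(\<integral>\<^sup>+\<omega>. ennreal ((H s \<omega> - ?v s \<omega>)\<^sup>2) \<partial>M) \<le> ennreal \<eta>" by (intro point) auto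
    qed
    then show "AE s in ?L. (\<integral>\<^sup>+\<omega>. ennreal ((H s \<omega> - ?v s \<omega>)\<^sup>2) \<partial>M) \<le> ennreal \<eta>"
      by (subst AE_restrict_space_iff) auto
  qed
  also have "\<dots> = ennreal (T * \<eta>)"
    using T0 \<eta> by (simp add: space_restrict_space emeasure_restrict_space ennreal_mult mult.commute)
  finally have fin: "(\<integral>\<^sup>+\<omega>. (\<integral>\<^sup>+s\<in>{0..T}. ennreal ((H s \<omega> - ?v s \<omega>)\<^sup>2) \<partial>lborel) \<partial>M) \<le> ennreal (T * \<eta>)" .
  have "(\<integral>\<^sup>+\<omega>. ennreal ((J \<omega> - step_sum k {..<q} ?a ?b ?\<xi> \<omega>)\<^sup>2) \<partial>M) \<le> 4 * ennreal (T * \<eta>)"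
    using ito_integral_step_bound[OF ito fam] mult_left_mono[OF fin, of 4] by (rule order_trans) simp
  then have le: "(\<integral>\<^sup>+\<omega>. ennreal ((J \<omega> - euler_sum k H h q \<omega>)\<^sup>2) \<partial>M) \<le> ennreal (4 * (T * \<eta>))"
    unfolding es by (simp add: ennreal_mult' T0 \<eta>)
  have m: "(\<lambda>\<omega>. J \<omega> - euler_sum k H h q \<omega>) \<in> borel_measurable M"
    using step_sum_measurable[OF fam, of k] Jm unfolding es[abs_def] by (intro borel_measurable_diff) auto
  show "square_integrable (\<lambda>\<omega>. J \<omega> - euler_sum k H h q \<omega>)"
    and "expectation (\<lambda>\<omega>. (J \<omega> - euler_sum k H h q \<omega>)\<^sup>2) \<le> 4 * (T * \<eta>)"
    using square_integrable_of_nn_integral[OF m le] T0 \<eta> by auto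
qed

section \<open>Ito integrals along a grid\<close>

lemma subdivided_step: "real (Suc m) * (h / real (Suc m)) = (h :: real)"
  by (simp del: of_nat_Suc)

lemma increment_transform:
  fixes k :: 'm
  assumes h: "0 \<le> h" and s0: "0 \<le> s0"
    and Y: "\<And>j. j < n \<Longrightarrow> Y j \<in> borel_measurable (F (s0 + real j * h))"
    and bd: "\<And>j \<omega>. j < n \<Longrightarrow> \<omega> \<in> space M \<Longrightarrow> \<bar>Y j \<omega>\<bar> \<le> C"
  defines "S \<equiv> (\<lambda>\<omega>. \<Sum>j<n. Y j \<omega> * (B k (s0 + real (Suc j) * h) \<omega> - B k (s0 + real j * h) \<omega>))"
  shows "square_integrable S" "expectation S = 0"
    "expectation (\<lambda>\<omega>. (S \<omega>)\<^sup>2) = h * (\<Sum>j<n. expectation (\<lambda>\<omega>. (Y j \<omega>)\<^sup>2))"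
proof -
  define G where "G j = F (s0 + real j * h)" for j
  have t0: "0 \<le> s0 + real j * h" for j using h s0 by simp
  have tj: "s0 + real j * h \<le> s0 + real (Suc j) * h" for j
    using h by (simp add: mult_right_mono)
  have inc: "centered_given (F (s0 + real j * h)) (s0 + real (Suc j) * h - (s0 + real j * h))
     (\<lambda>\<omega>. B k (s0 + real (Suc j) * h) \<omega> - B k (s0 + real j * h) \<omega>)" for j
    by (rule centered_increment[OF t0 tj])
  have c: "centered_given (G j) h (\<lambda>\<omega>. B k (s0 + real (Suc j) * h) \<omega> - B k (s0 + real j * h) \<omega>)" for j
    unfolding G_def by (rule centered_given_subst[OF inc]) (simp add: algebra_simps)
  have sub: "subalgebra M (G j)" "subalgebra (G (Suc j)) (G j)" for j
    unfolding G_def by (rule subalg[OF t0], rule subalg_mono[OF t0 tj])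
  have Zm: "(\<lambda>\<omega>. B k (s0 + real (Suc j) * h) \<omega> - B k (s0 + real j * h) \<omega>) \<in> borel_measurable (G (Suc j))" for j
    unfolding G_def by (rule increment_adapted[OF t0 tj order_refl])
  note mt = martingale_transform[where G=G and Y=Y and N=n and C=C and v="\<lambda>_. h"
      and Z="\<lambda>j \<omega>. B k (s0 + real (Suc j) * h) \<omega> - B k (s0 + real j * h) \<omega>", OF sub]
  have Y': "\<And>j. j < n \<Longrightarrow> Y j \<in> borel_measurable (G j)" using Y by (simp add: G_def)
  note r = mt[OF Y' bd Zm c]
  have "S \<in> borel_measurable M" using measurable_from_subalg[OF sub(1) r(1)] by (simp add: S_def)
  then show "square_integrable S" using r(2) by (simp add: square_integrable_def S_def)
  show "expectation S = 0" using r(4) by (simp add: S_def)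
  show "expectation (\<lambda>\<omega>. (S \<omega>)\<^sup>2) = h * (\<Sum>j<n. expectation (\<lambda>\<omega>. (Y j \<omega>)\<^sup>2))"
    using r(5) by (simp add: S_def sum_distrib_left)
qed

lemma expectation_square_bounded:
  fixes f :: "'a \<Rightarrow> real"
  assumes "f \<in> borel_measurable M" "\<And>\<omega>. \<omega> \<in> space M \<Longrightarrow> \<bar>f \<omega>\<bar> \<le> C"
  shows "expectation (\<lambda>\<omega>. (f \<omega>)\<^sup>2) \<le> C\<^sup>2"
proof -
  have "integrable M (\<lambda>\<omega>. (f \<omega>)\<^sup>2)"
    using square_integrable_bounded[OF assms] by (simp add: square_integrable_def)
  moreover have "(f \<omega>)\<^sup>2 \<le> C\<^sup>2" if "\<omega> \<in> space M" for \<omega>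
    using assms(2)[OF that] by (metis abs_ge_zero power2_abs power_mono)
  ultimately have "expectation (\<lambda>\<omega>. (f \<omega>)\<^sup>2) \<le> expectation (\<lambda>\<omega>. C\<^sup>2)"
    by (intro integral_mono) auto
  then show ?thesis by (simp add: prob_space)
qed

text \<open>
  \<open>J k\<close> are the Ito integrals of one bounded integrand with continuous paths up to the grid times
  \<open>k * h\<close>. They are kept as separate random variables, since each Ito integral is only given as some
  version of an \<open>L\<^sup>2\<close> limit and no relation between different times is part of its definition.
\<close>

definition ito_grid :: "'m \<Rightarrow> (real \<Rightarrow> 'a \<Rightarrow> real) \<Rightarrow> real \<Rightarrow> real \<Rightarrow> nat \<Rightarrow> (nat \<Rightarrow> 'a \<Rightarrow> real) \<Rightarrow> bool" where
  "ito_grid a H C h N J \<longleftrightarrow> 0 < h \<and>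
     (\<forall>k\<le>N. ito_integral M F (B a) H (real k * h) (J k)) \<and>
     (\<forall>s\<in>{0..real N * h}. \<forall>\<omega>\<in>space M. \<bar>H s \<omega>\<bar> \<le> C) \<and>
     (\<forall>\<omega>\<in>space M. continuous_on {0..real N * h} (\<lambda>s. H s \<omega>))"

lemma ito_grid_adapted:
  assumes "ito_grid a H C h N J" "0 \<le> s" "s \<le> real N * h"
  shows "H s \<in> borel_measurable (F s)"
  using assms unfolding ito_grid_def ito_integral_def ito_integrand_def by auto

lemma grid_time:
  assumes "0 < h" "k \<le> N"
  shows "0 \<le> real k * h" "real k * h \<le> real N * (h::real)"
  using assms by (auto intro: mult_right_mono)

text \<open>
  The refined meshes divide \<open>h\<close>, so that every time of the coarse grid stays a time of the refined grid
  and the Euler sums up to different grid times can be subtracted.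
\<close>

lemma ito_grid_euler_limit:
  assumes g: "ito_grid a H C h N J" and k: "k \<le> N"
  shows "square_integrable (\<lambda>\<omega>. J k \<omega> - euler_sum a H (h / real (Suc m)) (k * Suc m) \<omega>)"
    and "(\<lambda>m. expectation (\<lambda>\<omega>. (J k \<omega> - euler_sum a H (h / real (Suc m)) (k * Suc m) \<omega>)\<^sup>2)) \<longlonglongrightarrow> 0"
proof -
  let ?T = "real N * h"
  have h: "0 < h" and ito: "ito_integral M F (B a) H (real k * h) (J k)"
    and bd: "\<And>s \<omega>. 0 \<le> s \<Longrightarrow> s \<le> ?T \<Longrightarrow> \<omega> \<in> space M \<Longrightarrow> \<bar>H s \<omega>\<bar> \<le> C"
    and ct: "\<And>\<omega>. \<omega> \<in> space M \<Longrightarrow> continuous_on {0..?T} (\<lambda>s. H s \<omega>)"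
    using g k by (auto simp: ito_grid_def)
  have Hm: "\<And>s. 0 \<le> s \<Longrightarrow> s \<le> ?T \<Longrightarrow> H s \<in> borel_measurable M"
    using adapted_measurable[OF ito_grid_adapted[OF g]] by blast
  note kT = grid_time[OF h k]
  have tm: "real k * h = real (k * Suc m) * (h / real (Suc m))" for m
    unfolding of_nat_mult mult.assoc subdivided_step ..
  have sub: "r \<in> {0..?T}" if "r \<in> {0..real k * h}" for r
    using that kT by (auto simp del: mult_le_cancel_right)
  have bdk: "\<bar>H s \<omega>\<bar> \<le> C" if "0 \<le> s" "s \<le> real k * h" "\<omega> \<in> space M" for s \<omega>
    using bd[OF that(1) _ that(3)] that(2) kT by auto
  have E: "expectation (\<lambda>\<omega>. (H r \<omega> - H s \<omega>)\<^sup>2) \<le> (2 * C)\<^sup>2" if "r \<in> {0..?T}" "s \<in> {0..?T}" for r s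
  proof (rule expectation_square_bounded)
    show "(\<lambda>\<omega>. H r \<omega> - H s \<omega>) \<in> borel_measurable M" using Hm that by (intro borel_measurable_diff) auto
    fix \<omega> assume "\<omega> \<in> space M"
    then show "\<bar>H r \<omega> - H s \<omega>\<bar> \<le> 2 * C" using bd[of r \<omega>] bd[of s \<omega>] that by auto
  qed
  show "square_integrable (\<lambda>\<omega>. J k \<omega> - euler_sum a H (h / real (Suc m)) (k * Suc m) \<omega>)" for m
  proof -
    have "expectation (\<lambda>\<omega>. (H r \<omega> - H s \<omega>)\<^sup>2) \<le> (2 * C)\<^sup>2"
      if "r \<in> {0..real k * h}" "s \<in> {0..real k * h}" "\<bar>r - s\<bar> \<le> h / real (Suc m)" for r s
      by (rule E[OF sub[OF that(1)] sub[OF that(2)]])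
    from euler_sum_bound(1)[OF ito tm _ bdk this] show ?thesis using h by simp
  qed
  show "(\<lambda>m. expectation (\<lambda>\<omega>. (J k \<omega> - euler_sum a H (h / real (Suc m)) (k * Suc m) \<omega>)\<^sup>2)) \<longlonglongrightarrow> 0"
  proof (rule LIMSEQ_I)
    fix r :: real assume r: "0 < r"
    define \<eta> where "\<eta> = r / (4 * ?T + 4)"
    have T0: "0 \<le> ?T" using h by simp
    have \<eta>: "0 < \<eta>" using r T0 by (auto simp: \<eta>_def intro!: divide_pos_pos)
    obtain \<delta> where \<delta>: "0 < \<delta>" and mod: "\<And>r s. r \<in> {0..?T} \<Longrightarrow> s \<in> {0..?T} \<Longrightarrow> \<bar>r - s\<bar> < \<delta> \<Longrightarrow>
        expectation (\<lambda>\<omega>. (H r \<omega> - H s \<omega>)\<^sup>2) \<le> \<eta>"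
      using uniform_mean_square_continuity[OF Hm ct bd \<eta>] by blast
    obtain m0 :: nat where m0: "h / \<delta> < real m0" using reals_Archimedean2 by blast
    show "\<exists>m0. \<forall>m\<ge>m0. norm (expectation (\<lambda>\<omega>. (J k \<omega> - euler_sum a H (h / real (Suc m)) (k * Suc m) \<omega>)\<^sup>2) - 0) < r"
    proof (intro exI allI impI)
      fix m assume m: "m0 \<le> m"
      have "h / real (Suc m) < \<delta>"
      proof -
        have "h / \<delta> < real (Suc m)" using m0 m by linarith
        then have "h < real (Suc m) * \<delta>" using \<delta> by (simp add: pos_divide_less_eq)
        then show ?thesis by (simp add: pos_divide_less_eq mult.commute)
      qed
      then have "expectation (\<lambda>\<omega>. (J k \<omega> - euler_sum a H (h / real (Suc m)) (k * Suc m) \<omega>)\<^sup>2) \<le> 4 * ((real k * h) * \<eta>)"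
        using h \<eta> by (intro euler_sum_bound(2)[OF ito tm _ bdk] mod sub) auto
      also have "\<dots> \<le> 4 * (?T * \<eta>)" using kT \<eta> by (auto intro!: mult_right_mono)
      also have "\<dots> < (4 * ?T + 4) * \<eta>" using \<eta> by (simp add: algebra_simps)
      also have "\<dots> = r" using T0 by (simp add: \<eta>_def)
      finally show "norm (expectation (\<lambda>\<omega>. (J k \<omega> - euler_sum a H (h / real (Suc m)) (k * Suc m) \<omega>)\<^sup>2) - 0) < r"
        by simp
    qed
  qed
qed

lemma euler_sum_increment:
  "euler_sum a H h' (k * m + m) \<omega> - euler_sum a H h' (k * m) \<omega> =
    (\<Sum>j<m. H (real (k * m) * h' + real j * h') \<omega> *
      (B a (real (k * m) * h' + real (Suc j) * h') \<omega> - B a (real (k * m) * h' + real j * h') \<omega>))"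
proof -
  have shift: "(\<Sum>l<n + m. f l) - (\<Sum>l<n. f l) = (\<Sum>j<m. f (n + j))" for n and f :: "nat \<Rightarrow> real"
    by (induction m) auto
  show ?thesis
    unfolding euler_sum_def shift
    by (intro sum.cong refl) (simp only: of_nat_add distrib_right add_Suc_right[symmetric])
qed

text \<open>
  Replacing the two Ito integrals by Euler sums on a refined grid, the residual over one cell becomes
  the sum of \<open>(H s - H (k * h))\<close> times the small increments, whose second moment is at most \<open>h * \<eta>\<close>. Summed
  over all cells this gives \<open>T * \<eta>\<close> up to a factor, and \<open>\<eta>\<close> is arbitrarily small for fine grids.
\<close>

lemma ito_grid_residual:
  assumes g: "ito_grid a H C h N J" and k: "k < N"
    and mod: "\<And>r s. r \<in> {0..real N * h} \<Longrightarrow> s \<in> {0..real N * h} \<Longrightarrow> \<bar>r - s\<bar> \<le> h \<Longrightarrow>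
       expectation (\<lambda>\<omega>. (H r \<omega> - H s \<omega>)\<^sup>2) \<le> \<eta>"
  defines "\<epsilon> \<equiv> (\<lambda>\<omega>. J (Suc k) \<omega> - J k \<omega> - H (real k * h) \<omega> * (B a (real (Suc k) * h) \<omega> - B a (real k * h) \<omega>))"
  shows "square_integrable \<epsilon>" "expectation (\<lambda>\<omega>. (\<epsilon> \<omega>)\<^sup>2) \<le> 2 * (h * \<eta>)"
proof -
  let ?T = "real N * h"
  have h: "0 < h"
    and bd: "\<And>s \<omega>. 0 \<le> s \<Longrightarrow> s \<le> ?T \<Longrightarrow> \<omega> \<in> space M \<Longrightarrow> \<bar>H s \<omega>\<bar> \<le> C"
    using g k by (auto simp: ito_grid_def)
  let ?s = "real k * h"
  have s0: "0 \<le> ?s" using h by simp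
  have sT: "?s + h \<le> ?T"
    using grid_time(2)[OF h, of "Suc k" N] k by (simp add: algebra_simps)
  define D where "D i m \<omega> = J i \<omega> - euler_sum a H (h / real (Suc m)) (i * Suc m) \<omega>" for i m \<omega>
  define R where "R m \<omega> = (\<Sum>j<Suc m. (H (?s + real j * (h / real (Suc m))) \<omega> - H ?s \<omega>) *
     (B a (?s + real (Suc j) * (h / real (Suc m))) \<omega> - B a (?s + real j * (h / real (Suc m))) \<omega>))" for m \<omega>
  have Ds: "square_integrable (D i m)" and Dl: "(\<lambda>m. expectation (\<lambda>\<omega>. (D i m \<omega>)\<^sup>2)) \<longlonglongrightarrow> 0"
    if "i \<le> N" for i m
    using ito_grid_euler_limit[OF g that] by (simp_all add: D_def[abs_def])
  have tel: "(\<Sum>j<Suc m. B a (?s + real (Suc j) * (h / real (Suc m))) \<omega> - B a (?s + real j * (h / real (Suc m))) \<omega>) =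
     B a (real (Suc k) * h) \<omega> - B a ?s \<omega>" for m :: nat and \<omega>
  proof -
    have "?s + real (Suc m) * (h / real (Suc m)) = real (Suc k) * h"
      unfolding subdivided_step by (simp add: algebra_simps)
    moreover have "?s + real 0 * (h / real (Suc m)) = ?s" by simp
    ultimately show ?thesis
      using sum_lessThan_telescope[of "\<lambda>j. B a (?s + real j * (h / real (Suc m))) \<omega>" "Suc m"] by presburger
  qed
  have eq: "\<epsilon> \<omega> = (D (Suc k) m \<omega> - D k m \<omega>) + R m \<omega>" for \<omega> m
  proof -
    have 1: "real (k * Suc m) * (h / real (Suc m)) = ?s" unfolding of_nat_mult mult.assoc subdivided_step ..
    have "euler_sum a H (h / real (Suc m)) (Suc k * Suc m) \<omega> - euler_sum a H (h / real (Suc m)) (k * Suc m) \<omega> =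
      (\<Sum>j<Suc m. H (?s + real j * (h / real (Suc m))) \<omega> *
         (B a (?s + real (Suc j) * (h / real (Suc m))) \<omega> - B a (?s + real j * (h / real (Suc m))) \<omega>))"
      using euler_sum_increment[of a H "h / real (Suc m)" k "Suc m" \<omega>] unfolding 1 by (simp only: mult_Suc add.commute)
    also have "\<dots> = R m \<omega> + H ?s \<omega> * (B a (real (Suc k) * h) \<omega> - B a ?s \<omega>)"
      unfolding R_def tel[of m \<omega>, symmetric] sum_distrib_left sum.distrib[symmetric]
      by (intro sum.cong refl) (simp add: left_diff_distrib del: of_nat_Suc)
    finally show ?thesis unfolding \<epsilon>_def D_def by linarith
  qed
  have RT: "?s + real j * (h / real (Suc m)) \<in> {?s..?s + h}" if "j < Suc m" for j m
  proof -
    have "real j * (h / real (Suc m)) \<le> real (Suc m) * (h / real (Suc m))"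
      using that h by (intro mult_right_mono) auto
    also have "\<dots> = h" by (rule subdivided_step)
    finally have "real j * (h / real (Suc m)) \<le> h" .
    moreover have "0 \<le> real j * (h / real (Suc m))" using h by (intro mult_nonneg_nonneg divide_nonneg_nonneg) auto
    ultimately show ?thesis by (simp del: of_nat_Suc times_divide_eq_right)
  qed
  have Rm: "square_integrable (R m)" "expectation (\<lambda>\<omega>. (R m \<omega>)\<^sup>2) \<le> h * \<eta>" for m
  proof -
    have ad: "(\<lambda>\<omega>. H (?s + real j * (h / real (Suc m))) \<omega> - H ?s \<omega>) \<in> borel_measurable (F (?s + real j * (h / real (Suc m))))"
      if "j < Suc m" for j
      using RT[OF that] s0 sT h k
      by (intro borel_measurable_diff ito_grid_adapted[OF g] adapted_mono[OF ito_grid_adapted[OF g], of ?s]) auto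
    have bb: "\<bar>H (?s + real j * (h / real (Suc m))) \<omega> - H ?s \<omega>\<bar> \<le> 2 * C" if "j < Suc m" "\<omega> \<in> space M" for j \<omega>
      using RT[OF that(1)] s0 sT h k bd[OF _ _ that(2), of "?s + real j * (h / real (Suc m))"] bd[OF _ _ that(2), of ?s] by auto
    note it = increment_transform[of "h / real (Suc m)" ?s "Suc m"
        "\<lambda>j \<omega>. H (?s + real j * (h / real (Suc m))) \<omega> - H ?s \<omega>" "2 * C" a, OF _ s0 ad bb]
    have hm: "0 \<le> h / real (Suc m)" using h by simp
    show "square_integrable (R m)" using it(1)[OF hm] unfolding R_def[abs_def] .
    have "expectation (\<lambda>\<omega>. (R m \<omega>)\<^sup>2) =
       h / real (Suc m) * (\<Sum>j<Suc m. expectation (\<lambda>\<omega>. (H (?s + real j * (h / real (Suc m))) \<omega> - H ?s \<omega>)\<^sup>2))"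
      using it(3)[OF hm] unfolding R_def[abs_def] .
    also have "\<dots> \<le> h / real (Suc m) * (\<Sum>j<Suc m. \<eta>)"
    proof (intro mult_left_mono sum_mono hm mod)
      fix j assume "j \<in> {..<Suc m}"
      then show "?s + real j * (h / real (Suc m)) \<in> {0..?T}" "?s \<in> {0..?T}"
        "\<bar>?s + real j * (h / real (Suc m)) - ?s\<bar> \<le> h"
        using RT[of j m] s0 sT h k by auto
    qed
    also have "\<dots> = h * \<eta>" by (simp del: of_nat_Suc)
    finally show "expectation (\<lambda>\<omega>. (R m \<omega>)\<^sup>2) \<le> h * \<eta>" .
  qed
  have k1: "Suc k \<le> N" "k \<le> N" using k by auto
  note dd1 = square_integrable_diff(1)[OF Ds[OF k1(1)] Ds[OF k1(2)]]
    and dd2 = square_integrable_diff(2)[OF Ds[OF k1(1)] Ds[OF k1(2)]]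
  show "square_integrable \<epsilon>"
    using square_integrable_add(1)[OF dd1[of 0 0] Rm(1)[of 0]] unfolding eq[of _ 0, symmetric] .
  have le: "expectation (\<lambda>\<omega>. (\<epsilon> \<omega>)\<^sup>2) \<le> 2 * (2 * expectation (\<lambda>\<omega>. (D (Suc k) m \<omega>)\<^sup>2) + 2 * expectation (\<lambda>\<omega>. (D k m \<omega>)\<^sup>2)) + 2 * (h * \<eta>)" for m
  proof -
    have "expectation (\<lambda>\<omega>. (\<epsilon> \<omega>)\<^sup>2) \<le> 2 * expectation (\<lambda>\<omega>. (D (Suc k) m \<omega> - D k m \<omega>)\<^sup>2) + 2 * expectation (\<lambda>\<omega>. (R m \<omega>)\<^sup>2)"
      using square_integrable_add(2)[OF dd1[of m m] Rm(1)[of m]] unfolding eq[of _ m, symmetric] .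
    also have "\<dots> \<le> 2 * (2 * expectation (\<lambda>\<omega>. (D (Suc k) m \<omega>)\<^sup>2) + 2 * expectation (\<lambda>\<omega>. (D k m \<omega>)\<^sup>2)) + 2 * (h * \<eta>)"
      by (intro add_mono mult_left_mono dd2 Rm(2)) auto
    finally show ?thesis .
  qed
  have "(\<lambda>m. 2 * (2 * expectation (\<lambda>\<omega>. (D (Suc k) m \<omega>)\<^sup>2) + 2 * expectation (\<lambda>\<omega>. (D k m \<omega>)\<^sup>2)) + 2 * (h * \<eta>))
      \<longlonglongrightarrow> 2 * (2 * 0 + 2 * 0) + 2 * (h * \<eta>)"
    using Dl k1 by (intro tendsto_intros) auto
  then have "expectation (\<lambda>\<omega>. (\<epsilon> \<omega>)\<^sup>2) \<le> 2 * (2 * 0 + 2 * 0) + 2 * (h * \<eta>)"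
    by (rule LIMSEQ_le_const) (use le in auto)
  then show "expectation (\<lambda>\<omega>. (\<epsilon> \<omega>)\<^sup>2) \<le> 2 * (h * \<eta>)" by simp
qed

text \<open>
  Integrals of discrete processes against the Ito integral process are centered. After replacing the Ito
  integrals by refined Euler sums this is the martingale transform \<open>P m\<close>; the error \<open>Q m\<close> of the
  replacement is negligible as the refinement goes on, since the coarse grid stays fixed.
\<close>

lemma ito_grid_transform:
  assumes g: "ito_grid a H C h N J"
    and G: "\<And>k. k < N \<Longrightarrow> G k \<in> borel_measurable (F (real k * h))"
    and Gb: "\<And>k \<omega>. k < N \<Longrightarrow> \<omega> \<in> space M \<Longrightarrow> \<bar>G k \<omega>\<bar> \<le> D"
  defines "S \<equiv> (\<lambda>\<omega>. \<Sum>k<N. G k \<omega> * (J (Suc k) \<omega> - J k \<omega>))"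
  shows "square_integrable S" "expectation S = 0"
    "expectation (\<lambda>\<omega>. (S \<omega>)\<^sup>2) \<le> 2 * (real N * h * (D * C)\<^sup>2)"
proof -
  let ?T = "real N * h"
  have h: "0 < h"
    and bd: "\<And>s \<omega>. 0 \<le> s \<Longrightarrow> s \<le> ?T \<Longrightarrow> \<omega> \<in> space M \<Longrightarrow> \<bar>H s \<omega>\<bar> \<le> C"
    using g by (auto simp: ito_grid_def)
  define E where "E i m \<omega> = J i \<omega> - euler_sum a H (h / real (Suc m)) (i * Suc m) \<omega>" for i m \<omega>
  have Es: "square_integrable (E i m)" and El: "(\<lambda>m. expectation (\<lambda>\<omega>. (E i m \<omega>)\<^sup>2)) \<longlonglongrightarrow> 0"
    if "i \<le> N" for i m
    using ito_grid_euler_limit[OF g that] by (simp_all add: E_def[abs_def])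
  (* The refined grid point with index l lies in the coarse cell with index l div (Suc m). *)
  define P where "P m \<omega> = (\<Sum>l<N * Suc m. G (l div Suc m) \<omega> * H (0 + real l * (h / real (Suc m))) \<omega> *
     (B a (0 + real (Suc l) * (h / real (Suc m))) \<omega> - B a (0 + real l * (h / real (Suc m))) \<omega>))" for m \<omega>
  define Q where "Q m \<omega> = (\<Sum>k<N. G k \<omega> * (E (Suc k) m \<omega> - E k m \<omega>))" for m \<omega>
  have GM: "G k \<in> borel_measurable M" if "k < N" for k
    using adapted_measurable[OF G[OF that]] h by simp
  have eq: "S \<omega> = Q m \<omega> + P m \<omega>" for \<omega> m
  proof -
    let ?h = "h / real (Suc m)"
    let ?f = "\<lambda>l. H (real l * ?h) \<omega> * (B a (real (Suc l) * ?h) \<omega> - B a (real l * ?h) \<omega>)"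
    have "euler_sum a H ?h (Suc k * Suc m) \<omega> - euler_sum a H ?h (k * Suc m) \<omega> =
       (\<Sum>l\<in>{k * Suc m..<k * Suc m + Suc m}. ?f l)" for k
    proof -
      have "sum ?f {..<k * Suc m + Suc m} = sum ?f {..<k * Suc m} + sum ?f {k * Suc m..<k * Suc m + Suc m}"
        using sum.atLeastLessThan_concat[of 0 "k * Suc m" "k * Suc m + Suc m" ?f] by (simp add: lessThan_atLeast0)
      then show ?thesis unfolding euler_sum_def by (simp only: mult_Suc add.commute)
    qed
    note es = this
    have "(\<Sum>k<N. G k \<omega> * (euler_sum a H ?h (Suc k * Suc m) \<omega> - euler_sum a H ?h (k * Suc m) \<omega>)) =
      (\<Sum>k<N. \<Sum>l\<in>{k * Suc m..<k * Suc m + Suc m}. G (l div Suc m) \<omega> * ?f l)"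
      unfolding es sum_distrib_left
    proof (intro sum.cong refl)
      fix k l assume l: "l \<in> {k * Suc m..<k * Suc m + Suc m}"
      then have "l div Suc m = k"
        by (intro div_nat_eqI) (auto simp: algebra_simps)
      then show "G k \<omega> * ?f l = G (l div Suc m) \<omega> * ?f l" by simp
    qed
    also have "\<dots> = (\<Sum>l<N * Suc m. G (l div Suc m) \<omega> * ?f l)"
      by (rule sum.nat_group)
    also have "\<dots> = P m \<omega>" unfolding P_def by (simp add: mult.assoc del: of_nat_Suc)
    finally have "P m \<omega> = (\<Sum>k<N. G k \<omega> * (euler_sum a H ?h (Suc k * Suc m) \<omega> - euler_sum a H ?h (k * Suc m) \<omega>))" ..
    then show ?thesis
      unfolding S_def Q_def E_def by (simp add: sum.distrib[symmetric] algebra_simps del: mult_Suc)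
  qed
  have Pm: "square_integrable (P m)" "expectation (P m) = 0" "expectation (\<lambda>\<omega>. (P m \<omega>)\<^sup>2) \<le> ?T * (D * C)\<^sup>2" for m
  proof -
    let ?h = "h / real (Suc m)"
    have hm: "0 \<le> ?h" using h by simp
    have l1: "l div Suc m < N" if "l < N * Suc m" for l
      using that by (simp add: less_mult_imp_div_less)
    have l2: "0 \<le> real l * ?h" "real (l div Suc m) * h \<le> real l * ?h" "real l * ?h \<le> ?T" if "l < N * Suc m" for l
    proof -
      show "0 \<le> real l * ?h" by (intro mult_nonneg_nonneg hm) simp
      have "real (l div Suc m) * real (Suc m) \<le> real l"
        by (metis div_times_less_eq_dividend of_nat_le_iff of_nat_mult)
      then have "real (l div Suc m) * real (Suc m) * ?h \<le> real l * ?h" using hm by (rule mult_right_mono)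
      then show "real (l div Suc m) * h \<le> real l * ?h" by (simp del: of_nat_Suc)
      have "real l \<le> real N * real (Suc m)" using that by (metis less_imp_le of_nat_le_iff of_nat_mult)
      then have "real l * ?h \<le> real N * real (Suc m) * ?h" using hm by (rule mult_right_mono)
      then show "real l * ?h \<le> ?T" by (simp del: of_nat_Suc)
    qed
    have ad: "(\<lambda>\<omega>. G (l div Suc m) \<omega> * H (0 + real l * ?h) \<omega>) \<in> borel_measurable (F (0 + real l * ?h))"
      if "l < N * Suc m" for l
      using adapted_mono[OF G[OF l1[OF that]] _ l2(2)[OF that]] ito_grid_adapted[OF g l2(1,3)[OF that]] h
      by (intro borel_measurable_times) auto
    have bb: "\<bar>G (l div Suc m) \<omega> * H (0 + real l * ?h) \<omega>\<bar> \<le> D * C" if "l < N * Suc m" "\<omega> \<in> space M" for l \<omega>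
    proof -
      have "\<bar>G (l div Suc m) \<omega>\<bar> \<le> D" "\<bar>H (0 + real l * ?h) \<omega>\<bar> \<le> C"
        using Gb[OF l1[OF that(1)] that(2)] bd[OF l2(1,3)[OF that(1)] that(2)] by simp_all
      then show ?thesis unfolding abs_mult by (intro mult_mono) auto
    qed
    note it = increment_transform[of ?h 0 "N * Suc m" "\<lambda>l \<omega>. G (l div Suc m) \<omega> * H (0 + real l * ?h) \<omega>" "D * C" a,
        OF hm order_refl ad bb]
    show "square_integrable (P m)" using it(1) unfolding P_def[abs_def] .
    show "expectation (P m) = 0" using it(2) unfolding P_def[abs_def] .
    have "expectation (\<lambda>\<omega>. (P m \<omega>)\<^sup>2) = ?h * (\<Sum>l<N * Suc m. expectation (\<lambda>\<omega>. (G (l div Suc m) \<omega> * H (0 + real l * ?h) \<omega>)\<^sup>2))"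
      using it(3) unfolding P_def[abs_def] .
    also have "\<dots> \<le> ?h * (\<Sum>l<N * Suc m. (D * C)\<^sup>2)"
    proof (intro mult_left_mono sum_mono hm expectation_square_bounded)
      fix l assume "l \<in> {..<N * Suc m}"
      then have l: "l < N * Suc m" by simp
      show "(\<lambda>\<omega>. G (l div Suc m) \<omega> * H (0 + real l * ?h) \<omega>) \<in> borel_measurable M"
        using adapted_measurable[OF ad[OF l]] l2(1)[OF l] by simp
      show "\<bar>G (l div Suc m) \<omega> * H (0 + real l * ?h) \<omega>\<bar> \<le> D * C" if "\<omega> \<in> space M" for \<omega>
        by (rule bb[OF l that])
    qed
    also have "\<dots> = ?T * (D * C)\<^sup>2" by (simp del: of_nat_Suc mult_Suc_right)
    finally show "expectation (\<lambda>\<omega>. (P m \<omega>)\<^sup>2) \<le> ?T * (D * C)\<^sup>2" .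
  qed
  have term_s: "square_integrable (\<lambda>\<omega>. G k \<omega> * (E (Suc k) m \<omega> - E k m \<omega>))" if "k < N" for k m
    using square_integrable_mult_bounded(1)[OF square_integrable_diff(1)[OF Es Es] GM[OF that] Gb[OF that]] that by auto
  have Qs: "square_integrable (Q m)" for m
    unfolding Q_def[abs_def] by (intro square_integrable_sum term_s) auto
  have Ql: "(\<lambda>m. expectation (\<lambda>\<omega>. (Q m \<omega>)\<^sup>2)) \<longlonglongrightarrow> 0"
  proof -
    define V where "V n m \<omega> = (\<Sum>k<n. G k \<omega> * (E (Suc k) m \<omega> - E k m \<omega>))" for n m \<omega>
    have Vs: "square_integrable (V n m)" if "n \<le> N" for n m
      unfolding V_def[abs_def] using that by (intro square_integrable_sum term_s) auto
    have "(\<lambda>m. expectation (\<lambda>\<omega>. (V n m \<omega>)\<^sup>2)) \<longlonglongrightarrow> 0" if "n \<le> N" for n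
      using that
    proof (induction n)
      case 0
      then show ?case by (simp add: V_def)
    next
      case (Suc n)
      then have n: "n < N" "n \<le> N" "Suc n \<le> N" by auto
      have le: "expectation (\<lambda>\<omega>. (V (Suc n) m \<omega>)\<^sup>2) \<le> 2 * expectation (\<lambda>\<omega>. (V n m \<omega>)\<^sup>2) +
          2 * (D\<^sup>2 * (2 * expectation (\<lambda>\<omega>. (E (Suc n) m \<omega>)\<^sup>2) + 2 * expectation (\<lambda>\<omega>. (E n m \<omega>)\<^sup>2)))" for m
      proof -
        note d = square_integrable_diff[OF Es[OF n(3)] Es[OF n(2)], of m m]
        have "V (Suc n) m \<omega> = V n m \<omega> + G n \<omega> * (E (Suc n) m \<omega> - E n m \<omega>)" for \<omega> by (simp add: V_def)
        then have "expectation (\<lambda>\<omega>. (V (Suc n) m \<omega>)\<^sup>2) \<le> 2 * expectation (\<lambda>\<omega>. (V n m \<omega>)\<^sup>2) +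
            2 * expectation (\<lambda>\<omega>. (G n \<omega> * (E (Suc n) m \<omega> - E n m \<omega>))\<^sup>2)"
          using square_integrable_add(2)[OF Vs[OF n(2)] term_s[OF n(1)], of m m] by simp
        also have "expectation (\<lambda>\<omega>. (G n \<omega> * (E (Suc n) m \<omega> - E n m \<omega>))\<^sup>2) \<le>
            D\<^sup>2 * expectation (\<lambda>\<omega>. (E (Suc n) m \<omega> - E n m \<omega>)\<^sup>2)"
          by (rule square_integrable_mult_bounded(2)[OF d(1) GM[OF n(1)] Gb[OF n(1)]])
        also have "\<dots> \<le> D\<^sup>2 * (2 * expectation (\<lambda>\<omega>. (E (Suc n) m \<omega>)\<^sup>2) + 2 * expectation (\<lambda>\<omega>. (E n m \<omega>)\<^sup>2))"
          by (intro mult_left_mono d(2)) simp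
        finally show ?thesis by simp
      qed
      have lim: "(\<lambda>m. 2 * expectation (\<lambda>\<omega>. (V n m \<omega>)\<^sup>2) +
          2 * (D\<^sup>2 * (2 * expectation (\<lambda>\<omega>. (E (Suc n) m \<omega>)\<^sup>2) + 2 * expectation (\<lambda>\<omega>. (E n m \<omega>)\<^sup>2)))) \<longlonglongrightarrow>
          2 * 0 + 2 * (D\<^sup>2 * (2 * 0 + 2 * 0))"
        using Suc.IH[OF n(2)] El[OF n(3)] El[OF n(2)] by (intro tendsto_intros) auto
      show ?case
        by (rule tendsto_sandwich[OF _ _ tendsto_const lim[simplified]]) (use le in auto)
    qed
    from this[of N] show ?thesis by (simp add: V_def Q_def[abs_def])
  qed
  show S: "square_integrable S"
    using square_integrable_add(1)[OF Qs[of 0] Pm(1)[of 0]] unfolding eq[of _ 0, symmetric] .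
  have "expectation (\<lambda>\<omega>. (S \<omega>)\<^sup>2) \<le> 2 * expectation (\<lambda>\<omega>. (Q m \<omega>)\<^sup>2) + 2 * (?T * (D * C)\<^sup>2)" for m
    using square_integrable_add(2)[OF Qs[of m] Pm(1)[of m]] Pm(3)[of m] unfolding eq[of _ m, symmetric] by linarith
  moreover have "(\<lambda>m. 2 * expectation (\<lambda>\<omega>. (Q m \<omega>)\<^sup>2) + 2 * (?T * (D * C)\<^sup>2)) \<longlonglongrightarrow> 2 * 0 + 2 * (?T * (D * C)\<^sup>2)"
    by (intro tendsto_intros Ql)
  ultimately have "expectation (\<lambda>\<omega>. (S \<omega>)\<^sup>2) \<le> 2 * 0 + 2 * (?T * (D * C)\<^sup>2)"
    by (intro LIMSEQ_le_const) auto
  then show "expectation (\<lambda>\<omega>. (S \<omega>)\<^sup>2) \<le> 2 * (?T * (D * C)\<^sup>2)" by simp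
  have "(expectation S)\<^sup>2 \<le> expectation (\<lambda>\<omega>. (Q m \<omega>)\<^sup>2)" for m
  proof -
    have "expectation S = expectation (Q m)"
      using square_integrable_integrable[OF Qs[of m]] square_integrable_integrable[OF Pm(1)[of m]] Pm(2)[of m]
      unfolding eq[of _ m, abs_def] by simp
    then show ?thesis using expectation_square_le[OF Qs[of m]] by simp
  qed
  then have "(expectation S)\<^sup>2 \<le> 0" by (intro LIMSEQ_le_const[OF Ql]) auto
  then show "expectation S = 0" by simp
qed

text \<open>
  Each of the \<open>n\<close> terms has a second moment of the order \<open>h\<^sup>2\<close>, and different terms are orthogonal; so the
  sum is of the order \<open>n * h\<^sup>2\<close>, that is, \<open>h\<close> for a fixed time span. This is the convergence of the
  quadratic variation.
\<close>

lemma increment_product_transform: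
  fixes a b :: 'm
  assumes h: "0 < h"
    and Y: "\<And>j. j < n \<Longrightarrow> Y j \<in> borel_measurable (F (real j * h))"
    and bd: "\<And>j \<omega>. j < n \<Longrightarrow> \<omega> \<in> space M \<Longrightarrow> \<bar>Y j \<omega>\<bar> \<le> C"
  defines "S \<equiv> (\<lambda>\<omega>. \<Sum>j<n. Y j \<omega> * ((B a (real (Suc j) * h) \<omega> - B a (real j * h) \<omega>) *
     (B b (real (Suc j) * h) \<omega> - B b (real j * h) \<omega>) - (if a = b then h else 0)))"
  shows "square_integrable S" "expectation (\<lambda>\<omega>. (S \<omega>)\<^sup>2) \<le> 2 * (real n * h * h * C\<^sup>2)"
proof -
  define G where "G j = F (real j * h)" for j
  define Z where "Z j \<omega> = (B a (real (Suc j) * h) \<omega> - B a (real j * h) \<omega>) *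
     (B b (real (Suc j) * h) \<omega> - B b (real j * h) \<omega>) - (if a = b then h else 0)" for j \<omega>
  have t0: "0 \<le> real j * h" for j using h by simp
  have tj: "real j * h < real (Suc j) * h" for j using h by simp
  have d: "real (Suc j) * h - real j * h = h" for j by (simp add: algebra_simps)
  let ?v = "if a = b then 2 * h\<^sup>2 else h\<^sup>2"
  have c: "centered_given (G j) ?v (Z j)" for j
    using centered_increment_product[OF t0 tj, of j a b] unfolding G_def Z_def[abs_def] d .
  have sub: "subalgebra M (G j)" "subalgebra (G (Suc j)) (G j)" for j
    unfolding G_def by (rule subalg[OF t0], rule subalg_mono[OF t0 less_imp_le[OF tj]])
  have Zm: "Z j \<in> borel_measurable (G (Suc j))" for j
    unfolding G_def Z_def[abs_def]
    by (intro borel_measurable_diff borel_measurable_times B_adapted adapted_mono[OF B_adapted]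
        t0 less_imp_le[OF tj] borel_measurable_const)
  have Y': "\<And>j. j < n \<Longrightarrow> Y j \<in> borel_measurable (G j)" using Y by (simp add: G_def)
  note r = martingale_transform[where G=G and Y=Y and N=n and C=C and v="\<lambda>_. ?v" and Z=Z, OF sub Y' bd Zm c]
  have S: "S = (\<lambda>\<omega>. \<Sum>j<n. Y j \<omega> * Z j \<omega>)" by (simp add: S_def Z_def)
  have "S \<in> borel_measurable M" using measurable_from_subalg[OF sub(1) r(1)] by (simp add: S)
  then show "square_integrable S" using r(2) by (simp add: square_integrable_def S)
  have "expectation (\<lambda>\<omega>. (S \<omega>)\<^sup>2) = (\<Sum>k<n. ?v * expectation (\<lambda>\<omega>. (Y k \<omega>)\<^sup>2))"
    using r(5) by (simp only: S)
  also have "\<dots> \<le> (\<Sum>k<n. (2 * h\<^sup>2) * C\<^sup>2)"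
  proof (intro sum_mono mult_mono)
    fix k assume k: "k \<in> {..<n}"
    show "expectation (\<lambda>\<omega>. (Y k \<omega>)\<^sup>2) \<le> C\<^sup>2"
      using k adapted_measurable[OF Y t0] bd by (intro expectation_square_bounded) auto
  qed auto
  also have "\<dots> = 2 * (real n * h * h * C\<^sup>2)" by (simp add: power2_eq_square)
  finally show "expectation (\<lambda>\<omega>. (S \<omega>)\<^sup>2) \<le> 2 * (real n * h * h * C\<^sup>2)" .
qed

end

section \<open>Second-order expansion along a path\<close>

lemma riemann_step_uniform:
  fixes f :: "real \<Rightarrow> real"
  assumes f: "continuous_on {0..T} f" and T: "0 < T" and \<epsilon>: "0 < \<epsilon>"
  shows "\<exists>n0. \<forall>n\<ge>n0. \<forall>k\<le>n. \<bar>integral {real k * (T / real (Suc n))..real (Suc k) * (T / real (Suc n))} f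
      - T / real (Suc n) * f (real k * (T / real (Suc n)))\<bar> \<le> \<epsilon> * (T / real (Suc n))"
proof -
  have "uniformly_continuous_on {0..T} f" using f by (intro compact_uniformly_continuous) auto
  then obtain \<delta> where \<delta>: "0 < \<delta>" and uc: "\<And>x y. x \<in> {0..T} \<Longrightarrow> y \<in> {0..T} \<Longrightarrow> \<bar>y - x\<bar> < \<delta> \<Longrightarrow> \<bar>f y - f x\<bar> < \<epsilon>"
    using \<epsilon> unfolding uniformly_continuous_on_def dist_real_def by metis
  obtain n0 :: nat where n0: "T / \<delta> < real n0" using reals_Archimedean2 by blast
  show ?thesis
  proof (intro exI allI impI)
    fix n k assume n: "n0 \<le> n" and k: "k \<le> n"
    define h where "h = T / real (Suc n)"
    have h0: "0 < h" using T by (simp add: h_def)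
    have "T / \<delta> < real (Suc n)" using n0 n by linarith
    then have "T < real (Suc n) * \<delta>" using \<delta> by (simp add: pos_divide_less_eq)
    then have h\<delta>: "h < \<delta>" by (simp add: h_def pos_divide_less_eq mult.commute)
    define a where "a = real k * h"
    have b: "real (Suc k) * h = a + h" by (simp add: a_def algebra_simps)
    have a0: "0 \<le> a" using h0 by (simp add: a_def)
    have "real (Suc k) * h \<le> real (Suc n) * h" using k h0 by (intro mult_right_mono) auto
    also have "\<dots> = T" by (simp add: h_def del: of_nat_Suc)
    finally have bT: "a + h \<le> T" unfolding b .
    have i: "f integrable_on {a..a + h}"
      by (intro integrable_continuous_interval continuous_on_subset[OF f]) (use a0 bT in auto)
    have "integral {a..a + h} f - h * f a = integral {a..a + h} (\<lambda>s. f s - f a)"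
      using i h0 by (subst Henstock_Kurzweil_Integration.integral_diff) (auto simp: integrable_const_ivl)
    also have "norm \<dots> \<le> \<epsilon> * (a + h - a)"
    proof (rule integral_bound)
      show "a \<le> a + h" using h0 by simp
      show "continuous_on {a..a + h} (\<lambda>s. f s - f a)"
        by (intro continuous_intros continuous_on_subset[OF f]) (use a0 bT in auto)
      fix s assume "s \<in> {a..a + h}"
      then show "norm (f s - f a) \<le> \<epsilon>" using uc[of a s] a0 bT h\<delta> by auto
    qed
    finally show "\<bar>integral {real k * (T / real (Suc n))..real (Suc k) * (T / real (Suc n))} f
      - T / real (Suc n) * f (real k * (T / real (Suc n)))\<bar> \<le> \<epsilon> * (T / real (Suc n))"
      unfolding h_def[symmetric] b a_def[symmetric] by simp
  qed
qed

lemma integral_grid_split: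
  fixes f :: "real \<Rightarrow> real"
  assumes f: "continuous_on {0..real N * h} f" and h: "0 \<le> h"
  shows "(\<Sum>k<N. integral {real k * h..real (Suc k) * h} f) = integral {0..real N * h} f"
  using f
proof (induction N)
  case (Suc N)
  have le: "0 \<le> real N * h" "real N * h \<le> real (Suc N) * h" using h by (auto simp: mult_right_mono)
  have "continuous_on {0..real N * h} f" by (rule continuous_on_subset[OF Suc.prems]) (use le in auto)
  note IH = Suc.IH[OF this]
  have "f integrable_on {0..real (Suc N) * h}" by (rule integrable_continuous_interval[OF Suc.prems])
  from Henstock_Kurzweil_Integration.integral_combine[OF le this] show ?case by (simp only: sum.lessThan_Suc IH)
qed simp

lemma riemann_sum_limit:
  fixes f :: "real \<Rightarrow> real"
  assumes f: "continuous_on {0..T} f" and T: "0 < T"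
  shows "(\<lambda>n. \<Sum>k<Suc n. T / real (Suc n) * f (real k * (T / real (Suc n)))) \<longlonglongrightarrow> integral {0..T} f"
proof (rule LIMSEQ_I)
  fix r :: real assume r: "0 < r"
  define \<epsilon> where "\<epsilon> = r / (2 * T)"
  have \<epsilon>: "0 < \<epsilon>" "\<epsilon> * T < r" using r T by (auto simp: \<epsilon>_def)
  from riemann_step_uniform[OF f T \<epsilon>(1)] obtain n0 where
    n0: "\<And>n k. n0 \<le> n \<Longrightarrow> k \<le> n \<Longrightarrow> \<bar>integral {real k * (T / real (Suc n))..real (Suc k) * (T / real (Suc n))} f
      - T / real (Suc n) * f (real k * (T / real (Suc n)))\<bar> \<le> \<epsilon> * (T / real (Suc n))" by blast
  show "\<exists>n0. \<forall>n\<ge>n0. norm ((\<Sum>k<Suc n. T / real (Suc n) * f (real k * (T / real (Suc n)))) - integral {0..T} f) < r"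
  proof (intro exI allI impI)
    fix n assume n: "n0 \<le> n"
    let ?h = "T / real (Suc n)"
    have NT: "real (Suc n) * ?h = T" by (simp del: of_nat_Suc)
    have "integral {0..T} f = (\<Sum>k<Suc n. integral {real k * ?h..real (Suc k) * ?h} f)"
      using integral_grid_split[of "Suc n" ?h f] f T unfolding NT by simp
    then have "norm ((\<Sum>k<Suc n. ?h * f (real k * ?h)) - integral {0..T} f) =
       \<bar>\<Sum>k<Suc n. integral {real k * ?h..real (Suc k) * ?h} f - ?h * f (real k * ?h)\<bar>"
      unfolding sum_subtractf by (simp only: real_norm_def abs_minus_commute)
    also have "\<dots> \<le> (\<Sum>k<Suc n. \<bar>integral {real k * ?h..real (Suc k) * ?h} f - ?h * f (real k * ?h)\<bar>)"
      by (rule sum_abs)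
    also have "\<dots> \<le> (\<Sum>k<Suc n. \<epsilon> * ?h)"
      by (intro sum_mono n0[OF n]) auto
    also have "\<dots> = \<epsilon> * T" by (simp del: of_nat_Suc sum.lessThan_Suc)
    finally show "norm ((\<Sum>k<Suc n. ?h * f (real k * ?h)) - integral {0..T} f) < r" using \<epsilon> by linarith
  qed
qed

definition quad :: "('n::finite \<Rightarrow> 'n \<Rightarrow> real) \<Rightarrow> real^'n \<Rightarrow> real^'n \<Rightarrow> real" where
  "quad H u v = (\<Sum>i\<in>UNIV. \<Sum>j\<in>UNIV. H i j * (u $ i * v $ j))"

lemma quad_add_left: "quad H (u + u') v = quad H u v + quad H u' v"
  by (simp add: quad_def sum.distrib algebra_simps)

lemma quad_add_right: "quad H u (v + v') = quad H u v + quad H u v'"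
  by (simp add: quad_def sum.distrib algebra_simps)

lemma quad_bound:
  fixes u v :: "real^'n::finite"
  assumes "\<And>i j. \<bar>H i j\<bar> \<le> C"
  shows "\<bar>quad H u v\<bar> \<le> C * (real CARD('n))\<^sup>2 * (norm u * norm v)"
proof -
  have C: "0 \<le> C" using assms[of undefined undefined] by linarith
  have "\<bar>quad H u v\<bar> \<le> (\<Sum>i\<in>(UNIV::'n set). \<Sum>j\<in>(UNIV::'n set). C * (norm u * norm v))"
    unfolding quad_def
  proof (intro order_trans[OF sum_abs] sum_mono)
    fix i j :: 'n
    show "\<bar>H i j * (u $ i * v $ j)\<bar> \<le> C * (norm u * norm v)"
      unfolding abs_mult by (intro mult_mono assms component_le_norm_cart C mult_nonneg_nonneg) auto
  qed
  also have "\<dots> = C * (real CARD('n))\<^sup>2 * (norm u * norm v)" by (simp add: power2_eq_square)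
  finally show ?thesis .
qed

lemma norm_add_square_le: "(norm (u + v :: 'b::real_normed_vector))\<^sup>2 \<le> 2 * (norm u)\<^sup>2 + 2 * (norm v)\<^sup>2"
proof -
  have "(norm (u + v))\<^sup>2 \<le> (norm u + norm v)\<^sup>2" by (intro power_mono norm_triangle_ineq) simp
  also have "\<dots> \<le> 2 * (norm u)\<^sup>2 + 2 * (norm v)\<^sup>2"
    using zero_le_power2[of "norm u - norm v"] by (simp add: power2_sum power2_diff)
  finally show ?thesis .
qed

text \<open>
  The mixed terms are split by the weighted inequality between the arithmetic and the geometric mean,
  so that the coefficient of the large part \<open>m\<close> can be made as small as desired.
\<close>

lemma quad_perturbation:
  fixes d m :: "real^'n::finite"
  assumes H: "\<And>i j. \<bar>H i j\<bar> \<le> C" and \<kappa>: "0 < \<kappa>"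
  shows "\<bar>quad H (d + m) (d + m) - quad H m m\<bar> \<le>
     C * (real CARD('n))\<^sup>2 * ((1 + 1 / \<kappa>) * (norm d)\<^sup>2 + \<kappa> * (norm m)\<^sup>2)"
proof -
  let ?K = "C * (real CARD('n))\<^sup>2"
  have K: "0 \<le> ?K" using H[of undefined undefined] by simp
  have "quad H (d + m) (d + m) - quad H m m = quad H d d + (quad H d m + quad H m d)"
    by (simp add: quad_add_left quad_add_right)
  also have "\<bar>\<dots>\<bar> \<le> \<bar>quad H d d\<bar> + \<bar>quad H d m\<bar> + \<bar>quad H m d\<bar>" by linarith
  also have "\<dots> \<le> ?K * (norm d * norm d) + ?K * (norm d * norm m) + ?K * (norm m * norm d)"
    by (intro add_mono quad_bound H)
  also have "\<dots> = ?K * ((norm d)\<^sup>2 + 2 * (norm d * norm m))"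
    by (simp add: power2_eq_square algebra_simps)
  also have "\<dots> \<le> ?K * ((1 + 1 / \<kappa>) * (norm d)\<^sup>2 + \<kappa> * (norm m)\<^sup>2)"
  proof (rule mult_left_mono[OF _ K])
    have "0 \<le> (norm d / sqrt \<kappa> - sqrt \<kappa> * norm m)\<^sup>2" by simp
    also have "\<dots> = (norm d)\<^sup>2 / \<kappa> + \<kappa> * (norm m)\<^sup>2 - 2 * (norm d * norm m)"
      using \<kappa> by (simp add: power2_diff power_divide power_mult_distrib)
    finally show "(norm d)\<^sup>2 + 2 * (norm d * norm m) \<le> (1 + 1 / \<kappa>) * (norm d)\<^sup>2 + \<kappa> * (norm m)\<^sup>2"
      by (simp add: algebra_simps)
  qed
  finally show ?thesis .
qed

text \<open>
  Taylor's formula on an arbitrary set, uniformly. The first and second derivatives enter as given data,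
  since \<open>S\<close> need not be open.
\<close>

definition second_order_expansion_on ::
  "(real^'n::finite) set \<Rightarrow> (real^'n \<Rightarrow> real) \<Rightarrow> (real^'n \<Rightarrow> real^'n) \<Rightarrow> (real^'n \<Rightarrow> 'n \<Rightarrow> 'n \<Rightarrow> real) \<Rightarrow> bool" where
  "second_order_expansion_on S \<Phi> g H \<longleftrightarrow>
     (\<forall>\<epsilon>>0. \<exists>\<delta>>0. \<forall>x\<in>S. \<forall>y\<in>S. norm (y - x) < \<delta> \<longrightarrow>
        \<bar>\<Phi> y - \<Phi> x - g x \<bullet> (y - x) - 1/2 * quad (H x) (y - x) (y - x)\<bar> \<le> \<epsilon> * (norm (y - x))\<^sup>2)"

text \<open>
  Ito's formula for a single path, as a statement on sums over a grid. The increments of the path are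
  split into the drift part, the martingale part \<open>m\<close> and a residual \<open>e\<close>. The drift and residual parts have
  a vanishing sum of squares, and the sum of squares of \<open>m\<close> stays bounded because it is asymptotic to
  the sum of \<open>h * v\<close>, where \<open>v\<close> is bounded above. So only the linear terms and the quadratic term of \<open>m\<close>
  survive, and the latter is asymptotic to the sum of \<open>h * w\<close>. The subsequence \<open>r\<close> of grids is the one along which the stochastic
  hypotheses hold almost surely.
\<close>

theorem pathwise_ito_remainder:
  fixes x :: "real \<Rightarrow> real^'n::finite" and f :: "real \<Rightarrow> real^'n"
    and m e :: "nat \<Rightarrow> nat \<Rightarrow> real^'n" and r :: "nat \<Rightarrow> nat"
  assumes T: "0 < T" and x: "continuous_on {0..T} x" "\<And>s. s \<in> {0..T} \<Longrightarrow> x s \<in> S"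
    and f: "continuous_on {0..T} f" and r: "strict_mono r"
    and exp: "second_order_expansion_on S \<Phi> g H"
    and gb: "\<And>y. y \<in> S \<Longrightarrow> norm (g y) \<le> Cg" and Hb: "\<And>y i j. y \<in> S \<Longrightarrow> \<bar>H y i j\<bar> \<le> CH"
  defines "t \<equiv> (\<lambda>n k. real k * (T / real (Suc (r n))))" and "h \<equiv> (\<lambda>n. T / real (Suc (r n)))"
  assumes step: "\<And>n k. k \<le> r n \<Longrightarrow> x (t n (Suc k)) - x (t n k) =
        (\<chi> i. integral {t n k..t n (Suc k)} (\<lambda>s. f s $ i)) + m n k + e n k"
    and e0: "(\<lambda>n. \<Sum>k<Suc (r n). (norm (e n k))\<^sup>2) \<longlonglongrightarrow> 0"
    and m0: "(\<lambda>n. (\<Sum>k<Suc (r n). (norm (m n k))\<^sup>2 - h n * v (t n k))) \<longlonglongrightarrow> 0"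
    and vb: "\<And>s. s \<in> {0..T} \<Longrightarrow> v s \<le> Cv"
    and q0: "(\<lambda>n. (\<Sum>k<Suc (r n). quad (H (x (t n k))) (m n k) (m n k) - h n * w (t n k))) \<longlonglongrightarrow> 0"
  shows "(\<lambda>n. \<Sum>k<Suc (r n). \<Phi> (x (t n (Suc k))) - \<Phi> (x (t n k)) - g (x (t n k)) \<bullet> (m n k + e n k)
      - h n * (g (x (t n k)) \<bullet> f (t n k) + 1/2 * w (t n k))) \<longlonglongrightarrow> 0"
proof -
  define \<beta> where "\<beta> n k = (\<chi> i. integral {t n k..t n (Suc k)} (\<lambda>s. f s $ i))" for n k
  define d where "d n k = \<beta> n k + e n k" for n k
  let ?c = "real CARD('n)"
  let ?K = "CH * ?c\<^sup>2"
  have rn: "n \<le> r n" for n using r by (rule strict_mono_imp_increasing)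
  have h0: "0 < h n" for n using T by (simp add: h_def)
  have NT: "real (Suc (r n)) * h n = T" for n by (simp add: h_def del: of_nat_Suc)
  have tk: "t n k = real k * h n" for n k by (simp add: t_def h_def)
  have tT: "t n k \<in> {0..T}" if "k \<le> Suc (r n)" for n k
  proof -
    have "real k * h n \<le> real (Suc (r n)) * h n" using that h0[of n] by (intro mult_right_mono) auto
    then show ?thesis using h0[of n] unfolding NT tk by simp
  qed
  have hl: "h \<longlonglongrightarrow> 0"
  proof -
    have "(\<lambda>n. T / real (Suc n)) \<longlonglongrightarrow> 0" by (rule LIMSEQ_Suc[OF lim_const_over_n])
    from LIMSEQ_subseq_LIMSEQ[OF this r] show ?thesis by (simp add: h_def o_def)
  qed
  (* the drift increments are uniformly close to their left-point approximation *)
  define A where "A n = (\<Sum>k<Suc (r n). norm (\<beta> n k - h n *\<^sub>R f (t n k)))" for n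
  have \<beta>c: "\<forall>\<^sub>F n in sequentially. \<forall>k\<le>r n. norm (\<beta> n k - h n *\<^sub>R f (t n k)) \<le> ?c * (\<epsilon> * h n)"
    if \<epsilon>: "0 < \<epsilon>" for \<epsilon>
  proof -
    have "\<forall>\<^sub>F n in sequentially. \<forall>k\<le>r n. \<bar>(\<beta> n k - h n *\<^sub>R f (t n k)) $ i\<bar> \<le> \<epsilon> * h n" for i
    proof -
      have "continuous_on {0..T} (\<lambda>s. f s $ i)" using f by (intro continuous_intros)
      from riemann_step_uniform[OF this T \<epsilon>] obtain n0 where
        n0: "\<And>n k. n0 \<le> n \<Longrightarrow> k \<le> n \<Longrightarrow> \<bar>integral {real k * (T / real (Suc n))..real (Suc k) * (T / real (Suc n))} (\<lambda>s. f s $ i)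
          - T / real (Suc n) * f (real k * (T / real (Suc n))) $ i\<bar> \<le> \<epsilon> * (T / real (Suc n))" by blast
      show ?thesis
        unfolding eventually_sequentially
      proof (intro exI[of _ n0] allI impI)
        fix n k assume "n0 \<le> n" "k \<le> r n"
        then have "n0 \<le> r n" using rn[of n] by simp
        from n0[OF this \<open>k \<le> r n\<close>] show "\<bar>(\<beta> n k - h n *\<^sub>R f (t n k)) $ i\<bar> \<le> \<epsilon> * h n"
          by (simp add: \<beta>_def t_def h_def)
      qed
    qed
    then have "\<forall>\<^sub>F n in sequentially. \<forall>i. \<forall>k\<le>r n. \<bar>(\<beta> n k - h n *\<^sub>R f (t n k)) $ i\<bar> \<le> \<epsilon> * h n"
      by (rule eventually_all_finite)
    then show ?thesis
    proof (rule eventually_mono, intro allI impI)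
      fix n k assume *: "\<forall>i. \<forall>k\<le>r n. \<bar>(\<beta> n k - h n *\<^sub>R f (t n k)) $ i\<bar> \<le> \<epsilon> * h n" and k: "k \<le> r n"
      have "norm (\<beta> n k - h n *\<^sub>R f (t n k)) \<le> (\<Sum>i\<in>UNIV. \<bar>(\<beta> n k - h n *\<^sub>R f (t n k)) $ i\<bar>)"
        by (rule norm_le_l1_cart)
      also have "\<dots> \<le> (\<Sum>i\<in>(UNIV::'n set). \<epsilon> * h n)" by (rule sum_mono) (use * k in blast)
      finally show "norm (\<beta> n k - h n *\<^sub>R f (t n k)) \<le> ?c * (\<epsilon> * h n)" by simp
    qed
  qed
  have A0: "A \<longlonglongrightarrow> 0"
  proof (rule LIMSEQ_I)
    fix \<rho> :: real assume \<rho>: "0 < \<rho>"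
    define \<epsilon> where "\<epsilon> = \<rho> / (2 * ?c * T)"
    have \<epsilon>: "0 < \<epsilon>" using \<rho> T by (simp add: \<epsilon>_def)
    from \<beta>c[OF \<epsilon>] obtain n0 where n0: "\<And>n k. n0 \<le> n \<Longrightarrow> k \<le> r n \<Longrightarrow> norm (\<beta> n k - h n *\<^sub>R f (t n k)) \<le> ?c * (\<epsilon> * h n)"
      unfolding eventually_sequentially by blast
    show "\<exists>n0. \<forall>n\<ge>n0. norm (A n - 0) < \<rho>"
    proof (intro exI allI impI)
      fix n assume n: "n0 \<le> n"
      have "A n \<le> (\<Sum>k<Suc (r n). ?c * (\<epsilon> * h n))"
        unfolding A_def by (intro sum_mono n0[OF n]) auto
      also have "\<dots> = ?c * (\<epsilon> * (real (Suc (r n)) * h n))" by (simp del: of_nat_Suc sum.lessThan_Suc)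
      also have "\<dots> = \<rho> / 2" unfolding NT using T by (simp add: \<epsilon>_def)
      finally have "A n < \<rho>" using \<rho> by linarith
      moreover have "0 \<le> A n" unfolding A_def by (intro sum_nonneg) auto
      ultimately show "norm (A n - 0) < \<rho>" by simp
    qed
  qed
  define U where "U n = (\<Sum>k<Suc (r n). (norm (d n k))\<^sup>2)" for n
  define V where "V n = (\<Sum>k<Suc (r n). (norm (m n k))\<^sup>2)" for n
  have "bounded (f ` {0..T})" using f by (intro compact_imp_bounded compact_continuous_image) auto
  then obtain Bf where Bf: "\<And>s. s \<in> {0..T} \<Longrightarrow> norm (f s) \<le> Bf" unfolding bounded_iff by blast
  have U0: "U \<longlonglongrightarrow> 0"
  proof -
    define Bb where "Bb = Bf + ?c"
    have "\<forall>\<^sub>F n in sequentially. U n \<le> 2 * (T * Bb\<^sup>2 * h n) + 2 * (\<Sum>k<Suc (r n). (norm (e n k))\<^sup>2)"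
      using \<beta>c[of 1]
    proof (rule eventually_mono)
      show "0 < (1::real)" by simp
      fix n assume *: "\<forall>k\<le>r n. norm (\<beta> n k - h n *\<^sub>R f (t n k)) \<le> ?c * (1 * h n)"
      have \<beta>b: "norm (\<beta> n k) \<le> Bb * h n" if k: "k \<le> r n" for k
      proof -
        have "norm (\<beta> n k) \<le> norm (\<beta> n k - h n *\<^sub>R f (t n k)) + norm (h n *\<^sub>R f (t n k))"
          by (metis add.commute norm_triangle_sub)
        moreover have "norm (h n *\<^sub>R f (t n k)) \<le> h n * Bf"
          using Bf[OF tT[of k n]] k h0[of n] by simp
        ultimately show ?thesis using *[rule_format, OF k] by (simp add: Bb_def algebra_simps)
      qed
      have "U n \<le> (\<Sum>k<Suc (r n). 2 * (Bb * h n)\<^sup>2 + 2 * (norm (e n k))\<^sup>2)"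
        unfolding U_def d_def
      proof (intro sum_mono order_trans[OF norm_add_square_le] add_mono mult_left_mono power_mono)
        fix k assume "k \<in> {..<Suc (r n)}"
        then show "norm (\<beta> n k) \<le> Bb * h n" by (intro \<beta>b) auto
      qed auto
      also have "\<dots> = 2 * ((real (Suc (r n)) * h n) * Bb\<^sup>2 * h n) + 2 * (\<Sum>k<Suc (r n). (norm (e n k))\<^sup>2)"
        by (simp add: sum.distrib sum_distrib_left power2_eq_square del: of_nat_Suc sum.lessThan_Suc)
      finally show "U n \<le> 2 * (T * Bb\<^sup>2 * h n) + 2 * (\<Sum>k<Suc (r n). (norm (e n k))\<^sup>2)" unfolding NT .
    qed
    note up = this
    have nn: "\<forall>\<^sub>F n in sequentially. 0 \<le> U n"
      by (intro always_eventually allI) (simp add: U_def sum_nonneg)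
    have "(\<lambda>n. 2 * (T * Bb\<^sup>2 * h n) + 2 * (\<Sum>k<Suc (r n). (norm (e n k))\<^sup>2)) \<longlonglongrightarrow> 2 * (T * Bb\<^sup>2 * 0) + 2 * 0"
      by (intro tendsto_intros hl e0)
    then have "(\<lambda>n. 2 * (T * Bb\<^sup>2 * h n) + 2 * (\<Sum>k<Suc (r n). (norm (e n k))\<^sup>2)) \<longlonglongrightarrow> 0" by simp
    from tendsto_sandwich[OF nn up tendsto_const this] show ?thesis .
  qed
  (* a bound for the eventually bounded sums of the squares of the martingale parts *)
  define BV where "BV = 1 + T * \<bar>Cv\<bar>"
  have BV: "0 < BV" using T by (simp add: BV_def add_pos_nonneg)
  have Vb: "\<forall>\<^sub>F n in sequentially. V n \<le> BV"
  proof -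
    from LIMSEQ_D[OF m0, of 1] obtain n0 where
      n0: "\<And>n. n0 \<le> n \<Longrightarrow> \<bar>\<Sum>k<Suc (r n). (norm (m n k))\<^sup>2 - h n * v (t n k)\<bar> < 1" by auto
    show ?thesis
      unfolding eventually_sequentially
    proof (intro exI allI impI)
      fix n assume n: "n0 \<le> n"
      have "(\<Sum>k<Suc (r n). h n * v (t n k)) \<le> (\<Sum>k<Suc (r n). h n * \<bar>Cv\<bar>)"
      proof (intro sum_mono mult_left_mono)
        fix k assume "k \<in> {..<Suc (r n)}"
        then show "v (t n k) \<le> \<bar>Cv\<bar>" using vb[OF tT[of k n]] by auto
        show "0 \<le> h n" using h0[of n] by simp
      qed
      also have "\<dots> = real (Suc (r n)) * h n * \<bar>Cv\<bar>" by (simp del: of_nat_Suc sum.lessThan_Suc)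
      also have "\<dots> = T * \<bar>Cv\<bar>" unfolding NT ..
      finally have "(\<Sum>k<Suc (r n). h n * v (t n k)) \<le> T * \<bar>Cv\<bar>" .
      moreover have "V n - (\<Sum>k<Suc (r n). h n * v (t n k)) < 1"
        using n0[OF n] unfolding V_def sum_subtractf by linarith
      ultimately show "V n \<le> BV" by (simp add: BV_def)
    qed
  qed
  define Q where "Q n = (\<Sum>k<Suc (r n). quad (H (x (t n k))) (m n k) (m n k) - h n * w (t n k))" for n
  define R where "R n = (\<Sum>k<Suc (r n). \<Phi> (x (t n (Suc k))) - \<Phi> (x (t n k)) - g (x (t n k)) \<bullet> (m n k + e n k)
      - h n * (g (x (t n k)) \<bullet> f (t n k) + 1/2 * w (t n k)))" for n
  have x0S: "x 0 \<in> S" using x(2)[of 0] T by auto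
  have CH0: "0 \<le> CH" using Hb[OF x0S, of undefined undefined] by linarith
  have Cg0: "0 \<le> Cg" using gb[OF x0S] norm_ge_zero order_trans by blast
  have main: "\<forall>\<^sub>F n in sequentially. \<bar>R n\<bar> \<le>
       Cg * A n + \<bar>Q n\<bar> + (?K * (1 + 1 / \<epsilon>) + 2 * \<epsilon>) * U n + \<epsilon> * (?K + 2) * BV"
    if \<epsilon>: "0 < \<epsilon>" for \<epsilon>
  proof -
    obtain \<delta> where \<delta>: "0 < \<delta>" and tay: "\<And>y z. y \<in> S \<Longrightarrow> z \<in> S \<Longrightarrow> norm (z - y) < \<delta> \<Longrightarrow>
        \<bar>\<Phi> z - \<Phi> y - g y \<bullet> (z - y) - 1/2 * quad (H y) (z - y) (z - y)\<bar> \<le> \<epsilon> * (norm (z - y))\<^sup>2"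
      using exp \<epsilon> unfolding second_order_expansion_on_def by meson
    have "uniformly_continuous_on {0..T} x" using x(1) by (intro compact_uniformly_continuous) auto
    then obtain \<delta>' where \<delta>': "0 < \<delta>'" and uc: "\<And>s s'. s \<in> {0..T} \<Longrightarrow> s' \<in> {0..T} \<Longrightarrow> \<bar>s' - s\<bar> < \<delta>' \<Longrightarrow> norm (x s' - x s) < \<delta>"
      using \<delta> unfolding uniformly_continuous_on_def dist_real_def dist_norm by metis
    have "\<forall>\<^sub>F n in sequentially. h n < \<delta>'" by (rule order_tendstoD(2)[OF hl \<delta>'])
    then show ?thesis using Vb
    proof eventually_elim
      case (elim n)
      have pt: "\<bar>\<Phi> (x (t n (Suc k))) - \<Phi> (x (t n k)) - g (x (t n k)) \<bullet> (m n k + e n k)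
          - h n * (g (x (t n k)) \<bullet> f (t n k) + 1/2 * w (t n k))
          - 1/2 * (quad (H (x (t n k))) (m n k) (m n k) - h n * w (t n k))\<bar> \<le>
         Cg * norm (\<beta> n k - h n *\<^sub>R f (t n k)) +
         (?K * (1 + 1 / \<epsilon>) + 2 * \<epsilon>) * (norm (d n k))\<^sup>2 + \<epsilon> * (?K + 2) * (norm (m n k))\<^sup>2"
        if k: "k \<le> r n" for k
      proof -
        let ?y = "x (t n k)" and ?z = "x (t n (Suc k))"
        have yz: "?y \<in> S" "?z \<in> S" using x(2) tT[of k n] tT[of "Suc k" n] k by auto
        have "t n (Suc k) - t n k = h n" by (simp add: tk algebra_simps)
        then have "norm (?z - ?y) < \<delta>"
          using uc[OF tT[of k n] tT[of "Suc k" n]] k elim h0[of n] by auto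
        note tz = tay[OF yz this]
        have dz: "?z - ?y = d n k + m n k" using step[OF k] by (simp add: d_def \<beta>_def)
        have q: "\<bar>quad (H ?y) (d n k + m n k) (d n k + m n k) - quad (H ?y) (m n k) (m n k)\<bar> \<le>
            ?K * ((1 + 1 / \<epsilon>) * (norm (d n k))\<^sup>2 + \<epsilon> * (norm (m n k))\<^sup>2)"
          by (rule quad_perturbation[OF Hb[OF yz(1)] \<epsilon>])
        have gq: "\<bar>g ?y \<bullet> (\<beta> n k - h n *\<^sub>R f (t n k))\<bar> \<le> Cg * norm (\<beta> n k - h n *\<^sub>R f (t n k))"
          by (rule order_trans[OF Cauchy_Schwarz_ineq2 mult_right_mono[OF gb[OF yz(1)] norm_ge_zero]])
        have gz: "g ?y \<bullet> (?z - ?y) = g ?y \<bullet> (\<beta> n k - h n *\<^sub>R f (t n k)) + g ?y \<bullet> (m n k + e n k) + h n * (g ?y \<bullet> f (t n k))"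
          unfolding dz d_def by (simp add: inner_add_right inner_diff_right)
        have nz: "\<epsilon> * (norm (?z - ?y))\<^sup>2 \<le> \<epsilon> * (2 * (norm (d n k))\<^sup>2 + 2 * (norm (m n k))\<^sup>2)"
          unfolding dz using \<epsilon> norm_add_square_le[of "d n k" "m n k"] by (intro mult_left_mono) auto
        have split: "P - gm - s * (gf + 1/2 * p) - 1/2 * (q1 - s * p) =
            (P - (gb + gm + s * gf) - 1/2 * q2) + gb + 1/2 * (q2 - q1)" for P gm s gf p q1 gb q2 :: real
          by (simp add: algebra_simps diff_divide_distrib add_divide_distrib)
        have collect: "a * (2 * D + 2 * N) + c + K * ((1 + b) * D + a * N) =
            c + (K * (1 + b) + 2 * a) * D + a * (K + 2) * N" for a D N c K b :: real
          by (simp add: algebra_simps)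
        let ?a = "\<Phi> ?z - \<Phi> ?y - g ?y \<bullet> (?z - ?y) - 1/2 * quad (H ?y) (?z - ?y) (?z - ?y)"
        have eqn: "\<Phi> ?z - \<Phi> ?y - g ?y \<bullet> (m n k + e n k) - h n * (g ?y \<bullet> f (t n k) + 1/2 * w (t n k))
          - 1/2 * (quad (H ?y) (m n k) (m n k) - h n * w (t n k)) =
          ?a + g ?y \<bullet> (\<beta> n k - h n *\<^sub>R f (t n k)) +
           1/2 * (quad (H ?y) (d n k + m n k) (d n k + m n k) - quad (H ?y) (m n k) (m n k))"
          unfolding gz unfolding dz by (rule split)
        have "\<bar>?a + g ?y \<bullet> (\<beta> n k - h n *\<^sub>R f (t n k)) +
           1/2 * (quad (H ?y) (d n k + m n k) (d n k + m n k) - quad (H ?y) (m n k) (m n k))\<bar> \<le> \<bar>?a\<bar> + \<bar>g ?y \<bullet> (\<beta> n k - h n *\<^sub>R f (t n k))\<bar> +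
           \<bar>quad (H ?y) (d n k + m n k) (d n k + m n k) - quad (H ?y) (m n k) (m n k)\<bar>"
        proof -
          have "\<bar>p + q + 1/2 * s\<bar> \<le> \<bar>p\<bar> + \<bar>q\<bar> + \<bar>s\<bar>" for p q s :: real by linarith
          then show ?thesis .
        qed
        also have "\<dots> \<le> \<epsilon> * (2 * (norm (d n k))\<^sup>2 + 2 * (norm (m n k))\<^sup>2) + Cg * norm (\<beta> n k - h n *\<^sub>R f (t n k)) +
           ?K * ((1 + 1 / \<epsilon>) * (norm (d n k))\<^sup>2 + \<epsilon> * (norm (m n k))\<^sup>2)"
          by (rule add_mono[OF add_mono[OF order_trans[OF tz nz] gq] q])
        also have "\<dots> = Cg * norm (\<beta> n k - h n *\<^sub>R f (t n k)) +
         (?K * (1 + 1 / \<epsilon>) + 2 * \<epsilon>) * (norm (d n k))\<^sup>2 + \<epsilon> * (?K + 2) * (norm (m n k))\<^sup>2"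
          by (rule collect)
        finally show ?thesis unfolding eqn .
      qed
      have "\<bar>R n - 1/2 * Q n\<bar> \<le> (\<Sum>k<Suc (r n). Cg * norm (\<beta> n k - h n *\<^sub>R f (t n k)) +
         (?K * (1 + 1 / \<epsilon>) + 2 * \<epsilon>) * (norm (d n k))\<^sup>2 + \<epsilon> * (?K + 2) * (norm (m n k))\<^sup>2)"
        unfolding R_def Q_def sum_distrib_left sum_subtractf[symmetric]
        by (intro order_trans[OF sum_abs] sum_mono pt) auto
      also have "\<dots> = Cg * A n + (?K * (1 + 1 / \<epsilon>) + 2 * \<epsilon>) * U n + \<epsilon> * (?K + 2) * V n"
        unfolding A_def U_def V_def sum_distrib_left sum.distrib ..
      also have "\<dots> \<le> Cg * A n + (?K * (1 + 1 / \<epsilon>) + 2 * \<epsilon>) * U n + \<epsilon> * (?K + 2) * BV"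
        using elim(2) \<epsilon> CH0 by (intro add_left_mono mult_left_mono) auto
      finally show ?case by linarith
    qed
  qed
  have "R \<longlonglongrightarrow> 0"
  proof (rule LIMSEQ_I)
    fix \<rho> :: real assume \<rho>: "0 < \<rho>"
    define \<epsilon> where "\<epsilon> = \<rho> / (2 * ((?K + 2) * BV))"
    have KB: "0 < (?K + 2) * BV" using CH0 BV by (intro mult_pos_pos add_nonneg_pos) auto
    have \<epsilon>: "0 < \<epsilon>" using \<rho> KB by (simp add: \<epsilon>_def)
    have "\<epsilon> * (?K + 2) * BV = \<epsilon> * ((?K + 2) * BV)" by simp
    also have "\<dots> = \<rho> / 2" unfolding \<epsilon>_def using KB by (simp only: times_divide_eq_left) (simp add: field_simps)
    finally have half: "\<epsilon> * (?K + 2) * BV = \<rho> / 2" .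
    have "(\<lambda>n. Cg * A n + \<bar>Q n\<bar> + (?K * (1 + 1 / \<epsilon>) + 2 * \<epsilon>) * U n) \<longlonglongrightarrow>
        Cg * 0 + \<bar>0\<bar> + (?K * (1 + 1 / \<epsilon>) + 2 * \<epsilon>) * 0"
      using q0 unfolding Q_def[symmetric] by (intro tendsto_intros A0 U0)
    then have "\<forall>\<^sub>F n in sequentially. Cg * A n + \<bar>Q n\<bar> + (?K * (1 + 1 / \<epsilon>) + 2 * \<epsilon>) * U n < \<rho> / 2"
      using \<rho> by (intro order_tendstoD(2)) auto
    then have "\<forall>\<^sub>F n in sequentially. norm (R n - 0) < \<rho>"
      using main[OF \<epsilon>]
      by eventually_elim (unfold real_norm_def diff_0_right, use half in linarith)
    then show "\<exists>n0. \<forall>n\<ge>n0. norm (R n - 0) < \<rho>" unfolding eventually_sequentially .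
  qed
  then show ?thesis unfolding R_def[abs_def] .
qed

section \<open>Dynkin's formula\<close>

context brownian_filtration
begin

lemma expectation_sum_square_le:
  assumes P: "finite P" and f: "\<And>p. p \<in> P \<Longrightarrow> square_integrable (f p)"
  shows "expectation (\<lambda>\<omega>. (\<Sum>p\<in>P. f p \<omega>)\<^sup>2) \<le> real (card P) * (\<Sum>p\<in>P. expectation (\<lambda>\<omega>. (f p \<omega>)\<^sup>2))"
proof -
  have i: "integrable M (\<lambda>\<omega>. (f p \<omega>)\<^sup>2)" if "p \<in> P" for p using f[OF that] by (simp add: square_integrable_def)
  have "expectation (\<lambda>\<omega>. (\<Sum>p\<in>P. f p \<omega>)\<^sup>2) \<le> expectation (\<lambda>\<omega>. real (card P) * (\<Sum>p\<in>P. (f p \<omega>)\<^sup>2))"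
  proof (rule integral_mono)
    show "integrable M (\<lambda>\<omega>. (\<Sum>p\<in>P. f p \<omega>)\<^sup>2)"
      using square_integrable_sum[OF P f] by (simp add: square_integrable_def)
    show "integrable M (\<lambda>\<omega>. real (card P) * (\<Sum>p\<in>P. (f p \<omega>)\<^sup>2))"
      using i by (intro integrable_mult_right Bochner_Integration.integrable_sum) auto
    show "(\<Sum>p\<in>P. f p \<omega>)\<^sup>2 \<le> real (card P) * (\<Sum>p\<in>P. (f p \<omega>)\<^sup>2)" for \<omega>
      using sum_squared_le_sum_of_squares[of "\<lambda>p. f p \<omega>" P] P by (simp add: mult.commute)
  qed
  also have "\<dots> = real (card P) * (\<Sum>p\<in>P. expectation (\<lambda>\<omega>. (f p \<omega>)\<^sup>2))"
    using i by (simp add: Bochner_Integration.integral_sum)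
  finally show ?thesis .
qed

text \<open>
  A bounded second moment gives uniform integrability: cut off at the height \<open>K\<close>, the expectations
  converge by dominated convergence, and the part above \<open>K\<close> contributes at most \<open>C / K\<close> by
  \<open>\<bar>y\<bar> \<le> min \<bar>y\<bar> K + y\<^sup>2 / K\<close>.
\<close>

lemma expectation_limit_of_bounded_second_moment:
  assumes f: "\<And>n. square_integrable (f n)" and bd: "\<And>n. expectation (\<lambda>\<omega>. (f n \<omega>)\<^sup>2) \<le> C"
    and lim: "AE \<omega> in M. (\<lambda>n. f n \<omega>) \<longlonglongrightarrow> 0"
  shows "(\<lambda>n. expectation (f n)) \<longlonglongrightarrow> 0"
proof (rule LIMSEQ_I)
  fix \<rho> :: real assume \<rho>: "0 < \<rho>"
  define K where "K = 2 * (\<bar>C\<bar> + 1) / \<rho>"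
  have K: "0 < K" using \<rho> by (simp add: K_def)
  have fm: "f n \<in> borel_measurable M" for n using f by (simp add: square_integrable_def)
  have "(\<lambda>n. expectation (\<lambda>\<omega>. min \<bar>f n \<omega>\<bar> K)) \<longlonglongrightarrow> expectation (\<lambda>\<omega>. 0)"
  proof (rule integral_dominated_convergence[where w="\<lambda>_. K"])
    show "AE \<omega> in M. (\<lambda>n. min \<bar>f n \<omega>\<bar> K) \<longlonglongrightarrow> 0"
      using lim
    proof eventually_elim
      case (elim \<omega>)
      then have "(\<lambda>n. min \<bar>f n \<omega>\<bar> K) \<longlonglongrightarrow> min \<bar>0\<bar> K" by (intro tendsto_intros)
      then show ?case using K by simp
    qed
    show "AE \<omega> in M. norm (min \<bar>f n \<omega>\<bar> K) \<le> K" for n using K by (intro AE_I2) (auto simp: min_def)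
  qed (use fm in auto)
  then have "\<forall>\<^sub>F n in sequentially. expectation (\<lambda>\<omega>. min \<bar>f n \<omega>\<bar> K) < \<rho> / 2"
    using \<rho> by (intro order_tendstoD(2)[where y=0]) auto
  then obtain n0 where n0: "\<And>n. n0 \<le> n \<Longrightarrow> expectation (\<lambda>\<omega>. min \<bar>f n \<omega>\<bar> K) < \<rho> / 2"
    unfolding eventually_sequentially by blast
  show "\<exists>n0. \<forall>n\<ge>n0. norm (expectation (f n) - 0) < \<rho>"
  proof (intro exI allI impI)
    fix n assume n: "n0 \<le> n"
    have i1: "integrable M (\<lambda>\<omega>. min \<bar>f n \<omega>\<bar> K)"
      by (rule bounded_measurable_integrable[where C=K]) (use fm K in \<open>auto simp: min_def\<close>)
    have i2: "integrable M (\<lambda>\<omega>. (f n \<omega>)\<^sup>2 / K)"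
      using f[of n] by (simp add: square_integrable_def)
    have le: "\<bar>y\<bar> \<le> min \<bar>y\<bar> K + y\<^sup>2 / K" for y :: real
    proof (cases "\<bar>y\<bar> \<le> K")
      case True
      then show ?thesis using K by (simp add: min_def)
    next
      case False
      then have "\<bar>y\<bar> * K \<le> \<bar>y\<bar> * \<bar>y\<bar>" by (intro mult_left_mono) auto
      then have "\<bar>y\<bar> \<le> y\<^sup>2 / K" using K by (simp add: pos_le_divide_eq power2_eq_square)
      then show ?thesis using K by linarith
    qed
    have "norm (expectation (f n)) \<le> expectation (\<lambda>\<omega>. \<bar>f n \<omega>\<bar>)"
      using integral_norm_bound[of M "f n"] by simp
    also have "\<dots> \<le> expectation (\<lambda>\<omega>. min \<bar>f n \<omega>\<bar> K + (f n \<omega>)\<^sup>2 / K)"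
      by (rule integral_mono) (use square_integrable_integrable[OF f[of n]] i1 i2 le in auto)
    also have "\<dots> = expectation (\<lambda>\<omega>. min \<bar>f n \<omega>\<bar> K) + expectation (\<lambda>\<omega>. (f n \<omega>)\<^sup>2) / K"
      using i1 i2 by simp
    also have "\<dots> < \<rho> / 2 + \<rho> / 2"
    proof (rule add_less_le_mono[OF n0[OF n]])
      have "expectation (\<lambda>\<omega>. (f n \<omega>)\<^sup>2) / K \<le> (\<bar>C\<bar> + 1) / K"
        using bd[of n] K by (intro divide_right_mono) auto
      also have "\<dots> = \<rho> / 2"
      proof -
        have "x / (2 * x / \<rho>) = \<rho> / 2" if "0 < x" for x using that \<rho> by (simp add: field_simps)
        from this[of "\<bar>C\<bar> + 1"] show ?thesis unfolding K_def by linarith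
      qed
      finally show "expectation (\<lambda>\<omega>. (f n \<omega>)\<^sup>2) / K \<le> \<rho> / 2" .
    qed
    finally show "norm (expectation (f n) - 0) < \<rho>" by simp
  qed
qed

end

lemma measurable_continuous_on_values:
  assumes "continuous_on S f" "X \<in> borel_measurable N" "\<And>\<omega>. \<omega> \<in> space N \<Longrightarrow> X \<omega> \<in> S"
  shows "(\<lambda>\<omega>. f (X \<omega>)) \<in> borel_measurable N"
proof -
  have "X \<in> N \<rightarrow>\<^sub>M restrict_space borel S"
    by (rule measurable_restrict_space2) (use assms in auto)
  from measurable_compose[OF this borel_measurable_continuous_on_restrict[OF assms(1)]] show ?thesis .
qed

text \<open>
  The quadratic form of the noise increment minus its compensator, written as a sum of compensated
  products of two increments, to which the estimate for the quadratic variation applies term by term.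
\<close>

lemma quad_of_noise:
  fixes s :: "'n::finite \<Rightarrow> 'm::finite \<Rightarrow> real"
  shows "quad A (\<chi> i. \<Sum>a\<in>UNIV. s i a * z a) (\<chi> i. \<Sum>a\<in>UNIV. s i a * z a) -
      h * (\<Sum>i\<in>UNIV. \<Sum>j\<in>UNIV. A i j * (\<Sum>a\<in>UNIV. s i a * s j a)) =
    (\<Sum>(i, j, a, b)\<in>UNIV. (A i j * s i a * s j b) * (z a * z b - (if a = b then h else 0)))"
proof -
  have *: "(\<Sum>(i, j, a, b)\<in>UNIV. f i j a b) = (\<Sum>i\<in>UNIV. \<Sum>j\<in>UNIV. \<Sum>a\<in>UNIV. \<Sum>b\<in>UNIV. f i j a b)"
    for f :: "'n \<Rightarrow> 'n \<Rightarrow> 'm \<Rightarrow> 'm \<Rightarrow> real"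
    by (simp add: sum.cartesian_product UNIV_Times_UNIV[symmetric] del: UNIV_Times_UNIV)
  have d: "(\<Sum>b\<in>UNIV. (A i j * s i a * s j b) * (if a = b then h else 0)) = h * (A i j * (s i a * s j a))" for i j a
  proof -
    have "(\<Sum>b\<in>UNIV. (A i j * s i a * s j b) * (if a = b then h else 0)) =
       (\<Sum>b\<in>UNIV. if a = b then (A i j * s i a * s j b) * h else 0)" by (intro sum.cong) auto
    then show ?thesis by simp
  qed
  have "A i j * ((\<Sum>a\<in>UNIV. s i a * z a) * (\<Sum>b\<in>UNIV. s j b * z b)) - h * (A i j * (\<Sum>a\<in>UNIV. s i a * s j a)) =
     (\<Sum>a\<in>UNIV. \<Sum>b\<in>UNIV. (A i j * s i a * s j b) * (z a * z b - (if a = b then h else 0)))" for i j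
  proof -
    have "(\<Sum>a\<in>UNIV. \<Sum>b\<in>UNIV. (A i j * s i a * s j b) * (z a * z b - (if a = b then h else 0))) =
       (\<Sum>a\<in>UNIV. \<Sum>b\<in>UNIV. A i j * ((s i a * z a) * (s j b * z b))) - (\<Sum>a\<in>UNIV. h * (A i j * (s i a * s j a)))"
      unfolding right_diff_distrib sum_subtractf d by (simp only: mult_ac)
    then show ?thesis by (subst sum_product) (simp only: sum_distrib_left)
  qed
  note ** = this
  show ?thesis
    unfolding * **[symmetric] by (simp only: quad_def vec_lambda_beta sum_subtractf sum_distrib_left)
qed

text \<open>
  Only the generator applied to \<open>\<Phi>\<close> is assumed to be bounded, not the drift: in the application the drift
  may be unbounded near the boundary of the simplex, where \<open>\<Phi>\<close> vanishes. For the same reason the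
  remainder is estimated path by path, with constants depending on the path.
\<close>

theorem ito_dynkin:
  fixes b :: "real^'n::finite \<Rightarrow> real^'n" and \<sigma> :: "real^'n \<Rightarrow> 'n \<Rightarrow> 'm::finite \<Rightarrow> real"
    and g :: "real^'n \<Rightarrow> real^'n" and H :: "real^'n \<Rightarrow> 'n \<Rightarrow> 'n \<Rightarrow> real"
  assumes sol: "ito_sde_solution M F B S b \<sigma> X" and T: "0 < T"
    and bc: "continuous_on S b"
    and \<sigma>c: "\<And>i k. continuous_on S (\<lambda>x. \<sigma> x i k)" and \<sigma>b: "\<And>x i k. x \<in> S \<Longrightarrow> \<bar>\<sigma> x i k\<bar> \<le> C\<sigma>"
    and \<Phi>c: "continuous_on S \<Phi>" and \<Phi>b: "\<And>x. x \<in> S \<Longrightarrow> \<bar>\<Phi> x\<bar> \<le> C\<Phi>"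
    and gc: "continuous_on S g" and gb: "\<And>x. x \<in> S \<Longrightarrow> norm (g x) \<le> Cg"
    and Hc: "\<And>i j. continuous_on S (\<lambda>x. H x i j)" and Hb: "\<And>x i j. x \<in> S \<Longrightarrow> \<bar>H x i j\<bar> \<le> CH"
    and expn: "second_order_expansion_on S \<Phi> g H"
  defines "A \<equiv> (\<lambda>x. b x \<bullet> g x + 1/2 * (\<Sum>i\<in>UNIV. \<Sum>j\<in>UNIV. covariation \<sigma> x $ i $ j * H x i j))"
  assumes Ab: "\<And>x. x \<in> S \<Longrightarrow> \<bar>A x\<bar> \<le> CA"
  shows "continuous_on {0..T} (\<lambda>r. \<integral>\<omega>. A (X r \<omega>) \<partial>M)"
    and "(\<integral>\<omega>. \<Phi> (X T \<omega>) \<partial>M) - (\<integral>\<omega>. \<Phi> (X 0 \<omega>) \<partial>M) = integral {0..T} (\<lambda>r. \<integral>\<omega>. A (X r \<omega>) \<partial>M)"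
proof -
  have "prob_space M" using sol by (auto simp: ito_sde_solution_def filtered_prob_space_def)
  then interpret prob_space M .
  interpret brownian_filtration M F B
    by standard (use sol[unfolded ito_sde_solution_def] in blast)+
  have Xad: "\<And>t. 0 \<le> t \<Longrightarrow> X t \<in> borel_measurable (F t)"
    and Xc: "\<And>\<omega>. \<omega> \<in> space M \<Longrightarrow> continuous_on {0..} (\<lambda>t. X t \<omega>)"
    and XS: "\<And>t \<omega>. \<omega> \<in> space M \<Longrightarrow> 0 \<le> t \<Longrightarrow> X t \<omega> \<in> S"
    using sol by (auto simp: ito_sde_solution_def)
  define good where "good t Jt \<longleftrightarrow> (\<forall>i k. ito_integral M F (B k) (\<lambda>s \<omega>. \<sigma> (X s \<omega>) i k) t (Jt i k)) \<and>
        (AE \<omega> in M. \<forall>i. X t \<omega> $ i = X 0 \<omega> $ i + integral {0..t} (\<lambda>s. b (X s \<omega>) $ i) + (\<Sum>k\<in>UNIV. Jt i k \<omega>))"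
    for t Jt
  have "\<forall>t\<ge>0. \<exists>Jt. good t Jt" using sol unfolding ito_sde_solution_def good_def by (elim conjE)
  then have ex: "\<exists>Jt. good t Jt" if "0 \<le> t" for t using that by blast
  define J where "J t = (SOME Jt. good t Jt)" for t
  have J_good: "good t (J t)" if "0 \<le> t" for t unfolding J_def by (rule someI_ex[OF ex[OF that]])
  have J: "ito_integral M F (B k) (\<lambda>s \<omega>. \<sigma> (X s \<omega>) i k) t (J t i k)" if "0 \<le> t" for t i k
    using J_good[OF that] unfolding good_def by blast
  have eq: "AE \<omega> in M. \<forall>i. X t \<omega> $ i = X 0 \<omega> $ i + integral {0..t} (\<lambda>s. b (X s \<omega>) $ i) + (\<Sum>k\<in>UNIV. J t i k \<omega>)"
    if "0 \<le> t" for t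
    using J_good[OF that] unfolding good_def by blast
  have spF: "space (F t) = space M" if "0 \<le> t" for t using subalg[OF that] by (simp add: subalgebra_def)
  have comp_ad: "(\<lambda>\<omega>. Y (X t \<omega>)) \<in> borel_measurable (F t)" if "continuous_on S Y" "0 \<le> t" for Y :: "real^'n \<Rightarrow> real" and t
  proof (rule measurable_continuous_on_values[OF that(1) Xad[OF that(2)]])
    fix \<omega> assume "\<omega> \<in> space (F t)"
    then show "X t \<omega> \<in> S" unfolding spF[OF that(2)] by (rule XS[OF _ that(2)])
  qed
  have comp_M: "(\<lambda>\<omega>. Y (X t \<omega>)) \<in> borel_measurable M" if "continuous_on S Y" "0 \<le> t" for Y :: "real^'n \<Rightarrow> real" and t
    using adapted_measurable[OF comp_ad[OF that] that(2)] .
  have Xpath: "continuous_on {0..T} (\<lambda>s. X s \<omega>)" if "\<omega> \<in> space M" for \<omega>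
    by (rule continuous_on_subset[OF Xc[OF that]]) auto
  have comp_path: "continuous_on {0..T} (\<lambda>s. Y (X s \<omega>))" if "continuous_on S Y" "\<omega> \<in> space M" for Y :: "real^'n \<Rightarrow> real" and \<omega>
    by (rule continuous_on_compose2[OF that(1) Xpath[OF that(2)]]) (use XS that(2) in auto)
  have Ac: "continuous_on S A"
    unfolding A_def covariation_def
    by (auto intro!: continuous_intros bc gc \<sigma>c Hc)
  define f where "f r = expectation (\<lambda>\<omega>. A (X r \<omega>))" for r
  show fc: "continuous_on {0..T} (\<lambda>r. \<integral>\<omega>. A (X r \<omega>) \<partial>M)"
  proof (rule continuous_on_sequentiallyI)
    fix u a assume u: "\<forall>n. u n \<in> {0..T}" "a \<in> {0..T}" "u \<longlonglongrightarrow> a"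
    show "(\<lambda>n. \<integral>\<omega>. A (X (u n) \<omega>) \<partial>M) \<longlonglongrightarrow> (\<integral>\<omega>. A (X a \<omega>) \<partial>M)"
    proof (rule integral_dominated_convergence[where w="\<lambda>_. CA"])
      show "AE \<omega> in M. (\<lambda>n. A (X (u n) \<omega>)) \<longlonglongrightarrow> A (X a \<omega>)"
        using comp_path[OF Ac] u by (intro AE_I2) (auto simp: continuous_on_sequentially o_def)
      show "AE \<omega> in M. norm (A (X (u n) \<omega>)) \<le> CA" for n
        using Ab XS u by (intro AE_I2) auto
    qed (use comp_M[OF Ac] u in auto)
  qed
  define h where "h n = T / real (Suc n)" for n
  define t where "t n k = real k * h n" for n k
  have h0: "0 < h n" for n using T by (simp add: h_def)
  have NT: "real (Suc n) * h n = T" for n by (simp add: h_def del: of_nat_Suc)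
  have t0: "0 \<le> t n k" for n k using h0[of n] by (simp add: t_def)
  have tT: "t n k \<in> {0..T}" if "k \<le> Suc n" for n k
  proof -
    have "real k * h n \<le> real (Suc n) * h n" using that h0[of n] by (intro mult_right_mono) auto
    then show ?thesis using t0[of n k] unfolding NT by (simp add: t_def)
  qed
  have hl: "h \<longlonglongrightarrow> 0" unfolding h_def by (rule LIMSEQ_Suc[OF lim_const_over_n])
  have tend: "t n (Suc n) = T" "t n 0 = 0" for n unfolding t_def NT by simp_all
  (* The increments of the solution over a cell consist of a drift integral, the martingale part m
     with left-point coefficients, and the residual e. *)
  define z where "z n k a \<omega> = B a (t n (Suc k)) \<omega> - B a (t n k) \<omega>" for n k a \<omega>
  define m where "m n k \<omega> = (\<chi> i. \<Sum>a\<in>UNIV. \<sigma> (X (t n k) \<omega>) i a * z n k a \<omega>)" for n k \<omega>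
  define \<epsilon> where "\<epsilon> n k i a \<omega> = J (t n (Suc k)) i a \<omega> - J (t n k) i a \<omega> - \<sigma> (X (t n k) \<omega>) i a * z n k a \<omega>" for n k i a \<omega>
  define e where "e n k \<omega> = (\<chi> i. \<Sum>a\<in>UNIV. \<epsilon> n k i a \<omega>)" for n k \<omega>
  have grid: "ito_grid a (\<lambda>s \<omega>. \<sigma> (X s \<omega>) i a) C\<sigma> (h n) (Suc n) (\<lambda>k. J (t n k) i a)" for n i a
    unfolding ito_grid_def NT
  proof (intro conjI ballI allI impI)
    show "0 < h n" by (rule h0)
    show "ito_integral M F (B a) (\<lambda>s \<omega>. \<sigma> (X s \<omega>) i a) (real k * h n) (J (t n k) i a)" for k
      using J[OF t0[of n k]] by (simp add: t_def)
    show "\<bar>\<sigma> (X s \<omega>) i a\<bar> \<le> C\<sigma>" if "s \<in> {0..T}" "\<omega> \<in> space M" for s \<omega>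
      using \<sigma>b[OF XS[OF that(2)]] that(1) by auto
    show "continuous_on {0..T} (\<lambda>s. \<sigma> (X s \<omega>) i a)" if "\<omega> \<in> space M" for \<omega>
      by (rule comp_path[OF \<sigma>c that])
  qed
  (* The residuals are negligible in mean square, by the mean-square continuity of the noise. *)
  have \<epsilon>s: "square_integrable (\<epsilon> n k i a)" if "k \<le> n" for n k i a
  proof -
    have "expectation (\<lambda>\<omega>. (\<sigma> (X r \<omega>) i a - \<sigma> (X s \<omega>) i a)\<^sup>2) \<le> (2 * C\<sigma>)\<^sup>2"
      if rs: "r \<in> {0..real (Suc n) * h n}" "s \<in> {0..real (Suc n) * h n}" "\<bar>r - s\<bar> \<le> h n" for r s
    proof (rule expectation_square_bounded)
      show "(\<lambda>\<omega>. \<sigma> (X r \<omega>) i a - \<sigma> (X s \<omega>) i a) \<in> borel_measurable M"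
        using comp_M[OF \<sigma>c] rs by (intro borel_measurable_diff) auto
      show "\<bar>\<sigma> (X r \<omega>) i a - \<sigma> (X s \<omega>) i a\<bar> \<le> 2 * C\<sigma>" if "\<omega> \<in> space M" for \<omega>
      proof -
        have "\<bar>\<sigma> (X r \<omega>) i a\<bar> \<le> C\<sigma>" "\<bar>\<sigma> (X s \<omega>) i a\<bar> \<le> C\<sigma>"
          using \<sigma>b[OF XS[OF that]] rs by auto
        then show ?thesis by linarith
      qed
    qed
    note md = this
    have "k < Suc n" using that by simp
    from ito_grid_residual(1)[OF grid this md]
    show ?thesis by (simp add: \<epsilon>_def[abs_def] z_def t_def)
  qed
  have \<epsilon>l: "(\<lambda>n. \<Sum>k<Suc n. expectation (\<lambda>\<omega>. (\<epsilon> n k i a \<omega>)\<^sup>2)) \<longlonglongrightarrow> 0" for i a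
  proof (rule LIMSEQ_I)
    fix \<rho> :: real assume \<rho>: "0 < \<rho>"
    define \<eta> where "\<eta> = \<rho> / (4 * T)"
    have \<eta>: "0 < \<eta>" using \<rho> T by (simp add: \<eta>_def)
    have "\<exists>\<delta>>0. \<forall>r\<in>{0..T}. \<forall>s\<in>{0..T}. \<bar>r - s\<bar> < \<delta> \<longrightarrow> expectation (\<lambda>\<omega>. (\<sigma> (X r \<omega>) i a - \<sigma> (X s \<omega>) i a)\<^sup>2) \<le> \<eta>"
    proof (rule uniform_mean_square_continuity[OF _ _ _ \<eta>, where C=C\<sigma>])
      show "(\<lambda>\<omega>. \<sigma> (X s \<omega>) i a) \<in> borel_measurable M" if "0 \<le> s" for s by (rule comp_M[OF \<sigma>c that])
      show "continuous_on {0..T} (\<lambda>s. \<sigma> (X s \<omega>) i a)" if "\<omega> \<in> space M" for \<omega> by (rule comp_path[OF \<sigma>c that])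
      show "\<bar>\<sigma> (X s \<omega>) i a\<bar> \<le> C\<sigma>" if "0 \<le> s" "\<omega> \<in> space M" for s \<omega> by (rule \<sigma>b[OF XS[OF that(2,1)]])
    qed
    then obtain \<delta> where \<delta>: "0 < \<delta>" and mod: "\<And>r s. r \<in> {0..T} \<Longrightarrow> s \<in> {0..T} \<Longrightarrow> \<bar>r - s\<bar> < \<delta> \<Longrightarrow>
        expectation (\<lambda>\<omega>. (\<sigma> (X r \<omega>) i a - \<sigma> (X s \<omega>) i a)\<^sup>2) \<le> \<eta>" by blast
    have "\<forall>\<^sub>F n in sequentially. h n < \<delta>" by (rule order_tendstoD(2)[OF hl \<delta>])
    then obtain n0 where n0: "\<And>n. n0 \<le> n \<Longrightarrow> h n < \<delta>" unfolding eventually_sequentially by blast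
    show "\<exists>n0. \<forall>n\<ge>n0. norm ((\<Sum>k<Suc n. expectation (\<lambda>\<omega>. (\<epsilon> n k i a \<omega>)\<^sup>2)) - 0) < \<rho>"
    proof (intro exI allI impI)
      fix n assume n: "n0 \<le> n"
      have md: "expectation (\<lambda>\<omega>. (\<sigma> (X r \<omega>) i a - \<sigma> (X s \<omega>) i a)\<^sup>2) \<le> \<eta>"
        if "r \<in> {0..real (Suc n) * h n}" "s \<in> {0..real (Suc n) * h n}" "\<bar>r - s\<bar> \<le> h n" for r s
        using mod[of r s] that n0[OF n] unfolding NT by linarith
      have "(\<Sum>k<Suc n. expectation (\<lambda>\<omega>. (\<epsilon> n k i a \<omega>)\<^sup>2)) \<le> (\<Sum>k<Suc n. 2 * (h n * \<eta>))"
      proof (rule sum_mono)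
        fix k assume "k \<in> {..<Suc n}"
        then have "k < Suc n" by simp
        from ito_grid_residual(2)[OF grid this md]
        show "expectation (\<lambda>\<omega>. (\<epsilon> n k i a \<omega>)\<^sup>2) \<le> 2 * (h n * \<eta>)" by (simp add: \<epsilon>_def z_def t_def)
      qed
      also have "\<dots> = 2 * ((real (Suc n) * h n) * \<eta>)" by (simp del: of_nat_Suc sum.lessThan_Suc)
      also have "\<dots> = \<rho> / 2" unfolding NT using T by (simp add: \<eta>_def)
      finally have "(\<Sum>k<Suc n. expectation (\<lambda>\<omega>. (\<epsilon> n k i a \<omega>)\<^sup>2)) < \<rho>" using \<rho> by linarith
      moreover have "0 \<le> (\<Sum>k<Suc n. expectation (\<lambda>\<omega>. (\<epsilon> n k i a \<omega>)\<^sup>2))" by (intro sum_nonneg) auto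
      ultimately show "norm ((\<Sum>k<Suc n. expectation (\<lambda>\<omega>. (\<epsilon> n k i a \<omega>)\<^sup>2)) - 0) < \<rho>" by simp
    qed
  qed
  (* So are the fluctuations of the quadratic variation. This is needed for H and, to bound the sums
     of squares of m, for the identity matrix I. *)
  define c where "c K x = (\<Sum>i\<in>UNIV. \<Sum>j\<in>UNIV. K x i j * (\<Sum>a\<in>UNIV. \<sigma> x i a * \<sigma> x j a))"
    for K :: "real^'n \<Rightarrow> 'n \<Rightarrow> 'n \<Rightarrow> real" and x
  define Q where "Q K n \<omega> = (\<Sum>k<Suc n. quad (K (X (t n k) \<omega>)) (m n k \<omega>) (m n k \<omega>) - h n * c K (X (t n k) \<omega>))"
    for K n \<omega>
  have Q: "square_integrable (Q K n)" "(\<lambda>n. expectation (\<lambda>\<omega>. (Q K n \<omega>)\<^sup>2)) \<longlonglongrightarrow> 0"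
    if Kc: "\<And>i j. continuous_on S (\<lambda>x. K x i j)" and Kb: "\<And>x i j. x \<in> S \<Longrightarrow> \<bar>K x i j\<bar> \<le> CK" for K CK n
  proof -
    define q where "q n p \<omega> = (case p of (i, j, a, b) \<Rightarrow> \<Sum>k<Suc n. (K (X (t n k) \<omega>) i j * \<sigma> (X (t n k) \<omega>) i a * \<sigma> (X (t n k) \<omega>) j b) *
       (z n k a \<omega> * z n k b \<omega> - (if a = b then h n else 0)))" for n p \<omega>
    have Qq: "Q K n \<omega> = (\<Sum>p\<in>UNIV. q n p \<omega>)" for n \<omega>
      unfolding Q_def c_def m_def quad_of_noise q_def by (subst sum.swap) (simp add: case_prod_beta)
    have Kbd: "\<bar>K x i j * \<sigma> x i a * \<sigma> x j b\<bar> \<le> CK * C\<sigma> * C\<sigma>" if "x \<in> S" for x i j a b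
    proof -
      have "0 \<le> CK" "0 \<le> C\<sigma>" using Kb[OF that, of i j] \<sigma>b[OF that, of i a] by linarith+
      then show ?thesis unfolding abs_mult by (intro mult_mono Kb \<sigma>b that mult_nonneg_nonneg) auto
    qed
    have q: "square_integrable (q n p)" "expectation (\<lambda>\<omega>. (q n p \<omega>)\<^sup>2) \<le> 2 * (T * h n * (CK * C\<sigma> * C\<sigma>)\<^sup>2)" for n p
    proof -
      obtain i j a b where p: "p = (i, j, a, b)" by (metis prod_cases4)
      have "(\<lambda>\<omega>. K (X (real k * h n) \<omega>) i j * \<sigma> (X (real k * h n) \<omega>) i a * \<sigma> (X (real k * h n) \<omega>) j b) \<in> borel_measurable (F (real k * h n))" for k
        using t0[of n k] by (intro borel_measurable_times comp_ad Kc \<sigma>c) (simp_all add: t_def)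
      moreover have "\<bar>K (X (real k * h n) \<omega>) i j * \<sigma> (X (real k * h n) \<omega>) i a * \<sigma> (X (real k * h n) \<omega>) j b\<bar> \<le> CK * C\<sigma> * C\<sigma>"
        if "\<omega> \<in> space M" for k \<omega>
        using Kbd[OF XS[OF that t0[of n k]]] by (simp add: t_def)
      ultimately have *: "square_integrable (\<lambda>\<omega>. \<Sum>k<Suc n. (K (X (real k * h n) \<omega>) i j * \<sigma> (X (real k * h n) \<omega>) i a * \<sigma> (X (real k * h n) \<omega>) j b) *
          ((B a (real (Suc k) * h n) \<omega> - B a (real k * h n) \<omega>) * (B b (real (Suc k) * h n) \<omega> - B b (real k * h n) \<omega>) - (if a = b then h n else 0)))"
        "expectation (\<lambda>\<omega>. (\<Sum>k<Suc n. (K (X (real k * h n) \<omega>) i j * \<sigma> (X (real k * h n) \<omega>) i a * \<sigma> (X (real k * h n) \<omega>) j b) *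
          ((B a (real (Suc k) * h n) \<omega> - B a (real k * h n) \<omega>) * (B b (real (Suc k) * h n) \<omega> - B b (real k * h n) \<omega>) - (if a = b then h n else 0)))\<^sup>2)
          \<le> 2 * (real (Suc n) * h n * h n * (CK * C\<sigma> * C\<sigma>)\<^sup>2)"
        by (intro increment_product_transform[OF h0]; blast)+
      show "square_integrable (q n p)" using *(1) unfolding q_def[abs_def] p z_def t_def by (simp only: prod.case)
      show "expectation (\<lambda>\<omega>. (q n p \<omega>)\<^sup>2) \<le> 2 * (T * h n * (CK * C\<sigma> * C\<sigma>)\<^sup>2)"
        using *(2) unfolding NT unfolding q_def[abs_def] p z_def t_def by (simp only: prod.case)
    qed
    show "square_integrable (Q K n)"
      unfolding Qq[abs_def] by (intro square_integrable_sum q) auto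
    define P where "P = real (card (UNIV :: ('n \<times> 'n \<times> 'm \<times> 'm) set))"
    have up: "expectation (\<lambda>\<omega>. (Q K n \<omega>)\<^sup>2) \<le> P * (P * (2 * (T * h n * (CK * C\<sigma> * C\<sigma>)\<^sup>2)))" for n
    proof -
      have "expectation (\<lambda>\<omega>. (Q K n \<omega>)\<^sup>2) \<le> P * (\<Sum>p\<in>UNIV. expectation (\<lambda>\<omega>. (q n p \<omega>)\<^sup>2))"
        unfolding Qq P_def by (intro expectation_sum_square_le q) auto
      also have "\<dots> \<le> P * (\<Sum>p\<in>(UNIV :: ('n \<times> 'n \<times> 'm \<times> 'm) set). 2 * (T * h n * (CK * C\<sigma> * C\<sigma>)\<^sup>2))"
        by (intro mult_left_mono sum_mono q) (simp add: P_def)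
      also have "\<dots> = P * (P * (2 * (T * h n * (CK * C\<sigma> * C\<sigma>)\<^sup>2)))" unfolding sum_constant P_def ..
      finally show ?thesis .
    qed
    have "(\<lambda>n. P * (P * (2 * (T * h n * (CK * C\<sigma> * C\<sigma>)\<^sup>2)))) \<longlonglongrightarrow> P * (P * (2 * (T * 0 * (CK * C\<sigma> * C\<sigma>)\<^sup>2)))"
      by (intro tendsto_intros hl)
    then have "(\<lambda>n. P * (P * (2 * (T * h n * (CK * C\<sigma> * C\<sigma>)\<^sup>2)))) \<longlonglongrightarrow> 0" by simp
    from tendsto_sandwich[OF _ always_eventually[OF allI[OF up]] tendsto_const this]
    show "(\<lambda>n. expectation (\<lambda>\<omega>. (Q K n \<omega>)\<^sup>2)) \<longlonglongrightarrow> 0" by (simp add: always_eventually)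
  qed
  define I where "I = (\<lambda>(x :: real^'n) (i :: 'n) j. if i = j then 1 else (0::real))"
  have Ic: "continuous_on S (\<lambda>x. I x i j)" and Ib: "\<bar>I x i j\<bar> \<le> 1" for i j x by (auto simp: I_def)
  note QI = Q[OF Ic Ib] and QH = Q[OF Hc Hb]
  define W where "W n i a \<omega> = (\<Sum>k<Suc n. (\<epsilon> n k i a \<omega>)\<^sup>2)" for n i a \<omega>
  (* One nonnegative variable dominates all the quantities that have to vanish, so that a single
     subsequence serves for all of them. *)
  define u where "u n \<omega> = (\<Sum>i\<in>UNIV. \<Sum>a\<in>UNIV. W n i a \<omega>) + ((Q I n \<omega>)\<^sup>2 + (Q H n \<omega>)\<^sup>2)" for n \<omega>
  have \<epsilon>i: "integrable M (\<lambda>\<omega>. (\<epsilon> n k i a \<omega>)\<^sup>2)" if "k < Suc n" for n k i a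
    using \<epsilon>s[of k n i a] that by (simp add: square_integrable_def)
  have Qi: "integrable M (\<lambda>\<omega>. (Q I n \<omega>)\<^sup>2)" "integrable M (\<lambda>\<omega>. (Q H n \<omega>)\<^sup>2)" for n
    using QI(1) QH(1) by (auto simp: square_integrable_def)
  have Wi: "integrable M (W n i a)" and We: "expectation (W n i a) = (\<Sum>k<Suc n. expectation (\<lambda>\<omega>. (\<epsilon> n k i a \<omega>)\<^sup>2))" for n i a
    unfolding W_def[abs_def] using \<epsilon>i
    by (auto intro!: Bochner_Integration.integrable_sum Bochner_Integration.integral_sum simp del: sum.lessThan_Suc)
  have ui: "integrable M (u n)" for n
    unfolding u_def[abs_def] using Wi Qi
    by (intro Bochner_Integration.integrable_add Bochner_Integration.integrable_sum) auto
  have W0: "0 \<le> W n i a \<omega>" for n i a \<omega> unfolding W_def by (intro sum_nonneg) auto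
  have u0: "0 \<le> u n \<omega>" for n \<omega> unfolding u_def by (intro add_nonneg_nonneg sum_nonneg W0) auto
  have "expectation (u n) = (\<Sum>i\<in>UNIV. \<Sum>a\<in>UNIV. expectation (W n i a)) +
      (expectation (\<lambda>\<omega>. (Q I n \<omega>)\<^sup>2) + expectation (\<lambda>\<omega>. (Q H n \<omega>)\<^sup>2))" for n
    unfolding u_def[abs_def] using Wi Qi
    by (simp add: Bochner_Integration.integral_sum Bochner_Integration.integrable_sum)
  moreover have "(\<lambda>n. (\<Sum>i\<in>UNIV. \<Sum>a\<in>UNIV. expectation (W n i a)) +
      (expectation (\<lambda>\<omega>. (Q I n \<omega>)\<^sup>2) + expectation (\<lambda>\<omega>. (Q H n \<omega>)\<^sup>2))) \<longlonglongrightarrow>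
      (\<Sum>i\<in>(UNIV::'n set). \<Sum>a\<in>(UNIV::'m set). 0) + (0 + 0)"
    unfolding We by (intro tendsto_add tendsto_sum \<epsilon>l QI QH)
  ultimately have "(\<lambda>n. expectation (\<lambda>\<omega>. norm (u n \<omega>))) \<longlonglongrightarrow> 0" using u0 by simp
  from tendsto_L1_AE_subseq[OF ui this] obtain r where r: "strict_mono r"
    and ul: "AE \<omega> in M. (\<lambda>n. u (r n) \<omega>) \<longlonglongrightarrow> 0" by blast
  (* The remainder of the expansion tends to 0 almost surely along the subsequence. *)
  define R where "R n \<omega> = (\<Sum>k<Suc n. \<Phi> (X (t n (Suc k)) \<omega>) - \<Phi> (X (t n k) \<omega>) -
      g (X (t n k) \<omega>) \<bullet> (m n k \<omega> + e n k \<omega>) - h n * A (X (t n k) \<omega>))" for n \<omega>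
  have cH: "c H x = (\<Sum>i\<in>UNIV. \<Sum>j\<in>UNIV. covariation \<sigma> x $ i $ j * H x i j)" for x
    by (simp add: c_def covariation_def mult.commute)
  have AE_eq: "AE \<omega> in M. \<forall>n k. \<forall>i. X (t n k) \<omega> $ i = X 0 \<omega> $ i + integral {0..t n k} (\<lambda>s. b (X s \<omega>) $ i) + (\<Sum>a\<in>UNIV. J (t n k) i a \<omega>)"
    using eq[OF t0] unfolding AE_all_countable by blast
  have Rl: "AE \<omega> in M. (\<lambda>n. R (r n) \<omega>) \<longlonglongrightarrow> 0"
    using AE_eq ul AE_space
  proof eventually_elim
    case (elim \<omega>)
    then have \<omega>: "\<omega> \<in> space M" by simp
    let ?x = "\<lambda>s. X s \<omega>" and ?f = "\<lambda>s. b (X s \<omega>)"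
    have xS: "?x s \<in> S" if "s \<in> {0..T}" for s using XS[OF \<omega>] that by simp
    have fcont: "continuous_on {0..T} ?f"
      by (rule continuous_on_compose2[OF bc Xpath[OF \<omega>]]) (use xS in auto)
    have fint: "(\<lambda>s. ?f s $ i) integrable_on {0..t n k}" if "k \<le> Suc n" for i n k
      using tT[OF that] by (intro integrable_continuous_interval continuous_intros continuous_on_subset[OF fcont]) auto
    have step: "?x (t n (Suc k)) - ?x (t n k) = (\<chi> i. integral {t n k..t n (Suc k)} (\<lambda>s. ?f s $ i)) + m n k \<omega> + e n k \<omega>"
      if k: "k \<le> n" for n k
    proof (rule iffD2[OF vec_eq_iff], intro allI)
      fix i
      have le: "0 \<le> t n k" "t n k \<le> t n (Suc k)" using t0 h0[of n] by (auto simp: t_def mult_right_mono)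
      have "integral {0..t n k} (\<lambda>s. ?f s $ i) + integral {t n k..t n (Suc k)} (\<lambda>s. ?f s $ i) = integral {0..t n (Suc k)} (\<lambda>s. ?f s $ i)"
        by (rule Henstock_Kurzweil_Integration.integral_combine[OF le fint]) (use k in simp)
      then have "?x (t n (Suc k)) $ i - ?x (t n k) $ i = integral {t n k..t n (Suc k)} (\<lambda>s. ?f s $ i) +
         ((\<Sum>a\<in>UNIV. J (t n (Suc k)) i a \<omega>) - (\<Sum>a\<in>UNIV. J (t n k) i a \<omega>))"
        using elim(1) by simp
      also have "(\<Sum>a\<in>UNIV. J (t n (Suc k)) i a \<omega>) - (\<Sum>a\<in>UNIV. J (t n k) i a \<omega>) = m n k \<omega> $ i + e n k \<omega> $ i"
        by (simp add: m_def e_def \<epsilon>_def sum_subtractf)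
      finally show "(?x (t n (Suc k)) - ?x (t n k)) $ i = ((\<chi> i. integral {t n k..t n (Suc k)} (\<lambda>s. ?f s $ i)) + m n k \<omega> + e n k \<omega>) $ i"
        by simp
    qed
    have part: "(\<lambda>n. v (r n)) \<longlonglongrightarrow> 0" if "\<And>n. \<bar>v n\<bar> \<le> C * u n \<omega>" for v C
    proof -
      have "(\<lambda>n. C * u (r n) \<omega>) \<longlonglongrightarrow> C * 0" by (intro tendsto_intros elim(2))
      then have "(\<lambda>n. C * u (r n) \<omega>) \<longlonglongrightarrow> 0" by simp
      from Lim_null_comparison[OF _ this, of "\<lambda>n. v (r n)"] show ?thesis using that by (simp add: always_eventually)
    qed
    have Ql: "(\<lambda>n. Q K (r n) \<omega>) \<longlonglongrightarrow> 0" if "\<And>n. (Q K n \<omega>)\<^sup>2 \<le> u n \<omega>" for K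
    proof -
      have "(\<lambda>n. (Q K (r n) \<omega>)\<^sup>2) \<longlonglongrightarrow> 0" by (rule part[of "\<lambda>n. (Q K n \<omega>)\<^sup>2" 1]) (use that in simp)
      then have "(\<lambda>n. sqrt ((Q K (r n) \<omega>)\<^sup>2)) \<longlonglongrightarrow> sqrt 0" by (intro tendsto_intros)
      then show ?thesis by (simp add: tendsto_rabs_zero_iff)
    qed
    have Qu: "(Q I n \<omega>)\<^sup>2 \<le> u n \<omega>" "(Q H n \<omega>)\<^sup>2 \<le> u n \<omega>" for n
      unfolding u_def by (simp_all add: sum_nonneg W0)
    have nm: "(norm v)\<^sup>2 = quad (I x) v v" for v :: "real^'n" and x
      by (simp add: quad_def I_def power2_norm_eq_inner inner_vec_def if_distrib[of "\<lambda>x. x * _"] cong: if_cong)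
    have e2: "(\<Sum>k<Suc n. (norm (e n k \<omega>))\<^sup>2) \<le> real CARD('m) * u n \<omega>" for n
    proof -
      have "(norm (e n k \<omega>))\<^sup>2 \<le> (\<Sum>i\<in>UNIV. real CARD('m) * (\<Sum>a\<in>UNIV. (\<epsilon> n k i a \<omega>)\<^sup>2))" for k
      proof -
        have "(norm (e n k \<omega>))\<^sup>2 = (\<Sum>i\<in>UNIV. (\<Sum>a\<in>UNIV. \<epsilon> n k i a \<omega>)\<^sup>2)"
          unfolding power2_norm_eq_inner inner_vec_def e_def by (simp add: power2_eq_square)
        also have "\<dots> \<le> (\<Sum>i\<in>UNIV. real CARD('m) * (\<Sum>a\<in>UNIV. (\<epsilon> n k i a \<omega>)\<^sup>2))"
        proof (rule sum_mono)
          fix i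
          show "(\<Sum>a\<in>UNIV. \<epsilon> n k i a \<omega>)\<^sup>2 \<le> real CARD('m) * (\<Sum>a\<in>UNIV. (\<epsilon> n k i a \<omega>)\<^sup>2)"
            using sum_squared_le_sum_of_squares[of "\<lambda>a. \<epsilon> n k i a \<omega>" UNIV] by (simp add: mult.commute)
        qed
        finally show ?thesis .
      qed
      then have "(\<Sum>k<Suc n. (norm (e n k \<omega>))\<^sup>2) \<le> (\<Sum>k<Suc n. \<Sum>i\<in>UNIV. real CARD('m) * (\<Sum>a\<in>UNIV. (\<epsilon> n k i a \<omega>)\<^sup>2))"
        by (intro sum_mono)
      also have "\<dots> = real CARD('m) * (\<Sum>k<Suc n. \<Sum>i\<in>UNIV. \<Sum>a\<in>UNIV. (\<epsilon> n k i a \<omega>)\<^sup>2)"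
        by (simp only: sum_distrib_left)
      also have "(\<Sum>k<Suc n. \<Sum>i\<in>UNIV. \<Sum>a\<in>UNIV. (\<epsilon> n k i a \<omega>)\<^sup>2) = (\<Sum>i\<in>UNIV. \<Sum>a\<in>UNIV. \<Sum>k<Suc n. (\<epsilon> n k i a \<omega>)\<^sup>2)"
        by (subst sum.swap, rule sum.cong[OF refl], rule sum.swap)
      also have "real CARD('m) * \<dots> \<le> real CARD('m) * u n \<omega>"
        unfolding u_def W_def by (intro mult_left_mono) auto
      finally show ?thesis .
    qed
    have "(\<lambda>n. \<Sum>k<Suc (r n). \<Phi> (?x (real (Suc k) * (T / real (Suc (r n))))) - \<Phi> (?x (real k * (T / real (Suc (r n))))) -
       g (?x (real k * (T / real (Suc (r n))))) \<bullet> (m (r n) k \<omega> + e (r n) k \<omega>)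
      - T / real (Suc (r n)) * (g (?x (real k * (T / real (Suc (r n))))) \<bullet> ?f (real k * (T / real (Suc (r n)))) +
         1/2 * c H (?x (real k * (T / real (Suc (r n))))))) \<longlonglongrightarrow> 0"
    proof (rule pathwise_ito_remainder[OF T Xpath[OF \<omega>] xS fcont r expn gb Hb, where v="\<lambda>s. c I (X s \<omega>)"
          and Cv="real CARD('n) * real CARD('m) * C\<sigma>\<^sup>2"])
      fix n k assume "k \<le> r n"
      from step[OF this] show "?x (real (Suc k) * (T / real (Suc (r n)))) - ?x (real k * (T / real (Suc (r n)))) =
        (\<chi> i. integral {real k * (T / real (Suc (r n)))..real (Suc k) * (T / real (Suc (r n)))} (\<lambda>s. ?f s $ i)) + m (r n) k \<omega> + e (r n) k \<omega>"
        by (simp only: t_def h_def)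
    next
      show "(\<lambda>n. \<Sum>k<Suc (r n). (norm (e (r n) k \<omega>))\<^sup>2) \<longlonglongrightarrow> 0"
      proof (rule part[of "\<lambda>n. \<Sum>k<Suc n. (norm (e n k \<omega>))\<^sup>2" "real CARD('m)"])
        fix n
        have "0 \<le> (\<Sum>k<Suc n. (norm (e n k \<omega>))\<^sup>2)" by (intro sum_nonneg) auto
        then show "\<bar>\<Sum>k<Suc n. (norm (e n k \<omega>))\<^sup>2\<bar> \<le> real CARD('m) * u n \<omega>" using e2[of n] by linarith
      qed
      show "(\<lambda>n. \<Sum>k<Suc (r n). (norm (m (r n) k \<omega>))\<^sup>2 - T / real (Suc (r n)) * c I (?x (real k * (T / real (Suc (r n)))))) \<longlonglongrightarrow> 0"
        using Ql[OF Qu(1)] unfolding Q_def nm[symmetric] t_def h_def .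
      show "(\<lambda>n. \<Sum>k<Suc (r n). quad (H (?x (real k * (T / real (Suc (r n)))))) (m (r n) k \<omega>) (m (r n) k \<omega>) -
          T / real (Suc (r n)) * c H (?x (real k * (T / real (Suc (r n)))))) \<longlonglongrightarrow> 0"
        using Ql[OF Qu(2)] unfolding Q_def t_def h_def .
      show "c I (?x s) \<le> real CARD('n) * real CARD('m) * C\<sigma>\<^sup>2" if "s \<in> {0..T}" for s
      proof -
        have "c I (?x s) = (\<Sum>i\<in>UNIV. \<Sum>a\<in>UNIV. (\<sigma> (?x s) i a)\<^sup>2)"
          by (simp add: c_def I_def power2_eq_square if_distrib[of "\<lambda>x. x * _"] cong: if_cong)
        also have "\<dots> \<le> (\<Sum>i\<in>(UNIV::'n set). \<Sum>a\<in>(UNIV::'m set). C\<sigma>\<^sup>2)"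
          using \<sigma>b[OF xS[OF that]] by (intro sum_mono) (metis abs_ge_zero power2_abs power_mono)
        finally show ?thesis by simp
      qed
    qed
    then show ?case
      unfolding R_def A_def cH t_def h_def by (simp only: inner_commute)
  qed
  have gi: "continuous_on S (\<lambda>x. g x $ i)" "\<And>x. x \<in> S \<Longrightarrow> \<bar>g x $ i\<bar> \<le> Cg" for i
    using gc gb component_le_norm_cart order_trans by (auto intro!: continuous_intros) blast
  define G where "G n p \<omega> = (case p of (i, a) \<Rightarrow> \<Sum>k<Suc n. g (X (t n k) \<omega>) $ i * (J (t n (Suc k)) i a \<omega> - J (t n k) i a \<omega>))" for n p \<omega>
  have G: "square_integrable (G n p)" "expectation (G n p) = 0" "expectation (\<lambda>\<omega>. (G n p \<omega>)\<^sup>2) \<le> 2 * (T * (Cg * C\<sigma>)\<^sup>2)" for n p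
  proof -
    obtain i a where p: "p = (i, a)" by fastforce
    have 1: "(\<lambda>\<omega>. g (X (t n k) \<omega>) $ i) \<in> borel_measurable (F (real k * h n))" for k
      using comp_ad[OF gi(1) t0[of n k]] by (simp add: t_def)
    have 2: "\<bar>g (X (t n k) \<omega>) $ i\<bar> \<le> Cg" if "\<omega> \<in> space M" for k \<omega> using gi(2)[OF XS[OF that t0]] .
    note tr = ito_grid_transform[OF grid[of a i n] 1 2]
    show "square_integrable (G n p)" "expectation (G n p) = 0" "expectation (\<lambda>\<omega>. (G n p \<omega>)\<^sup>2) \<le> 2 * (T * (Cg * C\<sigma>)\<^sup>2)"
      using tr unfolding NT by (simp_all only: G_def[abs_def] p prod.case)
  qed
  have Gsum: "(\<Sum>k<Suc n. g (X (t n k) \<omega>) \<bullet> (m n k \<omega> + e n k \<omega>)) = (\<Sum>p\<in>UNIV. G n p \<omega>)" for n \<omega>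
  proof -
    have me: "(m n k \<omega> + e n k \<omega>) $ i = (\<Sum>a\<in>UNIV. J (t n (Suc k)) i a \<omega> - J (t n k) i a \<omega>)" for k i
      by (simp add: m_def e_def \<epsilon>_def sum_subtractf)
    have "(\<Sum>k<Suc n. g (X (t n k) \<omega>) \<bullet> (m n k \<omega> + e n k \<omega>)) =
      (\<Sum>k<Suc n. \<Sum>(i, a)\<in>UNIV. g (X (t n k) \<omega>) $ i * (J (t n (Suc k)) i a \<omega> - J (t n k) i a \<omega>))"
      unfolding inner_vec_def me inner_real_def sum_distrib_left
      by (simp only: sum.cartesian_product UNIV_Times_UNIV)
    also have "\<dots> = (\<Sum>p\<in>UNIV. G n p \<omega>)"
      unfolding G_def by (subst sum.swap) (auto intro!: sum.cong)
    finally show ?thesis .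
  qed
  (* The remainder is a bounded variable minus a centered stochastic sum with bounded second moment,
     so its expectation tends to 0 as well. *)
  have Req: "R n \<omega> = (\<Phi> (X T \<omega>) - \<Phi> (X 0 \<omega>) - (\<Sum>k<Suc n. h n * A (X (t n k) \<omega>))) - (\<Sum>p\<in>UNIV. G n p \<omega>)" for n \<omega>
  proof -
    have "(\<Sum>k<Suc n. \<Phi> (X (t n (Suc k)) \<omega>) - \<Phi> (X (t n k) \<omega>)) = \<Phi> (X T \<omega>) - \<Phi> (X 0 \<omega>)"
      using sum_lessThan_telescope[of "\<lambda>k. \<Phi> (X (t n k) \<omega>)" "Suc n"] unfolding tend .
    then show ?thesis
      unfolding R_def sum_subtractf Gsum by simp
  qed
  have Li: "(\<lambda>\<omega>. \<Phi> (X T \<omega>) - \<Phi> (X 0 \<omega>) - (\<Sum>k<Suc n. h n * A (X (t n k) \<omega>))) \<in> borel_measurable M" for n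
    using T by (intro borel_measurable_diff borel_measurable_sum borel_measurable_times borel_measurable_const comp_M \<Phi>c Ac t0) auto
  have Lb: "\<bar>\<Phi> (X T \<omega>) - \<Phi> (X 0 \<omega>) - (\<Sum>k<Suc n. h n * A (X (t n k) \<omega>))\<bar> \<le> 2 * C\<Phi> + T * CA" if "\<omega> \<in> space M" for n \<omega>
  proof -
    have "\<bar>\<Sum>k<Suc n. h n * A (X (t n k) \<omega>)\<bar> \<le> (\<Sum>k<Suc n. h n * CA)"
      using h0[of n] Ab[OF XS[OF that t0]] by (intro order_trans[OF sum_abs] sum_mono) (simp add: abs_mult)
    also have "\<dots> = (real (Suc n) * h n) * CA" by (simp del: of_nat_Suc sum.lessThan_Suc)
    finally have "\<bar>\<Sum>k<Suc n. h n * A (X (t n k) \<omega>)\<bar> \<le> T * CA" unfolding NT .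
    moreover have "\<bar>\<Phi> (X T \<omega>)\<bar> \<le> C\<Phi>" "\<bar>\<Phi> (X 0 \<omega>)\<bar> \<le> C\<Phi>" using \<Phi>b XS[OF that] T by auto
    ultimately show ?thesis by linarith
  qed
  have Ls: "square_integrable (\<lambda>\<omega>. \<Phi> (X T \<omega>) - \<Phi> (X 0 \<omega>) - (\<Sum>k<Suc n. h n * A (X (t n k) \<omega>)))" for n
    by (rule square_integrable_bounded[OF Li]) (rule Lb)
  have Gs: "square_integrable (\<lambda>\<omega>. \<Sum>p\<in>UNIV. G n p \<omega>)" for n by (intro square_integrable_sum G) auto
  define P where "P = real (card (UNIV :: ('n \<times> 'm) set))"
  have Gb: "expectation (\<lambda>\<omega>. (\<Sum>p\<in>UNIV. G n p \<omega>)\<^sup>2) \<le> P * (P * (2 * (T * (Cg * C\<sigma>)\<^sup>2)))" for n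
  proof -
    have "expectation (\<lambda>\<omega>. (\<Sum>p\<in>UNIV. G n p \<omega>)\<^sup>2) \<le> P * (\<Sum>p\<in>UNIV. expectation (\<lambda>\<omega>. (G n p \<omega>)\<^sup>2))"
      unfolding P_def by (intro expectation_sum_square_le G) auto
    also have "\<dots> \<le> P * (\<Sum>p\<in>(UNIV :: ('n \<times> 'm) set). 2 * (T * (Cg * C\<sigma>)\<^sup>2))"
      by (intro mult_left_mono sum_mono G) (simp add: P_def)
    also have "\<dots> = P * (P * (2 * (T * (Cg * C\<sigma>)\<^sup>2)))" unfolding sum_constant P_def ..
    finally show ?thesis .
  qed
  have Rs: "square_integrable (R n)" for n
    unfolding Req[abs_def] by (rule square_integrable_diff(1)[OF Ls Gs])
  have Rb: "expectation (\<lambda>\<omega>. (R n \<omega>)\<^sup>2) \<le> 2 * (2 * C\<Phi> + T * CA)\<^sup>2 + 2 * (P * (P * (2 * (T * (Cg * C\<sigma>)\<^sup>2))))" for n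
  proof -
    have "expectation (\<lambda>\<omega>. (\<Phi> (X T \<omega>) - \<Phi> (X 0 \<omega>) - (\<Sum>k<Suc n. h n * A (X (t n k) \<omega>)))\<^sup>2) \<le> (2 * C\<Phi> + T * CA)\<^sup>2"
      by (rule expectation_square_bounded[OF Li]) (rule Lb)
    then have "2 * expectation (\<lambda>\<omega>. (\<Phi> (X T \<omega>) - \<Phi> (X 0 \<omega>) - (\<Sum>k<Suc n. h n * A (X (t n k) \<omega>)))\<^sup>2) +
        2 * expectation (\<lambda>\<omega>. (\<Sum>p\<in>UNIV. G n p \<omega>)\<^sup>2) \<le>
        2 * (2 * C\<Phi> + T * CA)\<^sup>2 + 2 * (P * (P * (2 * (T * (Cg * C\<sigma>)\<^sup>2))))"
      by (intro add_mono mult_left_mono Gb) auto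
    then show ?thesis
      unfolding Req[abs_def] by (rule order_trans[OF square_integrable_diff(2)[OF Ls Gs]])
  qed
  have ER0: "(\<lambda>n. expectation (R (r n))) \<longlonglongrightarrow> 0"
    by (rule expectation_limit_of_bounded_second_moment[OF Rs Rb Rl])
  have Ai: "integrable M (\<lambda>\<omega>. A (X s \<omega>))" if "0 \<le> s" for s
    by (rule bounded_measurable_integrable[OF comp_M[OF Ac that] Ab]) (use XS that in auto)
  have \<Phi>i: "integrable M (\<lambda>\<omega>. \<Phi> (X s \<omega>))" if "0 \<le> s" for s
    by (rule bounded_measurable_integrable[OF comp_M[OF \<Phi>c that] \<Phi>b]) (use XS that in auto)
  have ER: "expectation (R n) = expectation (\<lambda>\<omega>. \<Phi> (X T \<omega>)) - expectation (\<lambda>\<omega>. \<Phi> (X 0 \<omega>)) - (\<Sum>k<Suc n. h n * f (t n k))" for n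
  proof -
    have Gi: "integrable M (G n p)" for p by (rule square_integrable_integrable[OF G(1)])
    have iA: "integrable M (\<lambda>\<omega>. \<Sum>k<Suc n. h n * A (X (t n k) \<omega>))"
      by (intro Bochner_Integration.integrable_sum integrable_mult_right Ai t0)
    have iG: "integrable M (\<lambda>\<omega>. \<Sum>p\<in>UNIV. G n p \<omega>)"
      by (intro Bochner_Integration.integrable_sum Gi)
    have i\<Phi>: "integrable M (\<lambda>\<omega>. \<Phi> (X T \<omega>))" "integrable M (\<lambda>\<omega>. \<Phi> (X 0 \<omega>))" using \<Phi>i T by auto
    have eA: "expectation (\<lambda>\<omega>. \<Sum>k<Suc n. h n * A (X (t n k) \<omega>)) = (\<Sum>k<Suc n. h n * f (t n k))"
      using Ai[OF t0] by (subst Bochner_Integration.integral_sum) (auto simp: f_def)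
    have eG: "expectation (\<lambda>\<omega>. \<Sum>p\<in>UNIV. G n p \<omega>) = 0"
      using Gi G(2) by (subst Bochner_Integration.integral_sum) auto
    show ?thesis
      unfolding Req[abs_def] using iA iG i\<Phi> eA eG by (simp del: sum.lessThan_Suc)
  qed
  have "(\<lambda>n. \<Sum>k<Suc n. h n * f (t n k)) \<longlonglongrightarrow> integral {0..T} f"
    using riemann_sum_limit[OF fc T] unfolding f_def[abs_def] t_def h_def by simp
  from LIMSEQ_subseq_LIMSEQ[OF this r]
  have "(\<lambda>n. expectation (R (r n))) \<longlonglongrightarrow> expectation (\<lambda>\<omega>. \<Phi> (X T \<omega>)) - expectation (\<lambda>\<omega>. \<Phi> (X 0 \<omega>)) - integral {0..T} f"
    unfolding ER o_def by (intro tendsto_intros)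
  from LIMSEQ_unique[OF ER0 this]
  show "(\<integral>\<omega>. \<Phi> (X T \<omega>) \<partial>M) - (\<integral>\<omega>. \<Phi> (X 0 \<omega>) \<partial>M) = integral {0..T} (\<lambda>r. \<integral>\<omega>. A (X r \<omega>) \<partial>M)"
    by (simp add: f_def[abs_def])
qed

section \<open>Derivatives along edges\<close>

lemma frechet_mult:
  fixes f g :: "real^'n::finite \<Rightarrow> real"
  assumes "f differentiable (at p)" "g differentiable (at p)"
  shows "frechet_derivative (\<lambda>q. f q * g q) (at p) v =
    f p * frechet_derivative g (at p) v + frechet_derivative f (at p) v * g p"
proof -
  have "((\<lambda>q. f q * g q) has_derivative (\<lambda>v. f p * frechet_derivative g (at p) v + frechet_derivative f (at p) v * g p)) (at p)"
    by (rule has_derivative_mult) (use assms in \<open>simp_all add: frechet_derivative_works[symmetric]\<close>)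
  from frechet_derivative_at[OF this, symmetric] show ?thesis by (rule fun_cong)
qed

lemma frechet_add:
  fixes f g :: "real^'n::finite \<Rightarrow> real"
  assumes "f differentiable (at p)" "g differentiable (at p)"
  shows "frechet_derivative (\<lambda>q. f q + g q) (at p) v =
    frechet_derivative f (at p) v + frechet_derivative g (at p) v"
proof -
  have "((\<lambda>q. f q + g q) has_derivative (\<lambda>v. frechet_derivative f (at p) v + frechet_derivative g (at p) v)) (at p)"
    by (rule has_derivative_add) (use assms in \<open>simp_all add: frechet_derivative_works[symmetric]\<close>)
  from frechet_derivative_at[OF this, symmetric] show ?thesis by (rule fun_cong)
qed

lemma frechet_cmult:
  fixes f :: "real^'n::finite \<Rightarrow> real"
  assumes "f differentiable (at p)"
  shows "frechet_derivative (\<lambda>q. c * f q) (at p) v = c * frechet_derivative f (at p) v"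
  using frechet_mult[of "\<lambda>_. c" p f v] assms by simp

lemma frechet_diff:
  fixes f g :: "real^'n::finite \<Rightarrow> real"
  assumes "f differentiable (at p)" "g differentiable (at p)"
  shows "frechet_derivative (\<lambda>q. f q - g q) (at p) v =
    frechet_derivative f (at p) v - frechet_derivative g (at p) v"
  using frechet_add[of f p "\<lambda>q. -1 * g q" v] frechet_cmult[of g p "-1" v] assms by simp

lemma frechet_sum:
  fixes f :: "'i \<Rightarrow> real^'n::finite \<Rightarrow> real"
  assumes "\<And>i. i \<in> I \<Longrightarrow> f i differentiable (at p)"
  shows "frechet_derivative (\<lambda>q. \<Sum>i\<in>I. f i q) (at p) v = (\<Sum>i\<in>I. frechet_derivative (f i) (at p) v)"
proof -
  have "((\<lambda>q. \<Sum>i\<in>I. f i q) has_derivative (\<lambda>v. \<Sum>i\<in>I. frechet_derivative (f i) (at p) v)) (at p)"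
    by (rule has_derivative_sum) (use assms in \<open>simp_all add: frechet_derivative_works[symmetric]\<close>)
  from frechet_derivative_at[OF this, symmetric] show ?thesis by (rule fun_cong)
qed

lemma frechet_linear_arg:
  fixes f :: "real^'n::finite \<Rightarrow> real"
  assumes "f differentiable (at p)"
  shows "frechet_derivative f (at p) (u - v) = frechet_derivative f (at p) u - frechet_derivative f (at p) v"
    and "frechet_derivative f (at p) u = (\<Sum>i\<in>UNIV. u $ i * partial i f p)"
proof -
  have l: "linear (frechet_derivative f (at p))" by (rule linear_frechet_derivative[OF assms])
  show "frechet_derivative f (at p) (u - v) = frechet_derivative f (at p) u - frechet_derivative f (at p) v"
    by (rule linear_diff[OF l])
  have "frechet_derivative f (at p) (\<Sum>i\<in>UNIV. u $ i *\<^sub>R axis i 1) = (\<Sum>i\<in>UNIV. u $ i * partial i f p)"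
    by (simp add: linear_sum[OF l] linear_scale[OF l] partial_def)
  then show "frechet_derivative f (at p) u = (\<Sum>i\<in>UNIV. u $ i * partial i f p)"
    using basis_expansion[of u] by (simp add: scalar_mult_eq_scaleR)
qed

text \<open>
  The edge directions are tangential to the simplex, so at its points the derivatives along edges only
  depend on the values of a function on the simplex.
\<close>

definition edge_dir :: "'n \<Rightarrow> 'n \<Rightarrow> real^'n::finite" where
  "edge_dir i j = axis i 1 - axis j 1"

definition edge_deriv :: "'n \<Rightarrow> 'n \<Rightarrow> (real^'n::finite \<Rightarrow> real) \<Rightarrow> real^'n \<Rightarrow> real" where
  "edge_deriv i j f p = frechet_derivative f (at p) (edge_dir i j)"

lemma sum_edge_dir: "(\<Sum>k\<in>UNIV. edge_dir i j $ k) = 0"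
  by (simp add: edge_dir_def axis_def sum_subtractf)

lemma edge_deriv_eq: "f differentiable (at p) \<Longrightarrow> edge_deriv i j f p = partial i f p - partial j f p"
  by (simp add: edge_deriv_def edge_dir_def partial_def frechet_linear_arg(1))

lemma edge_deriv_swap: "f differentiable (at p) \<Longrightarrow> edge_deriv j i f p = - edge_deriv i j f p"
  by (simp add: edge_deriv_eq)

lemma C1_on_differentiable: "C1_on U f \<Longrightarrow> p \<in> U \<Longrightarrow> f differentiable (at p)"
  by (simp add: C1_on_def)

lemma C2_on_differentiable: "C2_on U f \<Longrightarrow> p \<in> U \<Longrightarrow> f differentiable (at p)"
  by (simp add: C2_on_def C1_on_def)

lemma C1_on_edge_deriv: "C2_on U f \<Longrightarrow> C1_on U (edge_deriv i j f)"
  using C2_on_frechet[of U f "edge_dir i j"] by (simp add: edge_deriv_def[abs_def])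

lemma C1_on_partial: "C2_on U f \<Longrightarrow> C1_on U (partial i f)"
  using C2_on_frechet[of U f "axis i 1"] by (simp add: partial_def[abs_def])

lemma edge_deriv_cong:
  "open U \<Longrightarrow> p \<in> U \<Longrightarrow> (\<And>q. q \<in> U \<Longrightarrow> f q = g q) \<Longrightarrow> edge_deriv i j f p = edge_deriv i j g p"
  unfolding edge_deriv_def using frechet_derivative_cong[of U p f g] by simp

lemma partial_cong:
  "open U \<Longrightarrow> p \<in> U \<Longrightarrow> (\<And>q. q \<in> U \<Longrightarrow> f q = g q) \<Longrightarrow> partial i f p = partial i g p"
  unfolding partial_def using frechet_derivative_cong[of U p f g] by simp

lemma edge_deriv_edge_deriv:
  assumes U: "open U" "p \<in> U" and f: "C2_on U f"
  shows "edge_deriv i j (edge_deriv i j f) p =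
    partial i (partial i f) p - partial i (partial j f) p - partial j (partial i f) p + partial j (partial j f) p"
proof -
  have "edge_deriv i j (edge_deriv i j f) p = edge_deriv i j (\<lambda>q. partial i f q - partial j f q) p"
    by (rule edge_deriv_cong[OF U]) (simp add: edge_deriv_eq C2_on_differentiable[OF f])
  also have "\<dots> = edge_deriv i j (partial i f) p - edge_deriv i j (partial j f) p"
    unfolding edge_deriv_def
    by (rule frechet_diff) (use C1_on_differentiable[OF C1_on_partial[OF f] U(2)] in auto)
  also have "\<dots> = partial i (partial i f) p - partial j (partial i f) p - (partial i (partial j f) p - partial j (partial j f) p)"
    by (simp add: edge_deriv_eq C1_on_differentiable[OF C1_on_partial[OF f] U(2)])
  finally show ?thesis by simp
qed

lemma antisymmetric_sum:
  fixes K :: "'n::finite \<Rightarrow> 'n \<Rightarrow> real"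
  assumes "\<And>i j. K j i = - K i j"
  shows "(\<Sum>i\<in>UNIV. \<Sum>j\<in>UNIV. K i j * x i) = 1/2 * (\<Sum>i\<in>UNIV. \<Sum>j\<in>UNIV. K i j * (x i - x j))"
proof -
  have "(\<Sum>i\<in>UNIV. \<Sum>j\<in>UNIV. K i j * x j) = (\<Sum>i\<in>UNIV. \<Sum>j\<in>UNIV. K j i * x i)" by (rule sum.swap)
  also have "\<dots> = - (\<Sum>i\<in>UNIV. \<Sum>j\<in>UNIV. K i j * x i)"
    unfolding sum_negf[symmetric]
  proof (intro sum.cong refl)
    fix i j show "K j i * x i = - (K i j * x i)" using assms[of i j] by simp
  qed
  finally show ?thesis by (simp add: right_diff_distrib sum_subtractf)
qed

text \<open>
  Exchanging the two summation indices combines \<open>\<partial> i\<close> of the current from \<open>j\<close> to \<open>i\<close> with \<open>\<partial> j\<close> of the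
  opposite current: the divergence of an edge field only involves derivatives along the edges.
\<close>

lemma divergence_antisymmetric:
  fixes V :: "real^'n::finite \<Rightarrow> real^'n" and K :: "'n \<Rightarrow> 'n \<Rightarrow> real^'n \<Rightarrow> real"
  assumes U: "open U" "p \<in> U" and V: "\<And>q i. q \<in> U \<Longrightarrow> V q $ i = (\<Sum>j\<in>UNIV. K i j q)"
    and d: "\<And>i j. K i j differentiable (at p)" and anti: "\<And>i j q. q \<in> U \<Longrightarrow> K j i q = - K i j q"
  shows "divergence V p = 1/2 * (\<Sum>i\<in>UNIV. \<Sum>j\<in>UNIV. edge_deriv i j (K i j) p)"
proof -
  have "divergence V p = (\<Sum>i\<in>UNIV. \<Sum>j\<in>UNIV. partial i (K i j) p)"
    unfolding divergence_def
  proof (rule sum.cong[OF refl])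
    fix i
    have "partial i (\<lambda>q. V q $ i) p = partial i (\<lambda>q. \<Sum>j\<in>UNIV. K i j q) p"
      by (rule partial_cong[OF U V])
    then show "partial i (\<lambda>q. V q $ i) p = (\<Sum>j\<in>UNIV. partial i (K i j) p)"
      unfolding partial_def by (simp add: frechet_sum[OF d])
  qed
  note dv = this
  have swp: "partial j (K j i) p = - partial j (K i j) p" for i j
  proof -
    have "partial j (K j i) p = partial j (\<lambda>q. -1 * K i j q) p"
    proof (rule partial_cong[OF U])
      fix q assume "q \<in> U"
      from anti[OF this, of i j] show "K j i q = -1 * K i j q" by simp
    qed
    then show ?thesis unfolding partial_def using frechet_cmult[OF d[of i j], of "-1"] by simp
  qed
  have "(\<Sum>i\<in>UNIV. \<Sum>j\<in>UNIV. partial i (K i j) p) = (\<Sum>i\<in>UNIV. \<Sum>j\<in>UNIV. partial j (K j i) p)"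
    by (rule sum.swap)
  then have "2 * divergence V p = (\<Sum>i\<in>UNIV. \<Sum>j\<in>UNIV. partial i (K i j) p) + (\<Sum>i\<in>UNIV. \<Sum>j\<in>UNIV. partial j (K j i) p)"
    using dv by simp
  also have "\<dots> = (\<Sum>i\<in>UNIV. \<Sum>j\<in>UNIV. edge_deriv i j (K i j) p)"
    unfolding sum.distrib[symmetric] by (simp add: swp edge_deriv_eq[OF d])
  finally show ?thesis by simp
qed

text \<open>
  The pairing of a graph Laplacian with a matrix \<open>h\<close>. For a Hessian matrix \<open>h\<close> the bracket on the right is
  the second derivative in the direction of the edge.
\<close>

lemma laplacian_form_sum:
  fixes \<kappa> h :: "'n::finite \<Rightarrow> 'n \<Rightarrow> real"
  assumes s: "\<And>i j. \<kappa> i j = \<kappa> j i" and d: "\<And>i. \<kappa> i i = 0"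
  shows "(\<Sum>i\<in>UNIV. \<Sum>j\<in>UNIV. (if i = j then \<Sum>k\<in>UNIV. \<kappa> k i else - \<kappa> i j) * h i j) =
    1/2 * (\<Sum>i\<in>UNIV. \<Sum>j\<in>UNIV. \<kappa> i j * (h i i - h i j - h j i + h j j))"
proof -
  have "(\<Sum>j\<in>UNIV. (if i = j then \<Sum>k\<in>UNIV. \<kappa> k i else - \<kappa> i j) * h i j) =
     (\<Sum>j\<in>UNIV. \<kappa> i j * (h i i - h i j))" for i
  proof -
    have "(\<Sum>j\<in>UNIV. (if i = j then \<Sum>k\<in>UNIV. \<kappa> k i else - \<kappa> i j) * h i j) =
      (\<Sum>j\<in>UNIV. (if i = j then (\<Sum>k\<in>UNIV. \<kappa> i k) * h i i else 0) + - (\<kappa> i j * h i j))"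
      by (intro sum.cong refl) (auto simp: d s[of _ i])
    also have "\<dots> = (\<Sum>k\<in>UNIV. \<kappa> i k) * h i i - (\<Sum>j\<in>UNIV. \<kappa> i j * h i j)"
      unfolding sum.distrib sum_negf by simp
    finally show ?thesis by (simp add: sum_distrib_right right_diff_distrib sum_subtractf)
  qed
  then have eq: "(\<Sum>i\<in>UNIV. \<Sum>j\<in>UNIV. (if i = j then \<Sum>k\<in>UNIV. \<kappa> k i else - \<kappa> i j) * h i j) =
    (\<Sum>i\<in>UNIV. \<Sum>j\<in>UNIV. \<kappa> i j * (h i i - h i j))" by simp
  have "(\<Sum>i\<in>UNIV. \<Sum>j\<in>UNIV. \<kappa> i j * (h i i - h i j)) = (\<Sum>i\<in>UNIV. \<Sum>j\<in>UNIV. \<kappa> j i * (h j j - h j i))"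
    by (rule sum.swap)
  also have "\<dots> = (\<Sum>i\<in>UNIV. \<Sum>j\<in>UNIV. \<kappa> i j * (h j j - h j i))"
    by (intro sum.cong refl) (simp add: s)
  finally have "2 * (\<Sum>i\<in>UNIV. \<Sum>j\<in>UNIV. \<kappa> i j * (h i i - h i j)) =
     (\<Sum>i\<in>UNIV. \<Sum>j\<in>UNIV. \<kappa> i j * (h i i - h i j)) + (\<Sum>i\<in>UNIV. \<Sum>j\<in>UNIV. \<kappa> i j * (h j j - h j i))" by simp
  also have "\<dots> = (\<Sum>i\<in>UNIV. \<Sum>j\<in>UNIV. \<kappa> i j * (h i i - h i j - h j i + h j j))"
    unfolding sum.distrib[symmetric] by (intro sum.cong refl) (simp add: algebra_simps)
  finally show ?thesis unfolding eq by simp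
qed

section \<open>The weighted graph, its Laplacian matrix and the divergence\<close>

locale wasserstein_graph =
  fixes E :: "('n::finite \<times> 'n) set" and w :: "real^'n^'n"
    and \<phi> :: "real \<Rightarrow> real" and \<theta> :: "real \<Rightarrow> real \<Rightarrow> real" and \<beta> :: real
  assumes two: "2 \<le> CARD('n)" and graph: "weighted_graph E w"
    and avg: "average_function \<phi> \<theta>" and \<beta>: "0 < \<beta>"
begin

abbreviation \<pi> :: "'n \<Rightarrow> real" where "\<pi> \<equiv> stat E w"
abbreviation th :: "'n \<Rightarrow> 'n \<Rightarrow> real^'n \<Rightarrow> real" where "th \<equiv> theta_edge E w \<theta>"
abbreviation lap :: "real^'n \<Rightarrow> real^'n^'n" where "lap \<equiv> laplacian E w \<theta>"
abbreviation lnPi :: "real^'n \<Rightarrow> real" where "lnPi \<equiv> (\<lambda>r. ln (Pi_lap E w \<theta> r))"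
abbreviation Dphi :: "real^'n \<Rightarrow> real" where "Dphi \<equiv> phi_divergence E w \<phi>"

lemma w_sym: "w $ i $ j = w $ j $ i" using graph by (auto simp: weighted_graph_def)
lemma w_edge: "(i, j) \<in> E \<Longrightarrow> 0 < w $ i $ j" using graph unfolding weighted_graph_def by metis
lemma w_nonedge: "(i, j) \<notin> E \<Longrightarrow> w $ i $ j = 0" using graph unfolding weighted_graph_def by metis
lemma w_diag: "w $ i $ i = 0" using graph w_nonedge by (auto simp: weighted_graph_def irrefl_def)
lemma w_nonneg: "0 \<le> w $ i $ j" by (cases "(i, j) \<in> E") (auto simp: w_nonedge dest: w_edge)
lemma connected: "(i, j) \<in> E\<^sup>*" using graph by (auto simp: weighted_graph_def)

lemma sum_neighbours: "(\<Sum>j\<in>E``{i}. w $ i $ j * f j) = (\<Sum>j\<in>UNIV. w $ i $ j * f j)"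
  by (rule sum.mono_neutral_left) (auto simp: w_nonedge)

lemma ex_neighbour: "\<exists>j. (i, j) \<in> E"
proof -
  have "\<exists>k. k \<noteq> i"
  proof (rule ccontr)
    assume "\<not> (\<exists>k. k \<noteq> i)"
    then have "UNIV = {i}" by auto
    then have "CARD('n) = 1" by (metis card.empty card.insert empty_iff finite.emptyI One_nat_def)
    then show False using two by simp
  qed
  then obtain k where "k \<noteq> i" by blast
  then show ?thesis using connected[of i k] by (metis converse_rtranclE)
qed

lemma \<pi>_pos: "0 < \<pi> i"
proof -
  obtain j where j: "(i, j) \<in> E" using ex_neighbour by blast
  have "0 < (\<Sum>j\<in>E``{i}. w $ i $ j)"
    by (rule sum_pos2[of _ j]) (use j in \<open>auto simp: w_edge w_nonneg\<close>)
  moreover have "0 < (\<Sum>(k, l)\<in>E. w $ k $ l)"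
    by (rule sum_pos2[OF _ j]) (auto simp: w_edge[OF j] w_nonneg)
  ultimately show ?thesis by (simp add: stat_def)
qed

lemma \<theta>_pos: "0 < x \<Longrightarrow> 0 < y \<Longrightarrow> 0 < \<theta> x y"
  using avg unfolding average_function_def by (metis less_imp_le less_irrefl mult_eq_0_iff)

lemma \<theta>_sym: "0 < x \<Longrightarrow> 0 < y \<Longrightarrow> \<theta> x y = \<theta> y x"
  using avg unfolding average_function_def by (metis less_imp_le)

lemma arg_pos: "p \<in> orthant \<Longrightarrow> 0 < p $ i / \<pi> i"
  using \<pi>_pos by (simp add: orthant_def)

lemma th_pos: "p \<in> orthant \<Longrightarrow> 0 < th i j p"
  unfolding theta_edge_def by (intro \<theta>_pos arg_pos)

lemma th_sym: "p \<in> orthant \<Longrightarrow> th i j p = th j i p"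
  unfolding theta_edge_def by (intro \<theta>_sym arg_pos)

lemma C2_th: "C2_on orthant (th i j)"
proof -
  have bl: "bounded_linear (\<lambda>p :: real^'n. (p $ i / \<pi> i, p $ j / \<pi> j))"
    by (intro bounded_linear_Pair bounded_linear_compose[OF bounded_linear_divide] bounded_linear_vec_nth)
  have g: "C2_on ({0<..} \<times> {0<..}) (\<lambda>(x, y). \<theta> x y)"
    using avg by (simp add: average_function_def)
  have "C2_on orthant (\<lambda>p. (\<lambda>(x, y). \<theta> x y) ((p $ i / \<pi> i, p $ j / \<pi> j) + 0))"
    by (rule C2_on_compose_affine[OF open_orthant g bl]) (auto simp: arg_pos)
  then show ?thesis by (simp add: theta_edge_def[abs_def])
qed

text \<open>
  The positivity of \<open>\<theta>\<close> excludes that the denominator in its definition is 0, so division can be undone.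
\<close>

lemma \<phi>_deriv_relation: "0 < x \<Longrightarrow> 0 < y \<Longrightarrow> \<theta> x y * (deriv \<phi> x - deriv \<phi> y) = x - y"
proof (cases "x = y")
  case False
  assume xy: "0 < x" "0 < y"
  have e: "\<theta> x y = (x - y) / (deriv \<phi> x - deriv \<phi> y)"
    using avg xy False unfolding average_function_def by blast
  then have "deriv \<phi> x - deriv \<phi> y \<noteq> 0" using \<theta>_pos[OF xy] by auto
  then show ?thesis using e by simp
qed simp

text \<open>
  The average function improves the regularity of \<open>\<phi>\<close>, which is only required to be of class \<open>C\<^sup>1\<close>: by the
  previous lemma the derivative of \<open>\<phi>\<close> at \<open>x\<close> is its value at 1 plus \<open>(x - 1) / \<theta> x 1\<close>.
\<close>

lemma C2_phi: "C2_on {0<..} \<phi>"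
proof -
  have C1: "C1_on {0<..} \<phi>" using avg by (simp add: average_function_def)
  have has: "(\<phi> has_derivative (\<lambda>v. deriv \<phi> x * v)) (at x)" if "x \<in> {0<..}" for x
  proof -
    have "\<phi> differentiable (at x)" by (rule C1_on_differentiable[OF C1 that])
    then have "(\<phi> has_real_derivative deriv \<phi> x) (at x)"
      by (metis DERIV_deriv_iff_real_differentiable)
    then show ?thesis by (simp add: has_field_derivative_def)
  qed
  have bl: "bounded_linear (\<lambda>x :: real. (x, 0 :: real))" by (intro bounded_linear_Pair bounded_linear_ident bounded_linear_zero)
  have g: "C2_on ({0<..} \<times> {0<..}) (\<lambda>(x, y). \<theta> x y)"
    using avg by (simp add: average_function_def)
  have "C2_on {0<..} (\<lambda>x. (\<lambda>(x, y). \<theta> x y) ((x, 0) + (0, 1)))"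
    by (rule C2_on_compose_affine[OF _ g bl]) auto
  then have t: "C2_on {0<..} (\<lambda>x. \<theta> x 1)" by simp
  have "C1_on {0<..} (\<lambda>x. deriv \<phi> 1 + (x - 1) * (1 / \<theta> x 1))"
    by (intro C1_on_add C1_on_mult C1_on_diff C1_on_const C1_on_linear bounded_linear_ident
        C2_on_imp_C1_on[OF C2_on_inverse[OF _ t]]) (auto intro: \<theta>_pos)
  then have "C1_on {0<..} (deriv \<phi>)"
  proof (rule C1_on_cong[rotated])
    fix x :: real assume "x \<in> {0<..}"
    then have "\<theta> x 1 * (deriv \<phi> x - deriv \<phi> 1) = x - 1" "0 < \<theta> x 1" by (auto intro: \<phi>_deriv_relation \<theta>_pos)
    then show "deriv \<phi> 1 + (x - 1) * (1 / \<theta> x 1) = deriv \<phi> x" by (simp add: field_simps)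
  qed simp
  then show ?thesis
    by (intro C2_onI[where f'="\<lambda>x v. deriv \<phi> x * v"] has C1_on_mult C1_on_const) auto
qed

lemma C2_Dphi: "C2_on orthant Dphi"
  unfolding phi_divergence_def[abs_def]
proof (intro C2_on_sum C2_on_mult C2_on_const open_orthant)
  fix i
  have bl: "bounded_linear (\<lambda>p :: real^'n. p $ i / \<pi> i)"
    by (intro bounded_linear_compose[OF bounded_linear_divide] bounded_linear_vec_nth)
  have "C2_on orthant (\<lambda>p. \<phi> (p $ i / \<pi> i + 0))"
    by (rule C2_on_compose_affine[OF open_orthant C2_phi bl]) (use arg_pos in auto)
  then show "C2_on orthant (\<lambda>p. \<phi> (p $ i / \<pi> i))" by simp
qed

lemma partial_Dphi: "p \<in> orthant \<Longrightarrow> partial i Dphi p = deriv \<phi> (p $ i / \<pi> i)"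
proof -
  assume p: "p \<in> orthant"
  have d: "((\<lambda>p. \<phi> (p $ k / \<pi> k) * \<pi> k) has_derivative (\<lambda>v. deriv \<phi> (p $ k / \<pi> k) * v $ k)) (at p)" for k
  proof -
    have "\<phi> differentiable (at (p $ k / \<pi> k))"
      by (rule C2_on_differentiable[OF C2_phi]) (use arg_pos[OF p] in auto)
    then have "(\<phi> has_real_derivative deriv \<phi> (p $ k / \<pi> k)) (at (p $ k / \<pi> k))"
      by (metis DERIV_deriv_iff_real_differentiable)
    then have f: "(\<phi> has_derivative (\<lambda>v. deriv \<phi> (p $ k / \<pi> k) * v)) (at (p $ k / \<pi> k))"
      by (simp add: has_field_derivative_def)
    have l: "((\<lambda>p. p $ k / \<pi> k) has_derivative (\<lambda>v. v $ k / \<pi> k)) (at p)"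
      by (intro bounded_linear_imp_has_derivative bounded_linear_compose[OF bounded_linear_divide] bounded_linear_vec_nth)
    from has_derivative_mult_left[OF diff_chain_at[OF l f], of "\<pi> k"] show ?thesis
      using \<pi>_pos[of k] by (simp add: o_def)
  qed
  have "(Dphi has_derivative (\<lambda>v. \<Sum>k\<in>UNIV. deriv \<phi> (p $ k / \<pi> k) * v $ k)) (at p)"
    unfolding phi_divergence_def[abs_def] by (intro has_derivative_sum d)
  from frechet_derivative_at[OF this]
  have "frechet_derivative Dphi (at p) = (\<lambda>v. \<Sum>k\<in>UNIV. deriv \<phi> (p $ k / \<pi> k) * v $ k)" by simp
  then show ?thesis by (simp add: partial_def axis_def if_distrib[of "\<lambda>x. _ * x"] cong: if_cong)
qed

text \<open>
  The current into \<open>i\<close> along an edge, per unit weight, in the linear flow of the \<open>Q\<close>-matrix.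
\<close>

definition flux :: "'n \<Rightarrow> 'n \<Rightarrow> real^'n \<Rightarrow> real" where
  "flux i j p = p $ j / \<pi> j - p $ i / \<pi> i"

lemma flux_swap: "flux j i p = - flux i j p" by (simp add: flux_def)

lemma C2_flux: "C2_on orthant (flux i j)"
  unfolding flux_def[abs_def]
  by (intro C2_on_linear open_orthant bounded_linear_sub bounded_linear_compose[OF bounded_linear_divide] bounded_linear_vec_nth)

text \<open>
  The average \<open>\<theta>\<close> is the quotient of the differences of its arguments and of \<open>\<phi>'\<close>, so the
  nonlinear gradient of the divergence becomes linear in \<open>p\<close>.
\<close>

lemma th_edge_deriv_Dphi: "p \<in> orthant \<Longrightarrow> th i j p * edge_deriv i j Dphi p = - flux i j p"
  using \<phi>_deriv_relation[OF arg_pos arg_pos, of p p i j]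
  by (simp add: edge_deriv_eq C2_on_differentiable[OF C2_Dphi] partial_Dphi theta_edge_def flux_def)

lemma Q_field_eq: "Q_field E w p $ i = (\<Sum>j\<in>UNIV. w $ i $ j * flux i j p)"
proof -
  have "Q_field E w p $ i = (\<Sum>j\<in>UNIV. Q_matrix E w $ j $ i * p $ j - Q_matrix E w $ i $ j * p $ i)"
    by (simp add: Q_field_def)
  also have "\<dots> = (\<Sum>j\<in>UNIV. w $ i $ j * flux i j p)"
  proof (rule sum.cong[OF refl])
    fix j
    show "Q_matrix E w $ j $ i * p $ j - Q_matrix E w $ i $ j * p $ i = w $ i $ j * flux i j p"
      by (cases "j = i") (auto simp: Q_matrix_def flux_def w_diag w_sym[of j i] right_diff_distrib)
  qed
  finally show ?thesis .
qed

lemma lap_entry: "lap p $ i $ j = (if i = j then \<Sum>k\<in>UNIV. w $ k $ i * th k i p else - (w $ i $ j * th i j p))"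
proof -
  have "(\<Sum>k\<in>E``{i}. w $ k $ i * th k i p) = (\<Sum>k\<in>UNIV. w $ k $ i * th k i p)"
    using sum_neighbours[of i "\<lambda>k. th k i p"] by (simp add: w_sym)
  then show ?thesis by (cases "i = j") (simp_all add: laplacian_def)
qed

lemma lap_mult: "p \<in> orthant \<Longrightarrow> (lap p *v x) $ i = (\<Sum>j\<in>UNIV. w $ i $ j * th i j p * (x $ i - x $ j))"
proof -
  assume p: "p \<in> orthant"
  have "(lap p *v x) $ i = (\<Sum>j\<in>UNIV. (if j = i then (\<Sum>k\<in>UNIV. w $ i $ k * th i k p) * x $ i else 0) - w $ i $ j * th i j p * x $ j)"
    unfolding matrix_vector_mult_def vec_lambda_beta
    by (intro sum.cong refl) (auto simp: lap_entry w_diag w_sym th_sym[OF p])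
  also have "\<dots> = (\<Sum>k\<in>UNIV. w $ i $ k * th i k p) * x $ i - (\<Sum>j\<in>UNIV. w $ i $ j * th i j p * x $ j)"
    unfolding sum_subtractf by simp
  finally show ?thesis by (simp add: right_diff_distrib sum_subtractf sum_distrib_right)
qed

lemma lap_quadratic_form:
  assumes p: "p \<in> orthant"
  shows "x \<bullet> (lap p *v x) = 1/2 * (\<Sum>i\<in>UNIV. \<Sum>j\<in>UNIV. w $ i $ j * th i j p * (x $ i - x $ j)\<^sup>2)"
proof -
  have "x \<bullet> (lap p *v x) = (\<Sum>i\<in>UNIV. \<Sum>j\<in>UNIV. w $ i $ j * th i j p * (x $ i - x $ j) * x $ i)"
    by (simp add: inner_vec_def lap_mult[OF p] sum_distrib_left mult.commute)
  also have "\<dots> = 1/2 * (\<Sum>i\<in>UNIV. \<Sum>j\<in>UNIV. w $ i $ j * th i j p * (x $ i - x $ j) * (x $ i - x $ j))"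
    by (rule antisymmetric_sum) (simp add: w_sym th_sym[OF p] algebra_simps)
  finally show ?thesis by (simp add: power2_eq_square mult.assoc)
qed

text \<open>
  The quadratic form of the Laplacian is a sum of nonnegative terms over the edges, so a vector in the
  kernel takes equal values at the ends of every edge, and the graph is connected.
\<close>

lemma lap_kernel:
  assumes p: "p \<in> orthant" and x: "lap p *v x = 0"
  shows "x $ i = x $ j"
proof -
  have nn: "0 \<le> w $ i $ j * th i j p * (x $ i - x $ j)\<^sup>2" for i j
    using w_nonneg th_pos[OF p] by (simp add: less_imp_le)
  have "(\<Sum>i\<in>UNIV. \<Sum>j\<in>UNIV. w $ i $ j * th i j p * (x $ i - x $ j)\<^sup>2) = 0"
    using lap_quadratic_form[OF p, of x] x by simp
  then have "w $ i $ j * th i j p * (x $ i - x $ j)\<^sup>2 = 0" for i j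
    by (simp add: sum_nonneg_eq_0_iff sum_nonneg nn)
  then have edge: "x $ i = x $ j" if "(i, j) \<in> E" for i j
    using w_edge[OF that] th_pos[OF p, of i j] by (metis eq_iff_diff_eq_0 less_irrefl mult_eq_0_iff power2_less_0 zero_less_power2)
  show ?thesis using connected[of i j] by (induction rule: rtrancl_induct) (auto simp: edge)
qed

text \<open>
  The unit kernel vector has all entries \<open>1 / sqrt n\<close>, and the products of its entries are \<open>1 / n\<close>.
\<close>

lemma Pi_lap_eq_det:
  assumes p: "p \<in> orthant"
  shows "Pi_lap E w \<theta> p = det (\<chi> i j. lap p $ i $ j + 1 / real CARD('n))" and "0 < Pi_lap E w \<theta> p"
proof -
  define u :: "real^'n" where "u = (\<chi> i. 1 / sqrt (real CARD('n)))"
  have tr: "transpose (lap p) = lap p"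
    by (simp add: transpose_def vec_eq_iff lap_entry w_sym th_sym[OF p])
  have psd: "0 \<le> x \<bullet> (lap p *v x)" for x
    unfolding lap_quadratic_form[OF p] using w_nonneg th_pos[OF p]
    by (intro mult_nonneg_nonneg sum_nonneg) (auto simp: less_imp_le)
  have "u \<bullet> u = 1" by (simp add: u_def inner_vec_def)
  then have nu: "norm u = 1" by (simp add: norm_eq_1)
  have ku: "lap p *v u = 0" by (simp add: vec_eq_iff lap_mult[OF p] u_def)
  have ker: "\<exists>c. x = c *\<^sub>R u" if "lap p *v x = 0" for x
  proof
    show "x = (x $ undefined * sqrt (real CARD('n))) *\<^sub>R u"
      using lap_kernel[OF p that] by (simp add: vec_eq_iff u_def)
  qed
  note * = prod_pos_eigenvalues_eq_det[OF tr psd nu ku ker]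
  show "0 < Pi_lap E w \<theta> p" using *(2) by (simp add: Pi_lap_def)
  show "Pi_lap E w \<theta> p = det (\<chi> i j. lap p $ i $ j + 1 / real CARD('n))"
    using *(1) by (simp add: Pi_lap_def u_def)
qed

lemma C2_Pi_lap: "C2_on orthant (Pi_lap E w \<theta>)"
proof -
  have "C2_on orthant (\<lambda>p. lap p $ i $ j)" for i j
    unfolding lap_entry
    using C2_on_sum[OF open_orthant, of UNIV "\<lambda>k p. w $ k $ i * th k i p"] C2_on_cmult[OF open_orthant C2_th]
      C2_on_cmult[OF open_orthant C2_on_cmult[OF open_orthant C2_th], of "-1"]
    by (cases "i = j") auto
  then have "C2_on orthant (\<lambda>p. det (\<chi> i j. lap p $ i $ j + 1 / real CARD('n)))"
    unfolding det_def
    by (intro C2_on_sum C2_on_mult C2_on_prod C2_on_const open_orthant)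
       (simp, intro C2_on_add C2_on_const open_orthant)
  then show ?thesis by (rule C2_on_cong[OF open_orthant]) (simp add: Pi_lap_eq_det)
qed

lemma C2_lnPi: "C2_on orthant lnPi"
  by (intro C2_on_ln open_orthant C2_Pi_lap Pi_lap_eq_det)

lemma C2_gibbs: "C2_on orthant (gibbs_weight E w \<phi> \<theta> \<beta>)"
  unfolding gibbs_weight_def[abs_def]
  by (intro C2_on_mult C2_on_exp C2_on_cmult C2_on_powr open_orthant C2_Dphi C2_Pi_lap Pi_lap_eq_det)

end

section \<open>Drift, covariation and generator in terms of edges\<close>

lemma edge_deriv_mult:
  "f differentiable (at p) \<Longrightarrow> g differentiable (at p) \<Longrightarrow>
    edge_deriv i j (\<lambda>q. f q * g q) p = f p * edge_deriv i j g p + edge_deriv i j f p * g p"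
  unfolding edge_deriv_def by (rule frechet_mult)

lemma edge_deriv_cmult:
  "f differentiable (at p) \<Longrightarrow> edge_deriv i j (\<lambda>q. c * f q) p = c * edge_deriv i j f p"
  unfolding edge_deriv_def by (rule frechet_cmult)

lemma edge_deriv_add:
  "f differentiable (at p) \<Longrightarrow> g differentiable (at p) \<Longrightarrow>
    edge_deriv i j (\<lambda>q. f q + g q) p = edge_deriv i j f p + edge_deriv i j g p"
  unfolding edge_deriv_def by (rule frechet_add)

lemma edge_deriv_diff:
  "f differentiable (at p) \<Longrightarrow> g differentiable (at p) \<Longrightarrow>
    edge_deriv i j (\<lambda>q. f q - g q) p = edge_deriv i j f p - edge_deriv i j g p"
  unfolding edge_deriv_def by (rule frechet_diff)

lemma edge_deriv_compose:
  fixes g :: "real^'n::finite \<Rightarrow> real"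
  assumes g: "g differentiable (at p)" and h: "(h has_real_derivative h') (at (g p))"
  shows "edge_deriv i j (\<lambda>q. h (g q)) p = h' * edge_deriv i j g p"
    and "(\<lambda>q. h (g q)) differentiable (at p)"
proof -
  have d: "((\<lambda>q. h (g q)) has_derivative (\<lambda>v. h' * frechet_derivative g (at p) v)) (at p)"
    using diff_chain_at[OF frechet_derivative_works[THEN iffD1, OF g] h[unfolded has_field_derivative_def]]
    by (simp add: o_def)
  show "(\<lambda>q. h (g q)) differentiable (at p)" using d by (rule differentiableI)
  have "frechet_derivative (\<lambda>q. h (g q)) (at p) = (\<lambda>v. h' * frechet_derivative g (at p) v)"
    using frechet_derivative_at[OF d] by (rule sym)
  then show "edge_deriv i j (\<lambda>q. h (g q)) p = h' * edge_deriv i j g p"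
    by (simp add: edge_deriv_def)
qed

context wasserstein_graph
begin

lemmas diff_th = C2_on_differentiable[OF C2_th]
lemmas diff_lnPi = C2_on_differentiable[OF C2_lnPi]

text \<open>
  The coefficient of the drift on an edge without the correction \<open>\<beta> * D i j (\<theta> i j)\<close>. The correction
  completes the second-order part of the generator to the divergence form \<open>D (\<theta> * D \<Phi>)\<close>.
\<close>

definition coef :: "'n \<Rightarrow> 'n \<Rightarrow> real^'n \<Rightarrow> real" where
  "coef i j p = flux i j p - \<beta> / 2 * (th i j p * edge_deriv i j lnPi p)"

lemma C1_coef: "C1_on orthant (coef i j)"
  unfolding coef_def[abs_def]
  by (intro C1_on_diff C1_on_cmult C1_on_mult C2_on_imp_C1_on[OF C2_th] C2_on_imp_C1_on[OF C2_flux] C1_on_edge_deriv[OF C2_lnPi])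

lemma coef_swap: "p \<in> orthant \<Longrightarrow> coef j i p = - coef i j p"
  using flux_swap[of j i p] th_sym[of p j i] edge_deriv_swap[OF diff_lnPi, of p j i] by (simp add: coef_def)

lemma edge_deriv_th_swap: "p \<in> orthant \<Longrightarrow> edge_deriv j i (th j i) p = - edge_deriv i j (th i j) p"
proof -
  assume p: "p \<in> orthant"
  have "edge_deriv j i (th j i) p = edge_deriv j i (th i j) p"
    by (rule edge_deriv_cong[OF open_orthant p]) (rule th_sym)
  also have "\<dots> = - edge_deriv i j (th i j) p" by (rule edge_deriv_swap[OF diff_th[OF p]])
  finally show ?thesis .
qed

lemma sde_drift_eq:
  assumes p: "p \<in> orthant"
  shows "sde_drift E w \<phi> \<theta> \<beta> p $ i = (\<Sum>j\<in>UNIV. w $ i $ j * (coef i j p + \<beta> * edge_deriv i j (th i j) p))"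
proof -
  let ?G = "\<lambda>j q. ln (Pi_lap E w \<theta> q powr (1/2) / th i j q)"
  have dD: "Dphi differentiable (at p)" by (rule C2_on_differentiable[OF C2_Dphi p])
  have G: "th i j p * (partial j (?G j) p - partial i (?G j) p) =
      - (1/2 * (th i j p * edge_deriv i j lnPi p)) + edge_deriv i j (th i j) p" for j
  proof -
    have "C2_on orthant (?G j)"
    proof -
      have a: "C2_on orthant (\<lambda>q. Pi_lap E w \<theta> q powr (1/2))"
        by (rule C2_on_powr[OF open_orthant C2_Pi_lap Pi_lap_eq_det(2)])
      have b: "C2_on orthant (\<lambda>q. 1 / th i j q)"
        by (rule C2_on_inverse[OF open_orthant C2_th th_pos])
      have "0 < Pi_lap E w \<theta> q powr (1/2) * (1 / th i j q)" if "q \<in> orthant" for q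
        using th_pos[OF that, of i j] Pi_lap_eq_det(2)[OF that] by simp
      from C2_on_ln[OF open_orthant C2_on_mult[OF open_orthant a b] this]
      have "C2_on orthant (\<lambda>q. ln (Pi_lap E w \<theta> q powr (1/2) * (1 / th i j q)))" .
      then show ?thesis by simp
    qed
    then have "?G j differentiable (at p)" by (rule C2_on_differentiable[OF _ p])
    from edge_deriv_eq[OF this, of i j] have 1: "partial j (?G j) p - partial i (?G j) p = - edge_deriv i j (?G j) p" by simp
    have "edge_deriv i j (?G j) p = edge_deriv i j (\<lambda>q. 1/2 * lnPi q - ln (th i j q)) p"
    proof (rule edge_deriv_cong[OF open_orthant p])
      fix q :: "real^'n" assume q: "q \<in> orthant"
      show "?G j q = 1/2 * lnPi q - ln (th i j q)"
        using Pi_lap_eq_det(2)[OF q] th_pos[OF q, of i j] by (simp add: ln_div ln_powr)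
    qed
    also have "\<dots> = 1/2 * edge_deriv i j lnPi p - edge_deriv i j (th i j) p / th i j p"
    proof -
      have l: "(ln has_real_derivative 1 / th i j p) (at (th i j p))"
        using th_pos[OF p, of i j] by (auto intro!: derivative_eq_intros)
      note c = edge_deriv_compose[OF diff_th[OF p] l]
      have "(\<lambda>q. 1/2 * lnPi q) differentiable (at p)"
        by (intro differentiable_mult differentiable_const diff_lnPi p)
      then show ?thesis
        using edge_deriv_diff[of "\<lambda>q. 1/2 * lnPi q" p "\<lambda>q. ln (th i j q)" i j] c
          edge_deriv_cmult[OF diff_lnPi[OF p], of i j "1/2"] by simp
    qed
    finally show ?thesis unfolding 1 using th_pos[OF p, of i j] by (simp add: right_diff_distrib)
  qed
  have F: "th i j p * (partial j Dphi p - partial i Dphi p) = flux i j p" for j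
    using th_edge_deriv_Dphi[OF p, of i j] edge_deriv_eq[OF dD, of i j] by (simp add: algebra_simps)
  have "sde_drift E w \<phi> \<theta> \<beta> p $ i = (\<Sum>j\<in>E``{i}. w $ i $ j * (th i j p * (partial j Dphi p - partial i Dphi p))) +
     \<beta> * (\<Sum>j\<in>E``{i}. w $ i $ j * (th i j p * (partial j (?G j) p - partial i (?G j) p)))"
    by (simp add: sde_drift_def mult.assoc)
  also have "\<dots> = (\<Sum>j\<in>UNIV. w $ i $ j * flux i j p) +
     \<beta> * (\<Sum>j\<in>UNIV. w $ i $ j * (- (1/2 * (th i j p * edge_deriv i j lnPi p)) + edge_deriv i j (th i j) p))"
    unfolding sum_neighbours G F ..
  also have "\<dots> = (\<Sum>j\<in>UNIV. w $ i $ j * (coef i j p + \<beta> * edge_deriv i j (th i j) p))"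
    unfolding sum_distrib_left sum.distrib[symmetric]
    by (intro sum.cong refl) (simp add: coef_def algebra_simps)
  finally show ?thesis .
qed

lemma sde_noise_eq:
  assumes p: "p \<in> orthant"
  shows "sde_noise E w \<theta> \<beta> p i (x, y) = sqrt \<beta> *
    ((if x = i then sqrt (w $ i $ y * th i y p) else 0) - (if y = i then sqrt (w $ i $ x * th i x p) else 0))"
proof -
  let ?s = "\<lambda>j. sqrt (w $ i $ j * th i j p)"
  have "(\<Sum>j\<in>E``{i}. ?s j * ((if (x, y) = (i, j) then 1 else 0) - (if (x, y) = (j, i) then 1 else 0))) =
    (\<Sum>j\<in>UNIV. ?s j * ((if (x, y) = (i, j) then 1 else 0) - (if (x, y) = (j, i) then 1 else 0)))"
    by (rule sum.mono_neutral_left) (auto simp: w_nonedge)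
  also have "\<dots> = (\<Sum>j\<in>UNIV. (if j = y then (if x = i then ?s j else 0) else 0) - (if j = x then (if y = i then ?s j else 0) else 0))"
    by (intro sum.cong refl) auto
  also have "\<dots> = (if x = i then ?s y else 0) - (if y = i then ?s x else 0)"
    unfolding sum_subtractf by simp
  finally show ?thesis by (simp add: sde_noise_def)
qed

text \<open>
  The factor 2: the noise at \<open>i\<close> and at \<open>l\<close> shares both \<open>B (i, l)\<close> and \<open>B (l, i)\<close>, each with opposite signs.
\<close>

lemma covariation_eq:
  assumes p: "p \<in> orthant"
  shows "covariation (sde_noise E w \<theta> \<beta>) p $ i $ l = 2 * \<beta> * lap p $ i $ l"
proof -
  define s where "s i j = sqrt (w $ i $ j * th i j p)" for i j
  have ss: "s i j * s i j = w $ i $ j * th i j p" for i j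
    using w_nonneg[of i j] th_pos[OF p, of i j] by (simp add: s_def)
  have sym: "s i j = s j i" for i j by (simp add: s_def w_sym th_sym[OF p])
  have "covariation (sde_noise E w \<theta> \<beta>) p $ i $ l =
     (\<Sum>x\<in>UNIV. \<Sum>y\<in>UNIV. sde_noise E w \<theta> \<beta> p i (x, y) * sde_noise E w \<theta> \<beta> p l (x, y))"
    by (simp add: covariation_def sum.cartesian_product UNIV_Times_UNIV[symmetric] del: UNIV_Times_UNIV)
  also have "\<dots> = (\<Sum>x\<in>UNIV. \<Sum>y\<in>UNIV. \<beta> *
      ((if x = i then (if x = l then s i y * s l y else 0) else 0) - (if y = l then (if x = i then s i y * s l x else 0) else 0)
      - (if y = i then (if x = l then s i x * s l y else 0) else 0) + (if y = i then (if y = l then s i x * s l x else 0) else 0)))"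
    unfolding sde_noise_eq[OF p] s_def[symmetric] using \<beta>
    by (intro sum.cong refl) auto
  also have "\<dots> = \<beta> * ((if i = l then \<Sum>y\<in>UNIV. s i y * s l y else 0) - s i l * s l i - s i l * s l i +
      (if i = l then \<Sum>x\<in>UNIV. s i x * s l x else 0))"
  proof -
    have a: "(\<Sum>x\<in>UNIV. \<Sum>y\<in>UNIV. (if x = i then (if x = l then s i y * s l y else 0) else 0)) = (if i = l then \<Sum>y\<in>UNIV. s i y * s l y else 0)"
    proof -
      have "(\<Sum>y\<in>UNIV. (if x = i then (if x = l then s i y * s l y else 0) else 0)) = (if x = i then (if i = l then \<Sum>y\<in>UNIV. s i y * s l y else 0) else 0)" for x
        by auto
      then show ?thesis by simp
    qed
    have b: "(\<Sum>x\<in>UNIV. \<Sum>y\<in>UNIV. (if y = l then (if x = i then s i y * s l x else 0) else 0)) = s i l * s l i"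
      by simp
    have c: "(\<Sum>x\<in>UNIV. \<Sum>y\<in>UNIV. (if y = i then (if x = l then s i x * s l y else 0) else 0)) = s i l * s l i"
      by simp
    have d: "(\<Sum>x\<in>UNIV. \<Sum>y\<in>UNIV. (if y = i then (if y = l then s i x * s l x else 0) else 0)) = (if i = l then \<Sum>x\<in>UNIV. s i x * s l x else 0)"
      by simp
    show ?thesis
      unfolding sum_distrib_left[symmetric] sum.distrib sum_subtractf a b c d ..
  qed
  also have "\<dots> = 2 * \<beta> * lap p $ i $ l"
  proof (cases "i = l")
    case True
    have "s l l = 0" by (simp add: s_def w_diag)
    moreover have "(\<Sum>y\<in>UNIV. s l y * s l y) = (\<Sum>k\<in>UNIV. w $ k $ l * th k l p)"
      by (simp add: ss w_sym th_sym[OF p])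
    ultimately show ?thesis using True by (simp add: lap_entry)
  next
    case False
    then show ?thesis using ss[of i l] sym[of l i] by (simp add: lap_entry)
  qed
  finally show ?thesis .
qed

theorem generator_eq:
  assumes U: "open U" "p \<in> U" "U \<subseteq> orthant" and \<Phi>: "C2_on U \<Phi>"
  shows "generator (sde_drift E w \<phi> \<theta> \<beta>) (covariation (sde_noise E w \<theta> \<beta>)) \<Phi> p =
    1/2 * (\<Sum>i\<in>UNIV. \<Sum>j\<in>UNIV. w $ i $ j * (coef i j p * edge_deriv i j \<Phi> p +
       \<beta> * (edge_deriv i j (th i j) p * edge_deriv i j \<Phi> p + th i j p * edge_deriv i j (edge_deriv i j \<Phi>) p)))"
proof -
  have p: "p \<in> orthant" using U by blast
  have d\<Phi>: "\<Phi> differentiable (at p)" by (rule C2_on_differentiable[OF \<Phi> U(2)])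
  let ?B = "\<lambda>i j. w $ i $ j * (coef i j p + \<beta> * edge_deriv i j (th i j) p)"
  have "sde_drift E w \<phi> \<theta> \<beta> p \<bullet> grad \<Phi> p = (\<Sum>i\<in>UNIV. \<Sum>j\<in>UNIV. ?B i j * partial i \<Phi> p)"
    by (simp add: inner_vec_def sde_drift_eq[OF p] grad_def sum_distrib_right)
  also have "\<dots> = 1/2 * (\<Sum>i\<in>UNIV. \<Sum>j\<in>UNIV. ?B i j * (partial i \<Phi> p - partial j \<Phi> p))"
  proof (rule antisymmetric_sum)
    fix i j
    show "?B j i = - ?B i j"
      using coef_swap[OF p, of j i] edge_deriv_th_swap[OF p, of j i] w_sym[of j i] by (simp add: algebra_simps)
  qed
  finally have 1: "sde_drift E w \<phi> \<theta> \<beta> p \<bullet> grad \<Phi> p = 1/2 * (\<Sum>i\<in>UNIV. \<Sum>j\<in>UNIV. ?B i j * edge_deriv i j \<Phi> p)"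
    by (simp only: edge_deriv_eq[OF d\<Phi>])
  let ?h = "\<lambda>i j. partial i (partial j \<Phi>) p"
  have "(\<Sum>i\<in>UNIV. \<Sum>j\<in>UNIV. covariation (sde_noise E w \<theta> \<beta>) p $ i $ j * ?h i j) =
     2 * \<beta> * (\<Sum>i\<in>UNIV. \<Sum>j\<in>UNIV. (if i = j then \<Sum>k\<in>UNIV. w $ k $ i * th k i p else - (w $ i $ j * th i j p)) * ?h i j)"
    unfolding covariation_eq[OF p] lap_entry sum_distrib_left by (simp only: mult.assoc)
  also have "\<dots> = 2 * \<beta> * (1/2 * (\<Sum>i\<in>UNIV. \<Sum>j\<in>UNIV. (w $ i $ j * th i j p) * (?h i i - ?h i j - ?h j i + ?h j j)))"
  proof -
    have s1: "w $ i $ j * th i j p = w $ j $ i * th j i p" for i j using w_sym[of i j] th_sym[OF p, of i j] by simp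
    have s2: "w $ i $ i * th i i p = 0" for i by (simp add: w_diag)
    show ?thesis using laplacian_form_sum[of "\<lambda>i j. w $ i $ j * th i j p" ?h, OF s1 s2] by simp
  qed
  finally have 2: "1/2 * (\<Sum>i\<in>UNIV. \<Sum>j\<in>UNIV. covariation (sde_noise E w \<theta> \<beta>) p $ i $ j * ?h i j) =
     1/2 * (\<Sum>i\<in>UNIV. \<Sum>j\<in>UNIV. \<beta> * ((w $ i $ j * th i j p) * edge_deriv i j (edge_deriv i j \<Phi>) p))"
    unfolding edge_deriv_edge_deriv[OF U(1,2) \<Phi>] sum_distrib_left[symmetric] by simp
  show ?thesis
    unfolding generator_def 1 2 distrib_left[symmetric] sum.distrib[symmetric]
    by (intro arg_cong[where f="\<lambda>x. 1/2 * x"] sum.cong refl) (simp add: algebra_simps)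
qed

section \<open>The Fokker--Planck operator\<close>

text \<open>
  The probability current along an edge: transport by the drift coefficient minus diffusion.
\<close>

definition prob_flux :: "(real^'n \<Rightarrow> real) \<Rightarrow> 'n \<Rightarrow> 'n \<Rightarrow> real^'n \<Rightarrow> real" where
  "prob_flux u i j q = coef i j q * u q - \<beta> * (th i j q * edge_deriv i j u q)"

lemma C1_prob_flux:
  assumes "U \<subseteq> orthant" "C2_on U u"
  shows "C1_on U (prob_flux u i j)"
  unfolding prob_flux_def[abs_def]
  by (intro C1_on_diff C1_on_mult C1_on_cmult C1_on_subset[OF C1_coef assms(1)] C2_on_imp_C1_on[OF assms(2)]
      C1_on_subset[OF C2_on_imp_C1_on[OF C2_th] assms(1)] C1_on_edge_deriv[OF assms(2)])

abbreviation fp_operator :: "(real^'n \<Rightarrow> real) \<Rightarrow> real^'n \<Rightarrow> real" where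
  "fp_operator u p \<equiv> \<beta> * LW_adj E w \<theta> u p - divergence (\<lambda>q. u q *\<^sub>R Q_field E w q) p"

theorem fp_operator_eq:
  assumes U: "open U" "p \<in> U" "U \<subseteq> orthant" and u: "C2_on U u"
  shows "fp_operator u p = - (1/2 * (\<Sum>i\<in>UNIV. \<Sum>j\<in>UNIV. w $ i $ j * edge_deriv i j (prob_flux u i j) p))"
proof -
  let ?K1 = "\<lambda>i j q. w $ i $ j * (u q * (th i j q * edge_deriv i j lnPi q))"
  let ?K2 = "\<lambda>i j q. w $ i $ j * (th i j q * edge_deriv i j u q)"
  let ?K3 = "\<lambda>i j q. w $ i $ j * (u q * flux i j q)"
  have O: "q \<in> orthant" if "q \<in> U" for q using that U(3) by blast
  have p: "p \<in> orthant" by (rule O[OF U(2)])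
  have du: "u differentiable (at q)" if "q \<in> U" for q by (rule C2_on_differentiable[OF u that])
  note d1 = du[OF U(2)] diff_th[OF p] C1_on_differentiable[OF C1_on_edge_deriv[OF C2_lnPi] p]
    C1_on_differentiable[OF C1_on_edge_deriv[OF u] U(2)] C2_on_differentiable[OF C2_flux p]
  have D1: "divergence (\<lambda>q. u q *\<^sub>R (lap q *v grad lnPi q)) p = 1/2 * (\<Sum>i\<in>UNIV. \<Sum>j\<in>UNIV. edge_deriv i j (?K1 i j) p)"
  proof (rule divergence_antisymmetric[OF U(1,2)])
    fix q i assume q: "q \<in> U"
    show "(u q *\<^sub>R (lap q *v grad lnPi q)) $ i = (\<Sum>j\<in>UNIV. ?K1 i j q)"
      by (simp add: lap_mult[OF O[OF q]] sum_distrib_left grad_def edge_deriv_eq[OF diff_lnPi[OF O[OF q]]] mult_ac)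
  next
    show "?K1 i j differentiable (at p)" for i j by (intro differentiable_mult differentiable_const d1)
    show "?K1 j i q = - ?K1 i j q" if "q \<in> U" for i j q
      using w_sym[of j i] th_sym[OF O[OF that], of j i] edge_deriv_swap[OF diff_lnPi[OF O[OF that]], of j i] by simp
  qed
  have D2: "divergence (\<lambda>q. lap q *v grad u q) p = 1/2 * (\<Sum>i\<in>UNIV. \<Sum>j\<in>UNIV. edge_deriv i j (?K2 i j) p)"
  proof (rule divergence_antisymmetric[OF U(1,2)])
    fix q i assume q: "q \<in> U"
    show "(lap q *v grad u q) $ i = (\<Sum>j\<in>UNIV. ?K2 i j q)"
      by (simp add: lap_mult[OF O[OF q]] grad_def edge_deriv_eq[OF du[OF q]] mult_ac)
  next
    show "?K2 i j differentiable (at p)" for i j by (intro differentiable_mult differentiable_const d1)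
    show "?K2 j i q = - ?K2 i j q" if "q \<in> U" for i j q
      using w_sym[of j i] th_sym[OF O[OF that], of j i] edge_deriv_swap[OF du[OF that], of j i] by simp
  qed
  have D3: "divergence (\<lambda>q. u q *\<^sub>R Q_field E w q) p = 1/2 * (\<Sum>i\<in>UNIV. \<Sum>j\<in>UNIV. edge_deriv i j (?K3 i j) p)"
  proof (rule divergence_antisymmetric[OF U(1,2)])
    fix q i assume q: "q \<in> U"
    show "(u q *\<^sub>R Q_field E w q) $ i = (\<Sum>j\<in>UNIV. ?K3 i j q)"
      by (simp add: Q_field_eq sum_distrib_left mult_ac)
  next
    show "?K3 i j differentiable (at p)" for i j by (intro differentiable_mult differentiable_const d1)
    show "?K3 j i q = - ?K3 i j q" if "q \<in> U" for i j q
      using w_sym[of j i] flux_swap[of j i q] by simp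
  qed
  have edge: "\<beta> * (1/2 * edge_deriv i j (?K1 i j) p + edge_deriv i j (?K2 i j) p) - edge_deriv i j (?K3 i j) p =
      - (w $ i $ j * edge_deriv i j (prob_flux u i j) p)" for i j
  proof -
    let ?k1 = "\<lambda>q. u q * (th i j q * edge_deriv i j lnPi q)" and ?k2 = "\<lambda>q. th i j q * edge_deriv i j u q"
      and ?k3 = "\<lambda>q. u q * flux i j q"
    have dk: "?k1 differentiable (at p)" "?k2 differentiable (at p)" "?k3 differentiable (at p)"
      by (intro differentiable_mult d1)+
    have "prob_flux u i j = (\<lambda>q. (?k3 q - \<beta> / 2 * ?k1 q) - \<beta> * ?k2 q)"
      by (simp add: fun_eq_iff prob_flux_def coef_def algebra_simps)
    moreover have "edge_deriv i j (\<lambda>q. (?k3 q - \<beta> / 2 * ?k1 q) - \<beta> * ?k2 q) p =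
        (edge_deriv i j ?k3 p - \<beta> / 2 * edge_deriv i j ?k1 p) - \<beta> * edge_deriv i j ?k2 p"
    proof -
      have dk': "(\<lambda>q. \<beta> / 2 * ?k1 q) differentiable (at p)" "(\<lambda>q. \<beta> * ?k2 q) differentiable (at p)"
        by (intro differentiable_mult differentiable_const d1)+
      have "edge_deriv i j (\<lambda>q. (?k3 q - \<beta> / 2 * ?k1 q) - \<beta> * ?k2 q) p =
          edge_deriv i j (\<lambda>q. ?k3 q - \<beta> / 2 * ?k1 q) p - edge_deriv i j (\<lambda>q. \<beta> * ?k2 q) p"
        by (rule edge_deriv_diff[OF differentiable_diff[OF dk(3) dk'(1)] dk'(2)])
      also have "\<dots> = (edge_deriv i j ?k3 p - edge_deriv i j (\<lambda>q. \<beta> / 2 * ?k1 q) p) - edge_deriv i j (\<lambda>q. \<beta> * ?k2 q) p"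
        by (simp only: edge_deriv_diff[OF dk(3) dk'(1)])
      finally show ?thesis by (simp only: edge_deriv_cmult[OF dk(1)] edge_deriv_cmult[OF dk(2)])
    qed
    ultimately have pf: "edge_deriv i j (prob_flux u i j) p =
        (edge_deriv i j ?k3 p - \<beta> / 2 * edge_deriv i j ?k1 p) - \<beta> * edge_deriv i j ?k2 p" by simp
    show ?thesis
      unfolding pf edge_deriv_cmult[OF dk(1)] edge_deriv_cmult[OF dk(2)] edge_deriv_cmult[OF dk(3)]
      by (simp add: algebra_simps)
  qed
  have "fp_operator u p = 1/2 * (\<Sum>i\<in>UNIV. \<Sum>j\<in>UNIV. \<beta> * (1/2 * edge_deriv i j (?K1 i j) p + edge_deriv i j (?K2 i j) p) - edge_deriv i j (?K3 i j) p)"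
    unfolding LW_adj_def D1 D2 D3 sum_subtractf sum.distrib sum_distrib_left[symmetric] by (simp add: algebra_simps)
  then show ?thesis unfolding edge sum_negf by simp
qed

lemma continuous_on_edge_deriv: "C1_on U f \<Longrightarrow> continuous_on U (edge_deriv i j f)"
  using C1_on_frechet_continuous[of U f "edge_dir i j"] by (simp add: edge_deriv_def[abs_def])

lemma continuous_on_fp_operator:
  assumes "C2_near_simplex u"
  shows "continuous_on prob_simplex (fp_operator u)"
proof -
  obtain U where U: "open U" "prob_simplex \<subseteq> U" "C2_on U u" using assms unfolding C2_near_simplex_def by blast
  let ?V = "U \<inter> orthant"
  have V: "open ?V" "?V \<subseteq> orthant" "prob_simplex \<subseteq> ?V"
    using U open_orthant prob_simplex_subset_orthant by auto
  have u: "C2_on ?V u" by (rule C2_on_subset[OF U(3)]) simp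
  have "continuous_on ?V (\<lambda>p. - (1/2 * (\<Sum>i\<in>UNIV. \<Sum>j\<in>UNIV. w $ i $ j * edge_deriv i j (prob_flux u i j) p)))"
    by (intro continuous_intros continuous_on_edge_deriv C1_prob_flux V u)
  then have "continuous_on ?V (fp_operator u)"
    by (rule continuous_on_eq) (rule fp_operator_eq[OF V(1) _ V(2) u, symmetric])
  then show ?thesis by (rule continuous_on_subset[OF _ V(3)])
qed

lemma continuous_on_generator:
  assumes U: "open U" "U \<subseteq> orthant" "C2_on U \<Phi>"
  shows "continuous_on U (generator (sde_drift E w \<phi> \<theta> \<beta>) (covariation (sde_noise E w \<theta> \<beta>)) \<Phi>)"
proof -
  have "continuous_on U (\<lambda>p. 1/2 * (\<Sum>i\<in>UNIV. \<Sum>j\<in>UNIV. w $ i $ j * (coef i j p * edge_deriv i j \<Phi> p +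
       \<beta> * (edge_deriv i j (th i j) p * edge_deriv i j \<Phi> p + th i j p * edge_deriv i j (edge_deriv i j \<Phi>) p))))"
    by (intro continuous_intros continuous_on_edge_deriv C1_on_edge_deriv U(3) C2_on_imp_C1_on[OF U(3)]
        C1_on_imp_continuous_on[OF C1_on_subset[OF C1_coef U(2)]]
        C1_on_subset[OF C2_on_imp_C1_on[OF C2_th] U(2)]
        C1_on_imp_continuous_on[OF C1_on_subset[OF C2_on_imp_C1_on[OF C2_th] U(2)]])
  then show ?thesis
    by (rule continuous_on_eq) (rule generator_eq[OF U(1) _ U(2,3), symmetric])
qed

text \<open>
  Derivatives along edges are tangential, so they vanish on the simplex off the support of \<open>h\<close>, although
  \<open>h\<close> need not vanish in a neighbourhood in the surrounding space.
\<close>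

lemma edge_deriv_zero_off_support:
  assumes U: "prob_simplex \<subseteq> U" "C1_on U h"
    and K: "compact K" "K \<subseteq> prob_simplex" "\<And>p. p \<in> prob_simplex - K \<Longrightarrow> h p = 0"
    and p: "p \<in> prob_simplex - K"
  shows "edge_deriv i j h p = 0"
proof -
  have "(\<Sum>k\<in>UNIV. p $ k) = 1" "p \<notin> K" using p by (auto simp: prob_simplex_def)
  from simplex_line_derivative(2)[OF U K sum_edge_dir this(1,2)] show ?thesis
    using p by (simp add: on_simplex_def edge_deriv_def)
qed

lemma generator_test_function:
  assumes "test_function \<Phi>"
  shows "continuous_on prob_simplex (generator (sde_drift E w \<phi> \<theta> \<beta>) (covariation (sde_noise E w \<theta> \<beta>)) \<Phi>)"
    and "compact_support_in_simplex (generator (sde_drift E w \<phi> \<theta> \<beta>) (covariation (sde_noise E w \<theta> \<beta>)) \<Phi>)"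
proof -
  obtain U where U: "open U" "prob_simplex \<subseteq> U" "C2_on U \<Phi>"
    using assms unfolding test_function_def C2_near_simplex_def by blast
  obtain K where K: "compact K" "K \<subseteq> prob_simplex" "\<forall>p\<in>prob_simplex - K. \<Phi> p = 0"
    using assms unfolding test_function_def by blast
  let ?V = "U \<inter> orthant"
  have V: "open ?V" "?V \<subseteq> orthant" "prob_simplex \<subseteq> ?V"
    using U open_orthant prob_simplex_subset_orthant by auto
  have \<Phi>: "C2_on ?V \<Phi>" by (rule C2_on_subset[OF U(3)]) simp
  show "continuous_on prob_simplex (generator (sde_drift E w \<phi> \<theta> \<beta>) (covariation (sde_noise E w \<theta> \<beta>)) \<Phi>)"
    by (rule continuous_on_subset[OF continuous_on_generator[OF V(1,2) \<Phi>] V(3)])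
  have z1: "edge_deriv i j \<Phi> p = 0" if "p \<in> prob_simplex - K" for p i j
    by (rule edge_deriv_zero_off_support[OF V(3) C2_on_imp_C1_on[OF \<Phi>] K(1,2) _ that]) (use K(3) in blast)
  have z2: "edge_deriv i j (edge_deriv i j \<Phi>) p = 0" if "p \<in> prob_simplex - K" for p i j
    by (rule edge_deriv_zero_off_support[OF V(3) C1_on_edge_deriv[OF \<Phi>] K(1,2) z1 that])
  have "generator (sde_drift E w \<phi> \<theta> \<beta>) (covariation (sde_noise E w \<theta> \<beta>)) \<Phi> p = 0" if p: "p \<in> prob_simplex - K" for p
  proof -
    have "p \<in> ?V" using p V(3) by blast
    from generator_eq[OF V(1) this V(2) \<Phi>] show ?thesis by (simp add: z1[OF p] z2[OF p])
  qed
  then show "compact_support_in_simplex (generator (sde_drift E w \<phi> \<theta> \<beta>) (covariation (sde_noise E w \<theta> \<beta>)) \<Phi>)"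
    unfolding compact_support_in_simplex_def using K(1,2) by blast
qed

lemma compact_support_mult1: "compact_support_in_simplex f \<Longrightarrow> compact_support_in_simplex (\<lambda>p. f p * g p)"
  unfolding compact_support_in_simplex_def by fastforce

text \<open>
  The integrands differ by derivatives along edges of the compactly supported functions \<open>W i j\<close>, which
  collect the terms that the product rule leaves over when derivatives are moved from \<open>\<Phi>\<close> to \<open>u\<close>.
\<close>

theorem generator_adjoint:
  "formal_adjoint_on_simplex (generator (sde_drift E w \<phi> \<theta> \<beta>) (covariation (sde_noise E w \<theta> \<beta>))) fp_operator"
  unfolding formal_adjoint_on_simplex_def
proof (intro allI impI)
  fix \<Phi> u :: "real^'n \<Rightarrow> real" assume \<Phi>t: "test_function \<Phi>" and ut: "C2_near_simplex u"
  let ?A = "generator (sde_drift E w \<phi> \<theta> \<beta>) (covariation (sde_noise E w \<theta> \<beta>))"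
  obtain U1 where U1: "open U1" "prob_simplex \<subseteq> U1" "C2_on U1 \<Phi>"
    using \<Phi>t unfolding test_function_def C2_near_simplex_def by blast
  obtain U2 where U2: "open U2" "prob_simplex \<subseteq> U2" "C2_on U2 u" using ut unfolding C2_near_simplex_def by blast
  obtain K where K: "compact K" "K \<subseteq> prob_simplex" "\<forall>p\<in>prob_simplex - K. \<Phi> p = 0"
    using \<Phi>t unfolding test_function_def by blast
  let ?V = "U1 \<inter> U2 \<inter> orthant"
  have V: "open ?V" "?V \<subseteq> orthant" "prob_simplex \<subseteq> ?V"
    using U1 U2 open_orthant prob_simplex_subset_orthant by auto
  have \<Phi>: "C2_on ?V \<Phi>" and u: "C2_on ?V u"
    by (rule C2_on_subset[OF U1(3)], blast, rule C2_on_subset[OF U2(3)], blast)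
  have uc: "continuous_on prob_simplex u" and \<Phi>c: "continuous_on prob_simplex \<Phi>"
    by (rule continuous_on_subset[OF C1_on_imp_continuous_on[OF C2_on_imp_C1_on[OF u]] V(3)],
        rule continuous_on_subset[OF C1_on_imp_continuous_on[OF C2_on_imp_C1_on[OF \<Phi>]] V(3)])
  have \<Phi>s: "compact_support_in_simplex \<Phi>" unfolding compact_support_in_simplex_def using K by blast
  define W where "W i j q = \<Phi> q * prob_flux u i j q + \<beta> * (th i j q * (u q * edge_deriv i j \<Phi> q))" for i j q
  have C1W: "C1_on ?V (W i j)" for i j
    unfolding W_def[abs_def]
    by (intro C1_on_add C1_on_mult C1_on_cmult C1_prob_flux V u C2_on_imp_C1_on[OF \<Phi>] C2_on_imp_C1_on[OF u]
        C1_on_subset[OF C2_on_imp_C1_on[OF C2_th] V(2)] C1_on_edge_deriv[OF \<Phi>])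
  have z1: "edge_deriv i j \<Phi> p = 0" if "p \<in> prob_simplex - K" for p i j
    by (rule edge_deriv_zero_off_support[OF V(3) C2_on_imp_C1_on[OF \<Phi>] K(1,2) _ that]) (use K(3) in blast)
  have Wz: "W i j p = 0" if "p \<in> prob_simplex - K" for i j p
    using K(3) that z1[OF that] by (simp add: W_def)
  have Ws: "compact_support_in_simplex (W i j)" for i j
    unfolding compact_support_in_simplex_def using K(1,2) Wz by blast
  have W0: "(\<integral>p. edge_deriv i j (W i j) p \<partial>simplex_volume) = 0" for i j
    using integral_tangential_derivative_eq_0[OF V(3) C1W Ws sum_edge_dir] by (simp add: edge_deriv_def)
  have Wi: "integrable simplex_volume (edge_deriv i j (W i j))" for i j
  proof (rule integrable_simplex_volume)
    show "continuous_on prob_simplex (edge_deriv i j (W i j))"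
      by (rule continuous_on_subset[OF continuous_on_edge_deriv[OF C1W] V(3)])
    have "edge_deriv i j (W i j) p = 0" if "p \<in> prob_simplex - K" for p
      by (rule edge_deriv_zero_off_support[OF V(3) C1W K(1,2) Wz that])
    then show "compact_support_in_simplex (edge_deriv i j (W i j))"
      unfolding compact_support_in_simplex_def using K(1,2) by blast
  qed
  have pt: "?A \<Phi> p * u p - \<Phi> p * fp_operator u p = 1/2 * (\<Sum>i\<in>UNIV. \<Sum>j\<in>UNIV. w $ i $ j * edge_deriv i j (W i j) p)"
    if p: "p \<in> prob_simplex" for p
  proof -
    have pV: "p \<in> ?V" and pO: "p \<in> orthant" using p V by auto
    note d = C2_on_differentiable[OF \<Phi> pV] C2_on_differentiable[OF u pV] diff_th[OF pO]
      C1_on_differentiable[OF C1_prob_flux[OF V(2) u] pV] C1_on_differentiable[OF C1_on_edge_deriv[OF \<Phi>] pV]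
    have e: "edge_deriv i j (W i j) p = \<Phi> p * edge_deriv i j (prob_flux u i j) p + edge_deriv i j \<Phi> p * prob_flux u i j p +
        \<beta> * (th i j p * (u p * edge_deriv i j (edge_deriv i j \<Phi>) p + edge_deriv i j u p * edge_deriv i j \<Phi> p) +
          edge_deriv i j (th i j) p * (u p * edge_deriv i j \<Phi> p))" for i j
    proof -
      have m: "(\<lambda>q. \<Phi> q * prob_flux u i j q) differentiable (at p)" "(\<lambda>q. u q * edge_deriv i j \<Phi> q) differentiable (at p)"
        "(\<lambda>q. th i j q * (u q * edge_deriv i j \<Phi> q)) differentiable (at p)"
        "(\<lambda>q. \<beta> * (th i j q * (u q * edge_deriv i j \<Phi> q))) differentiable (at p)"
        by (intro differentiable_mult differentiable_const d)+
      show ?thesis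
        unfolding W_def[abs_def] edge_deriv_add[OF m(1) m(4)] edge_deriv_cmult[OF m(3)]
          edge_deriv_mult[OF d(1) d(4)] edge_deriv_mult[OF d(3) m(2)] edge_deriv_mult[OF d(2) d(5)] ..
    qed
    have summand: "w $ i $ j * edge_deriv i j (W i j) p =
      w $ i $ j * (coef i j p * edge_deriv i j \<Phi> p +
       \<beta> * (edge_deriv i j (th i j) p * edge_deriv i j \<Phi> p + th i j p * edge_deriv i j (edge_deriv i j \<Phi>) p)) * u p
       + \<Phi> p * (w $ i $ j * edge_deriv i j (prob_flux u i j) p)" for i j
      unfolding e by (simp add: prob_flux_def algebra_simps)
    show ?thesis
      unfolding generator_eq[OF V(1) pV V(2) \<Phi>] fp_operator_eq[OF V(1) pV V(2) u] summand sum.distrib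
        sum_distrib_right[symmetric] sum_distrib_left[symmetric]
      by (simp add: algebra_simps)
  qed
  have i1: "integrable simplex_volume (\<lambda>p. ?A \<Phi> p * u p)"
    by (intro integrable_simplex_volume continuous_on_mult generator_test_function[OF \<Phi>t] uc compact_support_mult1)
  have i2: "integrable simplex_volume (\<lambda>p. \<Phi> p * fp_operator u p)"
    by (intro integrable_simplex_volume continuous_on_mult continuous_on_fp_operator[OF ut] \<Phi>c \<Phi>s compact_support_mult1)
  have "(\<integral>p. ?A \<Phi> p * u p \<partial>simplex_volume) - (\<integral>p. \<Phi> p * fp_operator u p \<partial>simplex_volume) =
      (\<integral>p. ?A \<Phi> p * u p - \<Phi> p * fp_operator u p \<partial>simplex_volume)"
    using i1 i2 by simp
  also have "\<dots> = (\<integral>p. 1/2 * (\<Sum>i\<in>UNIV. \<Sum>j\<in>UNIV. w $ i $ j * edge_deriv i j (W i j) p) \<partial>simplex_volume)"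
    by (rule Bochner_Integration.integral_cong[OF refl]) (rule pt, simp add: space_simplex_volume)
  also have "\<dots> = 1/2 * (\<Sum>i\<in>UNIV. \<Sum>j\<in>UNIV. w $ i $ j * (\<integral>p. edge_deriv i j (W i j) p \<partial>simplex_volume))"
    using Wi by (simp add: Bochner_Integration.integral_sum Bochner_Integration.integrable_sum)
  also have "\<dots> = 0" by (simp add: W0)
  finally show "(\<integral>p. ?A \<Phi> p * u p \<partial>simplex_volume) = (\<integral>p. \<Phi> p * fp_operator u p \<partial>simplex_volume)" by simp
qed

lemma gibbs_exponential: "q \<in> orthant \<Longrightarrow> gibbs_weight E w \<phi> \<theta> \<beta> q = exp (- (1 / \<beta>) * Dphi q - 1/2 * lnPi q)"
proof -
  assume q: "q \<in> orthant"
  have "Pi_lap E w \<theta> q powr (- 1/2) = exp (- 1/2 * lnPi q)"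
    using Pi_lap_eq_det(2)[OF q] by (simp add: powr_def)
  then show ?thesis by (simp add: gibbs_weight_def exp_add[symmetric])
qed

text \<open>
  Detailed balance. The derivative along an edge of \<open>- D\<^sub>\<phi> / \<beta> - 1/2 * log \<Pi>\<close> contains one term for
  each of the two parts of the drift coefficient, and the diffusive current cancels both.
\<close>

lemma gibbs_prob_flux: "q \<in> orthant \<Longrightarrow> prob_flux (\<lambda>q. c * gibbs_weight E w \<phi> \<theta> \<beta> q) i j q = 0"
proof -
  assume q: "q \<in> orthant"
  let ?g = "\<lambda>q. - (1 / \<beta>) * Dphi q - 1/2 * lnPi q"
  have dD: "Dphi differentiable (at q)" by (rule C2_on_differentiable[OF C2_Dphi q])
  have m: "(\<lambda>q. - (1 / \<beta>) * Dphi q) differentiable (at q)" "(\<lambda>q. 1/2 * lnPi q) differentiable (at q)"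
    by (intro differentiable_mult differentiable_const dD diff_lnPi[OF q])+
  have g: "edge_deriv i j ?g q = - (1 / \<beta>) * edge_deriv i j Dphi q - 1/2 * edge_deriv i j lnPi q"
    unfolding edge_deriv_diff[OF m] edge_deriv_cmult[OF dD] edge_deriv_cmult[OF diff_lnPi[OF q]] ..
  have dg: "?g differentiable (at q)" by (rule differentiable_diff[OF m])
  have "edge_deriv i j (\<lambda>q. c * gibbs_weight E w \<phi> \<theta> \<beta> q) q = edge_deriv i j (\<lambda>q. c * exp (?g q)) q"
    by (rule edge_deriv_cong[OF open_orthant q]) (simp only: gibbs_exponential)
  also have "\<dots> = c * (exp (?g q) * edge_deriv i j ?g q)"
    using edge_deriv_cmult[OF edge_deriv_compose(2)[OF dg DERIV_exp], of i j c] edge_deriv_compose(1)[OF dg DERIV_exp, of i j]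
    by (simp only:)
  finally have "edge_deriv i j (\<lambda>q. c * gibbs_weight E w \<phi> \<theta> \<beta> q) q =
      c * gibbs_weight E w \<phi> \<theta> \<beta> q * (- (1 / \<beta>) * edge_deriv i j Dphi q - 1/2 * edge_deriv i j lnPi q)"
    unfolding gibbs_exponential[OF q] g by simp
  note Du = this
  have "prob_flux (\<lambda>q. c * gibbs_weight E w \<phi> \<theta> \<beta> q) i j q =
     c * gibbs_weight E w \<phi> \<theta> \<beta> q * (flux i j q + th i j q * edge_deriv i j Dphi q)"
    unfolding prob_flux_def Du coef_def using \<beta> by (simp add: field_simps)
  then show ?thesis using th_edge_deriv_Dphi[OF q, of i j] by simp
qed

theorem gibbs_stationary:
  "fokker_planck_solution E w \<theta> \<beta> (\<lambda>t p. c * gibbs_weight E w \<phi> \<theta> \<beta> p)"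
  unfolding fokker_planck_solution_def
proof (intro allI impI conjI ballI)
  let ?u = "\<lambda>p. c * gibbs_weight E w \<phi> \<theta> \<beta> p"
  have C2: "C2_on orthant ?u" by (intro C2_on_cmult open_orthant C2_gibbs)
  show "C2_near_simplex ?u"
    unfolding C2_near_simplex_def using open_orthant prob_simplex_subset_orthant C2 by blast
  show "(\<lambda>s. ?u p) differentiable (at t)" for t :: real and p by simp
  fix t :: real and p :: "real^'n" assume "p \<in> prob_simplex"
  then have p: "p \<in> orthant" using prob_simplex_subset_orthant by blast
  have "edge_deriv i j (prob_flux ?u i j) p = 0" for i j
  proof -
    have "edge_deriv i j (prob_flux ?u i j) p = edge_deriv i j (\<lambda>q. 0) p"
      by (rule edge_deriv_cong[OF open_orthant p]) (rule gibbs_prob_flux)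
    then show ?thesis by (simp add: edge_deriv_def)
  qed
  then have "fp_operator ?u p = 0" using fp_operator_eq[OF open_orthant p order_refl C2] by simp
  then show "deriv (\<lambda>s. ?u p) t + divergence (\<lambda>q. ?u q *\<^sub>R Q_field E w q) p = \<beta> * LW_adj E w \<theta> ?u p" by simp
qed

end

section \<open>From the weak to the pointwise equation\<close>

lemma DERIV_max_0_power:
  "((\<lambda>s :: real. max 0 s ^ Suc (Suc n)) has_real_derivative real (Suc (Suc n)) * max 0 s ^ Suc n) (at s)"
proof -
  consider "0 < s" | "s < 0" | "s = 0" by linarith
  then show ?thesis
  proof cases
    case 1
    have "((\<lambda>s. s ^ Suc (Suc n)) has_real_derivative real (Suc (Suc n)) * s ^ Suc n) (at s)"
      using DERIV_pow[of "Suc (Suc n)" s] by simp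
    then have "((\<lambda>s. max 0 s ^ Suc (Suc n)) has_real_derivative real (Suc (Suc n)) * s ^ Suc n) (at s)"
      by (rule has_field_derivative_transform_within_open[where S="{0<..}"]) (use 1 in auto)
    then show ?thesis using 1 by simp
  next
    case 2
    have "((\<lambda>s. max 0 s ^ Suc (Suc n)) has_real_derivative 0) (at s)"
      by (rule has_field_derivative_transform_within_open[where S="{..<0}" and f="\<lambda>_. 0"]) (use 2 in auto)
    then show ?thesis using 2 by simp
  next
    case 3
    have "(\<forall>z :: real. max 0 z ^ Suc (Suc n) - max 0 0 ^ Suc (Suc n) = max 0 z ^ Suc n * (z - 0)) \<and>
        isCont (\<lambda>z :: real. max 0 z ^ Suc n) 0 \<and> max 0 0 ^ Suc n = (0 :: real)"
    proof (intro conjI allI)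
      show "max 0 z ^ Suc (Suc n) - max 0 0 ^ Suc (Suc n) = max 0 z ^ Suc n * (z - 0)" for z :: real
        by (simp add: max_def)
      show "isCont (\<lambda>z :: real. max 0 z ^ Suc n) 0" by (intro continuous_intros)
    qed simp
    then have "((\<lambda>s :: real. max 0 s ^ Suc (Suc n)) has_real_derivative 0) (at 0)"
      unfolding CARAT_DERIV by (intro exI[where x="\<lambda>z. max 0 z ^ Suc n"])
    then show ?thesis using 3 by simp
  qed
qed

text \<open>
  The third power of the positive part is the smallest natural power for which the function is of class
  \<open>C\<^sup>2\<close>. The squared distance is written out in coordinates, where it is visibly a polynomial.
\<close>

definition bump :: "real^'n::finite \<Rightarrow> real \<Rightarrow> real^'n \<Rightarrow> real" where
  "bump c r p = max 0 (r\<^sup>2 - (\<Sum>i\<in>UNIV. (p $ i - c $ i) * (p $ i - c $ i))) ^ 3"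

lemma bump_eq: "bump c r p = max 0 (r\<^sup>2 - (norm (p - c))\<^sup>2) ^ 3"
  by (simp add: bump_def power2_norm_eq_inner inner_vec_def)

lemma bump_nonneg: "0 \<le> bump c r p"
  by (simp add: bump_def)

lemma bump_center: "0 < r \<Longrightarrow> 0 < bump c r c"
  by (simp add: bump_eq)

lemma bump_outside: "0 < r \<Longrightarrow> p \<notin> cball c r \<Longrightarrow> bump c r p = 0"
proof -
  assume r: "0 < r" and p: "p \<notin> cball c r"
  have "r \<le> norm (p - c)" using p by (simp add: dist_norm norm_minus_commute)
  then have "r\<^sup>2 \<le> (norm (p - c))\<^sup>2" using r by (intro power_mono) auto
  then show ?thesis by (simp add: bump_eq)
qed

lemma C2_bump: "C2_on UNIV (bump c r)"
  unfolding bump_def[abs_def]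
proof (rule C2_on_compose_real[where T=UNIV and h="\<lambda>s. max 0 s ^ 3" and h'="\<lambda>s. 3 * max 0 s ^ 2"
      and h''="\<lambda>s. 3 * (2 * max 0 s)"])
  show "C2_on UNIV (\<lambda>p. r\<^sup>2 - (\<Sum>i\<in>UNIV. (p $ i - c $ i) * (p $ i - c $ i)))"
    by (intro C2_on_diff C2_on_sum C2_on_mult C2_on_const C2_on_nth open_UNIV)
  show "((\<lambda>s. max 0 s ^ 3) has_real_derivative 3 * (max 0 s)\<^sup>2) (at s)" for s :: real
    using DERIV_max_0_power[of 1 s] by (simp add: numeral_3_eq_3 numeral_2_eq_2)
  show "((\<lambda>s. 3 * (max 0 s)\<^sup>2) has_real_derivative 3 * (2 * max 0 s)) (at s)" for s :: real
    using DERIV_cmult[OF DERIV_max_0_power[of 0 s], of 3] by (simp add: numeral_2_eq_2)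
qed (auto intro!: continuous_intros)

lemma line_derivative:
  fixes f :: "real^'n::finite \<Rightarrow> real"
  assumes "C1_on UNIV f"
  shows "((\<lambda>\<tau>. f (x + \<tau> *\<^sub>R v)) has_real_derivative (\<Sum>i\<in>UNIV. v $ i * partial i f (x + \<tau> *\<^sub>R v))) (at \<tau>)"
proof -
  let ?y = "x + \<tau> *\<^sub>R v"
  have d: "(f has_derivative frechet_derivative f (at ?y)) (at ?y)"
    by (rule C1_on_has_derivative[OF assms]) simp
  have l: "((\<lambda>\<tau>. x + \<tau> *\<^sub>R v) has_derivative (\<lambda>s. s *\<^sub>R v)) (at \<tau>)"
    by (auto intro!: derivative_eq_intros)
  have "((\<lambda>\<tau>. f (x + \<tau> *\<^sub>R v)) has_derivative (\<lambda>s. frechet_derivative f (at ?y) (s *\<^sub>R v))) (at \<tau>)"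
    using diff_chain_at[OF l d] by (simp add: o_def)
  moreover have "frechet_derivative f (at ?y) (s *\<^sub>R v) = (\<Sum>i\<in>UNIV. v $ i * partial i f ?y) * s" for s
    using linear_scale[OF has_derivative_linear[OF d], of s v]
      frechet_linear_arg(2)[OF C1_on_differentiable[OF assms, of ?y], of v] by simp
  ultimately show ?thesis by (simp add: has_field_derivative_def)
qed

definition hess :: "(real^'n::finite \<Rightarrow> real) \<Rightarrow> real^'n \<Rightarrow> 'n \<Rightarrow> 'n \<Rightarrow> real" where
  "hess f x i j = partial i (partial j f) x"

lemma continuous_on_hess:
  assumes "C2_on UNIV f"
  shows "continuous_on S (\<lambda>x. hess f x i j)"
proof -
  have "continuous_on UNIV (\<lambda>x. hess f x i j)"
    unfolding hess_def partial_def[of i]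
    by (rule C1_on_frechet_continuous[OF C1_on_partial[OF assms]])
  then show ?thesis by (rule continuous_on_subset) simp
qed

text \<open>
  Taylor's formula with the Lagrange remainder on the segment from \<open>x\<close> to \<open>y\<close>. The segment stays in a
  ball, on which the second derivatives are uniformly continuous.
\<close>

lemma C2_second_order_expansion:
  fixes f :: "real^'n::finite \<Rightarrow> real"
  assumes f: "C2_on UNIV f" and S: "bounded S"
  shows "second_order_expansion_on S f (grad f) (hess f)"
  unfolding second_order_expansion_on_def
proof (intro allI impI)
  fix \<epsilon> :: real assume \<epsilon>: "0 < \<epsilon>"
  obtain R where R: "S \<subseteq> cball 0 R" using bounded_subset_ballD[OF S, of 0] ball_subset_cball by blast
  define \<eta> where "\<eta> = \<epsilon> / (real CARD('n))\<^sup>2"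
  have \<eta>: "0 < \<eta>" using \<epsilon> by (simp add: \<eta>_def)
  have "\<exists>\<delta>>0. \<forall>x\<in>cball 0 R. \<forall>y\<in>cball 0 R. norm (y - x) < \<delta> \<longrightarrow> \<bar>hess f y i j - hess f x i j\<bar> < \<eta>" for i j
  proof -
    have "uniformly_continuous_on (cball 0 R) (\<lambda>x. hess f x i j)"
      by (rule compact_uniformly_continuous[OF continuous_on_hess[OF f] compact_cball])
    then show ?thesis using \<eta> unfolding uniformly_continuous_on_def dist_norm real_norm_def by blast
  qed
  then obtain d where d: "\<forall>i j. 0 < d i j \<and> (\<forall>x\<in>cball 0 R. \<forall>y\<in>cball 0 R. norm (y - x) < d i j \<longrightarrow> \<bar>hess f y i j - hess f x i j\<bar> < \<eta>)"
    by metis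
  define \<delta> where "\<delta> = Min (range (\<lambda>(i, j). d i j))"
  have \<delta>: "0 < \<delta>" unfolding \<delta>_def using d by (subst Min_gr_iff) auto
  have \<delta>d: "\<delta> \<le> d i j" for i j
    unfolding \<delta>_def by (intro Min_le) (auto intro: range_eqI[of _ _ "(i, j)"])
  show "\<exists>\<delta>>0. \<forall>x\<in>S. \<forall>y\<in>S. norm (y - x) < \<delta> \<longrightarrow>
      \<bar>f y - f x - grad f x \<bullet> (y - x) - 1 / 2 * quad (hess f x) (y - x) (y - x)\<bar> \<le> \<epsilon> * (norm (y - x))\<^sup>2"
  proof (intro exI[of _ \<delta>] conjI ballI impI \<delta>)
    fix x y assume xy: "x \<in> S" "y \<in> S" and lt: "norm (y - x) < \<delta>"
    define v where "v = y - x"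
    define D where "D m \<tau> = (if m = 0 then f (x + \<tau> *\<^sub>R v) else if m = 1 then \<Sum>j\<in>UNIV. v $ j * partial j f (x + \<tau> *\<^sub>R v)
        else quad (hess f (x + \<tau> *\<^sub>R v)) v v)" for m :: nat and \<tau>
    have D0: "DERIV (D 0) \<tau> :> D 1 \<tau>" for \<tau>
      using line_derivative[OF C2_on_imp_C1_on[OF f]] by (simp add: D_def[abs_def])
    have D1: "DERIV (D 1) \<tau> :> D 2 \<tau>" for \<tau>
    proof -
      have "((\<lambda>\<tau>. \<Sum>j\<in>UNIV. v $ j * partial j f (x + \<tau> *\<^sub>R v)) has_real_derivative
          (\<Sum>j\<in>UNIV. v $ j * (\<Sum>i\<in>UNIV. v $ i * partial i (partial j f) (x + \<tau> *\<^sub>R v)))) (at \<tau>)"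
        by (intro DERIV_sum DERIV_cmult line_derivative C1_on_partial f)
      moreover have "(\<Sum>j\<in>UNIV. v $ j * (\<Sum>i\<in>UNIV. v $ i * partial i (partial j f) (x + \<tau> *\<^sub>R v))) =
          quad (hess f (x + \<tau> *\<^sub>R v)) v v"
        unfolding quad_def hess_def sum_distrib_left by (subst sum.swap) (simp add: mult_ac)
      ultimately show ?thesis by (simp add: D_def[abs_def])
    qed
    have "\<forall>m t. m < 2 \<and> 0 \<le> t \<and> t \<le> 1 \<longrightarrow> DERIV (D m) t :> D (Suc m) t"
      using D0 D1 by (auto simp: less_Suc_eq numeral_2_eq_2)
    from Maclaurin[of 1 2 D "D 0", OF _ _ refl this] obtain \<tau> where \<tau>: "0 < \<tau>" "\<tau> < 1"
      and e: "D 0 1 = (\<Sum>m<2. D m 0 / fact m * 1 ^ m) + D 2 \<tau> / fact 2 * 1 ^ 2" by auto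
    have "D 0 1 = D 0 0 + D 1 0 + D 2 \<tau> / 2" using e by (simp add: numeral_2_eq_2)
    then have fy: "f y = f x + grad f x \<bullet> v + quad (hess f (x + \<tau> *\<^sub>R v)) v v / 2"
      by (simp add: D_def v_def grad_def inner_vec_def mult.commute)
    have "x + \<tau> *\<^sub>R v = (1 - \<tau>) *\<^sub>R x + \<tau> *\<^sub>R y" by (simp add: v_def algebra_simps)
    moreover have "x \<in> cball 0 R" "y \<in> cball 0 R" using R xy by auto
    ultimately have zR: "x + \<tau> *\<^sub>R v \<in> cball 0 R" and xR: "x \<in> cball 0 R"
      using \<tau> convexD_alt[OF convex_cball, of x 0 R y \<tau>] by auto
    have "norm (\<tau> *\<^sub>R v) \<le> 1 * norm v" unfolding norm_scaleR using \<tau> by (intro mult_right_mono) auto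
    then have nz: "norm (x + \<tau> *\<^sub>R v - x) < d i j" for i j
      using lt \<delta>d[of i j] by (simp add: v_def)
    have Hd: "\<bar>hess f (x + \<tau> *\<^sub>R v) i j - hess f x i j\<bar> \<le> \<eta>" for i j
      using d[rule_format, of i j] xR zR nz[of i j] by (auto intro: less_imp_le)
    have "quad (hess f (x + \<tau> *\<^sub>R v)) v v - quad (hess f x) v v =
        quad (\<lambda>i j. hess f (x + \<tau> *\<^sub>R v) i j - hess f x i j) v v"
      by (simp add: quad_def sum_subtractf left_diff_distrib)
    then have "\<bar>quad (hess f (x + \<tau> *\<^sub>R v)) v v - quad (hess f x) v v\<bar> \<le> \<eta> * (real CARD('n))\<^sup>2 * (norm v * norm v)"
      using quad_bound[OF Hd] by simp
    also have "\<dots> = \<epsilon> * (norm v)\<^sup>2" by (simp add: \<eta>_def power2_eq_square)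
    finally have q: "\<bar>quad (hess f (x + \<tau> *\<^sub>R v)) v v - quad (hess f x) v v\<bar> \<le> \<epsilon> * (norm v)\<^sup>2" .
    define dq where "dq = quad (hess f (x + \<tau> *\<^sub>R v)) v v - quad (hess f x) v v"
    have eq: "f y - f x - grad f x \<bullet> v - 1 / 2 * quad (hess f x) v v = 1 / 2 * dq"
      using fy by (simp add: dq_def)
    have "\<bar>1 / 2 * dq\<bar> \<le> \<epsilon> * (norm v)\<^sup>2" using q unfolding dq_def[symmetric] by linarith
    then have "\<bar>f y - f x - grad f x \<bullet> v - 1 / 2 * quad (hess f x) v v\<bar> \<le> \<epsilon> * (norm v)\<^sup>2"
      unfolding eq .
    then show "\<bar>f y - f x - grad f x \<bullet> (y - x) - 1 / 2 * quad (hess f x) (y - x) (y - x)\<bar> \<le> \<epsilon> * (norm (y - x))\<^sup>2"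
      by (simp add: v_def)
  qed
qed

text \<open>
  The average function is continuous up to the boundary, so the noise coefficients are bounded on the
  simplex as continuous functions on this compact set. The drift contains derivatives of \<open>\<theta>\<close> and has no
  such extension in general.
\<close>

definition closed_simplex :: "(real^'n::finite) set" where
  "closed_simplex = {p. (\<Sum>i\<in>UNIV. p $ i) = 1 \<and> (\<forall>i. 0 \<le> p $ i)}"

lemma compact_closed_simplex: "compact (closed_simplex :: (real^'n::finite) set)"
proof -
  have "closed {p :: real^'n. (\<Sum>i\<in>UNIV. p $ i) = 1}" by (intro closed_Collect_eq continuous_intros)
  moreover have "closed {p :: real^'n. 0 \<le> p $ i}" for i by (intro closed_Collect_le continuous_intros)
  ultimately have "closed ({p :: real^'n. (\<Sum>i\<in>UNIV. p $ i) = 1} \<inter> (\<Inter>i\<in>UNIV. {p. 0 \<le> p $ i}))"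
    by (intro closed_Int closed_INT) auto
  moreover have "closed_simplex = {p :: real^'n. (\<Sum>i\<in>UNIV. p $ i) = 1} \<inter> (\<Inter>i\<in>UNIV. {p. 0 \<le> p $ i})"
    by (auto simp: closed_simplex_def)
  ultimately have c: "closed (closed_simplex :: (real^'n) set)" by simp
  have "norm p \<le> 1" if "p \<in> closed_simplex" for p :: "real^'n"
  proof -
    have "norm p \<le> (\<Sum>i\<in>UNIV. \<bar>p $ i\<bar>)" by (rule norm_le_l1_cart)
    also have "\<dots> = 1" using that by (simp add: closed_simplex_def)
    finally show ?thesis .
  qed
  then have "bounded (closed_simplex :: (real^'n) set)" unfolding bounded_iff by blast
  then show ?thesis using c by (simp add: compact_eq_bounded_closed)
qed

lemma prob_simplex_subset_closed: "prob_simplex \<subseteq> closed_simplex"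
  by (auto simp: prob_simplex_def closed_simplex_def less_imp_le)

lemma bounded_prob_simplex: "bounded (prob_simplex :: (real^'n::finite) set)"
  by (rule bounded_subset[OF compact_imp_bounded[OF compact_closed_simplex] prob_simplex_subset_closed])

lemma continuous_bounded_on_simplex:
  fixes f :: "real^'n::finite \<Rightarrow> 'b::real_normed_vector"
  assumes "continuous_on closed_simplex f"
  shows "\<exists>C. \<forall>p\<in>prob_simplex. norm (f p) \<le> C"
proof -
  have "bounded (f ` closed_simplex)"
    by (intro compact_imp_bounded compact_continuous_image assms compact_closed_simplex)
  then show ?thesis using prob_simplex_subset_closed unfolding bounded_iff by blast
qed

lemma bump_test_function:
  assumes r: "0 < r" and c: "cball c r \<subseteq> orthant"
  shows "test_function (bump c r)" and "compact_support_in_simplex (bump c r)"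
proof -
  let ?K = "cball c r \<inter> {p. (\<Sum>i\<in>UNIV. p $ i) = 1}"
  have "closed {p :: real^'n::finite. (\<Sum>i\<in>UNIV. p $ i) = 1}" by (intro closed_Collect_eq continuous_intros)
  then have K: "compact ?K" by (intro compact_Int_closed compact_cball)
  have KS: "?K \<subseteq> prob_simplex" using c by (auto simp: prob_simplex_eq)
  have z: "\<forall>p\<in>prob_simplex - ?K. bump c r p = 0"
  proof
    fix p assume "p \<in> prob_simplex - ?K"
    then have "p \<notin> cball c r" by (auto simp: prob_simplex_eq)
    then show "bump c r p = 0" by (rule bump_outside[OF r])
  qed
  show "compact_support_in_simplex (bump c r)"
    unfolding compact_support_in_simplex_def using K KS z by blast
  have "C2_near_simplex (bump c r)" unfolding C2_near_simplex_def using C2_bump open_UNIV subset_UNIV by blast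
  then show "test_function (bump c r)"
    unfolding test_function_def using K KS z by blast
qed

context wasserstein_graph
begin

lemma continuous_on_drift: "continuous_on prob_simplex (sde_drift E w \<phi> \<theta> \<beta>)"
proof -
  have "continuous_on orthant (\<lambda>p. sde_drift E w \<phi> \<theta> \<beta> p $ i)" for i
  proof -
    have "continuous_on orthant (\<lambda>p. \<Sum>j\<in>UNIV. w $ i $ j * (coef i j p + \<beta> * edge_deriv i j (th i j) p))"
      by (intro continuous_intros C1_on_imp_continuous_on[OF C1_coef] continuous_on_edge_deriv C2_on_imp_C1_on[OF C2_th])
    then show ?thesis by (rule continuous_on_eq) (rule sde_drift_eq[symmetric])
  qed
  then have "continuous_on orthant (\<lambda>p. \<chi> i. sde_drift E w \<phi> \<theta> \<beta> p $ i)" by (intro continuous_on_vec_lambda)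
  then show ?thesis using continuous_on_subset[OF _ prob_simplex_subset_orthant] by (simp add: vec_lambda_eta)
qed

lemma continuous_on_noise_closed: "continuous_on closed_simplex (\<lambda>p. sde_noise E w \<theta> \<beta> p i k)"
proof -
  have "continuous_on closed_simplex (th i j)" for i j
  proof -
    have t: "continuous_on ({0..} \<times> {0..}) (\<lambda>(x, y). \<theta> x y)" using avg unfolding average_function_def by blast
    have "continuous_on closed_simplex (\<lambda>p. (\<lambda>(x, y). \<theta> x y) (p $ i / \<pi> i, p $ j / \<pi> j))"
    proof (rule continuous_on_compose2[OF t])
      show "continuous_on closed_simplex (\<lambda>p :: real^'n. (p $ i / \<pi> i, p $ j / \<pi> j))"
        using \<pi>_pos by (intro continuous_intros) (metis less_irrefl)+
      show "(\<lambda>p :: real^'n. (p $ i / \<pi> i, p $ j / \<pi> j)) ` closed_simplex \<subseteq> {0..} \<times> {0..}"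
        using \<pi>_pos[of i] \<pi>_pos[of j] by (auto simp: closed_simplex_def)
    qed
    then show ?thesis by (simp add: theta_edge_def[abs_def])
  qed
  note th = this
  show ?thesis unfolding sde_noise_def by (intro continuous_intros th)
qed

lemma continuous_on_noise: "continuous_on prob_simplex (\<lambda>p. sde_noise E w \<theta> \<beta> p i k)"
  by (rule continuous_on_subset[OF continuous_on_noise_closed prob_simplex_subset_closed])

lemma noise_bounded: "\<exists>C. \<forall>p\<in>prob_simplex. \<forall>i k. \<bar>sde_noise E w \<theta> \<beta> p i k\<bar> \<le> C"
proof -
  have "\<forall>i k. \<exists>C. \<forall>p\<in>prob_simplex. \<bar>sde_noise E w \<theta> \<beta> p i k\<bar> \<le> C"
    using continuous_bounded_on_simplex[OF continuous_on_noise_closed] by simp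
  then obtain C where C: "\<forall>i k. \<forall>p\<in>prob_simplex. \<bar>sde_noise E w \<theta> \<beta> p i k\<bar> \<le> C i k" by metis
  have "\<bar>sde_noise E w \<theta> \<beta> p i k\<bar> \<le> (\<Sum>(i, k)\<in>UNIV. \<bar>C i k\<bar>)" if "p \<in> prob_simplex" for p i k
  proof -
    have "\<bar>sde_noise E w \<theta> \<beta> p i k\<bar> \<le> C i k" using C that by blast
    also have "\<dots> \<le> \<bar>C i k\<bar>" by simp
    also have "\<dots> \<le> (\<Sum>(i, k)\<in>UNIV. \<bar>C i k\<bar>)"
      using member_le_sum[of "(i, k)" UNIV "\<lambda>(i, k). \<bar>C i k\<bar>"] by auto
    finally show ?thesis .
  qed
  then show ?thesis by blast
qed

text \<open>
  The compact support of the bump function in the open simplex makes the generator applied to it bounded.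
\<close>

theorem dynkin_bump:
  assumes sol: "ito_sde_solution M F B prob_simplex (sde_drift E w \<phi> \<theta> \<beta>) (sde_noise E w \<theta> \<beta>) X"
    and r: "0 < r" and c: "cball c r \<subseteq> orthant" and T: "0 < T"
  shows "continuous_on {0..T} (\<lambda>s. \<integral>\<omega>. generator (sde_drift E w \<phi> \<theta> \<beta>) (covariation (sde_noise E w \<theta> \<beta>)) (bump c r) (X s \<omega>) \<partial>M)"
    and "(\<integral>\<omega>. bump c r (X T \<omega>) \<partial>M) - (\<integral>\<omega>. bump c r (X 0 \<omega>) \<partial>M) =
      integral {0..T} (\<lambda>s. \<integral>\<omega>. generator (sde_drift E w \<phi> \<theta> \<beta>) (covariation (sde_noise E w \<theta> \<beta>)) (bump c r) (X s \<omega>) \<partial>M)"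
proof -
  let ?A = "generator (sde_drift E w \<phi> \<theta> \<beta>) (covariation (sde_noise E w \<theta> \<beta>)) (bump c r)"
  have Aeq: "?A = (\<lambda>x. sde_drift E w \<phi> \<theta> \<beta> x \<bullet> grad (bump c r) x +
      1/2 * (\<Sum>i\<in>UNIV. \<Sum>j\<in>UNIV. covariation (sde_noise E w \<theta> \<beta>) x $ i $ j * hess (bump c r) x i j))"
    by (simp add: fun_eq_iff generator_def hess_def)
  have C1: "C1_on UNIV (bump c r)" by (rule C2_on_imp_C1_on[OF C2_bump])
  have bc: "continuous_on S (bump c r)" for S
    by (rule continuous_on_subset[OF C1_on_imp_continuous_on[OF C1]]) simp
  have gc: "continuous_on S (grad (bump c r))" for S
  proof -
    have "continuous_on UNIV (\<lambda>p. \<chi> i. partial i (bump c r) p)"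
      by (intro continuous_on_vec_lambda C1_on_imp_continuous_on[OF C1_on_partial[OF C2_bump]])
    then show ?thesis using continuous_on_subset by (auto simp: grad_def[abs_def])
  qed
  obtain C\<sigma> where C\<sigma>: "\<forall>p\<in>prob_simplex. \<forall>i k. \<bar>sde_noise E w \<theta> \<beta> p i k\<bar> \<le> C\<sigma>" using noise_bounded by blast
  obtain C\<Phi> where C\<Phi>: "\<forall>p\<in>prob_simplex. norm (bump c r p) \<le> C\<Phi>" using continuous_bounded_on_simplex[OF bc] by blast
  obtain Cg where Cg: "\<forall>p\<in>prob_simplex. norm (grad (bump c r) p) \<le> Cg" using continuous_bounded_on_simplex[OF gc] by blast
  have "continuous_on S (\<lambda>p. \<chi> i. \<chi> j. hess (bump c r) p i j)" for S
    by (intro continuous_on_vec_lambda continuous_on_hess C2_bump)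
  then obtain CH where CH: "\<forall>p\<in>prob_simplex. norm (\<chi> i. \<chi> j. hess (bump c r) p i j) \<le> CH"
    using continuous_bounded_on_simplex by blast
  have CH': "\<bar>hess (bump c r) p i j\<bar> \<le> CH" if "p \<in> prob_simplex" for p i j
  proof -
    have "norm ((\<chi> i. \<chi> j. hess (bump c r) p i j) $ i $ j) \<le> norm ((\<chi> i. \<chi> j. hess (bump c r) p i j) $ i)"
      by (rule Finite_Cartesian_Product.norm_nth_le)
    also have "\<dots> \<le> norm (\<chi> i. \<chi> j. hess (bump c r) p i j)" by (rule Finite_Cartesian_Product.norm_nth_le)
    also have "\<dots> \<le> CH" using CH that by blast
    finally show ?thesis by simp
  qed
  note gt = generator_test_function[OF bump_test_function(1)[OF r c]]
  obtain K where K: "compact K" "K \<subseteq> prob_simplex" "\<forall>p\<in>prob_simplex - K. ?A p = 0"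
    using gt(2) unfolding compact_support_in_simplex_def by blast
  obtain CA where "\<forall>p. \<bar>on_simplex ?A p\<bar> \<le> CA"
    using compact_support_bounds[OF gt(1) K(1,2)] K(3) by blast
  then have CA: "\<bar>?A p\<bar> \<le> CA" if "p \<in> prob_simplex" for p using that by (auto simp: on_simplex_def dest: spec[of _ p])
  have \<sigma>b: "\<bar>sde_noise E w \<theta> \<beta> p i k\<bar> \<le> C\<sigma>" if "p \<in> prob_simplex" for p i k using C\<sigma> that by blast
  have \<Phi>b: "\<bar>bump c r p\<bar> \<le> C\<Phi>" if "p \<in> prob_simplex" for p using C\<Phi> that by simp
  have gb: "norm (grad (bump c r) p) \<le> Cg" if "p \<in> prob_simplex" for p using Cg that by simp
  note dyn = ito_dynkin[where b="sde_drift E w \<phi> \<theta> \<beta>" and \<sigma>="sde_noise E w \<theta> \<beta>" and \<Phi>="bump c r"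
      and g="grad (bump c r)" and H="hess (bump c r)" and X=X and S=prob_simplex, OF sol T continuous_on_drift
      continuous_on_noise \<sigma>b bc \<Phi>b gc gb continuous_on_hess[OF C2_bump] CH'
      C2_second_order_expansion[OF C2_bump bounded_prob_simplex] CA[unfolded Aeq]]
  show "continuous_on {0..T} (\<lambda>s. \<integral>\<omega>. ?A (X s \<omega>) \<partial>M)"
    unfolding Aeq by (rule dyn(1))
  show "(\<integral>\<omega>. bump c r (X T \<omega>) \<partial>M) - (\<integral>\<omega>. bump c r (X 0 \<omega>) \<partial>M) = integral {0..T} (\<lambda>s. \<integral>\<omega>. ?A (X s \<omega>) \<partial>M)"
    unfolding Aeq by (rule dyn(2))
qed

text \<open>
  The derivative of \<open>\<integral> \<Phi> * u t\<close> in time, computed in two ways: by Dynkin's formula and adjointness, and by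
  differentiation under the integral sign. Difference quotients to the right suffice for both.
\<close>

theorem weak_fokker_planck:
  assumes sol: "ito_sde_solution M F B prob_simplex (sde_drift E w \<phi> \<theta> \<beta>) (sde_noise E w \<theta> \<beta>) X"
    and den: "classical_density_of M X u" and r: "0 < r" and c: "cball c r \<subseteq> orthant" and t: "0 < t"
  shows "(\<integral>p. bump c r p * (deriv (\<lambda>s. u s p) t - fp_operator (u t) p) \<partial>simplex_volume) = 0"
proof -
  let ?A = "generator (sde_drift E w \<phi> \<theta> \<beta>) (covariation (sde_noise E w \<theta> \<beta>)) (bump c r)"
  note tf = bump_test_function[OF r c]
  have dist: "\<And>s. 0 < s \<Longrightarrow> distributed M simplex_volume (X s) (\<lambda>p. ennreal (u s p))"
    and nn: "\<And>s p. 0 < s \<Longrightarrow> p \<in> prob_simplex \<Longrightarrow> 0 \<le> u s p"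
    and C2u: "\<And>s. 0 < s \<Longrightarrow> C2_near_simplex (u s)"
    and dif: "\<And>s p. 0 < s \<Longrightarrow> p \<in> prob_simplex \<Longrightarrow> (\<lambda>s. u s p) differentiable (at s)"
    and dc: "continuous_on ({0<..} \<times> prob_simplex) (\<lambda>(t, p). deriv (\<lambda>s. u s p) t)"
    using den unfolding classical_density_of_def by blast+
  have uc: "continuous_on prob_simplex (u s)" if s: "0 < s" for s
  proof -
    obtain U where "prob_simplex \<subseteq> U" "C2_on U (u s)" using C2u[OF s] unfolding C2_near_simplex_def by blast
    then show ?thesis using continuous_on_subset[OF C1_on_imp_continuous_on[OF C2_on_imp_C1_on]] by blast
  qed
  have bc: "continuous_on prob_simplex (bump c r)"
    by (rule continuous_on_subset[OF C1_on_imp_continuous_on[OF C2_on_imp_C1_on[OF C2_bump]]]) simp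
  have Ac: "continuous_on prob_simplex ?A" and As: "compact_support_in_simplex ?A"
    by (rule generator_test_function[OF tf(1)])+
  have dtc: "continuous_on prob_simplex (\<lambda>p. deriv (\<lambda>s. u s p) t)"
    using continuous_on_compose2[OF dc, of prob_simplex "\<lambda>p. (t, p)",
        OF continuous_on_Pair[OF continuous_on_const continuous_on_id]] t by auto
  have ex: "(\<integral>\<omega>. f (X s \<omega>) \<partial>M) = (\<integral>p. f p * u s p \<partial>simplex_volume)" if "0 < s" "continuous_on prob_simplex f" for f s
    using distributed_integral[OF dist[OF that(1)] simplex_volume_measurable[OF that(2)]] nn[OF that(1)]
    by (simp add: space_simplex_volume mult.commute)
  define G where "G s = (\<integral>p. bump c r p * u s p \<partial>simplex_volume)" for s
  define a where "a s = (\<integral>\<omega>. ?A (X s \<omega>) \<partial>M)" for s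
  have Gi: "integrable simplex_volume (\<lambda>p. bump c r p * u s p)" if "0 < s" for s
    by (intro integrable_simplex_volume continuous_on_mult bc uc that compact_support_mult1 tf)
  have G: "G s = (\<integral>\<omega>. bump c r (X 0 \<omega>) \<partial>M) + integral {0..s} a" if "0 < s" for s
    using dynkin_bump(2)[OF sol r c that] ex[OF that bc] by (simp add: G_def a_def[abs_def])
  have ac: "continuous_on {0..t + 1} a"
    unfolding a_def[abs_def] by (rule dynkin_bump(1)[OF sol r c]) (use t in simp)
  define h where "h n = 1 / real (Suc n)" for n
  have h0: "0 < h n" "h n \<le> 1" for n by (auto simp: h_def)
  have hl: "h \<longlonglongrightarrow> 0" unfolding h_def by (rule LIMSEQ_Suc[OF lim_const_over_n])
  have l1: "(\<lambda>n. (G (t + h n) - G t) / h n) \<longlonglongrightarrow> a t"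
  proof -
    have "((\<lambda>x. integral {0..x} a) has_real_derivative a t) (at t within {0..t + 1})"
      by (rule integral_has_real_derivative[OF ac]) (use t in auto)
    then have "((\<lambda>y. (integral {0..y} a - integral {0..t} a) / (y - t)) \<longlongrightarrow> a t) (at t within {0..t + 1})"
      by (simp add: has_field_derivative_iff)
    moreover have "filterlim (\<lambda>n. t + h n) (at t within {0..t + 1}) sequentially"
      unfolding filterlim_at
    proof
      show "(\<lambda>n. t + h n) \<longlonglongrightarrow> t" using tendsto_add[OF tendsto_const hl, of t] by simp
      show "\<forall>\<^sub>F n in sequentially. t + h n \<in> {0..t + 1} \<and> t + h n \<noteq> t"
      proof (intro always_eventually allI conjI)
        fix n show "t + h n \<in> {0..t + 1}" using h0[of n] t by simp
        show "t + h n \<noteq> t" using h0(1)[of n] by simp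
      qed
    qed
    ultimately have "(\<lambda>n. (integral {0..t + h n} a - integral {0..t} a) / (t + h n - t)) \<longlonglongrightarrow> a t"
      by (rule filterlim_compose)
    moreover have "(integral {0..t + h n} a - integral {0..t} a) / (t + h n - t) = (G (t + h n) - G t) / h n" for n
      using G[OF t] G[of "t + h n"] h0(1)[of n] t by simp
    ultimately show ?thesis by (simp only:)
  qed
  have l2: "(\<lambda>n. (G (t + h n) - G t) / h n) \<longlonglongrightarrow> (\<integral>p. bump c r p * deriv (\<lambda>s. u s p) t \<partial>simplex_volume)"
  proof -
    obtain K where K: "compact K" "K \<subseteq> prob_simplex" "\<forall>p\<in>prob_simplex - K. bump c r p = 0"
      using tf(2) unfolding compact_support_in_simplex_def by blast
    have "compact ({t..t + 1} \<times> K)" by (intro compact_Times compact_Icc K)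
    moreover have "continuous_on ({t..t + 1} \<times> K) (\<lambda>(t, p). deriv (\<lambda>s. u s p) t)"
      by (rule continuous_on_subset[OF dc]) (use t K(2) in auto)
    ultimately have "bounded ((\<lambda>(t, p). deriv (\<lambda>s. u s p) t) ` ({t..t + 1} \<times> K))"
      by (intro compact_imp_bounded compact_continuous_image)
    then obtain C where "\<forall>y\<in>(\<lambda>(t, p). deriv (\<lambda>s. u s p) t) ` ({t..t + 1} \<times> K). norm y \<le> C"
      unfolding bounded_iff by blast
    then have C: "norm (deriv (\<lambda>s. u s p) s) \<le> C" if "s \<in> {t..t + 1}" "p \<in> K" for s p using that by force
    have has: "((\<lambda>s. u s p) has_real_derivative deriv (\<lambda>s. u s p) s) (at s)" if "0 < s" "p \<in> prob_simplex" for s p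
      using dif[OF that] by (simp add: DERIV_deriv_iff_real_differentiable)
    have quot: "\<bar>(u (t + h n) p - u t p) / h n\<bar> \<le> C" if p: "p \<in> K" for n p
    proof -
      have "norm (u (t + h n) p - u t p) \<le> C * norm (t + h n - t)"
      proof (rule field_differentiable_bound[of "{t..t + 1}" "\<lambda>s. u s p" "\<lambda>s. deriv (\<lambda>s. u s p) s"])
        show "((\<lambda>s. u s p) has_field_derivative deriv (\<lambda>s. u s p) z) (at z within {t..t + 1})" if "z \<in> {t..t + 1}" for z
          using has_field_derivative_at_within[OF has[of z p]] that t p K(2) by auto
      qed (use C p h0[of n] in auto)
      then show ?thesis using h0(1)[of n] by (simp add: pos_divide_le_eq)
    qed
    have "(\<lambda>n. \<integral>p. bump c r p * ((u (t + h n) p - u t p) / h n) \<partial>simplex_volume) \<longlonglongrightarrow>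
        (\<integral>p. bump c r p * deriv (\<lambda>s. u s p) t \<partial>simplex_volume)"
    proof (rule integral_dominated_convergence[where w="\<lambda>p. bump c r p * C"])
      show "(\<lambda>p. bump c r p * deriv (\<lambda>s. u s p) t) \<in> borel_measurable simplex_volume"
        by (intro simplex_volume_measurable continuous_on_mult bc dtc)
      show "(\<lambda>p. bump c r p * ((u (t + h n) p - u t p) / h n)) \<in> borel_measurable simplex_volume" for n
        using h0(1)[of n] t
        by (intro simplex_volume_measurable continuous_on_mult continuous_on_divide continuous_on_diff bc uc continuous_on_const) auto
      show "integrable simplex_volume (\<lambda>p. bump c r p * C)"
        by (intro integrable_mult_left integrable_simplex_volume bc tf)
      show "AE p in simplex_volume. (\<lambda>n. bump c r p * ((u (t + h n) p - u t p) / h n)) \<longlonglongrightarrow> bump c r p * deriv (\<lambda>s. u s p) t"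
      proof (rule AE_I2)
        fix p assume "p \<in> space (simplex_volume :: (real^'n) measure)"
        then have p: "p \<in> prob_simplex" by (simp add: space_simplex_volume)
        have "((\<lambda>k. (u (t + k) p - u t p) / k) \<longlongrightarrow> deriv (\<lambda>s. u s p) t) (at 0)"
          using has[OF t p] by (simp add: DERIV_def)
        moreover have "filterlim h (at 0) sequentially"
          unfolding filterlim_at using hl h0(1) by (auto simp: less_imp_neq[symmetric])
        ultimately have "(\<lambda>n. (u (t + h n) p - u t p) / h n) \<longlonglongrightarrow> deriv (\<lambda>s. u s p) t" by (rule filterlim_compose)
        then show "(\<lambda>n. bump c r p * ((u (t + h n) p - u t p) / h n)) \<longlonglongrightarrow> bump c r p * deriv (\<lambda>s. u s p) t"
          by (intro tendsto_mult tendsto_const)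
      qed
      show "AE p in simplex_volume. norm (bump c r p * ((u (t + h n) p - u t p) / h n)) \<le> bump c r p * C" for n
      proof (rule AE_I2)
        fix p assume "p \<in> space (simplex_volume :: (real^'n) measure)"
        then have p: "p \<in> prob_simplex" by (simp add: space_simplex_volume)
        show "norm (bump c r p * ((u (t + h n) p - u t p) / h n)) \<le> bump c r p * C"
        proof (cases "p \<in> K")
          case True
          have "norm (bump c r p * ((u (t + h n) p - u t p) / h n)) = bump c r p * \<bar>(u (t + h n) p - u t p) / h n\<bar>"
            unfolding real_norm_def abs_mult using bump_nonneg[of c r p] by simp
          also have "\<dots> \<le> bump c r p * C" by (rule mult_left_mono[OF quot[OF True] bump_nonneg])
          finally show ?thesis .
        next
          case False
          then have "bump c r p = 0" using K(3) p by blast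
          then show ?thesis by simp
        qed
      qed
    qed
    moreover have "(\<integral>p. bump c r p * ((u (t + h n) p - u t p) / h n) \<partial>simplex_volume) = (G (t + h n) - G t) / h n" for n
    proof -
      have "(\<integral>p. bump c r p * ((u (t + h n) p - u t p) / h n) \<partial>simplex_volume) =
         (\<integral>p. (bump c r p * u (t + h n) p - bump c r p * u t p) / h n \<partial>simplex_volume)"
        by (intro Bochner_Integration.integral_cong refl) (simp add: right_diff_distrib)
      then show ?thesis using Gi[of "t + h n"] Gi[OF t] h0(1)[of n] t by (simp add: G_def)
    qed
    ultimately show ?thesis by (simp only:)
  qed
  have at: "a t = (\<integral>p. bump c r p * fp_operator (u t) p \<partial>simplex_volume)"
  proof -
    have "a t = (\<integral>p. ?A p * u t p \<partial>simplex_volume)" unfolding a_def by (rule ex[OF t Ac])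
    also have "\<dots> = (\<integral>p. bump c r p * fp_operator (u t) p \<partial>simplex_volume)"
      using generator_adjoint tf(1) C2u[OF t] unfolding formal_adjoint_on_simplex_def by blast
    finally show ?thesis .
  qed
  have "(\<integral>p. bump c r p * deriv (\<lambda>s. u s p) t \<partial>simplex_volume) = (\<integral>p. bump c r p * fp_operator (u t) p \<partial>simplex_volume)"
    using LIMSEQ_unique[OF l2 l1] at by simp
  moreover have "integrable simplex_volume (\<lambda>p. bump c r p * deriv (\<lambda>s. u s p) t)"
    by (intro integrable_simplex_volume continuous_on_mult bc dtc compact_support_mult1 tf)
  moreover have "integrable simplex_volume (\<lambda>p. bump c r p * fp_operator (u t) p)"
    by (intro integrable_simplex_volume continuous_on_mult bc continuous_on_fp_operator C2u t compact_support_mult1 tf)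
  ultimately show ?thesis by (simp add: right_diff_distrib)
qed

text \<open>
  If the residual \<open>f\<close> of the equation were not 0 at \<open>p\<close>, it would keep its sign near \<open>p\<close>, and its integral
  against a small bump around \<open>p\<close> would not vanish.
\<close>

theorem density_fokker_planck:
  assumes sol: "ito_sde_solution M F B prob_simplex (sde_drift E w \<phi> \<theta> \<beta>) (sde_noise E w \<theta> \<beta>) X"
    and den: "classical_density_of M X u"
  shows "fokker_planck_solution E w \<theta> \<beta> u"
  unfolding fokker_planck_solution_def
proof (intro allI impI conjI ballI)
  fix t :: real assume t: "0 < t"
  show C2u: "C2_near_simplex (u t)" using den t unfolding classical_density_of_def by blast
  fix p :: "real^'n" assume p: "p \<in> prob_simplex"
  show "(\<lambda>s. u s p) differentiable (at t)" using den t p unfolding classical_density_of_def by blast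
  define f where "f q = deriv (\<lambda>s. u s q) t - fp_operator (u t) q" for q
  have dc: "continuous_on ({0<..} \<times> prob_simplex) (\<lambda>(t, p). deriv (\<lambda>s. u s p) t)"
    using den unfolding classical_density_of_def by blast
  have "continuous_on prob_simplex (\<lambda>p. deriv (\<lambda>s. u s p) t)"
    using continuous_on_compose2[OF dc, of prob_simplex "\<lambda>p. (t, p)",
        OF continuous_on_Pair[OF continuous_on_const continuous_on_id]] t by auto
  then have fc: "continuous_on prob_simplex f"
    unfolding f_def[abs_def] by (intro continuous_on_diff continuous_on_fp_operator C2u)
  have "f p = 0"
  proof (rule ccontr)
    assume fp: "f p \<noteq> 0"
    have "\<exists>d>0. \<forall>q\<in>prob_simplex. dist q p < d \<longrightarrow> dist (f q) (f p) < \<bar>f p\<bar>"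
      using fc p fp unfolding continuous_on_iff by (metis zero_less_abs_iff)
    then obtain d where d: "0 < d" "\<forall>q\<in>prob_simplex. dist q p < d \<longrightarrow> dist (f q) (f p) < \<bar>f p\<bar>" by blast
    have pO: "p \<in> orthant" using p prob_simplex_subset_orthant by blast
    obtain e where e: "0 < e" "cball p e \<subseteq> orthant" using open_contains_cball[THEN iffD1, OF open_orthant] pO by blast
    define r where "r = min (d / 2) e"
    have r: "0 < r" "r < d" "r \<le> e" using d(1) e(1) by (auto simp: r_def)
    have c: "cball p r \<subseteq> orthant" using e(2) r(3) by (meson order_trans subset_cball)
    have pos: "0 \<le> bump p r q * (f p * f q)" if q: "q \<in> prob_simplex" for q
    proof (cases "q \<in> cball p r")
      case True
      then have "dist q p < d" using r by (simp add: dist_commute)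
      then have "\<bar>f q - f p\<bar> < \<bar>f p\<bar>" using d(2) q by (simp add: dist_real_def)
      then have "0 \<le> f p * f q" by (cases "0 < f p") (auto simp: zero_le_mult_iff abs_if split: if_splits)
      then show ?thesis using bump_nonneg[of p r q] by (rule mult_nonneg_nonneg[rotated])
    next
      case False
      then show ?thesis using bump_outside[OF r(1) False] by simp
    qed
    have "bump p r p * (f p * f p) = 0"
    proof (rule nonneg_integral_eq_0_imp[OF _ _ pos _ p])
      show "continuous_on prob_simplex (\<lambda>q. bump p r q * (f p * f q))"
        by (intro continuous_on_mult continuous_on_const fc
            continuous_on_subset[OF C1_on_imp_continuous_on[OF C2_on_imp_C1_on[OF C2_bump]]]) simp
      show "compact_support_in_simplex (\<lambda>q. bump p r q * (f p * f q))"
        by (intro compact_support_mult1 bump_test_function(2) r c)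
      have "(\<integral>q. bump p r q * (f p * f q) \<partial>simplex_volume) = (\<integral>q. f p * (bump p r q * f q) \<partial>simplex_volume)"
        by (intro Bochner_Integration.integral_cong refl) simp
      also have "\<dots> = 0"
        using weak_fokker_planck[OF sol den r(1) c t] by (simp add: f_def)
      finally show "(\<integral>q. bump p r q * (f p * f q) \<partial>simplex_volume) = 0" .
    qed
    then show False using bump_center[OF r(1), of p] fp by simp
  qed
  then show "deriv (\<lambda>s. u s p) t + divergence (\<lambda>q. u t q *\<^sub>R Q_field E w q) p = \<beta> * LW_adj E w \<theta> (u t) p"
    by (simp add: f_def)
qed

end

theorem proposition5:
  fixes E :: "('n::finite \<times> 'n) set"
    and w :: "real^'n^'n"
    and \<phi> :: "real \<Rightarrow> real"
    and \<theta> :: "real \<Rightarrow> real \<Rightarrow> real"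
    and \<beta> :: real
  assumes "2 \<le> CARD('n)"
    and "weighted_graph E w"
    and "average_function \<phi> \<theta>"
    and "0 < \<beta>"
  shows "formal_adjoint_on_simplex
           (generator (sde_drift E w \<phi> \<theta> \<beta>) (covariation (sde_noise E w \<theta> \<beta>)))
           (\<lambda>u p. \<beta> * LW_adj E w \<theta> u p - divergence (\<lambda>q. u q *\<^sub>R Q_field E w q) p)
         \<and>
         (\<forall>(M :: 'a measure) F (B :: 'n \<times> 'n \<Rightarrow> real \<Rightarrow> 'a \<Rightarrow> real) X u.
           ito_sde_solution M F B prob_simplex (sde_drift E w \<phi> \<theta> \<beta>) (sde_noise E w \<theta> \<beta>) X \<longrightarrow>
           classical_density_of M X u \<longrightarrow>
           fokker_planck_solution E w \<theta> \<beta> u)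
         \<and>
         (integrable simplex_volume (gibbs_weight E w \<phi> \<theta> \<beta>) \<longrightarrow>
           fokker_planck_solution E w \<theta> \<beta>
             (\<lambda>t p. 1 / (\<integral>q. gibbs_weight E w \<phi> \<theta> \<beta> q \<partial>simplex_volume) * gibbs_weight E w \<phi> \<theta> \<beta> p))"
proof -
  interpret wasserstein_graph E w \<phi> \<theta> \<beta> by standard (fact assms)+
  show ?thesis
    by (intro conjI allI impI generator_adjoint gibbs_stationary density_fokker_planck)
qed

end
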